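(* Let $\boldsymbol{p}=(p_1,p_2)$ be a pair of relatively prime integers, $k\in\mathbb{Z}\setminus\{0\}$, $d=k/p^2$ and $\theta=k\,\boldsymbol{p}\cdot\boldsymbol{q}/p^2$. The function $$E(c;\theta,d)=-2+2\cos(2\pi\theta)+4D(g_0-d^2)\sin^2\!\left(\pi\sqrt{g_0-d^2}\right)$$ is an Evans function for the ODE $$f''+\frac{2ik\,\boldsymbol{p}\cdot\boldsymbol{q}}{p^2}f'+\left(\frac{\sin\eta}{c+\sin\eta}-\frac{k^2q^2}{p^2}\right)f=0 .\qquad( * )$$ That is, $E(c;\theta,d)$ is analytic in $c$ outside of $[-1,1]$ and vanishes for values of $c$ where $0$ is in the spectrum of (the operator on the left-hand side of) $( * )$ with $f$ having $2\pi$-periodic boundary conditions. The degree of vanishing of $E$ as a function of $c$ is the same as the algebraic multiplicity of $0$ as an eigenvalue of $( * )$ or, equivalently, of $\mu=d^2$ as an eigenvalue of $g''+\frac{\sin\eta}{c+\sin\eta}g=\mu g$ with boundary conditions $g(2\pi)=e^{2\pi i\theta}g(0)$, $g'(2\pi)=e^{2\pi i\theta}g'(0)$.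
   Context: Here $p^2=p_1^2+p_2^2$, $\boldsymbol{q}=(q_1,q_2)\in\mathbb{Z}^2$ satisfies $p_2q_1-p_1q_2=1$ with $|\boldsymbol{p}\cdot\boldsymbol{q}|$ as small as possible, and $q^2=q_1^2+q_2^2$. For $c\in\mathbb{C}\setminus[-1,1]$ let $s=s(c)$ be the unique solution of $c=\frac12(s+\frac1s)$ with $|s|<1$. Put $\kappa=-\frac{1+s^2}{1-s^2}$, $g_0=1+\kappa$, and $g_k=\kappa\, i^k s^{|k|}$ for $k\in\mathbb{Z}\setminus\{0\}$; these are the Fourier coefficients of $Q(\eta)=\frac{\sin\eta}{c+\sin\eta}$. The Hill determinant is the bi-infinite determinant $$D(\Lambda)=\det\left(\frac{\tilde g_{n-m}}{\Lambda-n^2}+\delta_{n,m}\right)_{n,m\in\mathbb{Z}},\qquad \tilde g_0=0,\ \tilde g_j=g_j\ (j\neq0),$$ understood as the limit of the determinants of the truncations to $|n|,|m|\le N$ as $N\to\infty$. At points where $g_0-d^2=n^2$ for an integer $n$, the product $D(g_0-d^2)\sin^2(\pi\sqrt{g_0-d^2})$ is defined by continuity. Equation $( * )$ arises by separating variables, with temporal eigenvalue $\lambda=-ikc$, in the Euler equations linearised about the stream function $\cos(p_1x+p_2y)$. *)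

theory Defs
  imports
    "HOL-Complex_Analysis.Complex_Analysis"
    "HOL-Library.Landau_Symbols"
    "HOL-Library.Extended_Nat"
    "Jordan_Normal_Form.Determinant"
begin

abbreviation real_cut :: "complex set" where
  "real_cut \<equiv> complex_of_real ` {-1..1}"

definition potential :: "complex \<Rightarrow> real \<Rightarrow> complex" where
  "potential c \<eta> = of_real (sin \<eta>) / (c + of_real (sin \<eta>))"

definition sroot :: "complex \<Rightarrow> complex" where
  "sroot c = (THE s. s \<noteq> 0 \<and> c = (s + 1 / s) / 2 \<and> norm s < 1)"

definition kap :: "complex \<Rightarrow> complex" where
  "kap c = - ((1 + (sroot c)\<^sup>2) / (1 - (sroot c)\<^sup>2))"

definition fcoeff :: "complex \<Rightarrow> int \<Rightarrow> complex" where
  "fcoeff c k = (if k = 0 then 1 + kap c else kap c * (\<i> powi k) * sroot c ^ nat \<bar>k\<bar>)"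

definition fcoeff_tilde :: "complex \<Rightarrow> int \<Rightarrow> complex" where
  "fcoeff_tilde c k = (if k = 0 then 0 else fcoeff c k)"

text \<open>Rows and columns \<open>0, \<dots>, 2 * N\<close> of the truncated matrix carry the
  indices \<open>-N, \<dots>, N\<close>.\<close>

definition hill_trunc :: "complex \<Rightarrow> complex \<Rightarrow> nat \<Rightarrow> complex" where
  "hill_trunc c \<Lambda> N = Determinant.det (Matrix.mat (2 * N + 1) (2 * N + 1) (\<lambda>(i, j).
     (let n = int i - int N; m = int j - int N
      in fcoeff_tilde c (n - m) / (\<Lambda> - (of_int n)\<^sup>2) + (if n = m then 1 else 0))))"

definition hill_det :: "complex \<Rightarrow> complex \<Rightarrow> complex" where
  "hill_det c \<Lambda> = lim (hill_trunc c \<Lambda>)"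

definition int_square :: "complex \<Rightarrow> bool" where
  "int_square \<Lambda> \<longleftrightarrow> (\<exists>n::int. \<Lambda> = (of_int n)\<^sup>2)"

text \<open>The product of \<open>D(g\<^sub>0 - d\<^sup>2)\<close> and \<open>sin\<^sup>2(\<pi> \<surd>(g\<^sub>0 - d\<^sup>2))\<close> as a function of \<open>c\<close>,
  extended by continuity in \<open>c\<close> where \<open>g\<^sub>0 - d\<^sup>2\<close> is the square of an integer.
  The branch of the square root is irrelevant, as it only enters through \<open>sin\<^sup>2\<close>.\<close>

definition hill_product :: "real \<Rightarrow> complex \<Rightarrow> complex" where
  "hill_product d c =
    (let \<Lambda> = (\<lambda>w. fcoeff w 0 - (of_real d)\<^sup>2);
         P = (\<lambda>w. hill_det w (\<Lambda> w) * (sin (of_real pi * csqrt (\<Lambda> w)))\<^sup>2)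
     in if int_square (\<Lambda> c) then Lim (at c) P else P c)"

definition evans :: "real \<Rightarrow> real \<Rightarrow> complex \<Rightarrow> complex" where
  "evans \<theta> d c = - 2 + 2 * of_real (cos (2 * pi * \<theta>)) + 4 * hill_product d c"

definition L2 :: "(real \<Rightarrow> complex) set" where
  "L2 = {h. set_borel_measurable lborel {0..2*pi} h \<and>
            set_integrable lborel {0..2*pi} (\<lambda>x. (cmod (h x))\<^sup>2)}"

definition L2norm :: "(real \<Rightarrow> complex) \<Rightarrow> real" where
  "L2norm h = sqrt (LBINT x:{0..2*pi}. (cmod (h x))\<^sup>2)"

text \<open>\<open>f\<close> is in the Sobolev space \<open>H\<^sup>2(0, 2\<pi>)\<close>, with derivative \<open>f'\<close> (absolutely continuous)
  and second derivative \<open>f''\<close> (defined up to null sets).\<close>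

definition H2_derivs :: "(real \<Rightarrow> complex) \<Rightarrow> (real \<Rightarrow> complex) \<Rightarrow> (real \<Rightarrow> complex) \<Rightarrow> bool" where
  "H2_derivs f f' f'' \<longleftrightarrow> f'' \<in> L2 \<and>
     (\<forall>x\<in>{0..2*pi}. (f has_vector_derivative f' x) (at x within {0..2*pi}) \<and>
                    f' x = f' 0 + (LBINT t:{0..x}. f'' t))"

text \<open>Unbounded operators are represented by their graphs. A domain element is given by its
  continuous representative, extended by 0 outside \<open>{0..2*pi}\<close>, so that equality in the domain is
  equality of functions; the second component of a graph is an arbitrary representative of its
  \<open>L\<^sup>2\<close> class. The operator below is \<open>f \<mapsto> f'' + a f' + V f\<close> with the boundary conditions
  \<open>f(2\<pi>) = z f(0)\<close>, \<open>f'(2\<pi>) = z f'(0)\<close>.\<close>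

type_synonym op_graph = "((real \<Rightarrow> complex) \<times> (real \<Rightarrow> complex)) set"

definition second_order_op :: "complex \<Rightarrow> (real \<Rightarrow> complex) \<Rightarrow> complex \<Rightarrow> op_graph" where
  "second_order_op a V z = {(f, h). h \<in> L2 \<and> (\<forall>x. x \<notin> {0..2*pi} \<longrightarrow> f x = 0) \<and>
     (\<exists>f' f''. H2_derivs f f' f'' \<and> f (2*pi) = z * f 0 \<and> f' (2*pi) = z * f' 0 \<and>
        (AE x in lborel. x \<in> {0..2*pi} \<longrightarrow> h x = f'' x + a * f' x + V x * f x))}"

definition op_minus :: "op_graph \<Rightarrow> complex \<Rightarrow> op_graph" where
  "op_minus T \<mu> = {(f, \<lambda>x. h x - \<mu> * f x) | f h. (f, h) \<in> T}"

definition op_spectrum :: "op_graph \<Rightarrow> complex set" where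
  "op_spectrum T = {\<mu>. \<not> ((\<forall>h\<in>L2. \<exists>!f. (f, h) \<in> op_minus T \<mu>) \<and>
                          (\<exists>C. \<forall>(f, h)\<in>op_minus T \<mu>. L2norm f \<le> C * L2norm h))}"

definition op_eigenvalue :: "op_graph \<Rightarrow> complex \<Rightarrow> bool" where
  "op_eigenvalue T \<mu> \<longleftrightarrow> (\<exists>f. f \<noteq> (\<lambda>x. 0) \<and> (f, \<lambda>x. 0) \<in> op_minus T \<mu>)"

definition cdim :: "('x \<Rightarrow> complex) set \<Rightarrow> enat" where
  "cdim V = (SUP B\<in>{B. finite B \<and> B \<subseteq> V \<and>
     (\<forall>u. (\<forall>x. (\<Sum>b\<in>B. u b * b x) = 0) \<longrightarrow> (\<forall>b\<in>B. u b = 0))}. enat (card B))"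

text \<open>For a family of operators \<open>T c\<close>, a Jordan chain \<open>F\<^sub>0, \<dots>, F\<^bsub>m-1\<^esub>\<close> at \<open>c\<^sub>0\<close> (possibly with
  vanishing leading terms) is the list of coefficients of a polynomial root function
  \<open>\<phi>(c) = (\<Sum>j<m. (c - c\<^sub>0)\<^sup>j F\<^sub>j)\<close> with \<open>T c (\<phi>(c)) = O((c - c\<^sub>0)\<^sup>m)\<close> in \<open>L\<^sup>2\<close>.
  If the partial multiplicities of \<open>T\<close> at \<open>c\<^sub>0\<close> are \<open>m\<^sub>1, \<dots>, m\<^sub>r\<close>, the chains of length \<open>m\<close> form a
  space of dimension \<open>\<Sum>i. min m m\<^sub>i\<close>, so that the supremum over \<open>m\<close> is the algebraic
  multiplicity \<open>m\<^sub>1 + \<dots> + m\<^sub>r\<close> of the eigenvalue 0 of the family (Keldysh, Gohberg-Sigal).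
  For \<open>T \<mu> = A - \<mu>\<close> the last term \<open>F\<^bsub>m-1\<^esub>\<close> ranges over the kernel of \<open>(A - \<mu>\<^sub>0)\<^sup>m\<close> and determines
  the others, so one recovers the dimension of the generalised eigenspace of \<open>A\<close>.
  The separated linearised Euler equations depend nonlinearly on their spectral parameter
  \<open>c\<close>; the multiplicity to be compared with the order of a zero in \<open>c\<close> is that of the family.\<close>

definition jordan_chains :: "(complex \<Rightarrow> op_graph) \<Rightarrow> complex \<Rightarrow> nat \<Rightarrow> (nat \<times> real \<Rightarrow> complex) set" where
  "jordan_chains T c\<^sub>0 m = {F. (\<forall>j\<ge>m. \<forall>x. F (j, x) = 0) \<and>
     (\<exists>h. (\<forall>\<^sub>F c in at c\<^sub>0. (\<lambda>x. \<Sum>j<m. (c - c\<^sub>0) ^ j * F (j, x), h c) \<in> T c) \<and>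
          (\<lambda>c. L2norm (h c)) \<in> O[at c\<^sub>0](\<lambda>c. cmod (c - c\<^sub>0) ^ m))}"

definition family_alg_mult :: "(complex \<Rightarrow> op_graph) \<Rightarrow> complex \<Rightarrow> enat" where
  "family_alg_mult T c\<^sub>0 = (SUP m. cdim (jordan_chains T c\<^sub>0 m))"

definition op_alg_mult :: "op_graph \<Rightarrow> complex \<Rightarrow> enat" where
  "op_alg_mult A \<mu> = family_alg_mult (op_minus A) \<mu>"

definition ode_op :: "int \<Rightarrow> int \<Rightarrow> int \<Rightarrow> int \<Rightarrow> int \<Rightarrow> complex \<Rightarrow> op_graph" where
  "ode_op p\<^sub>1 p\<^sub>2 q\<^sub>1 q\<^sub>2 k c = second_order_op
     (2 * \<i> * of_int k * of_int (p\<^sub>1 * q\<^sub>1 + p\<^sub>2 * q\<^sub>2) / of_int (p\<^sub>1\<^sup>2 + p\<^sub>2\<^sup>2))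
     (\<lambda>\<eta>. potential c \<eta> - of_int (k\<^sup>2 * (q\<^sub>1\<^sup>2 + q\<^sub>2\<^sup>2)) / of_int (p\<^sub>1\<^sup>2 + p\<^sub>2\<^sup>2))
     1"

definition hill_op :: "real \<Rightarrow> complex \<Rightarrow> op_graph" where
  "hill_op \<theta> c = second_order_op 0 (potential c) (exp (2 * of_real pi * \<i> * of_real \<theta>))"

end

theory Submission
  imports Defs
begin

text \<open>Let \<open>M(c)\<close> be the monodromy matrix over \<open>[0, 2\<pi>]\<close> of \<open>g'' + Q g = d\<^sup>2 g\<close>, where
  \<open>Q = sin \<eta> / (c + sin \<eta>)\<close>, and let \<open>z = exp (2 \<pi> \<i> \<theta>)\<close>. Since \<open>det M(c) = 1\<close>,
  \<open>det (z - M(c)) = z (z + 1/z - tr M(c))\<close>. The theorem rests on the identity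
  \<open>E(c; \<theta>, d) = z + 1/z - tr M(c)\<close> (\<open>evans_eq_trace\<close>): up to the factor \<open>z\<close>, the right-hand side
  is the characteristic determinant of the boundary value problem.

  \<^bold>\<open>The identity\<close> is Hill's formula, proved here for an arbitrary potential with absolutely
  summable Fourier coefficients \<open>u\<close>. Suitably normalised, the truncated determinants of the matrix
  \<open>u (n - m) - (n + \<nu>)\<^sup>2 \<delta>\<^sub>n\<^sub>m\<close> converge to an entire function of \<open>\<nu>\<close> (\<open>char_fun\<close>) that has period 1
  and differs from \<open>- sin\<^sup>2 (\<pi> \<nu>)\<close> by \<open>o(exp (2 \<pi> |Im \<nu>|))\<close>; so it equals \<open>C - sin\<^sup>2 (\<pi> \<nu>)\<close>
  with a constant \<open>C\<close> (\<open>char_fun_eq_const\<close>). At a Floquet exponent the Fourier coefficients of the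
  Floquet solution are a left null vector of the matrix, and the function vanishes
  (\<open>char_fun_eq_0_at_Floquet_exponent\<close>). This gives \<open>C = sin\<^sup>2 (\<pi> \<nu>) = (2 - tr M) / 4\<close>, and the value
  at \<open>\<nu> = 0\<close> is the Hill determinant times \<open>sin\<^sup>2\<close> (\<open>Hill_formula\<close>). Convergence of the
  determinants rests on von Koch's criterion (\<open>koch_matrix\<close>).

  \<^bold>\<open>The spectrum.\<close> If \<open>z - M(c)\<close> is invertible, then the boundary value problem is solved by
  variation of constants with a bound; otherwise a null vector of \<open>z - M(c)\<close> is the initial datum of
  an eigenfunction (\<open>floquet_graph_regular\<close>, \<open>floquet_graph_singular\<close>).

  \<^bold>\<open>Multiplicities.\<close> Assigning to a function its Cauchy data at 0 identifies the Jordan chains of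
  length \<open>m\<close> at \<open>c\<^sub>0\<close> with the polynomial vectors \<open>v\<close> of degree below \<open>m\<close> that satisfy
  \<open>(z - M(c)) v(c) = O((c - c\<^sub>0)\<^sup>m)\<close>. Elimination over the power series ring turns \<open>z - M(c)\<close> into
  a diagonal matrix with entries of orders \<open>a\<close> and \<open>b\<close>, where \<open>a + b\<close> is the order of the
  determinant at \<open>c\<^sub>0\<close>, and the space of these vectors has dimension \<open>min m a + min m b\<close>. The supremum
  over \<open>m\<close> is the order of the zero (\<open>family_alg_mult_eq_zorder\<close>), provided that the determinant
  is not identically zero. The latter holds because an energy estimate excludes eigenfunctions when
  \<open>Q\<close> is small compared with \<open>d\<^sup>2\<close>, that is for large \<open>c\<close>, and because the complement of \<open>[-1, 1]\<close>
  is connected (\<open>floquet_trace_not_identically\<close>).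

  \<^bold>\<open>The two forms of the equation\<close> are conjugate: \<open>g = exp (\<i> \<theta> \<eta>) f\<close> removes the first-order
  term, turns periodic boundary conditions into those with multiplier \<open>z\<close>, and shifts the spectral
  parameter to \<open>d\<^sup>2\<close>, by Lagrange's identity
  \<open>p\<^sup>2 q\<^sup>2 - (p \<bullet> q)\<^sup>2 = (p\<^sub>2 q\<^sub>1 - p\<^sub>1 q\<^sub>2)\<^sup>2 = 1\<close>. Multiplication by a unimodular function
  preserves \<open>L\<^sup>2\<close> norms, hence spectra and chains.\<close>

section \<open>Linear second-order equations\<close>

text \<open>Picard iteration converges on the whole interval, however long it is: the successive differences
  are bounded by \<open>C (K x)\<^sup>n / n!\<close>, a summable sequence.\<close>

lemma Volterra_equation_solvable:
  fixes P :: "real \<Rightarrow> 'a::banach" and A :: "real \<Rightarrow> 'a \<Rightarrow> 'a"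
  assumes b: "0 \<le> b" and K: "0 \<le> K" and P: "continuous_on {0..b} P"
    and A: "\<And>Y. continuous_on {0..b} Y \<Longrightarrow> continuous_on {0..b} (\<lambda>t. A t (Y t))"
    and lip: "\<And>t u v. t \<in> {0..b} \<Longrightarrow> norm (A t u - A t v) \<le> K * norm (u - v)"
  obtains Y where "continuous_on {0..b} Y"
    and "\<And>x. x \<in> {0..b} \<Longrightarrow> Y x = P x + integral {0..x} (\<lambda>t. A t (Y t))"
proof -
  define Y where "Y = rec_nat P (\<lambda>n y x. P x + integral {0..x} (\<lambda>t. A t (y t)))"
  have Y0: "Y 0 = P" and YS: "Y (Suc n) = (\<lambda>x. P x + integral {0..x} (\<lambda>t. A t (Y n t)))" for n
    by (simp_all add: Y_def)
  have cY: "continuous_on {0..b} (Y n)" for n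
  proof (induction n)
    case (Suc n)
    then show ?case unfolding YS
      by (intro continuous_intros P indefinite_integral_continuous_1 integrable_continuous_real A)
  qed (simp add: Y0 P)
  have cA: "continuous_on {0..x} (\<lambda>t. A t (Y n t))" if "x \<in> {0..b}" for x n
    by (rule continuous_on_subset[OF A[OF cY]]) (use that in auto)
  have "bounded ((\<lambda>x. Y 1 x - Y 0 x) ` {0..b})"
    by (intro compact_imp_bounded compact_continuous_image continuous_intros cY) simp
  then obtain C where C: "\<And>x. x \<in> {0..b} \<Longrightarrow> norm (Y 1 x - Y 0 x) \<le> C"
    unfolding bounded_iff by blast
  have C0: "C \<ge> 0" using order_trans[OF norm_ge_zero C[of 0]] b by simp
  have step: "norm (Y (Suc n) x - Y n x) \<le> C * ((K * x) ^ n / fact n)" if "x \<in> {0..b}" for n x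
    using that
  proof (induction n arbitrary: x)
    case 0
    then show ?case using C[of x] by simp
  next
    case (Suc n)
    have int: "((\<lambda>t. K * (C * ((K * t) ^ n / fact n))) has_integral
        C * ((K * x) ^ Suc n / fact (Suc n)) - C * ((K * 0) ^ Suc n / fact (Suc n))) {0..x}"
    proof (rule fundamental_theorem_of_calculus)
      fix t assume "t \<in> {0..x}"
      have "((\<lambda>t. C * ((K * t) ^ Suc n / fact (Suc n))) has_real_derivative
          C * (of_nat (Suc n) * (K * t) ^ n * K / fact (Suc n))) (at t within {0..x})"
        by (auto intro!: derivative_eq_intros simp del: of_nat_Suc power_Suc fact_Suc)
      also have "C * (of_nat (Suc n) * (K * t) ^ n * K / fact (Suc n)) = K * (C * ((K * t) ^ n / fact n))"
        by (simp add: fact_Suc field_simps del: of_nat_Suc)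
      finally show "((\<lambda>t. C * ((K * t) ^ Suc n / fact (Suc n))) has_vector_derivative
          K * (C * ((K * t) ^ n / fact n))) (at t within {0..x})"
        by (simp add: has_real_derivative_iff_has_vector_derivative)
    qed (use Suc.prems in auto)
    have "Y (Suc (Suc n)) x - Y (Suc n) x = integral {0..x} (\<lambda>t. A t (Y (Suc n) t) - A t (Y n t))"
    proof -
      have 1: "Y (Suc (Suc n)) x = P x + integral {0..x} (\<lambda>t. A t (Y (Suc n) t))"
        and 2: "Y (Suc n) x = P x + integral {0..x} (\<lambda>t. A t (Y n t))"
        by (rule fun_cong[OF YS])+
      show ?thesis using Suc.prems by (subst integral_diff) (simp_all add: 1 2 integrable_continuous_real cA)
    qed
    also have "norm \<dots> \<le> integral {0..x} (\<lambda>t. K * (C * ((K * t) ^ n / fact n)))"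
    proof (rule integral_norm_bound_integral)
      show "(\<lambda>t. A t (Y (Suc n) t) - A t (Y n t)) integrable_on {0..x}"
        using Suc.prems by (intro integrable_continuous_real continuous_intros cA)
      show "(\<lambda>t. K * (C * ((K * t) ^ n / fact n))) integrable_on {0..x}" using int by blast
      fix t assume "t \<in> {0..x}"
      then have t: "t \<in> {0..b}" using Suc.prems by auto
      show "norm (A t (Y (Suc n) t) - A t (Y n t)) \<le> K * (C * ((K * t) ^ n / fact n))"
        using lip[OF t] Suc.IH[OF t] K by (meson mult_left_mono order_trans)
    qed
    also have "\<dots> = C * ((K * x) ^ Suc n / fact (Suc n)) - C * ((K * 0) ^ Suc n / fact (Suc n))"
      by (rule integral_unique[OF int])
    also have "\<dots> = C * ((K * x) ^ Suc n / fact (Suc n))" by simp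
    finally show ?case .
  qed
  have "uniform_limit {0..b} (\<lambda>n x. \<Sum>i<n. Y (Suc i) x - Y i x) (\<lambda>x. \<Sum>i. Y (Suc i) x - Y i x) sequentially"
  proof (rule Weierstrass_m_test)
    fix n x assume x: "x \<in> {0..b}"
    have "norm (Y (Suc n) x - Y n x) \<le> C * ((K * x) ^ n / fact n)" by (rule step[OF x])
    also have "\<dots> \<le> C * ((K * b) ^ n / fact n)"
      using x K C0 by (intro mult_left_mono divide_right_mono power_mono) auto
    finally show "norm (Y (Suc n) x - Y n x) \<le> C * ((K * b) ^ n / fact n)" .
  next
    show "summable (\<lambda>n. C * ((K * b) ^ n / fact n))"
      using summable_exp[of "K * b"] by (intro summable_mult) (simp add: divide_inverse mult.commute)
  qed
  moreover have "(\<Sum>i<n. Y (Suc i) x - Y i x) = Y n x - P x" for n x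
    using sum_lessThan_telescope[of "\<lambda>i. Y i x" n] by (simp add: Y0)
  ultimately have "uniform_limit {0..b} (\<lambda>n x. Y n x - P x) (\<lambda>x. \<Sum>i. Y (Suc i) x - Y i x) sequentially"
    by simp
  from uniform_limit_add[OF this uniform_limit_const[where c = P]]
  have unif: "uniform_limit {0..b} Y (\<lambda>x. (\<Sum>i. Y (Suc i) x - Y i x) + P x) sequentially"
    by simp
  define Z where "Z = (\<lambda>x. (\<Sum>i. Y (Suc i) x - Y i x) + P x)"
  have unif: "uniform_limit {0..b} Y Z sequentially" using unif by (simp add: Z_def)
  have cZ: "continuous_on {0..b} Z"
    by (rule uniform_limit_theorem[OF _ unif]) (auto intro!: always_eventually cY)
  have eq: "Z x = P x + integral {0..x} (\<lambda>t. A t (Z t))" if x: "x \<in> {0..b}" for x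
  proof -
    have u: "uniform_limit {0..x} (\<lambda>n t. A t (Y n t)) (\<lambda>t. A t (Z t)) sequentially"
    proof (rule uniform_limitI)
      fix e :: real assume "e > 0"
      then have "e / (K + 1) > 0" using K by simp
      from uniform_limitD[OF unif this]
      show "\<forall>\<^sub>F n in sequentially. \<forall>t\<in>{0..x}. dist (A t (Y n t)) (A t (Z t)) < e"
      proof eventually_elim
        case (elim n)
        show ?case
        proof
          fix t assume "t \<in> {0..x}"
          then have t: "t \<in> {0..b}" using x by auto
          have "dist (A t (Y n t)) (A t (Z t)) \<le> K * norm (Y n t - Z t)" using lip[OF t] by (simp add: dist_norm)
          also have "\<dots> \<le> K * (e / (K + 1))"
            using elim t K by (intro mult_left_mono) (auto simp: dist_norm less_imp_le)
          also have "\<dots> < e" using \<open>e > 0\<close> K by (simp add: field_simps)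
          finally show "dist (A t (Y n t)) (A t (Z t)) < e" .
        qed
      qed
    qed
    obtain I J where I: "\<And>n. ((\<lambda>t. A t (Y n t)) has_integral I n) {0..x}"
      and J: "((\<lambda>t. A t (Z t)) has_integral J) {0..x}" and IJ: "I \<longlonglongrightarrow> J"
      by (rule uniform_limit_integral[OF u cA[OF x] sequentially_bot], rule that)
    have 1: "(\<lambda>n. P x + I n) \<longlonglongrightarrow> P x + J" by (intro tendsto_intros IJ)
    have 2: "(\<lambda>n. Y (Suc n) x) = (\<lambda>n. P x + I n)" by (simp add: YS integral_unique[OF I])
    have "(\<lambda>n. Y (Suc n) x) \<longlonglongrightarrow> Z x"
      using tendsto_uniform_limitI[OF unif x] by (rule LIMSEQ_Suc)
    then have "Z x = P x + J" unfolding 2 using 1 by (rule LIMSEQ_unique)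
    then show ?thesis using J by (simp add: integral_unique)
  qed
  show ?thesis by (rule that[OF cZ eq])
qed

text \<open>\<open>(a + K \<integral> N) exp (- K x)\<close> has derivative at most 0, so it stays below its initial value \<open>a\<close>.\<close>

lemma Gronwall:
  fixes N :: "real \<Rightarrow> real"
  assumes N: "continuous_on {0..b} N" and K: "0 \<le> K" and x: "x \<in> {0..b}"
    and le: "\<And>x. x \<in> {0..b} \<Longrightarrow> N x \<le> a + K * integral {0..x} N"
  shows "N x \<le> a * exp (K * x)"
proof -
  define V where "V = (\<lambda>x. (a + K * integral {0..x} N) * exp (- K * x))"
  have cont: "continuous_on {0..x} N" by (rule continuous_on_subset[OF N]) (use x in auto)
  have dV: "(V has_real_derivative (K * (N t - (a + K * integral {0..t} N))) * exp (- K * t)) (at t within {0..x})"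
    if "t \<in> {0..x}" for t
    unfolding V_def using integral_has_real_derivative[OF cont that]
    by (auto intro!: derivative_eq_intros simp: algebra_simps)
  have "\<exists>t\<in>{0..x}. V x - V 0 = ((K * (N t - (a + K * integral {0..t} N))) * exp (- K * t)) * (x - 0)"
    by (rule mvt_very_simple) (use x dV in \<open>auto simp: has_field_derivative_def\<close>)
  then obtain t where t: "t \<in> {0..x}" "V x - V 0 = ((K * (N t - (a + K * integral {0..t} N))) * exp (- K * t)) * (x - 0)"
    by blast
  have "N t - (a + K * integral {0..t} N) \<le> 0" using le[of t] t x by auto
  then have "V x - V 0 \<le> 0"
    unfolding t(2) using x K by (intro mult_nonpos_nonneg mult_nonneg_nonpos) simp_all
  then have "(a + K * integral {0..x} N) * exp (- K * x) \<le> a" by (simp add: V_def)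
  then have "a + K * integral {0..x} N \<le> a * exp (K * x)" by (simp add: exp_minus field_simps)
  then show ?thesis using le[OF x] by linarith
qed

abbreviation period :: "real set" where "period \<equiv> {0..2*pi}"

text \<open>The equation \<open>f'' = R f + h\<close> is imposed in integrated form, because the inhomogeneity \<open>h\<close> is an
  \<open>L\<^sup>2\<close> function, for which \<open>f''\<close> exists only almost everywhere.\<close>

definition solves :: "(real \<Rightarrow> complex) \<Rightarrow> (real \<Rightarrow> complex) \<Rightarrow> (real \<Rightarrow> complex) \<Rightarrow> (real \<Rightarrow> complex) \<Rightarrow> bool" where
  "solves R h f f' \<longleftrightarrow> (\<forall>x\<in>period. (f has_vector_derivative f' x) (at x within period) \<and>
     f' x = f' 0 + (LBINT t:{0..x}. R t * f t + h t))"

lemma set_integrable_initial: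
  fixes h :: "real \<Rightarrow> complex"
  assumes "set_integrable lborel period h" "x \<in> period"
  shows "set_integrable lborel {0..x} h"
  by (rule set_integrable_subset[OF assms(1)]) (use assms(2) in auto)

lemma set_integrable_zero [simp]: "set_integrable lborel S (\<lambda>_. 0 :: complex)"
  by (simp add: set_integrable_def)

lemma set_integrable_continuous: "continuous_on period (R :: real \<Rightarrow> complex) \<Longrightarrow> set_integrable lborel period R"
  by (rule borel_integrable_atLeastAtMost')

lemma solvesD:
  assumes "solves R h f f'" "x \<in> period"
  shows "(f has_vector_derivative f' x) (at x within period)"
    and "(LBINT t:{0..x}. R t * f t + h t) = f' x - f' 0"
proof -
  show "(f has_vector_derivative f' x) (at x within period)"
    using assms unfolding solves_def by blast
  have "f' x = f' 0 + (LBINT t:{0..x}. R t * f t + h t)"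
    using assms unfolding solves_def by blast
  then show "(LBINT t:{0..x}. R t * f t + h t) = f' x - f' 0" by (simp only: add_diff_cancel_left')
qed

lemma solves_continuous: "solves R h f f' \<Longrightarrow> continuous_on period f"
  by (rule continuous_on_vector_derivative) (rule solvesD(1))

context
  fixes R :: "real \<Rightarrow> complex"
  assumes R: "continuous_on period R"
begin

lemma solves_integrable:
  assumes "solves R h f f'" "set_integrable lborel period h"
  shows "set_integrable lborel period (\<lambda>t. R t * f t + h t)"
  by (intro set_integral_add(1)[OF _ assms(2)] set_integrable_continuous continuous_on_mult R solves_continuous[OF assms(1)])

lemma solves_integral:
  assumes "solves R h f f'" "set_integrable lborel period h" "x \<in> period"
  shows "f' x = f' 0 + integral {0..x} (\<lambda>t. R t * f t) + integral {0..x} h"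
proof -
  have 1: "set_integrable lborel {0..x} (\<lambda>t. R t * f t)"
    by (intro set_integrable_initial[OF _ assms(3)] set_integrable_continuous continuous_on_mult R solves_continuous[OF assms(1)])
  have 2: "set_integrable lborel {0..x} h" by (rule set_integrable_initial[OF assms(2,3)])
  have "f' x = f' 0 + (LBINT t:{0..x}. R t * f t + h t)"
    using assms unfolding solves_def by blast
  also have "\<dots> = f' 0 + integral {0..x} (\<lambda>t. R t * f t) + integral {0..x} h"
    by (simp add: set_integral_add[OF 1 2] set_borel_integral_eq_integral[OF 1] set_borel_integral_eq_integral[OF 2])
  finally show ?thesis .
qed

lemma solves_continuous':
  assumes "solves R h f f'" "set_integrable lborel period h"
  shows "continuous_on period f'"
proof -
  have "continuous_on period (\<lambda>x. f' 0 + integral {0..x} (\<lambda>t. R t * f t) + integral {0..x} h)"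
    by (intro continuous_intros indefinite_integral_continuous_1 integrable_continuous_real R solves_continuous[OF assms(1)]
        set_borel_integral_eq_integral(1) assms)
  then show ?thesis by (rule continuous_on_eq) (rule solves_integral[OF assms, symmetric])
qed

lemma solves_has_vector_derivative:
  assumes "solves R h f f'" "continuous_on period h" "x \<in> period"
  shows "(f' has_vector_derivative R x * f x + h x) (at x within period)"
proof -
  have c: "continuous_on period (\<lambda>t. R t * f t + h t)"
    by (intro continuous_intros R solves_continuous[OF assms(1)] assms)
  have "f' y = f' 0 + integral {0..y} (\<lambda>t. R t * f t + h t)" if "y \<in> period" for y
  proof -
    have "integral {0..y} (\<lambda>t. R t * f t + h t) = f' y - f' 0"
      using solvesD(2)[OF assms(1) that]
      unfolding set_borel_integral_eq_integral(2)[OF set_integrable_initial[OF set_integrable_continuous[OF c] that]] .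
    then show ?thesis by simp
  qed
  moreover have "((\<lambda>y. f' 0 + integral {0..y} (\<lambda>t. R t * f t + h t)) has_vector_derivative (0 + (R x * f x + h x))) (at x within period)"
    by (intro has_vector_derivative_add has_vector_derivative_const integral_has_vector_derivative c assms)
  ultimately have "(f' has_vector_derivative (0 + (R x * f x + h x))) (at x within period)"
    by (rule has_vector_derivative_transform[OF assms(3)])
  then show ?thesis by simp
qed

lemma solvesI:
  assumes "\<And>x. x \<in> period \<Longrightarrow> (f has_vector_derivative f' x) (at x within period)"
    and "\<And>x. x \<in> period \<Longrightarrow> (f' has_vector_derivative R x * f x + h x) (at x within period)"
    and "continuous_on period h"
  shows "solves R h f f'"
  unfolding solves_def
proof (intro ballI conjI assms(1))
  fix x assume x: "x \<in> period"
  have c: "continuous_on period (\<lambda>t. R t * f t + h t)"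
    using assms(1) by (intro continuous_intros R assms(3) continuous_on_vector_derivative[where f' = f'])
  have "((\<lambda>t. R t * f t + h t) has_integral f' x - f' 0) {0..x}"
  proof (rule fundamental_theorem_of_calculus)
    fix t assume "t \<in> {0..x}"
    then show "(f' has_vector_derivative R t * f t + h t) (at t within {0..x})"
      using x by (intro has_vector_derivative_within_subset[OF assms(2)]) auto
  qed (use x in auto)
  then show "f' x = f' 0 + (LBINT t:{0..x}. R t * f t + h t)"
    using set_borel_integral_eq_integral(2)[OF set_integrable_initial[OF set_integrable_continuous[OF c] x]]
    by (simp add: integral_unique)
qed

lemma solves_linear_combination:
  assumes f: "solves R h f f'" and g: "solves R k g g'"
    and h: "set_integrable lborel period h" and k: "set_integrable lborel period k"
  shows "solves R (\<lambda>x. a * h x + b * k x) (\<lambda>x. a * f x + b * g x) (\<lambda>x. a * f' x + b * g' x)"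
  unfolding solves_def
proof (intro ballI conjI)
  fix x assume x: "x \<in> period"
  show "((\<lambda>x. a * f x + b * g x) has_vector_derivative a * f' x + b * g' x) (at x within period)"
    by (intro has_vector_derivative_add has_vector_derivative_mult_right solvesD(1)[OF f x] solvesD(1)[OF g x])
  have i: "set_integrable lborel {0..x} (\<lambda>t. R t * f t + h t)" "set_integrable lborel {0..x} (\<lambda>t. R t * g t + k t)"
    by (rule set_integrable_initial[OF solves_integrable[OF f h] x] set_integrable_initial[OF solves_integrable[OF g k] x])+
  have "(LBINT t:{0..x}. R t * (a * f t + b * g t) + (a * h t + b * k t)) =
      (LBINT t:{0..x}. a * (R t * f t + h t) + b * (R t * g t + k t))"
    by (simp add: algebra_simps)
  also have "\<dots> = a * (LBINT t:{0..x}. R t * f t + h t) + b * (LBINT t:{0..x}. R t * g t + k t)"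
    using i by (subst set_integral_add) auto
  also have "\<dots> = a * (f' x - f' 0) + b * (g' x - g' 0)"
    by (simp only: solvesD(2)[OF f x] solvesD(2)[OF g x])
  finally show "a * f' x + b * g' x = (a * f' 0 + b * g' 0) +
      (LBINT t:{0..x}. R t * (a * f t + b * g t) + (a * h t + b * k t))"
    by (simp add: algebra_simps)
qed

text \<open>Gronwall's inequality for \<open>|f| + |f'|\<close>. With \<open>K \<ge> 1\<close> the same constant serves for both
  components of the first-order system.\<close>

lemma solves_estimate:
  assumes f: "solves R h f f'" and h: "set_integrable lborel period h"
    and K: "\<And>x. x \<in> period \<Longrightarrow> norm (R x) \<le> K" "1 \<le> K" and x: "x \<in> period"
  shows "norm (f x) + norm (f' x) \<le>
    (norm (f 0) + norm (f' 0) + (LBINT t:period. norm (h t))) * exp (K * (2 * pi))"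
proof -
  let ?H = "LBINT t:period. norm (h t)"
  let ?N = "\<lambda>x. norm (f x) + norm (f' x)"
  have hn: "set_integrable lborel period (\<lambda>t. norm (h t))" using h by (rule set_integrable_norm)
  have H: "norm (integral {0..x} h) \<le> ?H" if "x \<in> period" for x
  proof -
    have hx: "set_integrable lborel {0..x} h" and hnx: "set_integrable lborel {0..x} (\<lambda>t. norm (h t))"
      by (rule set_integrable_subset[OF h] set_integrable_subset[OF hn]; use that in auto)+
    have "norm (integral {0..x} h) \<le> integral {0..x} (\<lambda>t. norm (h t))"
      by (intro integral_norm_bound_integral set_borel_integral_eq_integral(1) hx hnx) simp
    also have "\<dots> \<le> integral period (\<lambda>t. norm (h t))"
      by (intro integral_subset_le set_borel_integral_eq_integral(1) hnx hn) (use that in auto)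
    also have "\<dots> = ?H" by (rule set_borel_integral_eq_integral(2)[OF hn, symmetric])
    finally show ?thesis .
  qed
  have cf: "continuous_on period f" by (rule solves_continuous[OF f])
  have cf': "continuous_on period f'" by (rule solves_continuous'[OF f h])
  have cN: "continuous_on period ?N" by (intro continuous_intros cf cf')
  have N_le: "?N y \<le> (norm (f 0) + norm (f' 0) + ?H) + K * integral {0..y} ?N" if y: "y \<in> period" for y
  proof -
    have sub: "{0..y} \<subseteq> period" using y by auto
    have c: "continuous_on {0..y} f" "continuous_on {0..y} f'" "continuous_on {0..y} R"
      using continuous_on_subset[OF _ sub] cf cf' R by blast+
    have "(f' has_integral f y - f 0) {0..y}"
    proof (rule fundamental_theorem_of_calculus)
      fix t assume "t \<in> {0..y}"
      then show "(f has_vector_derivative f' t) (at t within {0..y})"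
        using sub by (intro has_vector_derivative_within_subset[OF solvesD(1)[OF f] sub]) auto
    qed (use y in auto)
    then have f1: "norm (f y) \<le> norm (f 0) + norm (integral {0..y} f')"
      using norm_triangle_ineq[of "f 0" "integral {0..y} f'"] by (simp add: integral_unique)
    have f2: "norm (integral {0..y} f') \<le> integral {0..y} (\<lambda>t. K * norm (f' t))"
    proof (intro integral_norm_bound_integral integrable_continuous_real continuous_intros c)
      show "norm (f' t) \<le> K * norm (f' t)" for t using K(2) mult_right_mono[of 1 K "norm (f' t)"] by simp
    qed
    have f3: "norm (f' y) \<le> norm (f' 0) + norm (integral {0..y} (\<lambda>t. R t * f t)) + ?H"
    proof -
      have "norm (f' y) = norm (f' 0 + integral {0..y} (\<lambda>t. R t * f t) + integral {0..y} h)"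
        by (rule arg_cong[OF solves_integral[OF f h y]])
      also have "\<dots> \<le> norm (f' 0) + norm (integral {0..y} (\<lambda>t. R t * f t)) + norm (integral {0..y} h)"
        by (intro order_trans[OF norm_triangle_ineq] add_mono norm_triangle_ineq order_refl)
      finally show ?thesis using H[OF y] by linarith
    qed
    have f4: "norm (integral {0..y} (\<lambda>t. R t * f t)) \<le> integral {0..y} (\<lambda>t. K * norm (f t))"
    proof (intro integral_norm_bound_integral integrable_continuous_real continuous_intros c)
      show "norm (R t * f t) \<le> K * norm (f t)" if "t \<in> {0..y}" for t
        using K(1)[of t] sub that by (auto simp: norm_mult intro!: mult_right_mono)
    qed
    have "integral {0..y} ?N = integral {0..y} (\<lambda>t. norm (f t)) + integral {0..y} (\<lambda>t. norm (f' t))"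
      by (intro integral_add integrable_continuous_real continuous_intros c)
    then have "K * integral {0..y} ?N = integral {0..y} (\<lambda>t. K * norm (f t)) + integral {0..y} (\<lambda>t. K * norm (f' t))"
      by (simp add: distrib_left)
    then show ?thesis using f1 f2 f3 f4 by linarith
  qed
  have H0: "0 \<le> ?H" using order_trans[OF norm_ge_zero H[OF x]] .
  have "?N x \<le> (norm (f 0) + norm (f' 0) + ?H) * exp (K * x)"
    by (rule Gronwall[OF cN _ x N_le]) (use K in auto)
  also have "\<dots> \<le> (norm (f 0) + norm (f' 0) + ?H) * exp (K * (2 * pi))"
    using x K H0 by (intro mult_left_mono) auto
  finally show ?thesis .
qed

lemma continuous_bound: obtains K where "\<And>x. x \<in> period \<Longrightarrow> norm (R x) \<le> K" "1 \<le> K"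
proof -
  have "bounded (R ` period)" by (intro compact_imp_bounded compact_continuous_image R) simp
  then obtain K where "\<And>x. x \<in> period \<Longrightarrow> norm (R x) \<le> K" unfolding bounded_iff by blast
  then show ?thesis by (intro that[of "max 1 K"]) (auto simp: le_max_iff_disj)
qed

text \<open>The Volterra equation for the pair \<open>(f, f')\<close>; only the indefinite integral of \<open>h\<close> enters, so
  integrability of \<open>h\<close> is enough.\<close>

lemma solves_exists:
  assumes h: "set_integrable lborel period h"
  obtains f f' where "solves R h f f'" "f 0 = v" "f' 0 = v'"
proof -
  obtain K where K: "\<And>x. x \<in> period \<Longrightarrow> norm (R x) \<le> K" "1 \<le> K" by (rule continuous_bound, rule that)
  let ?A = "\<lambda>t p. (snd p, R t * fst p)"
  let ?P = "\<lambda>x. (v, v' + integral {0..x} h)"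
  have cP: "continuous_on period ?P"
    by (intro continuous_intros indefinite_integral_continuous_1 set_borel_integral_eq_integral(1) h)
  have lip: "norm (?A t p - ?A t q) \<le> (1 + K) * norm (p - q)" if "t \<in> period" for t and p q :: "complex \<times> complex"
  proof -
    have "norm (?A t p - ?A t q) \<le> norm (snd (p - q)) + norm (R t * fst (p - q))"
      by (simp add: right_diff_distrib) (rule norm_Pair_le)
    also have "\<dots> \<le> norm (p - q) + K * norm (p - q)"
    proof (intro add_mono)
      show "norm (snd (p - q)) \<le> norm (p - q)" by (metis norm_snd_le prod.collapse)
      have "norm (fst (p - q)) \<le> norm (p - q)" by (metis norm_fst_le prod.collapse)
      then show "norm (R t * fst (p - q)) \<le> K * norm (p - q)"
        unfolding norm_mult using K that by (intro mult_mono) auto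
    qed
    finally show ?thesis by (simp add: algebra_simps)
  qed
  obtain Y where cY: "continuous_on period Y"
    and Y: "\<And>x. x \<in> period \<Longrightarrow> Y x = ?P x + integral {0..x} (\<lambda>t. ?A t (Y t))"
  proof (rule Volterra_equation_solvable[OF _ _ cP, of "1 + K" ?A])
    show "continuous_on period (\<lambda>t. ?A t (Y t))" if "continuous_on period Y" for Y :: "real \<Rightarrow> complex \<times> complex"
      by (intro continuous_intros that R)
  qed (use K lip in auto)
  let ?f = "\<lambda>x. fst (Y x)" and ?f' = "\<lambda>x. snd (Y x)"
  have cf: "continuous_on period ?f" "continuous_on period ?f'" by (intro continuous_intros cY)+
  have f: "?f x = v + integral {0..x} ?f'" and f': "?f' x = v' + integral {0..x} h + integral {0..x} (\<lambda>t. R t * ?f t)"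
    if x: "x \<in> period" for x
  proof -
    have "continuous_on period (\<lambda>t. ?A t (Y t))"
      by (intro continuous_on_Pair continuous_on_mult cf R)
    moreover have "{0..x} \<subseteq> period" using x by auto
    ultimately have int: "(\<lambda>t. ?A t (Y t)) integrable_on {0..x}"
      by (intro integrable_continuous_real) (rule continuous_on_subset)
    have "fst (integral {0..x} (\<lambda>t. ?A t (Y t))) = integral {0..x} ?f'"
      using integral_linear[OF int bounded_linear_fst] by (simp add: o_def)
    moreover have "snd (integral {0..x} (\<lambda>t. ?A t (Y t))) = integral {0..x} (\<lambda>t. R t * ?f t)"
      using integral_linear[OF int bounded_linear_snd] by (simp add: o_def)
    ultimately show "?f x = v + integral {0..x} ?f'"
      "?f' x = v' + integral {0..x} h + integral {0..x} (\<lambda>t. R t * ?f t)"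
      using arg_cong[OF Y[OF x], of fst] arg_cong[OF Y[OF x], of snd] by simp_all
  qed
  have init: "?f 0 = v" "?f' 0 = v'" using f[of 0] f'[of 0] by simp_all
  have "solves R h ?f ?f'"
    unfolding solves_def
  proof (intro ballI conjI)
    fix x assume x: "x \<in> period"
    have "((\<lambda>x. v + integral {0..x} ?f') has_vector_derivative (0 + ?f' x)) (at x within period)"
      by (intro has_vector_derivative_add has_vector_derivative_const integral_has_vector_derivative cf x)
    from has_vector_derivative_transform[OF x f this]
    show "(?f has_vector_derivative ?f' x) (at x within period)" by simp
    have 1: "set_integrable lborel {0..x} (\<lambda>t. R t * ?f t)"
      by (rule set_integrable_initial[OF set_integrable_continuous[OF continuous_on_mult[OF R cf(1)]] x])
    have 2: "set_integrable lborel {0..x} h" by (rule set_integrable_initial[OF h x])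
    show "?f' x = ?f' 0 + (LBINT t:{0..x}. R t * ?f t + h t)"
      unfolding set_integral_add(2)[OF 1 2] set_borel_integral_eq_integral(2)[OF 1] set_borel_integral_eq_integral(2)[OF 2]
      using f'[OF x] init by (simp only: ac_simps)
  qed
  moreover note init
  ultimately show ?thesis by (rule that)
qed

lemma solves_unique:
  assumes "solves R h f f'" "solves R h g g'" "set_integrable lborel period h"
    and "f 0 = g 0" "f' 0 = g' 0" "x \<in> period"
  shows "f x = g x" "f' x = g' x"
proof -
  obtain K where K: "\<And>x. x \<in> period \<Longrightarrow> norm (R x) \<le> K" "1 \<le> K" by (rule continuous_bound, rule that)
  have s: "solves R (\<lambda>x. 1 * h x + (-1) * h x) (\<lambda>x. 1 * f x + (-1) * g x) (\<lambda>x. 1 * f' x + (-1) * g' x)"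
    by (rule solves_linear_combination) (use assms in auto)
  have "norm (f x - g x) + norm (f' x - g' x) \<le> 0"
    using solves_estimate[OF s _ K assms(6)] assms(4,5) by (simp add: set_integrable_def set_lebesgue_integral_def)
  then show "f x = g x" "f' x = g' x"
    by (smt (verit) norm_ge_zero norm_le_zero_iff right_minus_eq)+
qed

text \<open>The monodromy map of \<open>f'' = R f\<close>, from the Cauchy data at 0 to those at \<open>2 \<pi>\<close>.\<close>

definition endpoint :: "complex \<Rightarrow> complex \<Rightarrow> complex \<times> complex" where
  "endpoint v v' = (SOME p. \<exists>f f'. solves R (\<lambda>_. 0) f f' \<and> f 0 = v \<and> f' 0 = v' \<and> p = (f (2*pi), f' (2*pi)))"

lemma endpoint_eq:
  assumes "solves R (\<lambda>_. 0) f f'"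
  shows "endpoint (f 0) (f' 0) = (f (2*pi), f' (2*pi))"
  unfolding endpoint_def
proof (rule some_equality)
  fix p assume "\<exists>g g'. solves R (\<lambda>_. 0) g g' \<and> g 0 = f 0 \<and> g' 0 = f' 0 \<and> p = (g (2*pi), g' (2*pi))"
  then obtain g g' where g: "solves R (\<lambda>_. 0) g g'" "g 0 = f 0" "g' 0 = f' 0" "p = (g (2*pi), g' (2*pi))" by blast
  show "p = (f (2*pi), f' (2*pi))"
    using solves_unique[OF g(1) assms _ g(2,3), of "2*pi"] g(4) by simp
qed (use assms in blast)

lemma endpoint_linear:
  "endpoint v v' = (v * fst (endpoint 1 0) + v' * fst (endpoint 0 1), v * snd (endpoint 1 0) + v' * snd (endpoint 0 1))"
proof -
  obtain f f' where f: "solves R (\<lambda>_. 0) f f'" "f 0 = 1" "f' 0 = 0" by (rule solves_exists[of "\<lambda>_. 0"]) auto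
  obtain g g' where g: "solves R (\<lambda>_. 0) g g'" "g 0 = 0" "g' 0 = 1" by (rule solves_exists[of "\<lambda>_. 0"]) auto
  have "solves R (\<lambda>x. v * 0 + v' * 0) (\<lambda>x. v * f x + v' * g x) (\<lambda>x. v * f' x + v' * g' x)"
    by (rule solves_linear_combination) (use f g in auto)
  then have "solves R (\<lambda>_. 0) (\<lambda>x. v * f x + v' * g x) (\<lambda>x. v * f' x + v' * g' x)" by simp
  from endpoint_eq[OF this] show ?thesis
    using endpoint_eq[OF f(1)] endpoint_eq[OF g(1)] f g by simp
qed

text \<open>Liouville's theorem for the monodromy matrix: the Wronskian is constant as there is no
  first-order term.\<close>

lemma endpoint_Wronskian:
  "fst (endpoint 1 0) * snd (endpoint 0 1) - fst (endpoint 0 1) * snd (endpoint 1 0) = 1"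
proof -
  obtain f f' where f: "solves R (\<lambda>_. 0) f f'" "f 0 = 1" "f' 0 = 0" by (rule solves_exists[of "\<lambda>_. 0"]) auto
  obtain g g' where g: "solves R (\<lambda>_. 0) g g'" "g 0 = 0" "g' 0 = 1" by (rule solves_exists[of "\<lambda>_. 0"]) auto
  let ?W = "\<lambda>x. f x * g' x - g x * f' x"
  have d: "(f has_vector_derivative f' x) (at x within period)" "(g has_vector_derivative g' x) (at x within period)"
    "(f' has_vector_derivative R x * f x) (at x within period)" "(g' has_vector_derivative R x * g x) (at x within period)"
    if "x \<in> period" for x
    using solvesD(1)[OF f(1) that] solvesD(1)[OF g(1) that] solves_has_vector_derivative[OF f(1) _ that]
      solves_has_vector_derivative[OF g(1) _ that] by simp_all
  have dW: "(?W has_vector_derivative 0) (at x within period)" if x: "x \<in> period" for x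
  proof -
    have "(?W has_vector_derivative (f x * (R x * g x) + f' x * g' x) - (g x * (R x * f x) + g' x * f' x)) (at x within period)"
      by (intro has_vector_derivative_diff has_vector_derivative_mult d x)
    then show ?thesis by (simp add: algebra_simps)
  qed
  obtain c where c: "\<And>x. x \<in> period \<Longrightarrow> ?W x = c"
    by (rule has_vector_derivative_zero_constant[OF convex_real_interval(5) dW], assumption, rule that)
  have "?W (2*pi) = ?W 0" using c[of 0] c[of "2*pi"] by simp
  then show ?thesis using endpoint_eq[OF f(1)] endpoint_eq[OF g(1)] f g by simp
qed

text \<open>Subtracting the homogeneous solution with the same initial data leaves a solution with zero
  initial data that is driven by \<open>h\<close> alone.\<close>

lemma endpoint_estimate:
  assumes f: "solves R h f f'" and h: "set_integrable lborel period h"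
    and K: "\<And>x. x \<in> period \<Longrightarrow> norm (R x) \<le> K" "1 \<le> K"
  shows "norm (f (2*pi) - fst (endpoint (f 0) (f' 0))) + norm (f' (2*pi) - snd (endpoint (f 0) (f' 0))) \<le>
    (LBINT t:period. norm (h t)) * exp (K * (2 * pi))"
proof -
  obtain g g' where g: "solves R (\<lambda>_. 0) g g'" "g 0 = f 0" "g' 0 = f' 0" by (rule solves_exists[of "\<lambda>_. 0"]) auto
  have s: "solves R (\<lambda>x. 1 * h x + (-1) * 0) (\<lambda>x. 1 * f x + (-1) * g x) (\<lambda>x. 1 * f' x + (-1) * g' x)"
    by (rule solves_linear_combination) (use f g h in auto)
  show ?thesis
    using solves_estimate[OF s _ K, of "2*pi"] h g endpoint_eq[OF g(1)] by simp
qed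

end

section \<open>Dependence on the parameter\<close>

definition hill_coeff :: "complex \<Rightarrow> complex \<Rightarrow> real \<Rightarrow> complex" where
  "hill_coeff \<mu> c x = \<mu> - potential c x"

lemma of_real_sin_in_real_cut: "complex_of_real (- sin x) \<in> real_cut"
  by (rule imageI) auto

lemma real_cut_compact: "compact real_cut"
  by (intro compact_continuous_image continuous_intros) simp

lemma open_Compl_real_cut: "open (- real_cut)"
  using real_cut_compact compact_imp_closed open_Compl by blast

lemma potential_denominator_nonzero: "c \<notin> real_cut \<Longrightarrow> c + of_real (sin x) \<noteq> 0"
  using of_real_sin_in_real_cut[of x] by (auto simp: add_eq_0_iff2)

lemma potential_denominator_bounded_below:
  assumes "c0 \<notin> real_cut"
  obtains r where "r > 0" "ball c0 r \<subseteq> - real_cut"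
    "\<And>c x. c \<in> ball c0 r \<Longrightarrow> norm (c + of_real (sin x)) \<ge> r"
proof -
  obtain e where e: "e > 0" "ball c0 e \<subseteq> - real_cut"
    using open_Compl_real_cut assms by (meson ComplI open_contains_ball)
  have "norm (c + of_real (sin x)) \<ge> e / 2" if "c \<in> ball c0 (e / 2)" for c x
  proof -
    have "complex_of_real (- sin x) \<notin> ball c0 e" using e of_real_sin_in_real_cut by blast
    then have "e \<le> dist c0 (of_real (- sin x))" by simp
    also have "\<dots> \<le> dist c0 c + dist c (of_real (- sin x))" by (rule dist_triangle)
    finally show ?thesis using that by (simp add: dist_norm)
  qed
  moreover have "ball c0 (e / 2) \<subseteq> - real_cut" using e subset_ball[of "e / 2" e c0] by auto
  ultimately show ?thesis using e(1) by (intro that[of "e / 2"]) auto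
qed

lemma continuous_on_hill_coeff: "c \<notin> real_cut \<Longrightarrow> continuous_on S (hill_coeff \<mu> c)"
  unfolding hill_coeff_def potential_def
  by (intro continuous_intros) (auto simp: potential_denominator_nonzero)

lemma norm_hill_coeff_le:
  assumes "r > 0" "norm (c + of_real (sin x)) \<ge> r"
  shows "norm (hill_coeff \<mu> c x) \<le> norm \<mu> + 1 / r + 1"
proof -
  have "norm (potential c x) \<le> 1 / r"
    unfolding potential_def norm_divide using assms by (intro frac_le) auto
  then show ?thesis unfolding hill_coeff_def using norm_triangle_ineq4[of \<mu> "potential c x"] by linarith
qed

text \<open>Multiplied by \<open>c + sin\<close>, the equation \<open>F'' - \<mu> F + Q F = 0\<close> becomes
  \<open>(c + sin) G + sin F = 0\<close> with \<open>G = F'' - \<mu> F\<close>, which is affine in \<open>c\<close>. Comparing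
  coefficients of \<open>c - c0\<close> for \<open>F = \<Sum>\<^sub>j (c - c0)\<^sup>j F\<^sub>j\<close> gives a recursion in which the
  new term \<open>F\<^sub>j\<close> solves the equation at \<open>c0\<close> with a right-hand side made from \<open>g = G\<^sub>j\<^sub>-\<^sub>1\<close>.\<close>

lemma formal_solution_step:
  assumes c0: "c0 \<notin> real_cut" and g: "continuous_on period g"
  obtains F F' G where "F 0 = v" "F' 0 = v'" "continuous_on period G"
    "\<And>x. x \<in> period \<Longrightarrow> (F has_vector_derivative F' x) (at x within period)"
    "\<And>x. x \<in> period \<Longrightarrow> (F' has_vector_derivative \<mu> * F x + G x) (at x within period)"
    "\<And>x. x \<in> period \<Longrightarrow> (c0 + of_real (sin x)) * G x + of_real (sin x) * F x + g x = 0"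
proof -
  define h where "h = (\<lambda>x. - g x / (c0 + of_real (sin x)))"
  have h: "continuous_on period h"
    unfolding h_def by (intro continuous_intros g) (auto simp: potential_denominator_nonzero c0)
  note R = continuous_on_hill_coeff[OF c0, of period \<mu>]
  obtain F F' where F: "solves (hill_coeff \<mu> c0) h F F'" "F 0 = v" "F' 0 = v'"
    by (rule solves_exists[OF R set_integrable_continuous[OF h], of v v'])
  define G where "G = (\<lambda>x. h x - potential c0 x * F x)"
  show ?thesis
  proof (rule that[of F F' G])
    have "continuous_on period (\<lambda>x. h x - (\<mu> - hill_coeff \<mu> c0 x) * F x)"
      by (intro continuous_intros h R solves_continuous[OF F(1)])
    then show "continuous_on period G" by (simp add: G_def hill_coeff_def)
    fix x assume x: "x \<in> period"
    show "(F has_vector_derivative F' x) (at x within period)" by (rule solvesD(1)[OF F(1) x])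
    show "(F' has_vector_derivative \<mu> * F x + G x) (at x within period)"
      using solves_has_vector_derivative[OF R F(1) h x] by (simp add: G_def hill_coeff_def algebra_simps)
    show "(c0 + of_real (sin x)) * G x + of_real (sin x) * F x + g x = 0"
      using potential_denominator_nonzero[OF c0, of x] by (simp add: G_def h_def potential_def right_diff_distrib)
  qed (use F in auto)
qed

lemma formal_solution_exists:
  fixes v v' :: "nat \<Rightarrow> complex"
  assumes c0: "c0 \<notin> real_cut"
  obtains F F' G :: "nat \<Rightarrow> real \<Rightarrow> complex" where
    "\<And>j. F j 0 = v j" "\<And>j. F' j 0 = v' j" "\<And>j. continuous_on period (G j)"
    "\<And>j x. x \<in> period \<Longrightarrow> (F j has_vector_derivative F' j x) (at x within period)"
    "\<And>j x. x \<in> period \<Longrightarrow> (F' j has_vector_derivative \<mu> * F j x + G j x) (at x within period)"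
    "\<And>j x. x \<in> period \<Longrightarrow> (c0 + of_real (sin x)) * G j x + of_real (sin x) * F j x +
       (if j = 0 then 0 else G (j - 1) x) = 0"
proof -
  define good where "good = (\<lambda>j g (F :: real \<Rightarrow> complex, F', G). F 0 = v j \<and> F' 0 = v' j \<and> continuous_on period G \<and>
    (\<forall>x\<in>period. (F has_vector_derivative F' x) (at x within period) \<and>
      (F' has_vector_derivative \<mu> * F x + G x) (at x within period) \<and>
      (c0 + of_real (sin x)) * G x + of_real (sin x) * F x + g x = 0))"
  have step: "\<exists>T. good j g T" if cg: "continuous_on period g" for j g
  proof -
    obtain F F' G where "F 0 = v j" "F' 0 = v' j" "continuous_on period G"
      "\<And>x. x \<in> period \<Longrightarrow> (F has_vector_derivative F' x) (at x within period)"
      "\<And>x. x \<in> period \<Longrightarrow> (F' has_vector_derivative \<mu> * F x + G x) (at x within period)"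
      "\<And>x. x \<in> period \<Longrightarrow> (c0 + of_real (sin x)) * G x + of_real (sin x) * F x + g x = 0"
      using formal_solution_step[OF c0 cg, of "v j" "v' j" \<mu>] by blast
    then show ?thesis by (intro exI[of _ "(F, F', G)"]) (auto simp: good_def)
  qed
  have cont: "continuous_on period (snd (snd T))" if "good j g T" for j g T
    using that by (auto simp: good_def split: prod.splits)
  have "\<exists>T. \<forall>j. ((\<exists>g. good j g (T j)) \<and> (j = 0 \<longrightarrow> good j (\<lambda>_. 0) (T j))) \<and>
      good (Suc j) (snd (snd (T j))) (T (Suc j))"
  proof (rule dependent_nat_choice)
    show "\<exists>T. (\<exists>g. good 0 g T) \<and> (0 = (0::nat) \<longrightarrow> good 0 (\<lambda>_. 0) T)"
      using step[of "\<lambda>_. 0" 0] by auto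
    fix T j assume "(\<exists>g. good j g T) \<and> (j = 0 \<longrightarrow> good j (\<lambda>_. 0) T)"
    then have "continuous_on period (snd (snd T))" using cont by blast
    from step[OF this, of "Suc j"]
    show "\<exists>T'. ((\<exists>g. good (Suc j) g T') \<and> (Suc j = 0 \<longrightarrow> good (Suc j) (\<lambda>_. 0) T')) \<and> good (Suc j) (snd (snd T)) T'"
      by auto
  qed
  then obtain T where T0: "good 0 (\<lambda>_. 0) (T 0)" and TS: "\<And>j. good (Suc j) (snd (snd (T j))) (T (Suc j))"
    by blast
  define F where "F = (\<lambda>j. fst (T j))"
  define F' where "F' = (\<lambda>j. fst (snd (T j)))"
  define G where "G = (\<lambda>j. snd (snd (T j)))"
  have good: "good j (\<lambda>x. if j = 0 then 0 else G (j - 1) x) (F j, F' j, G j)" for j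
    using T0 TS[of "j - 1"] by (cases j) (auto simp: F_def F'_def G_def)
  show ?thesis
    by (rule that[of F F' G]) (use good in \<open>auto simp: good_def\<close>)
qed

text \<open>The recursion cancels all coefficients of order below \<open>m\<close>; cutting the series off leaves the
  single term \<open>(c - c0)\<^sup>m G\<^sub>m\<^sub>-\<^sub>1\<close>.\<close>

lemma formal_solution_solves:
  fixes F F' G :: "nat \<Rightarrow> real \<Rightarrow> complex"
  assumes c: "c \<notin> real_cut" and G: "\<And>j. continuous_on period (G j)"
    and F: "\<And>j x. x \<in> period \<Longrightarrow> (F j has_vector_derivative F' j x) (at x within period)"
    and F': "\<And>j x. x \<in> period \<Longrightarrow> (F' j has_vector_derivative \<mu> * F j x + G j x) (at x within period)"
    and rec: "\<And>j x. x \<in> period \<Longrightarrow> (c0 + of_real (sin x)) * G j x + of_real (sin x) * F j x +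
       (if j = 0 then 0 else G (j - 1) x) = 0"
    and m: "m > 0"
  shows "solves (hill_coeff \<mu> c) (\<lambda>x. (c - c0) ^ m * G (m - 1) x / (c + of_real (sin x)))
    (\<lambda>x. \<Sum>j<m. (c - c0) ^ j * F j x) (\<lambda>x. \<Sum>j<m. (c - c0) ^ j * F' j x)"
proof (rule solvesI[OF continuous_on_hill_coeff[OF c]])
  show "continuous_on period (\<lambda>x. (c - c0) ^ m * G (m - 1) x / (c + of_real (sin x)))"
    by (intro continuous_intros G) (auto simp: potential_denominator_nonzero c)
  fix x assume x: "x \<in> period"
  show "((\<lambda>x. \<Sum>j<m. (c - c0) ^ j * F j x) has_vector_derivative (\<Sum>j<m. (c - c0) ^ j * F' j x)) (at x within period)"
    by (intro has_vector_derivative_sum has_vector_derivative_mult_right F x)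
  have d: "((\<lambda>x. \<Sum>j<m. (c - c0) ^ j * F' j x) has_vector_derivative (\<Sum>j<m. (c - c0) ^ j * (\<mu> * F j x + G j x))) (at x within period)"
    by (intro has_vector_derivative_sum has_vector_derivative_mult_right F' x)
  let ?s = "complex_of_real (sin x)"
  have tele: "(\<Sum>j<n. (c - c0) ^ j * ((c + ?s) * G j x + ?s * F j x)) = (c - c0) ^ n * (if n = 0 then 0 else G (n - 1) x)" for n
  proof (induction n)
    case (Suc n)
    have e: "(c + ?s) * G n x + ?s * F n x = (c - c0) * G n x - (if n = 0 then 0 else G (n - 1) x)"
      using rec[OF x, of n] by (simp add: algebra_simps)
    then show ?case unfolding sum.lessThan_Suc Suc e by (simp add: algebra_simps)
  qed simp
  have nz: "c + ?s \<noteq> 0" by (rule potential_denominator_nonzero[OF c])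
  have *: "(c + ?s) * (\<Sum>j<m. (c - c0) ^ j * G j x) + ?s * (\<Sum>j<m. (c - c0) ^ j * F j x) = (c - c0) ^ m * G (m - 1) x"
    using tele[of m] m by (simp add: sum_distrib_left sum.distrib algebra_simps)
  have "(\<Sum>j<m. (c - c0) ^ j * G j x) = (c - c0) ^ m * G (m - 1) x / (c + ?s) - ?s / (c + ?s) * (\<Sum>j<m. (c - c0) ^ j * F j x)"
  proof -
    have "(\<Sum>j<m. (c - c0) ^ j * G j x) = ((c - c0) ^ m * G (m - 1) x - ?s * (\<Sum>j<m. (c - c0) ^ j * F j x)) / (c + ?s)"
      unfolding *[symmetric] using nz by simp
    then show ?thesis by (simp add: diff_divide_distrib)
  qed
  moreover have "(\<Sum>j<m. (c - c0) ^ j * (\<mu> * F j x + G j x)) = \<mu> * (\<Sum>j<m. (c - c0) ^ j * F j x) + (\<Sum>j<m. (c - c0) ^ j * G j x)"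
    by (simp add: sum_distrib_left sum.distrib algebra_simps)
  ultimately have "(\<Sum>j<m. (c - c0) ^ j * (\<mu> * F j x + G j x)) =
      hill_coeff \<mu> c x * (\<Sum>j<m. (c - c0) ^ j * F j x) + (c - c0) ^ m * G (m - 1) x / (c + ?s)"
    by (simp add: hill_coeff_def potential_def algebra_simps)
  then show "((\<lambda>x. \<Sum>j<m. (c - c0) ^ j * F' j x) has_vector_derivative
      hill_coeff \<mu> c x * (\<Sum>j<m. (c - c0) ^ j * F j x) + (c - c0) ^ m * G (m - 1) x / (c + ?s)) (at x within period)"
    using d by simp
qed

text \<open>The Cauchy data at \<open>2 \<pi>\<close> of the truncated formal solution approximate the image of its initial
  data under the monodromy map to order \<open>m\<close>, by \<open>endpoint_estimate\<close> for the defect just found.\<close>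

lemma formal_solution_endpoint_estimate:
  fixes F F' G :: "nat \<Rightarrow> real \<Rightarrow> complex"
  assumes c0: "c0 \<notin> real_cut" and G: "\<And>j. continuous_on period (G j)"
    and F: "\<And>j x. x \<in> period \<Longrightarrow> (F j has_vector_derivative F' j x) (at x within period)"
    and F': "\<And>j x. x \<in> period \<Longrightarrow> (F' j has_vector_derivative \<mu> * F j x + G j x) (at x within period)"
    and rec: "\<And>j x. x \<in> period \<Longrightarrow> (c0 + of_real (sin x)) * G j x + of_real (sin x) * F j x +
       (if j = 0 then 0 else G (j - 1) x) = 0"
    and m: "m > 0"
  shows "\<exists>C r. r > 0 \<and> ball c0 r \<subseteq> - real_cut \<and>
    (\<forall>c\<in>ball c0 r. \<forall>x\<in>period.
      norm ((c - c0) ^ m * G (m - 1) x / (c + of_real (sin x))) \<le> C * norm (c - c0) ^ m) \<and>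
    (\<forall>c\<in>ball c0 r.
      norm ((\<Sum>j<m. (c - c0) ^ j * F j (2*pi)) -
        fst (endpoint (hill_coeff \<mu> c) (\<Sum>j<m. (c - c0) ^ j * F j 0) (\<Sum>j<m. (c - c0) ^ j * F' j 0))) +
      norm ((\<Sum>j<m. (c - c0) ^ j * F' j (2*pi)) -
        snd (endpoint (hill_coeff \<mu> c) (\<Sum>j<m. (c - c0) ^ j * F j 0) (\<Sum>j<m. (c - c0) ^ j * F' j 0)))
      \<le> C * norm (c - c0) ^ m)"
proof -
  obtain r where r: "r > 0" "ball c0 r \<subseteq> - real_cut"
    "\<And>c x. c \<in> ball c0 r \<Longrightarrow> norm (c + of_real (sin x)) \<ge> r"
    using potential_denominator_bounded_below[OF c0] by blast
  have "bounded (G (m - 1) ` period)" by (intro compact_imp_bounded compact_continuous_image G) simp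
  then obtain L where L: "\<And>x. x \<in> period \<Longrightarrow> norm (G (m - 1) x) \<le> L" unfolding bounded_iff by blast
  have L0: "L \<ge> 0" using order_trans[OF norm_ge_zero L[of 0]] by simp
  define K where "K = norm \<mu> + 1 / r + 1"
  define C where "C = L / r * (2 * pi) * exp (K * (2 * pi)) + L / r"
  have hb: "norm ((c - c0) ^ m * G (m - 1) x / (c + of_real (sin x))) \<le> L / r * norm (c - c0) ^ m"
    if "c \<in> ball c0 r" "x \<in> period" for c x
  proof -
    have "norm ((c - c0) ^ m * G (m - 1) x / (c + of_real (sin x))) =
        norm (c - c0) ^ m * (norm (G (m - 1) x) / norm (c + of_real (sin x)))"
      by (simp add: norm_mult norm_divide norm_power)
    also have "\<dots> \<le> norm (c - c0) ^ m * (L / r)"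
      using r(1) r(3)[OF that(1)] L[OF that(2)] L0 by (intro mult_left_mono frac_le) auto
    finally show ?thesis by (simp add: mult.commute)
  qed
  show ?thesis
  proof (rule exI[of _ C], rule exI[of _ r], intro conjI ballI)
    show "norm ((c - c0) ^ m * G (m - 1) x / (c + of_real (sin x))) \<le> C * norm (c - c0) ^ m"
      if "c \<in> ball c0 r" "x \<in> period" for c x
      using hb[OF that] r(1) L0 unfolding C_def distrib_right by (smt (verit) divide_nonneg_pos exp_ge_zero mult_nonneg_nonneg pi_ge_zero zero_le_power norm_ge_zero)
    fix c assume c: "c \<in> ball c0 r"
    let ?h = "\<lambda>x. (c - c0) ^ m * G (m - 1) x / (c + of_real (sin x))"
    have cc: "c \<notin> real_cut" using c r(2) by auto
    have s: "solves (hill_coeff \<mu> c) ?h (\<lambda>x. \<Sum>j<m. (c - c0) ^ j * F j x) (\<lambda>x. \<Sum>j<m. (c - c0) ^ j * F' j x)"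
      by (rule formal_solution_solves[OF cc G F F' rec m])
    have ch: "continuous_on period ?h"
      by (intro continuous_intros G) (auto simp: potential_denominator_nonzero cc)
    have K: "norm (hill_coeff \<mu> c x) \<le> K" for x
      unfolding K_def using r(1) r(3)[OF c] by (rule norm_hill_coeff_le)
    have K1: "1 \<le> K" unfolding K_def using r(1) by simp
    have "(LBINT x:period. norm (?h x)) = integral period (\<lambda>x. norm (?h x))"
      by (intro set_borel_integral_eq_integral(2) borel_integrable_atLeastAtMost' continuous_on_norm ch)
    also have "\<dots> \<le> integral period (\<lambda>x. L / r * norm (c - c0) ^ m)"
      by (intro integral_le integrable_continuous_real continuous_on_norm ch continuous_on_const hb c) auto
    also have "\<dots> = L / r * norm (c - c0) ^ m * (2 * pi)" by simp
    finally have h_int: "(LBINT x:period. norm (?h x)) \<le> L / r * norm (c - c0) ^ m * (2 * pi)" .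
    have "norm ((\<Sum>j<m. (c - c0) ^ j * F j (2*pi)) -
        fst (endpoint (hill_coeff \<mu> c) (\<Sum>j<m. (c - c0) ^ j * F j 0) (\<Sum>j<m. (c - c0) ^ j * F' j 0))) +
      norm ((\<Sum>j<m. (c - c0) ^ j * F' j (2*pi)) -
        snd (endpoint (hill_coeff \<mu> c) (\<Sum>j<m. (c - c0) ^ j * F j 0) (\<Sum>j<m. (c - c0) ^ j * F' j 0)))
       \<le> (LBINT x:period. norm (?h x)) * exp (K * (2 * pi))"
      by (rule endpoint_estimate[OF continuous_on_hill_coeff[OF cc] s set_integrable_continuous[OF ch] K K1])
    also have "\<dots> \<le> L / r * norm (c - c0) ^ m * (2 * pi) * exp (K * (2 * pi))"
      by (intro mult_right_mono h_int) simp
    also have "\<dots> \<le> C * norm (c - c0) ^ m"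
      unfolding C_def distrib_right using L0 r(1) by (simp add: mult_ac)
    finally show "norm ((\<Sum>j<m. (c - c0) ^ j * F j (2*pi)) -
        fst (endpoint (hill_coeff \<mu> c) (\<Sum>j<m. (c - c0) ^ j * F j 0) (\<Sum>j<m. (c - c0) ^ j * F' j 0))) +
      norm ((\<Sum>j<m. (c - c0) ^ j * F' j (2*pi)) -
        snd (endpoint (hill_coeff \<mu> c) (\<Sum>j<m. (c - c0) ^ j * F j 0) (\<Sum>j<m. (c - c0) ^ j * F' j 0)))
      \<le> C * norm (c - c0) ^ m" .
  qed (use r in auto)
qed

lemma has_field_derivative_of_quadratic_error:
  fixes g :: "complex \<Rightarrow> complex"
  assumes r: "r > 0" and le: "\<And>c. c \<in> ball c0 r \<Longrightarrow> norm (a + (c - c0) * b - g c) \<le> C * norm (c - c0) ^ 2"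
  shows "(g has_field_derivative b) (at c0)"
proof -
  have a: "a = g c0" using le[of c0] r by simp
  have "((\<lambda>c. (g c - g c0) / (c - c0) - b) \<longlongrightarrow> 0) (at c0)"
  proof (rule Lim_null_comparison)
    have "\<forall>\<^sub>F c in at c0. c \<in> ball c0 r - {c0}" 
      unfolding eventually_at using r by (intro exI[of _ r]) (auto simp: dist_commute)
    then show "\<forall>\<^sub>F c in at c0. norm ((g c - g c0) / (c - c0) - b) \<le> C * norm (c - c0)"
    proof eventually_elim
      case (elim c)
      then have "(g c - g c0) / (c - c0) - b = - (a + (c - c0) * b - g c) / (c - c0)"
        by (simp add: a field_simps)
      then have "norm ((g c - g c0) / (c - c0) - b) = norm (a + (c - c0) * b - g c) / norm (c - c0)"
        by (simp only: norm_divide norm_minus_cancel)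
      also have "\<dots> \<le> C * norm (c - c0) ^ 2 / norm (c - c0)"
        using elim by (intro divide_right_mono le) auto
      also have "\<dots> = C * norm (c - c0)" using elim by (simp add: power2_eq_square)
      finally show ?case .
    qed
    show "((\<lambda>c. C * norm (c - c0)) \<longlongrightarrow> 0) (at c0)"
      by (rule tendsto_eq_intros refl | simp)+
  qed
  then have "((\<lambda>c. (g c - g c0) / (c - c0)) \<longlongrightarrow> b) (at c0)" using LIM_zero_iff by blast
  then show ?thesis by (simp add: has_field_derivative_iff)
qed

text \<open>The estimate with \<open>m = 2\<close> is a first-order Taylor expansion with quadratic error around any point
  off the cut.\<close>

lemma endpoint_holomorphic:
  shows "(\<lambda>c. fst (endpoint (hill_coeff \<mu> c) v v')) holomorphic_on - real_cut"
    and "(\<lambda>c. snd (endpoint (hill_coeff \<mu> c) v v')) holomorphic_on - real_cut"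
proof -
  have "\<exists>b b'. ((\<lambda>c. fst (endpoint (hill_coeff \<mu> c) v v')) has_field_derivative b) (at c0) \<and>
     ((\<lambda>c. snd (endpoint (hill_coeff \<mu> c) v v')) has_field_derivative b') (at c0)" if c0: "c0 \<notin> real_cut" for c0
  proof -
    let ?v = "\<lambda>j::nat. if j = 0 then v else 0" and ?v' = "\<lambda>j::nat. if j = 0 then v' else 0"
    obtain F F' G :: "nat \<Rightarrow> real \<Rightarrow> complex" where init: "\<And>j. F j 0 = ?v j" "\<And>j. F' j 0 = ?v' j" and G: "\<And>j. continuous_on period (G j)"
      and F: "\<And>j x. x \<in> period \<Longrightarrow> (F j has_vector_derivative F' j x) (at x within period)"
        "\<And>j x. x \<in> period \<Longrightarrow> (F' j has_vector_derivative \<mu> * F j x + G j x) (at x within period)"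
        "\<And>j x. x \<in> period \<Longrightarrow> (c0 + of_real (sin x)) * G j x + of_real (sin x) * F j x +
           (if j = 0 then 0 else G (j - 1) x) = 0"
      by (rule formal_solution_exists[OF c0, of ?v ?v' \<mu>], rule that)
    have m: "(2::nat) > 0" by simp
    obtain C r where r: "r > 0" and est: "\<And>c. c \<in> ball c0 r \<Longrightarrow>
      norm ((\<Sum>j<2. (c - c0) ^ j * F j (2*pi)) -
        fst (endpoint (hill_coeff \<mu> c) (\<Sum>j<2. (c - c0) ^ j * F j 0) (\<Sum>j<2. (c - c0) ^ j * F' j 0))) +
      norm ((\<Sum>j<2. (c - c0) ^ j * F' j (2*pi)) -
        snd (endpoint (hill_coeff \<mu> c) (\<Sum>j<2. (c - c0) ^ j * F j 0) (\<Sum>j<2. (c - c0) ^ j * F' j 0)))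
      \<le> C * norm (c - c0) ^ 2"
      using formal_solution_endpoint_estimate[OF c0 G F m] by blast
    have est: "norm (F 0 (2*pi) + (c - c0) * F 1 (2*pi) - fst (endpoint (hill_coeff \<mu> c) v v')) +
      norm (F' 0 (2*pi) + (c - c0) * F' 1 (2*pi) - snd (endpoint (hill_coeff \<mu> c) v v')) \<le> C * norm (c - c0) ^ 2"
      if "c \<in> ball c0 r" for c
      using est[OF that] by (simp add: init numeral_2_eq_2)
    have est': "norm (F 0 (2*pi) + (c - c0) * F 1 (2*pi) - fst (endpoint (hill_coeff \<mu> c) v v')) \<le> C * norm (c - c0) ^ 2"
      "norm (F' 0 (2*pi) + (c - c0) * F' 1 (2*pi) - snd (endpoint (hill_coeff \<mu> c) v v')) \<le> C * norm (c - c0) ^ 2"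
      if "c \<in> ball c0 r" for c
      using est[OF that] norm_ge_zero by (smt (verit))+
    show ?thesis
      by (rule exI, rule exI, rule conjI; rule has_field_derivative_of_quadratic_error[OF r], rule est', assumption)
  qed
  then show "(\<lambda>c. fst (endpoint (hill_coeff \<mu> c) v v')) holomorphic_on - real_cut"
    "(\<lambda>c. snd (endpoint (hill_coeff \<mu> c) v v')) holomorphic_on - real_cut"
    using open_Compl_real_cut by (auto simp: holomorphic_on_open; metis)+
qed

section \<open>Square-integrable functions\<close>

lemma L2_measurable: "h \<in> L2 \<Longrightarrow> (\<lambda>x. indicator period x *\<^sub>R h x) \<in> borel_measurable borel"
  by (simp add: L2_def set_borel_measurable_def)

lemma L2_square_integrable: "h \<in> L2 \<Longrightarrow> set_integrable lborel period (\<lambda>x. (norm (h x))\<^sup>2)"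
  by (simp add: L2_def)

lemma L2_dominated:
  assumes meas: "(\<lambda>x. indicator period x *\<^sub>R h x) \<in> borel_measurable borel"
    and g: "set_integrable lborel period (g :: real \<Rightarrow> real)"
    and le: "\<And>x. x \<in> period \<Longrightarrow> (norm (h x))\<^sup>2 \<le> g x"
  shows "h \<in> L2"
proof -
  have eq: "(\<lambda>x. indicator period x *\<^sub>R (norm (h x))\<^sup>2) = (\<lambda>x. (norm (indicator period x *\<^sub>R h x))\<^sup>2)"
    by (auto simp: indicator_def)
  have "set_integrable lborel period (\<lambda>x. (norm (h x))\<^sup>2)"
    unfolding set_integrable_def
  proof (rule Bochner_Integration.integrable_bound)
    show "integrable lborel (\<lambda>x. indicator period x *\<^sub>R g x)" using g by (simp add: set_integrable_def)
    show "(\<lambda>x. indicator period x *\<^sub>R (norm (h x))\<^sup>2) \<in> borel_measurable lborel"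
    proof -
      have "(\<lambda>x. indicator period x *\<^sub>R h x) \<in> borel_measurable lborel" using meas by simp
      then show ?thesis unfolding eq by measurable
    qed
    show "AE x in lborel. norm (indicator period x *\<^sub>R (norm (h x))\<^sup>2) \<le> norm (indicator period x *\<^sub>R g x)"
      using le by (intro AE_I2) (auto simp: indicator_def intro: order_trans abs_ge_self)
  qed
  then show ?thesis using meas by (simp add: L2_def set_borel_measurable_def)
qed

lemma set_integrable_const: "set_integrable lborel period (\<lambda>_. c :: real)"
  by (intro borel_integrable_atLeastAtMost' continuous_intros)

lemma L2_continuous:
  assumes "continuous_on period h"
  shows "h \<in> L2"
proof (rule L2_dominated)
  show "(\<lambda>x. indicator period x *\<^sub>R h x) \<in> borel_measurable borel"
    using borel_measurable_continuous_on_indicator[OF _ assms] by simp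
  show "set_integrable lborel period (\<lambda>x. (norm (h x))\<^sup>2)"
    by (intro borel_integrable_atLeastAtMost' continuous_intros assms)
qed simp

lemma L2_add:
  assumes "h \<in> L2" "k \<in> L2"
  shows "(\<lambda>x. h x + k x) \<in> L2"
proof (rule L2_dominated)
  show "(\<lambda>x. indicator period x *\<^sub>R (h x + k x)) \<in> borel_measurable borel"
    unfolding scaleR_add_right using assms[THEN L2_measurable] by measurable
  show "set_integrable lborel period (\<lambda>x. 2 * (norm (h x))\<^sup>2 + 2 * (norm (k x))\<^sup>2)"
    by (intro set_integral_add set_integrable_mult_right L2_square_integrable assms)
  fix x
  have "(norm (h x + k x))\<^sup>2 \<le> (norm (h x) + norm (k x))\<^sup>2"
    by (intro power_mono norm_triangle_ineq) auto
  also have "\<dots> \<le> 2 * (norm (h x))\<^sup>2 + 2 * (norm (k x))\<^sup>2"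
    using zero_le_power2[of "norm (h x) - norm (k x)"] by (simp add: power2_eq_square algebra_simps)
  finally show "(norm (h x + k x))\<^sup>2 \<le> 2 * (norm (h x))\<^sup>2 + 2 * (norm (k x))\<^sup>2" .
qed

lemma L2_mult:
  assumes b: "continuous_on period b" and h: "h \<in> L2"
  shows "(\<lambda>x. b x * h x) \<in> L2"
proof -
  have "bounded (b ` period)" by (intro compact_imp_bounded compact_continuous_image b) simp
  then obtain K where K: "\<And>x. x \<in> period \<Longrightarrow> norm (b x) \<le> K" unfolding bounded_iff by blast
  show ?thesis
  proof (rule L2_dominated)
    have "(\<lambda>x. indicator period x *\<^sub>R (b x * h x)) = (\<lambda>x. (indicator period x *\<^sub>R b x) * (indicator period x *\<^sub>R h x))"
      by (auto simp: fun_eq_iff split: split_indicator)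
    moreover have "(\<lambda>x. indicator period x *\<^sub>R b x) \<in> borel_measurable borel"
      by (rule borel_measurable_continuous_on_indicator[OF _ b]) simp
    ultimately show "(\<lambda>x. indicator period x *\<^sub>R (b x * h x)) \<in> borel_measurable borel"
      using L2_measurable[OF h] by (simp only: borel_measurable_times)
    show "set_integrable lborel period (\<lambda>x. K\<^sup>2 * (norm (h x))\<^sup>2)"
      by (intro set_integrable_mult_right L2_square_integrable h)
    fix x assume "x \<in> period"
    then show "(norm (b x * h x))\<^sup>2 \<le> K\<^sup>2 * (norm (h x))\<^sup>2"
      using K by (auto simp: norm_mult power_mult_distrib intro!: mult_right_mono power_mono)
  qed
qed

lemma L2_diff: "h \<in> L2 \<Longrightarrow> k \<in> L2 \<Longrightarrow> (\<lambda>x. h x - k x) \<in> L2"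
  using L2_add[of h "\<lambda>x. -1 * k x"] L2_mult[of "\<lambda>_. -1" k] by simp

lemma L2_set_integrable:
  assumes "h \<in> L2"
  shows "set_integrable lborel period h"
  unfolding set_integrable_def
proof (rule Bochner_Integration.integrable_bound)
  have "set_integrable lborel period (\<lambda>x. 1 + (norm (h x))\<^sup>2)"
    by (intro set_integral_add set_integrable_const L2_square_integrable assms)
  then show "integrable lborel (\<lambda>x. indicator period x *\<^sub>R (1 + (norm (h x))\<^sup>2))"
    by (simp add: set_integrable_def)
  have "norm (h x) \<le> 1 + (norm (h x))\<^sup>2" for x
    using zero_le_power2[of "norm (h x) - 1"] by (simp add: power2_eq_square algebra_simps) (smt (verit) norm_ge_zero)
  then show "AE x in lborel. norm (indicator period x *\<^sub>R h x) \<le> norm (indicator period x *\<^sub>R (1 + (norm (h x))\<^sup>2))"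
    by (intro AE_I2) (auto simp: indicator_def intro: order_trans abs_ge_self)
qed (use L2_measurable[OF assms] in simp)

lemma set_integral_const_period: "(LBINT x:period. c) = 2 * pi * (c :: real)"
  by (subst set_borel_integral_eq_integral(2)[OF set_integrable_const]) simp

text \<open>The Cauchy-Schwarz inequality, from expanding \<open>0 \<le> \<integral> (|h| - s)\<^sup>2\<close> with \<open>s\<close> the mean of
  \<open>|h|\<close>.\<close>

lemma L1_le_L2norm:
  assumes "h \<in> L2"
  shows "(LBINT x:period. norm (h x)) \<le> sqrt (2 * pi) * L2norm h"
proof -
  let ?I1 = "LBINT x:period. norm (h x)" and ?I2 = "LBINT x:period. (norm (h x))\<^sup>2"
  define s where "s = ?I1 / (2 * pi)"
  have i1: "set_integrable lborel period (\<lambda>x. norm (h x))"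
    by (intro set_integrable_norm L2_set_integrable assms)
  have i2: "set_integrable lborel period (\<lambda>x. (norm (h x))\<^sup>2)" by (rule L2_square_integrable[OF assms])
  have "0 \<le> (LBINT x:period. (norm (h x) - s)\<^sup>2)"
    unfolding set_lebesgue_integral_def by (intro Bochner_Integration.integral_nonneg) simp
  also have "\<dots> = (LBINT x:period. (norm (h x))\<^sup>2 + (- 2 * s) * norm (h x) + s\<^sup>2)"
    by (simp add: power2_eq_square algebra_simps)
  also have "\<dots> = ?I2 + (- 2 * s) * ?I1 + 2 * pi * s\<^sup>2"
  proof -
    have i3: "set_integrable lborel period (\<lambda>x. (- 2 * s) * norm (h x))" by (rule set_integrable_mult_right) (simp add: i1)
    show ?thesis
      unfolding set_integral_add(2)[OF set_integral_add(1)[OF i2 i3] set_integrable_const] set_integral_add(2)[OF i2 i3]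
        set_integral_mult_right set_integral_const_period by simp
  qed
  also have "\<dots> = ?I2 - ?I1\<^sup>2 / (2 * pi)" by (simp add: s_def power2_eq_square field_simps)
  finally have "?I1\<^sup>2 \<le> 2 * pi * ?I2" by (simp add: field_simps)
  then have "sqrt (?I1\<^sup>2) \<le> sqrt (2 * pi * ?I2)" by (rule real_sqrt_le_mono)
  then show ?thesis by (simp add: L2norm_def real_sqrt_mult)
qed

lemma L2norm_le_sup:
  assumes f: "f \<in> L2" and B: "\<And>x. x \<in> period \<Longrightarrow> norm (f x) \<le> B"
  shows "L2norm f \<le> sqrt (2 * pi) * B"
proof -
  have B0: "B \<ge> 0" using order_trans[OF norm_ge_zero B[of 0]] by simp
  have "(LBINT x:period. (norm (f x))\<^sup>2) \<le> (LBINT x:period. B\<^sup>2)"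
    using B by (intro set_integral_mono L2_square_integrable f set_integrable_const power_mono) auto
  then have "L2norm f \<le> sqrt (2 * pi * B\<^sup>2)"
    unfolding L2norm_def set_integral_const_period by simp
  then show ?thesis using B0 by (simp add: real_sqrt_mult)
qed

lemma L2norm_nonneg: "L2norm h \<ge> 0"
  unfolding L2norm_def set_lebesgue_integral_def
  by (intro real_sqrt_ge_zero Bochner_Integration.integral_nonneg) simp

section \<open>The graph of the Hill operator\<close>

lemma solves_cong:
  assumes s: "solves R h f f'" and "\<And>x. x \<in> period \<Longrightarrow> f x = g x" "\<And>x. x \<in> period \<Longrightarrow> f' x = g' x"
  shows "solves R h g g'"
  unfolding solves_def
proof (intro ballI conjI)
  fix x assume x: "x \<in> period"
  show "(g has_vector_derivative g' x) (at x within period)"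
    using has_vector_derivative_transform[OF x _ solvesD(1)[OF s x], of g] assms x by simp
  have "(LBINT t:{0..x}. R t * g t + h t) = (LBINT t:{0..x}. R t * f t + h t)"
    using x assms(2) by (intro set_lebesgue_integral_cong) auto
  then show "g' x = g' 0 + (LBINT t:{0..x}. R t * g t + h t)"
    using solvesD(2)[OF s x] assms(3)[OF x] assms(3)[of 0] by simp
qed

lemma second_order_opI:
  assumes "h \<in> L2" "\<And>x. x \<notin> period \<Longrightarrow> f x = 0" "H2_derivs f f' f''"
    "f (2*pi) = z * f 0" "f' (2*pi) = z * f' 0"
    "AE x in lborel. x \<in> period \<longrightarrow> h x = f'' x + a * f' x + V x * f x"
  shows "(f, h) \<in> second_order_op a V z"
  unfolding second_order_op_def using assms by blast

lemma second_order_opE: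
  assumes "(f, h) \<in> second_order_op a V z"
  obtains f' f'' where "h \<in> L2" "\<And>x. x \<notin> period \<Longrightarrow> f x = 0" "H2_derivs f f' f''"
    "f (2*pi) = z * f 0" "f' (2*pi) = z * f' 0"
    "AE x in lborel. x \<in> period \<longrightarrow> h x = f'' x + a * f' x + V x * f x"
  using assms unfolding second_order_op_def by blast

lemma op_minusI: "(f, h) \<in> T \<Longrightarrow> k = (\<lambda>x. h x - \<mu> * f x) \<Longrightarrow> (f, k) \<in> op_minus T \<mu>"
  unfolding op_minus_def by blast

lemma op_minusE:
  assumes "(f, k) \<in> op_minus T \<mu>"
  obtains h where "(f, h) \<in> T" "k = (\<lambda>x. h x - \<mu> * f x)"
  using assms unfolding op_minus_def by blast

definition floquet_graph :: "complex \<Rightarrow> complex \<Rightarrow> complex \<Rightarrow> op_graph" where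
  "floquet_graph z \<mu> c = op_minus (second_order_op 0 (potential c) z) \<mu>"

lemma set_integral_cong_AE_period:
  assumes "set_integrable lborel period f" "set_integrable lborel period (g :: real \<Rightarrow> complex)" "x \<in> period"
    and "AE x in lborel. x \<in> period \<longrightarrow> f x = g x"
  shows "(LBINT t:{0..x}. f t) = (LBINT t:{0..x}. g t)"
  unfolding set_lebesgue_integral_def
proof (rule Bochner_Integration.integral_cong_AE)
  show "(\<lambda>t. indicator {0..x} t *\<^sub>R f t) \<in> borel_measurable lborel" "(\<lambda>t. indicator {0..x} t *\<^sub>R g t) \<in> borel_measurable lborel"
    using set_integrable_initial[OF assms(1,3)] set_integrable_initial[OF assms(2,3)]
    unfolding set_integrable_def by (auto dest: borel_measurable_integrable)
  show "AE t in lborel. indicator {0..x} t *\<^sub>R f t = indicator {0..x} t *\<^sub>R g t"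
    using assms(4) by eventually_elim (use assms(3) in \<open>auto simp: indicator_def\<close>)
qed

text \<open>This replaces the almost everywhere equation and the choice of a second derivative in the operator
  graph by the integrated equation, for which existence, uniqueness and estimates are available.\<close>

lemma floquet_graph_iff:
  assumes c: "c \<notin> real_cut"
  shows "(f, h) \<in> floquet_graph z \<mu> c \<longleftrightarrow> h \<in> L2 \<and> (\<forall>x. x \<notin> period \<longrightarrow> f x = 0) \<and>
    (\<exists>f'. solves (hill_coeff \<mu> c) h f f' \<and> f (2*pi) = z * f 0 \<and> f' (2*pi) = z * f' 0)"
    (is "?L \<longleftrightarrow> ?R")
proof
  note R = continuous_on_hill_coeff[OF c, of period \<mu>]
  assume ?L
  then obtain h1 where op: "(f, h1) \<in> second_order_op 0 (potential c) z" and h: "h = (\<lambda>x. h1 x - \<mu> * f x)"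
    unfolding floquet_graph_def by (rule op_minusE)
  from op obtain f' f'' where h1: "h1 \<in> L2"
    and out: "\<And>x. x \<notin> period \<Longrightarrow> f x = 0" and H2: "H2_derivs f f' f''"
    and bc: "f (2*pi) = z * f 0" "f' (2*pi) = z * f' 0"
    and ae: "AE x in lborel. x \<in> period \<longrightarrow> h1 x = f'' x + 0 * f' x + potential c x * f x"
    by (rule second_order_opE) (rule that)
  have cf: "continuous_on period f"
  proof (rule continuous_on_vector_derivative)
    show "(f has_vector_derivative f' x) (at x within period)" if "x \<in> period" for x
      using H2 that unfolding H2_derivs_def by blast
  qed
  have hL2: "h \<in> L2" unfolding h
    by (intro L2_diff h1 L2_continuous continuous_intros cf)
  have "solves (hill_coeff \<mu> c) h f f'"
    unfolding solves_def
  proof (intro ballI conjI)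
    fix x assume x: "x \<in> period"
    show "(f has_vector_derivative f' x) (at x within period)" using H2 x unfolding H2_derivs_def by blast
    have "f' x = f' 0 + (LBINT t:{0..x}. f'' t)" using H2 x unfolding H2_derivs_def by blast
    also have "(LBINT t:{0..x}. f'' t) = (LBINT t:{0..x}. hill_coeff \<mu> c t * f t + h t)"
    proof (rule set_integral_cong_AE_period[OF _ _ x])
      show "set_integrable lborel period f''" using H2 unfolding H2_derivs_def by (blast intro: L2_set_integrable)
      show "set_integrable lborel period (\<lambda>t. hill_coeff \<mu> c t * f t + h t)"
        by (intro L2_set_integrable L2_add hL2 L2_continuous continuous_on_mult R cf)
      show "AE x in lborel. x \<in> period \<longrightarrow> f'' x = hill_coeff \<mu> c x * f x + h x"
        using ae by eventually_elim (auto simp: h hill_coeff_def algebra_simps)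
    qed
    finally show "f' x = f' 0 + (LBINT t:{0..x}. hill_coeff \<mu> c t * f t + h t)" .
  qed
  then show ?R using hL2 out bc by blast
next
  note R = continuous_on_hill_coeff[OF c, of period \<mu>]
  assume ?R
  then obtain f' where h: "h \<in> L2" and out: "\<forall>x. x \<notin> period \<longrightarrow> f x = 0" and s: "solves (hill_coeff \<mu> c) h f f'"
    and bc: "f (2*pi) = z * f 0" "f' (2*pi) = z * f' 0" by blast
  have cf: "continuous_on period f" by (rule solves_continuous[OF s])
  define f'' where "f'' = (\<lambda>t. hill_coeff \<mu> c t * f t + h t)"
  have "f'' \<in> L2" unfolding f''_def by (intro L2_add h L2_continuous continuous_on_mult R cf)
  then have H2: "H2_derivs f f' f''"
    using s unfolding H2_derivs_def solves_def f''_def by blast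
  have "(f, \<lambda>x. h x + \<mu> * f x) \<in> second_order_op 0 (potential c) z"
  proof (rule second_order_opI[OF _ _ H2 bc])
    show "(\<lambda>x. h x + \<mu> * f x) \<in> L2" by (intro L2_add h L2_continuous continuous_on_mult continuous_on_const cf)
    show "AE x in lborel. x \<in> period \<longrightarrow> h x + \<mu> * f x = f'' x + 0 * f' x + potential c x * f x"
      by (intro AE_I2) (simp add: f''_def hill_coeff_def algebra_simps)
  qed (use out in blast)
  then show ?L
    unfolding floquet_graph_def by (rule op_minusI) simp
qed

definition regular_graph :: "op_graph \<Rightarrow> bool" where
  "regular_graph T \<longleftrightarrow> (\<forall>h\<in>L2. \<exists>!f. (f, h) \<in> T) \<and> (\<exists>C. \<forall>(f, h)\<in>T. L2norm f \<le> C * L2norm h)"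

lemma op_spectrum_iff: "\<mu> \<in> op_spectrum T \<longleftrightarrow> \<not> regular_graph (op_minus T \<mu>)"
  by (simp add: op_spectrum_def regular_graph_def)

definition monodromy_trace :: "complex \<Rightarrow> complex \<Rightarrow> complex" where
  "monodromy_trace \<mu> c = fst (endpoint (hill_coeff \<mu> c) 1 0) + snd (endpoint (hill_coeff \<mu> c) 0 1)"

lemma monodromy_trace_holomorphic: "monodromy_trace \<mu> holomorphic_on - real_cut"
  unfolding monodromy_trace_def by (intro holomorphic_intros endpoint_holomorphic)

lemma eigenvector_2x2:
  fixes a b c d :: complex
  assumes "a * d - b * c = 0"
  obtains x y where "(x, y) \<noteq> (0, 0)" "a * x + b * y = 0" "c * x + d * y = 0"
proof (cases "a = 0 \<and> b = 0")
  case True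
  show ?thesis
  proof (cases "c = 0 \<and> d = 0")
    case True
    then show ?thesis using \<open>a = 0 \<and> b = 0\<close> that[of 1 0] by simp
  next
    case False
    then show ?thesis using \<open>a = 0 \<and> b = 0\<close> that[of d "- c"] by auto
  qed
next
  case False
  then show ?thesis using that[of "- b" a] assms by (auto simp: algebra_simps)
qed

text \<open>Cramer's rule with norms.\<close>

lemma linear_system_2x2_bound:
  fixes a b c d x y :: complex
  assumes det: "a * d - b * c \<noteq> 0"
  shows "norm x + norm y \<le> (norm a + norm b + norm c + norm d) / norm (a * d - b * c) * (norm (a * x + b * y) + norm (c * x + d * y))"
proof -
  let ?\<Delta> = "a * d - b * c" and ?p = "a * x + b * y" and ?q = "c * x + d * y"
  have "?\<Delta> * x = d * ?p - b * ?q" "?\<Delta> * y = a * ?q - c * ?p" by (simp_all add: algebra_simps)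
  then have "norm ?\<Delta> * norm x \<le> norm d * norm ?p + norm b * norm ?q" "norm ?\<Delta> * norm y \<le> norm a * norm ?q + norm c * norm ?p"
    by (metis norm_mult norm_triangle_ineq4)+
  then have "norm ?\<Delta> * (norm x + norm y) \<le> norm d * norm ?p + norm b * norm ?q + (norm a * norm ?q + norm c * norm ?p)"
    by (simp add: distrib_left)
  also have "\<dots> \<le> (norm a + norm b + norm c + norm d) * (norm ?p + norm ?q)"
    by (simp add: algebra_simps)
  finally show ?thesis using det by (simp add: field_simps)
qed

context
  fixes c \<mu> z :: complex
  assumes c: "c \<notin> real_cut" and z: "z \<noteq> 0"
begin

text \<open>The left-hand side is \<open>det (z - M)\<close>; as \<open>det M = 1\<close> it depends on \<open>M\<close> only through its trace.\<close>

lemma floquet_determinant: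
  fixes v v' :: complex
  defines "M \<equiv> endpoint (hill_coeff \<mu> c)"
  shows "(z - fst (M 1 0)) * (z - snd (M 0 1)) - (- fst (M 0 1)) * (- snd (M 1 0)) = z * (z + 1 / z - monodromy_trace \<mu> c)"
  using endpoint_Wronskian[OF continuous_on_hill_coeff[OF c], of \<mu>] z
  unfolding M_def monodromy_trace_def by (simp add: field_simps power2_eq_square)

lemma endpoint_boundary:
  "z * v - fst (endpoint (hill_coeff \<mu> c) v v') =
     (z - fst (endpoint (hill_coeff \<mu> c) 1 0)) * v + (- fst (endpoint (hill_coeff \<mu> c) 0 1)) * v'"
  "z * v' - snd (endpoint (hill_coeff \<mu> c) v v') =
     (- snd (endpoint (hill_coeff \<mu> c) 1 0)) * v + (z - snd (endpoint (hill_coeff \<mu> c) 0 1)) * v'"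
  by (subst endpoint_linear[OF continuous_on_hill_coeff[OF c]], simp add: algebra_simps)+

lemma floquet_eigenfunction_exists:
  assumes "z + 1 / z = monodromy_trace \<mu> c"
  obtains f f' where "solves (hill_coeff \<mu> c) (\<lambda>_. 0) f f'" "f (2*pi) = z * f 0" "f' (2*pi) = z * f' 0"
    "(f 0, f' 0) \<noteq> (0, 0)"
proof -
  let ?M = "endpoint (hill_coeff \<mu> c)"
  note R = continuous_on_hill_coeff[OF c, of period \<mu>]
  obtain v v' where v: "(v, v') \<noteq> (0, 0)"
    "(z - fst (?M 1 0)) * v + (- fst (?M 0 1)) * v' = 0" "(- snd (?M 1 0)) * v + (z - snd (?M 0 1)) * v' = 0"
    by (rule eigenvector_2x2[of "z - fst (?M 1 0)" "z - snd (?M 0 1)" "- fst (?M 0 1)" "- snd (?M 1 0)"])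
       (use floquet_determinant assms in auto)
  obtain f f' where f: "solves (hill_coeff \<mu> c) (\<lambda>_. 0) f f'" "f 0 = v" "f' 0 = v'"
    by (rule solves_exists[OF R, of "\<lambda>_. 0" v v']) auto
  have "z * v = fst (?M v v')" "z * v' = snd (?M v v')"
    using v(2,3) endpoint_boundary[where v = v and v' = v'] by simp_all
  then show ?thesis using endpoint_eq[OF R f(1)] f v(1) by (intro that[of f f']) auto
qed

lemma floquet_graph_singular:
  assumes "z + 1 / z = monodromy_trace \<mu> c"
  shows "\<not> regular_graph (floquet_graph z \<mu> c)" "\<exists>f. f \<noteq> (\<lambda>x. 0) \<and> (f, \<lambda>x. 0) \<in> floquet_graph z \<mu> c"
proof -
  obtain f f' where f: "solves (hill_coeff \<mu> c) (\<lambda>_. 0) f f'" "f (2*pi) = z * f 0" "f' (2*pi) = z * f' 0"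
    "(f 0, f' 0) \<noteq> (0, 0)" using floquet_eigenfunction_exists[OF assms] by blast
  define g where "g = (\<lambda>x. if x \<in> period then f x else 0)"
  have s: "solves (hill_coeff \<mu> c) (\<lambda>_. 0) g f'" by (rule solves_cong[OF f(1)]) (auto simp: g_def)
  have zero: "(\<lambda>_. 0) \<in> L2" by (intro L2_continuous continuous_intros)
  have g: "(g, \<lambda>_. 0) \<in> floquet_graph z \<mu> c"
    unfolding floquet_graph_iff[OF c] using s f zero by (auto simp: g_def)
  have s0: "solves (hill_coeff \<mu> c) (\<lambda>_. 0) (\<lambda>_. 0) (\<lambda>_. 0)"
    by (rule solvesI[OF continuous_on_hill_coeff[OF c]]) (auto intro!: derivative_eq_intros)
  have 0: "((\<lambda>_. 0), (\<lambda>_. 0)) \<in> floquet_graph z \<mu> c"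
    unfolding floquet_graph_iff[OF c] using s0 zero by auto
  have "g \<noteq> (\<lambda>_. 0)"
  proof
    assume g0: "g = (\<lambda>_. 0)"
    have "f 0 = 0" using fun_cong[OF g0, of 0] by (simp add: g_def)
    have "(g has_vector_derivative f' 0) (at 0 within period)" using solvesD(1)[OF s, of 0] by simp
    moreover have "(g has_vector_derivative 0) (at 0 within period)" unfolding g0 by (rule has_vector_derivative_const)
    ultimately have "f' 0 = 0" by (rule vector_derivative_unique_within[rotated]) (simp add: trivial_limit_within islimpt_Icc)
    then show False using f(4) \<open>f 0 = 0\<close> by simp
  qed
  then show "\<not> regular_graph (floquet_graph z \<mu> c)" "\<exists>f. f \<noteq> (\<lambda>x. 0) \<and> (f, \<lambda>x. 0) \<in> floquet_graph z \<mu> c"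
    using g 0 zero unfolding regular_graph_def by blast+
qed

text \<open>A solution with zero initial data misses the boundary condition by some vector; adding the
  homogeneous solution whose initial data are the image of this vector under the inverse of
  \<open>z - M\<close> repairs it. The same inverse bounds the initial data of any solution by \<open>h\<close>, which yields
  uniqueness and boundedness of the inverse operator.\<close>

lemma floquet_graph_regular:
  assumes D: "z + 1 / z \<noteq> monodromy_trace \<mu> c"
  shows "regular_graph (floquet_graph z \<mu> c)"
proof -
  let ?M = "endpoint (hill_coeff \<mu> c)"
  note R = continuous_on_hill_coeff[OF c, of period \<mu>]
  let ?a = "z - fst (?M 1 0)" and ?b = "- fst (?M 0 1)" and ?c = "- snd (?M 1 0)" and ?d = "z - snd (?M 0 1)"
  define \<Delta> where "\<Delta> = ?a * ?d - ?b * ?c"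
  have \<Delta>: "\<Delta> \<noteq> 0" unfolding \<Delta>_def floquet_determinant using D z by auto
  obtain K where K: "\<And>x. x \<in> period \<Longrightarrow> norm (hill_coeff \<mu> c x) \<le> K" "1 \<le> K"
    by (rule continuous_bound[OF R], rule that)
  define E where "E = exp (K * (2 * pi))"
  define N where "N = (norm ?a + norm ?b + norm ?c + norm ?d) / norm \<Delta>"
  have E0: "E > 0" by (simp add: E_def)
  have N0: "N \<ge> 0" unfolding N_def by simp
  have init: "norm (f 0) + norm (f' 0) \<le> N * (E * (LBINT t:period. norm (h t)))"
    if s: "solves (hill_coeff \<mu> c) h f f'" and h: "h \<in> L2" and bc: "f (2*pi) = z * f 0" "f' (2*pi) = z * f' 0" for f f' h
  proof -
    have "norm (f 0) + norm (f' 0) \<le> N * (norm (z * f 0 - fst (?M (f 0) (f' 0))) + norm (z * f' 0 - snd (?M (f 0) (f' 0))))"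
      unfolding N_def endpoint_boundary \<Delta>_def
      by (rule linear_system_2x2_bound) (use \<Delta> \<Delta>_def in simp)
    also have "\<dots> \<le> N * (E * (LBINT t:period. norm (h t)))"
      using endpoint_estimate[OF R s L2_set_integrable[OF h] K] N0
      unfolding bc E_def by (intro mult_left_mono) (auto simp: mult.commute)
    finally show ?thesis .
  qed
  have sup: "norm (f x) \<le> (N * E + 1) * E * (LBINT t:period. norm (h t))"
    if s: "solves (hill_coeff \<mu> c) h f f'" and h: "h \<in> L2" and bc: "f (2*pi) = z * f 0" "f' (2*pi) = z * f' 0"
      and x: "x \<in> period" for f f' h x
  proof -
    have "norm (f x) \<le> norm (f x) + norm (f' x)" by simp
    also have "\<dots> \<le> (norm (f 0) + norm (f' 0) + (LBINT t:period. norm (h t))) * E"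
      unfolding E_def by (rule solves_estimate[OF R s L2_set_integrable[OF h] K x])
    also have "\<dots> \<le> (N * (E * (LBINT t:period. norm (h t))) + (LBINT t:period. norm (h t))) * E"
      using init[OF s h bc] E0 by (intro mult_right_mono add_right_mono) auto
    finally show ?thesis by (simp add: algebra_simps)
  qed
  have bound: "L2norm f \<le> (sqrt (2 * pi) * ((N * E + 1) * E * sqrt (2 * pi))) * L2norm h" if gr: "(f, h) \<in> floquet_graph z \<mu> c" for f h
  proof -
    obtain f' where f': "h \<in> L2" "solves (hill_coeff \<mu> c) h f f'" "f (2*pi) = z * f 0" "f' (2*pi) = z * f' 0"
      using gr unfolding floquet_graph_iff[OF c] by blast
    have "L2norm f \<le> sqrt (2 * pi) * ((N * E + 1) * E * (LBINT t:period. norm (h t)))"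
      by (rule L2norm_le_sup[OF L2_continuous[OF solves_continuous[OF f'(2)]]]) (rule sup[OF f'(2,1,3,4)])
    also have "\<dots> \<le> sqrt (2 * pi) * ((N * E + 1) * E * (sqrt (2 * pi) * L2norm h))"
      using N0 E0 by (intro mult_left_mono L1_le_L2norm f') auto
    finally show ?thesis by (simp add: mult_ac)
  qed
  have exists: "\<exists>f. (f, h) \<in> floquet_graph z \<mu> c" if h: "h \<in> L2" for h
  proof -
    obtain p p' where p: "solves (hill_coeff \<mu> c) h p p'" "p 0 = 0" "p' 0 = 0"
      by (rule solves_exists[OF R L2_set_integrable[OF h], of 0 0])
    define v where "v = (?d * p (2*pi) - ?b * p' (2*pi)) / \<Delta>"
    define v' where "v' = (?a * p' (2*pi) - ?c * p (2*pi)) / \<Delta>"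
    obtain g g' where g: "solves (hill_coeff \<mu> c) (\<lambda>_. 0) g g'" "g 0 = v" "g' 0 = v'"
      by (rule solves_exists[OF R, of "\<lambda>_. 0" v v']) auto
    have "?a * v + ?b * v' = (?a * (?d * p (2*pi) - ?b * p' (2*pi)) + ?b * (?a * p' (2*pi) - ?c * p (2*pi))) / \<Delta>"
      "?c * v + ?d * v' = (?c * (?d * p (2*pi) - ?b * p' (2*pi)) + ?d * (?a * p' (2*pi) - ?c * p (2*pi))) / \<Delta>"
      unfolding v_def v'_def by (simp_all only: times_divide_eq_right add_divide_distrib)
    moreover have "?a * (?d * p (2*pi) - ?b * p' (2*pi)) + ?b * (?a * p' (2*pi) - ?c * p (2*pi)) = \<Delta> * p (2*pi)"
      "?c * (?d * p (2*pi) - ?b * p' (2*pi)) + ?d * (?a * p' (2*pi) - ?c * p (2*pi)) = \<Delta> * p' (2*pi)"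
      unfolding \<Delta>_def by (simp_all only: algebra_simps)
    ultimately have "?a * v + ?b * v' = p (2*pi)" "?c * v + ?d * v' = p' (2*pi)"
      using \<Delta> by simp_all
    then have "z * v - g (2*pi) = p (2*pi)" "z * v' - g' (2*pi) = p' (2*pi)"
      using endpoint_boundary[where v = v and v' = v'] endpoint_eq[OF R g(1)] g(2,3) by simp_all
    then have e: "g (2*pi) + p (2*pi) = z * v" "g' (2*pi) + p' (2*pi) = z * v'" by (simp_all add: algebra_simps)
    have s: "solves (hill_coeff \<mu> c) (\<lambda>x. 1 * 0 + 1 * h x) (\<lambda>x. 1 * g x + 1 * p x) (\<lambda>x. 1 * g' x + 1 * p' x)"
      by (rule solves_linear_combination[OF R g(1) p(1) _ L2_set_integrable[OF h]]) simp
    define f where "f = (\<lambda>x. if x \<in> period then g x + p x else 0)"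
    have "solves (hill_coeff \<mu> c) h f (\<lambda>x. g' x + p' x)"
      using s by (intro solves_cong[of _ _ "\<lambda>x. g x + p x" "\<lambda>x. g' x + p' x" f]) (auto simp: f_def)
    then have "(f, h) \<in> floquet_graph z \<mu> c"
      unfolding floquet_graph_iff[OF c] using e h g p by (auto simp: f_def intro!: exI[of _ "\<lambda>x. g' x + p' x"])
    then show ?thesis by blast
  qed
  have unique: "f = g" if f: "(f, h) \<in> floquet_graph z \<mu> c" and g: "(g, h) \<in> floquet_graph z \<mu> c" for f g h
  proof
    fix x
    obtain f' where f': "h \<in> L2" "solves (hill_coeff \<mu> c) h f f'" "f (2*pi) = z * f 0" "f' (2*pi) = z * f' 0" "\<And>x. x \<notin> period \<Longrightarrow> f x = 0"
      using f unfolding floquet_graph_iff[OF c] by blast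
    obtain g' where g': "solves (hill_coeff \<mu> c) h g g'" "g (2*pi) = z * g 0" "g' (2*pi) = z * g' 0" "\<And>x. x \<notin> period \<Longrightarrow> g x = 0"
      using g unfolding floquet_graph_iff[OF c] by blast
    have hi: "set_integrable lborel period h" by (rule L2_set_integrable[OF f'(1)])
    have "solves (hill_coeff \<mu> c) (\<lambda>x. 1 * h x + (-1) * h x) (\<lambda>x. 1 * f x + (-1) * g x) (\<lambda>x. 1 * f' x + (-1) * g' x)"
      by (rule solves_linear_combination[OF R f'(2) g'(1) hi hi])
    then have s: "solves (hill_coeff \<mu> c) (\<lambda>_. 0) (\<lambda>x. f x - g x) (\<lambda>x. f' x - g' x)" by simp
    have zero: "(\<lambda>_. 0) \<in> L2" by (intro L2_continuous continuous_intros)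
    have "norm (f x - g x) \<le> 0" if "x \<in> period"
      using sup[OF s zero _ _ that] f' g' by (simp add: right_diff_distrib set_lebesgue_integral_def)
    then show "f x = g x" using f'(5)[of x] g'(4)[of x] by (cases "x \<in> period") auto
  qed
  show ?thesis unfolding regular_graph_def using exists unique bound by blast
qed

end

section \<open>Dimension counts\<close>

text \<open>A homogeneous linear system with fewer equations than unknowns: the unknown \<open>b0\<close> is eliminated
  by means of the equation \<open>k0\<close>.\<close>

lemma nontrivial_combination_exists:
  fixes L :: "'k \<Rightarrow> 'b \<Rightarrow> complex"
  assumes "finite K" "finite B" "card K < card B"
  shows "\<exists>u. (\<exists>b\<in>B. u b \<noteq> 0) \<and> (\<forall>k\<in>K. (\<Sum>b\<in>B. u b * L k b) = 0)"
  using assms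
proof (induction K arbitrary: B L rule: finite_induct)
  case empty
  then have "B \<noteq> {}" by auto
  then show ?case by (intro exI[of _ "\<lambda>_. 1"]) auto
next
  case (insert k0 K)
  show ?case
  proof (cases "\<forall>b\<in>B. L k0 b = 0")
    case True
    have "card K < card B" using insert by simp
    then obtain u where "\<exists>b\<in>B. u b \<noteq> 0" "\<forall>k\<in>K. (\<Sum>b\<in>B. u b * L k b) = 0"
      using insert.IH[OF insert.prems(1)] by blast
    then show ?thesis using True by (intro exI[of _ u]) auto
  next
    case False
    then obtain b0 where b0: "b0 \<in> B" "L k0 b0 \<noteq> 0" by blast
    define L' where "L' = (\<lambda>k b. L k b - L k0 b / L k0 b0 * L k b0)"
    have "card K < card (B - {b0})" using insert b0 by simp
    then obtain u where u: "\<exists>b\<in>B - {b0}. u b \<noteq> 0" "\<And>k. k \<in> K \<Longrightarrow> (\<Sum>b\<in>B - {b0}. u b * L' k b) = 0"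
      using insert.IH[of "B - {b0}" L'] insert.prems(1) by auto
    define w where "w = u(b0 := - (\<Sum>b\<in>B - {b0}. u b * L k0 b) / L k0 b0)"
    have w: "(\<Sum>b\<in>B. w b * L k b) = (\<Sum>b\<in>B - {b0}. u b * L' k b)" for k
    proof -
      have "(\<Sum>b\<in>B. w b * L k b) = w b0 * L k b0 + (\<Sum>b\<in>B - {b0}. w b * L k b)"
        by (rule sum.remove) (use insert.prems b0 in auto)
      also have "(\<Sum>b\<in>B - {b0}. w b * L k b) = (\<Sum>b\<in>B - {b0}. u b * L k b)"
        by (intro sum.cong) (auto simp: w_def)
      also have "w b0 * L k b0 = - (\<Sum>b\<in>B - {b0}. u b * (L k0 b / L k0 b0 * L k b0))"
        by (simp add: w_def sum_distrib_left sum_distrib_right sum_divide_distrib mult_ac)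
      finally show ?thesis
        by (simp add: L'_def right_diff_distrib sum_subtractf)
    qed
    have "(\<Sum>b\<in>B. w b * L k b) = 0" if "k \<in> insert k0 K" for k
      unfolding w using that u(2) b0(2) by (auto simp: L'_def)
    moreover have "\<exists>b\<in>B. w b \<noteq> 0" using u(1) by (auto simp: w_def)
    ultimately show ?thesis by blast
  qed
qed

text \<open>Functionals that separate the points of \<open>V\<close> bound the dimension from above, and the vectors
  dual to them are independent.\<close>

lemma cdim_eq_card_dual_basis:
  fixes V :: "('x \<Rightarrow> complex) set" and L :: "'k \<Rightarrow> ('x \<Rightarrow> complex) \<Rightarrow> complex"
  assumes K: "finite K"
    and closed: "\<And>B u. finite B \<Longrightarrow> B \<subseteq> V \<Longrightarrow> (\<lambda>x. \<Sum>b\<in>B. u b * b x) \<in> V"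
    and lin: "\<And>k B u. k \<in> K \<Longrightarrow> finite B \<Longrightarrow> B \<subseteq> V \<Longrightarrow> L k (\<lambda>x. \<Sum>b\<in>B. u b * b x) = (\<Sum>b\<in>B. u b * L k b)"
    and inj: "\<And>F. F \<in> V \<Longrightarrow> (\<And>k. k \<in> K \<Longrightarrow> L k F = 0) \<Longrightarrow> F = (\<lambda>_. 0)"
    and dual: "\<And>k. k \<in> K \<Longrightarrow> \<exists>F\<in>V. \<forall>k'\<in>K. L k' F = (if k' = k then 1 else 0)"
  shows "cdim V = enat (card K)"
proof (rule antisym)
  show "cdim V \<le> enat (card K)"
    unfolding cdim_def
  proof (rule SUP_least)
    fix B assume "B \<in> {B. finite B \<and> B \<subseteq> V \<and> (\<forall>u. (\<forall>x. (\<Sum>b\<in>B. u b * b x) = 0) \<longrightarrow> (\<forall>b\<in>B. u b = 0))}"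
    then have B: "finite B" "B \<subseteq> V" and ind: "\<And>u. (\<And>x. (\<Sum>b\<in>B. u b * b x) = 0) \<Longrightarrow> \<forall>b\<in>B. u b = 0" by auto
    have "\<not> card K < card B"
    proof
      assume "card K < card B"
      then obtain u where u: "\<exists>b\<in>B. u b \<noteq> 0" "\<forall>k\<in>K. (\<Sum>b\<in>B. u b * L k b) = 0"
        using nontrivial_combination_exists[OF K B(1)] by blast
      have "(\<lambda>x. \<Sum>b\<in>B. u b * b x) = (\<lambda>_. 0)"
        by (rule inj[OF closed[OF B]]) (use u lin B in auto)
      then have "(\<Sum>b\<in>B. u b * b x) = 0" for x by (rule fun_cong)
      from ind[OF this] u(1) show False by blast
    qed
    then show "enat (card B) \<le> enat (card K)" by simp
  qed
next
  obtain e where e: "\<And>k. k \<in> K \<Longrightarrow> e k \<in> V" "\<And>k k'. k \<in> K \<Longrightarrow> k' \<in> K \<Longrightarrow> L k' (e k) = (if k' = k then 1 else 0)"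
    using dual by metis
  have inj_e: "inj_on e K"
  proof (rule inj_onI)
    fix k k' assume k: "k \<in> K" "k' \<in> K" "e k = e k'"
    then have "L k (e k) = L k (e k')" by simp
    then show "k = k'" using e(2)[of k k] e(2)[of k' k] k by (auto split: if_splits)
  qed
  have sub: "e ` K \<subseteq> V" and fin: "finite (e ` K)" using e(1) K by auto
  have "u b = 0" if 0: "\<And>x. (\<Sum>b\<in>e ` K. u b * b x) = 0" and b: "b \<in> e ` K" for u b
  proof -
    obtain k where k: "k \<in> K" "b = e k" using b by blast
    have "L k (\<lambda>x. \<Sum>b\<in>{}. 0 * b x) = (\<Sum>b\<in>{}. 0 * L k b)" by (rule lin) (use k in auto)
    then have "L k (\<lambda>x. 0) = 0" by simp
    then have "0 = L k (\<lambda>x. \<Sum>b\<in>e ` K. u b * b x)" using 0 by simp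
    also have "\<dots> = (\<Sum>b\<in>e ` K. u b * L k b)" by (rule lin[OF k(1) fin sub])
    also have "\<dots> = (\<Sum>k'\<in>K. u (e k') * L k (e k'))" by (simp add: sum.reindex[OF inj_e])
    also have "\<dots> = (\<Sum>k'\<in>K. if k' = k then u (e k) else 0)"
      by (intro sum.cong) (auto simp: e(2) k)
    also have "\<dots> = u b" using K k by simp
    finally show ?thesis by simp
  qed
  then have "e ` K \<in> {B. finite B \<and> B \<subseteq> V \<and> (\<forall>u. (\<forall>x. (\<Sum>b\<in>B. u b * b x) = 0) \<longrightarrow> (\<forall>b\<in>B. u b = 0))}"
    using fin sub by blast
  then have "enat (card (e ` K)) \<le> cdim V" unfolding cdim_def by (rule SUP_upper)
  then show "enat (card K) \<le> cdim V" by (simp add: card_image[OF inj_e])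
qed

section \<open>Power series matrices\<close>

lemma fps_X_power_dvd_iff_coeffs:
  fixes f :: "complex fps"
  shows "fps_X ^ m dvd f \<longleftrightarrow> (\<forall>i<m. fps_nth f i = 0)"
proof
  assume "fps_X ^ m dvd f"
  then obtain g where "f = fps_X ^ m * g" by (rule dvdE)
  then show "\<forall>i<m. fps_nth f i = 0" by (simp add: fps_X_power_mult_nth)
next
  assume *: "\<forall>i<m. fps_nth f i = 0"
  have "f = fps_X ^ m * fps_shift m f"
    using * by (intro fps_ext) (simp add: fps_X_power_mult_nth)
  then show "fps_X ^ m dvd f" by (rule dvdI)
qed

lemma fps_X_power_dvd_mult_iff:
  fixes f g :: "complex fps"
  assumes "f \<noteq> 0"
  shows "fps_X ^ m dvd f * g \<longleftrightarrow> fps_X ^ (m - subdegree f) dvd g"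
proof (cases "g = 0")
  case False
  have *: "fps_X ^ k dvd h \<longleftrightarrow> k \<le> subdegree h" if "h \<noteq> 0" for k and h :: "complex fps"
    using that by (subst fps_dvd_iff) auto
  show ?thesis using assms False by (auto simp: *)
qed simp

definition vec_fps :: "(bool \<times> nat \<Rightarrow> complex) \<Rightarrow> bool \<Rightarrow> complex fps" where
  "vec_fps v r = Abs_fps (\<lambda>j. v (r, j))"

text \<open>The kernel of a \<open>2 \<times> 2\<close> power series matrix \<open>A\<close> acting on vectors of polynomials modulo
  \<open>t\<^sup>m\<close>. Rows and columns are indexed by truth values; later \<open>True\<close> stands for the value
  and \<open>False\<close> for the derivative in a pair of Cauchy data.\<close>

definition truncated_kernel :: "(bool \<Rightarrow> bool \<Rightarrow> complex fps) \<Rightarrow> nat \<Rightarrow> (bool \<times> nat \<Rightarrow> complex) set" where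
  "truncated_kernel A m = {v. (\<forall>r. \<forall>j\<ge>m. v (r, j) = 0) \<and>
     (\<forall>s. fps_X ^ m dvd A s True * vec_fps v True + A s False * vec_fps v False)}"

text \<open>The positions \<open>K\<close> are free variables of the linear space \<open>V\<close>, in the sense of Gaussian
  elimination.\<close>

definition coordinates :: "(bool \<times> nat \<Rightarrow> complex) set \<Rightarrow> (bool \<times> nat) set \<Rightarrow> bool" where
  "coordinates V K \<longleftrightarrow> (\<forall>v\<in>V. (\<forall>k\<in>K. v k = 0) \<longrightarrow> v = (\<lambda>_. 0)) \<and>
     (\<forall>k\<in>K. \<exists>v\<in>V. \<forall>k'\<in>K. v k' = (if k' = k then 1 else 0))"

text \<open>Elimination with a pivot that divides its row and its column decouples the two congruences:
  with \<open>a\<close> and \<open>b\<close> the orders of the pivot and of the reduced entry \<open>\<delta>\<close>, they say that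
  \<open>v\<^sub>1 + \<beta> v\<^sub>2\<close> is divisible by \<open>t\<^sup>m\<^sup>-\<^sup>a\<close> and \<open>v\<^sub>2\<close> by \<open>t\<^sup>m\<^sup>-\<^sup>b\<close>. What remains free are the
  \<open>a\<close> highest coefficients of \<open>v\<^sub>1\<close> and the \<open>b\<close> highest ones of \<open>v\<^sub>2\<close>.\<close>

lemma truncated_kernel_coordinates_pivot:
  fixes A :: "bool \<Rightarrow> bool \<Rightarrow> complex fps"
  assumes pivot: "A s r \<noteq> 0" and \<beta>: "A s (\<not> r) = A s r * \<beta>" and \<gamma>: "A (\<not> s) r = A s r * \<gamma>"
    and \<delta>: "\<delta> = A (\<not> s) (\<not> r) - \<gamma> * A s (\<not> r)" "\<delta> \<noteq> 0"
  shows "coordinates (truncated_kernel A m)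
    ({r} \<times> {m - subdegree (A s r)..<m} \<union> {\<not> r} \<times> {m - subdegree \<delta>..<m})"
proof -
  let ?a = "subdegree (A s r)" and ?b = "subdegree \<delta>"
  let ?K = "{r} \<times> {m - ?a..<m} \<union> {\<not> r} \<times> {m - ?b..<m}"
  have rows: "A s' True * vec_fps v True + A s' False * vec_fps v False = A s' r * vec_fps v r + A s' (\<not> r) * vec_fps v (\<not> r)" for s' v
    by (cases r) (auto simp: add.commute)
  have ker: "v \<in> truncated_kernel A m \<longleftrightarrow> (\<forall>r. \<forall>j\<ge>m. v (r, j) = 0) \<and>
      fps_X ^ (m - ?a) dvd vec_fps v r + \<beta> * vec_fps v (\<not> r) \<and> fps_X ^ (m - ?b) dvd vec_fps v (\<not> r)" for v
  proof -
    let ?v1 = "vec_fps v r" and ?v2 = "vec_fps v (\<not> r)"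
    have "(\<forall>s'. fps_X ^ m dvd A s' r * ?v1 + A s' (\<not> r) * ?v2) \<longleftrightarrow>
        fps_X ^ m dvd A s r * ?v1 + A s (\<not> r) * ?v2 \<and> fps_X ^ m dvd A (\<not> s) r * ?v1 + A (\<not> s) (\<not> r) * ?v2"
      by (cases s) (auto simp: all_bool_eq)
    also have "A s r * ?v1 + A s (\<not> r) * ?v2 = A s r * (?v1 + \<beta> * ?v2)" by (simp add: \<beta> algebra_simps)
    also have "A (\<not> s) r * ?v1 + A (\<not> s) (\<not> r) * ?v2 = \<gamma> * (A s r * (?v1 + \<beta> * ?v2)) + \<delta> * ?v2"
      by (simp add: \<gamma> \<delta> \<beta> algebra_simps)
    also have "fps_X ^ m dvd A s r * (?v1 + \<beta> * ?v2) \<and> fps_X ^ m dvd \<gamma> * (A s r * (?v1 + \<beta> * ?v2)) + \<delta> * ?v2 \<longleftrightarrow>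
        fps_X ^ m dvd A s r * (?v1 + \<beta> * ?v2) \<and> fps_X ^ m dvd \<delta> * ?v2"
      using dvd_add_right_iff dvd_mult by blast
    finally show ?thesis
      unfolding truncated_kernel_def rows fps_X_power_dvd_mult_iff[OF pivot] fps_X_power_dvd_mult_iff[OF \<delta>(2)] by simp
  qed
  have zero_fps: "f = 0" if "\<And>i. fps_nth f i = 0" for f :: "complex fps" using that by (simp add: fps_eq_iff)
  have "v = (\<lambda>_. 0)" if v: "v \<in> truncated_kernel A m" and 0: "\<And>k. k \<in> ?K \<Longrightarrow> v k = 0" for v
  proof -
    have v2: "vec_fps v (\<not> r) = 0"
    proof (rule zero_fps)
      fix i
      have "fps_nth (vec_fps v (\<not> r)) i = 0" if "i < m - ?b" using v that unfolding ker fps_X_power_dvd_iff_coeffs by blast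
      moreover have "v (\<not> r, i) = 0" if "i \<ge> m" using v that unfolding ker by blast
      moreover have "v (\<not> r, i) = 0" if "m - ?b \<le> i" "i < m" using 0[of "(\<not> r, i)"] that by auto
      moreover have "i < m - ?b \<or> (m - ?b \<le> i \<and> i < m) \<or> i \<ge> m" by linarith
      ultimately show "fps_nth (vec_fps v (\<not> r)) i = 0" by (auto simp: vec_fps_def)
    qed
    have v1: "vec_fps v r = 0"
    proof (rule zero_fps)
      fix i
      have "fps_X ^ (m - ?a) dvd vec_fps v r" using v v2 unfolding ker by simp
      then have "fps_nth (vec_fps v r) i = 0" if "i < m - ?a" using that unfolding fps_X_power_dvd_iff_coeffs by blast
      moreover have "v (r, i) = 0" if "i \<ge> m" using v that unfolding ker by blast
      moreover have "v (r, i) = 0" if "m - ?a \<le> i" "i < m" using 0[of "(r, i)"] that by auto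
      moreover have "i < m - ?a \<or> (m - ?a \<le> i \<and> i < m) \<or> i \<ge> m" by linarith
      ultimately show "fps_nth (vec_fps v r) i = 0" by (auto simp: vec_fps_def)
    qed
    have "vec_fps v s' = 0" for s' using v1 v2 by (cases "s' = r") auto
    then have "v (s', i) = 0" for s' i unfolding vec_fps_def fps_eq_iff by simp
    then show ?thesis by auto
  qed
  moreover have "\<exists>v\<in>truncated_kernel A m. \<forall>k'\<in>?K. v k' = (if k' = k then 1 else 0)" if k: "k \<in> ?K" for k
  proof -
    obtain r' j where k': "k = (r', j)" by (cases k)
    show ?thesis
    proof (cases "r' = r")
      case True
      then have j: "m - ?a \<le> j" "j < m" using k k' by auto
      define v :: "bool \<times> nat \<Rightarrow> complex" where "v = (\<lambda>k'. if k' = (r, j) then 1 else 0)"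
      have "fps_X ^ (m - ?a) dvd vec_fps v r" using j unfolding fps_X_power_dvd_iff_coeffs by (auto simp: vec_fps_def v_def)
      moreover have "vec_fps v (\<not> r) = 0" by (rule zero_fps) (simp add: vec_fps_def v_def)
      ultimately have "v \<in> truncated_kernel A m" unfolding ker using j by (auto simp: v_def)
      then show ?thesis using True k' by (intro bexI[of _ v]) (auto simp: v_def)
    next
      case False
      then have r': "r' = (\<not> r)" by auto
      then have j: "m - ?b \<le> j" "j < m" using k k' by auto
      \<comment> \<open>the component \<open>r\<close> compensates \<open>\<beta> t\<^sup>j\<close> in the orders below \<open>m - a\<close> and vanishes at the free positions\<close>
      define v :: "bool \<times> nat \<Rightarrow> complex" where
        "v = (\<lambda>(q, i). if q = r then (if i < m - ?a then - fps_nth (\<beta> * fps_X ^ j) i else 0) else if i = j then 1 else 0)"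
      have v2: "vec_fps v (\<not> r) = fps_X ^ j"
        by (rule fps_ext) (auto simp: vec_fps_def v_def fps_X_power_nth)
      have "fps_X ^ (m - ?a) dvd vec_fps v r + \<beta> * vec_fps v (\<not> r)"
        unfolding v2 fps_X_power_dvd_iff_coeffs by (simp add: vec_fps_def v_def)
      moreover have "fps_X ^ (m - ?b) dvd vec_fps v (\<not> r)"
        unfolding v2 using j by (intro le_imp_power_dvd)
      ultimately have "v \<in> truncated_kernel A m" unfolding ker using j by (auto simp: v_def)
      then show ?thesis using r' k' by (intro bexI[of _ v]) (auto simp: v_def split: if_splits)
    qed
  qed
  ultimately show ?thesis unfolding coordinates_def by blast
qed

text \<open>Power series over a field form a discrete valuation ring, so a nonzero entry of least order divides
  all others and can serve as pivot. This is the Smith normal form of a \<open>2 \<times> 2\<close> matrix: the orders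
  of pivot and reduced entry add up to the order of the determinant.\<close>

lemma truncated_kernel_coordinates:
  fixes A :: "bool \<Rightarrow> bool \<Rightarrow> complex fps"
  defines "\<Delta> \<equiv> A True True * A False False - A True False * A False True"
  assumes \<Delta>: "\<Delta> \<noteq> 0"
  obtains K where "K \<subseteq> UNIV \<times> {..<m}" "coordinates (truncated_kernel A m) K"
    "card K \<le> subdegree \<Delta>" "subdegree \<Delta> \<le> m \<Longrightarrow> card K = subdegree \<Delta>"
proof -
  define N where "N = {p :: bool \<times> bool. A (fst p) (snd p) \<noteq> 0}"
  have "N \<noteq> {}"
  proof
    assume "N = {}"
    then have "A s r = 0" for s r by (auto simp: N_def)
    then show False using \<Delta> by (simp add: \<Delta>_def)
  qed
  then obtain p0 where "p0 \<in> N" by blast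
  then obtain p where p: "p \<in> N" "\<And>q. q \<in> N \<Longrightarrow> subdegree (A (fst p) (snd p)) \<le> subdegree (A (fst q) (snd q))"
    using ex_has_least_nat[of "\<lambda>p. p \<in> N" p0 "\<lambda>p. subdegree (A (fst p) (snd p))"] by blast
  obtain s r where sr: "p = (s, r)" by (cases p)
  have pivot: "A s r \<noteq> 0" using p sr by (simp add: N_def)
  have dvd: "A s r dvd A s' r'" for s' r'
  proof (cases "A s' r' = 0")
    case False
    then have "(s', r') \<in> N" by (simp add: N_def)
    then show ?thesis using p(2) sr pivot False by (subst fps_dvd_iff) force+
  qed simp
  obtain \<beta> where \<beta>: "A s (\<not> r) = A s r * \<beta>" using dvd by (rule dvdE)
  obtain \<gamma> where \<gamma>: "A (\<not> s) r = A s r * \<gamma>" using dvd by (rule dvdE)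
  define \<delta> where "\<delta> = A (\<not> s) (\<not> r) - \<gamma> * A s (\<not> r)"
  have "A s r * A (\<not> s) (\<not> r) - A s (\<not> r) * A (\<not> s) r = A s r * \<delta>"
    by (simp add: \<delta>_def \<gamma> algebra_simps)
  moreover have "A s r * A (\<not> s) (\<not> r) - A s (\<not> r) * A (\<not> s) r = \<Delta> \<or> A s r * A (\<not> s) (\<not> r) - A s (\<not> r) * A (\<not> s) r = - \<Delta>"
    by (cases s; cases r) (auto simp: \<Delta>_def algebra_simps)
  ultimately have "A s r * \<delta> = \<Delta> \<or> A s r * \<delta> = - \<Delta>" by simp
  then have d: "\<Delta> = A s r * \<delta> \<or> \<Delta> = - (A s r * \<delta>)" by auto
  then have \<delta>0: "\<delta> \<noteq> 0" using \<Delta> by auto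
  have "subdegree \<Delta> = subdegree (A s r * \<delta>)" using d by (elim disjE) simp_all
  then have sd: "subdegree \<Delta> = subdegree (A s r) + subdegree \<delta>"
    by (simp only: subdegree_mult[OF pivot \<delta>0])
  let ?a = "subdegree (A s r)" and ?b = "subdegree \<delta>"
  let ?K = "{r} \<times> {m - ?a..<m} \<union> {\<not> r} \<times> {m - ?b..<m}"
  have card: "card ?K = (m - (m - ?a)) + (m - (m - ?b))"
    by (subst card_Un_disjoint) (auto simp: card_cartesian_product)
  show ?thesis
  proof (rule that[of ?K])
    show "coordinates (truncated_kernel A m) ?K"
      by (rule truncated_kernel_coordinates_pivot[OF pivot \<beta> \<gamma> \<delta>_def \<delta>0])
  qed (use card sd in auto)
qed

section \<open>Order of vanishing\<close>

definition vanishes_to_order :: "nat \<Rightarrow> (complex \<Rightarrow> complex) \<Rightarrow> bool" where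
  "vanishes_to_order m f \<longleftrightarrow> (\<exists>C. \<forall>\<^sub>F t in at 0. norm (f t) \<le> C * norm t ^ m)"

text \<open>If \<open>F\<close> has order \<open>k\<close>, then \<open>f(t) / t\<^sup>k\<close> has a nonzero limit, which is incompatible with
  \<open>O(t\<^sup>m)\<close> for \<open>m > k\<close>.\<close>

lemma vanishes_to_order_iff_dvd:
  assumes f: "f has_fps_expansion F"
  shows "vanishes_to_order m f \<longleftrightarrow> fps_X ^ m dvd F"
proof
  assume dvd: "fps_X ^ m dvd F"
  show "vanishes_to_order m f"
  proof (cases "F = 0")
    case True
    have "\<forall>\<^sub>F t in nhds 0. eval_fps F t = f t" using f by (simp add: has_fps_expansion_def)
    then have "\<forall>\<^sub>F t in nhds 0. f t = 0" by eventually_elim (simp add: True)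
    then have "\<forall>\<^sub>F t in at 0. f t = 0" by (auto simp: eventually_at_filter elim: eventually_mono)
    then show ?thesis unfolding vanishes_to_order_def by (intro exI[of _ 0]) (auto elim: eventually_mono)
  next
    case False
    then have "m \<le> subdegree F" using dvd by (subst (asm) fps_dvd_iff) auto
    define g where "g = (\<lambda>x. if x = 0 then fps_nth F m else f x / x ^ m)"
    have "g has_fps_expansion fps_shift m F"
      unfolding g_def by (rule has_fps_expansion_shift[OF f \<open>m \<le> subdegree F\<close> refl])
    then have "isCont g 0" using has_fps_expansion_imp_continuous by blast
    then have "(g \<longlongrightarrow> g 0) (at 0)" by (simp add: isCont_def)
    then have "((\<lambda>t. norm (g t)) \<longlongrightarrow> norm (g 0)) (at 0)" by (rule tendsto_norm)
    then have "\<forall>\<^sub>F t in at 0. norm (g t) < norm (g 0) + 1" by (rule order_tendstoD) simp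
    moreover have "\<forall>\<^sub>F t in at (0::complex). t \<noteq> 0" by (simp add: eventually_at_filter)
    ultimately have "\<forall>\<^sub>F t in at 0. norm (f t) \<le> (norm (g 0) + 1) * norm t ^ m"
    proof eventually_elim
      case (elim t)
      then have "norm (f t) = norm (g t) * norm t ^ m" by (simp add: g_def norm_divide norm_power)
      then show ?case using elim by (simp add: mult_right_mono)
    qed
    then show ?thesis unfolding vanishes_to_order_def by blast
  qed
next
  assume "vanishes_to_order m f"
  then obtain C where C: "\<forall>\<^sub>F t in at 0. norm (f t) \<le> C * norm t ^ m" unfolding vanishes_to_order_def by blast
  show "fps_X ^ m dvd F"
  proof (rule ccontr)
    assume ndvd: "\<not> fps_X ^ m dvd F"
    then have F0: "F \<noteq> 0" by auto
    define k where "k = subdegree F"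
    have km: "k < m" using ndvd F0 by (subst (asm) fps_dvd_iff) (auto simp: k_def)
    define g where "g = (\<lambda>x. if x = 0 then fps_nth F k else f x / x ^ k)"
    have "g has_fps_expansion fps_shift k F"
      unfolding g_def by (rule has_fps_expansion_shift[OF f _ refl]) (simp add: k_def)
    then have "isCont g 0" using has_fps_expansion_imp_continuous by blast
    then have lim: "(g \<longlongrightarrow> fps_nth F k) (at 0)" by (simp add: isCont_def g_def)
    have "(g \<longlongrightarrow> 0) (at 0)"
    proof (rule Lim_null_comparison)
      have "\<forall>\<^sub>F t in at (0::complex). t \<noteq> 0" by (simp add: eventually_at_filter)
      with C show "\<forall>\<^sub>F t in at 0. norm (g t) \<le> C * norm t ^ (m - k)"
      proof eventually_elim
        case (elim t)
        have "norm (g t) = norm (f t) / norm t ^ k" using elim by (simp add: g_def norm_divide norm_power)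
        also have "\<dots> \<le> C * norm t ^ m / norm t ^ k" using elim by (intro divide_right_mono) auto
        also have "\<dots> = C * norm t ^ (m - k)" using elim km by (simp add: power_diff)
        finally show ?case .
      qed
      have "((\<lambda>t::complex. C * norm t ^ (m - k)) \<longlongrightarrow> C * norm (0::complex) ^ (m - k)) (at 0)"
        by (intro tendsto_intros)
      then show "((\<lambda>t::complex. C * norm t ^ (m - k)) \<longlongrightarrow> 0) (at 0)" using km by (simp add: zero_power)
    qed
    with lim have "fps_nth F k = 0" using tendsto_unique by (metis trivial_limit_at)
    then show False using F0 by (simp add: k_def)
  qed
qed

lemma has_fps_expansion_polynomial:
  fixes a :: "nat \<Rightarrow> complex"
  shows "(\<lambda>t. \<Sum>j<m. t ^ j * a j) has_fps_expansion Abs_fps (\<lambda>j. if j < m then a j else 0)"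
proof -
  have "(\<lambda>t. \<Sum>j<m. t ^ j * a j) has_fps_expansion (\<Sum>j<m. fps_X ^ j * fps_const (a j))"
    by (intro fps_expansion_intros)
  also have "(\<Sum>j<m. fps_X ^ j * fps_const (a j)) = Abs_fps (\<lambda>j. if j < m then a j else 0)"
  proof (rule fps_ext)
    fix n
    have "fps_nth (\<Sum>j<m. fps_X ^ j * fps_const (a j)) n = (\<Sum>j<m. if n = j then a j else 0)"
      unfolding fps_sum_nth by (intro sum.cong) (auto simp: fps_X_power_mult_nth)
    then show "fps_nth (\<Sum>j<m. fps_X ^ j * fps_const (a j)) n = fps_nth (Abs_fps (\<lambda>j. if j < m then a j else 0)) n"
      by simp
  qed
  finally show ?thesis .
qed

lemma polynomial_vanishing_coefficients:
  assumes "vanishes_to_order m (\<lambda>t. \<Sum>j<m. t ^ j * a j)" "j < m"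
  shows "a j = 0"
proof -
  have "fps_X ^ m dvd Abs_fps (\<lambda>j. if j < m then a j else 0)"
    using assms(1) vanishes_to_order_iff_dvd[OF has_fps_expansion_polynomial] by blast
  then show ?thesis using assms(2) unfolding fps_X_power_dvd_iff_coeffs by auto
qed

section \<open>Jordan chains of the Hill family\<close>

lemma period_derivative:
  fixes f :: "real \<Rightarrow> complex"
  shows "(f has_vector_derivative y) (at x within period) \<Longrightarrow> x \<in> period \<Longrightarrow> vector_derivative f (at x within period) = y"
  by (rule vector_derivative_within_closed_interval) auto

text \<open>A polynomial with values in a subspace has its coefficients there. With \<open>m\<close> the degree,
  \<open>p(t/2) - 2\<^sup>-\<^sup>m p(t)\<close> has lost the leading coefficient, while the others are multiplied by the
  nonzero numbers \<open>2\<^sup>-\<^sup>j - 2\<^sup>-\<^sup>m\<close>; so induction on the degree applies.\<close>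

lemma polynomial_coefficients_in_subspace:
  fixes F :: "nat \<Rightarrow> real \<Rightarrow> complex"
  assumes lin: "\<And>a b G H. P G \<Longrightarrow> P H \<Longrightarrow> P (\<lambda>x. a * G x + b * H x)" and r: "r > 0"
    and P: "\<And>t::complex. t \<noteq> 0 \<Longrightarrow> norm t < r \<Longrightarrow> P (\<lambda>x. \<Sum>j<m. t ^ j * F j x)"
    and j: "j < m"
  shows "P (F j)"
  using P j
proof (induction m arbitrary: F j)
  case (Suc m)
  have cong: "P H" if G: "P G" and eq: "\<And>x. G x = H x" for G H
  proof -
    have "G = H" by (rule ext) (rule eq)
    then show ?thesis using G by simp
  qed
  define t0 where "t0 = complex_of_real (r / 2)"
  have t0: "t0 \<noteq> 0" "norm t0 < r" using r by (simp_all add: t0_def)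
  have zero: "P (\<lambda>_. 0)"
    using lin[OF Suc.prems(1)[OF t0] Suc.prems(1)[OF t0], of 0 0] by simp
  define d where "d = (\<lambda>j. (1/2) ^ j - (1/2) ^ m :: complex)"
  have d: "d j \<noteq> 0" if "j < m" for j
  proof -
    have "(1/2) ^ m < ((1/2) ^ j :: real)" using that by (intro power_strict_decreasing) auto
    then have "complex_of_real ((1/2) ^ j - (1/2) ^ m) \<noteq> 0" by (metis of_real_eq_0_iff eq_iff_diff_eq_0 less_irrefl)
    then show ?thesis by (simp add: d_def)
  qed
  have lower: "P (F j)" if j: "j < m" for j
  proof -
    have "P (\<lambda>x. d j * F j x)"
    proof (rule Suc.IH[where F = "\<lambda>j x. d j * F j x", OF _ j])
      fix t :: complex assume t: "t \<noteq> 0" "norm t < r"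
      then have t2: "t / 2 \<noteq> 0" "norm (t / 2) < r" using r by (auto simp: norm_divide)
      have "P (\<lambda>x. 1 * (\<Sum>j<Suc m. (t / 2) ^ j * F j x) + (- ((1/2) ^ m)) * (\<Sum>j<Suc m. t ^ j * F j x))"
        by (intro lin Suc.prems(1) t t2)
      then show "P (\<lambda>x. \<Sum>j<m. t ^ j * (d j * F j x))"
      proof (rule cong)
        fix x
        have "1 * (\<Sum>j<Suc m. (t / 2) ^ j * F j x) + (- ((1/2) ^ m)) * (\<Sum>j<Suc m. t ^ j * F j x) =
            (\<Sum>j<Suc m. t ^ j * (d j * F j x))"
          unfolding sum_distrib_left sum.distrib[symmetric]
          by (intro sum.cong) (simp_all add: d_def power_divide algebra_simps)
        also have "\<dots> = (\<Sum>j<m. t ^ j * (d j * F j x))" by (simp add: d_def)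
        finally show "1 * (\<Sum>j<Suc m. (t / 2) ^ j * F j x) + (- ((1/2) ^ m)) * (\<Sum>j<Suc m. t ^ j * F j x) =
            (\<Sum>j<m. t ^ j * (d j * F j x))" .
      qed
    qed
    from lin[OF this zero, of "1 / d j" 0] show ?thesis using d[OF j] by simp
  qed
  show ?case
  proof (cases "j = m")
    case True
    have sums: "P (\<lambda>x. \<Sum>j<n. t0 ^ j * F j x)" if "n \<le> m" for n
      using that
    proof (induction n)
      case (Suc n)
      then show ?case using lin[OF Suc.IH lower[of n], of 1 "t0 ^ n"] by simp
    qed (simp add: zero)
    have "P (\<lambda>x. (1 / t0 ^ m) * (\<Sum>j<Suc m. t0 ^ j * F j x) + (- 1 / t0 ^ m) * (\<Sum>j<m. t0 ^ j * F j x))"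
      by (intro lin Suc.prems(1)[OF t0] sums) simp
    then show ?thesis
    proof (rule cong)
      show "(1 / t0 ^ m) * (\<Sum>j<Suc m. t0 ^ j * F j x) + (- 1 / t0 ^ m) * (\<Sum>j<m. t0 ^ j * F j x) = F j x" for x
        using t0(1) True by (simp add: field_simps)
    qed
  qed (use lower Suc.prems(2) in auto)
qed simp

text \<open>Conditions that hold on the domain of the operator for every value of the parameter; being linear,
  they pass from a polynomial root function to its coefficients.\<close>

definition bc_space :: "complex \<Rightarrow> (real \<Rightarrow> complex) \<Rightarrow> bool" where
  "bc_space z G \<longleftrightarrow> (\<forall>x. x \<notin> period \<longrightarrow> G x = 0) \<and> G (2*pi) = z * G 0 \<and>
     (\<exists>G'. (\<forall>x\<in>period. (G has_vector_derivative G' x) (at x within period)) \<and> G' (2*pi) = z * G' 0)"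

lemma bc_space_linear:
  assumes "bc_space z G" "bc_space z H"
  shows "bc_space z (\<lambda>x. a * G x + b * H x)"
proof -
  obtain G' H' where G': "\<And>x. x \<in> period \<Longrightarrow> (G has_vector_derivative G' x) (at x within period)" "G' (2*pi) = z * G' 0"
    and H': "\<And>x. x \<in> period \<Longrightarrow> (H has_vector_derivative H' x) (at x within period)" "H' (2*pi) = z * H' 0"
    using assms unfolding bc_space_def by blast
  have "((\<lambda>x. a * G x + b * H x) has_vector_derivative a * G' x + b * H' x) (at x within period)" if "x \<in> period" for x
    by (intro has_vector_derivative_add has_vector_derivative_mult_right G' H' that)
  moreover have "a * G' (2*pi) + b * H' (2*pi) = z * (a * G' 0 + b * H' 0)" using G'(2) H'(2) by (simp add: algebra_simps)
  moreover have "\<forall>x. x \<notin> period \<longrightarrow> a * G x + b * H x = 0" "a * G (2*pi) + b * H (2*pi) = z * (a * G 0 + b * H 0)"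
    using assms unfolding bc_space_def by (simp_all add: algebra_simps)
  ultimately show ?thesis unfolding bc_space_def by (intro conjI exI[of _ "\<lambda>x. a * G' x + b * H' x"]) blast+
qed

lemma floquet_graph_linear:
  assumes c: "c \<notin> real_cut" and "(f, h) \<in> floquet_graph z \<mu> c" "(g, k) \<in> floquet_graph z \<mu> c"
  shows "(\<lambda>x. a * f x + b * g x, \<lambda>x. a * h x + b * k x) \<in> floquet_graph z \<mu> c"
proof -
  obtain f' where f: "h \<in> L2" "\<And>x. x \<notin> period \<Longrightarrow> f x = 0" "solves (hill_coeff \<mu> c) h f f'" "f (2*pi) = z * f 0" "f' (2*pi) = z * f' 0"
    using assms(2) unfolding floquet_graph_iff[OF c] by blast
  obtain g' where g: "k \<in> L2" "\<And>x. x \<notin> period \<Longrightarrow> g x = 0" "solves (hill_coeff \<mu> c) k g g'" "g (2*pi) = z * g 0" "g' (2*pi) = z * g' 0"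
    using assms(3) unfolding floquet_graph_iff[OF c] by blast
  have "solves (hill_coeff \<mu> c) (\<lambda>x. a * h x + b * k x) (\<lambda>x. a * f x + b * g x) (\<lambda>x. a * f' x + b * g' x)"
    by (rule solves_linear_combination[OF continuous_on_hill_coeff[OF c] f(3) g(3)]) (intro L2_set_integrable f g)+
  moreover have "(\<lambda>x. a * h x + b * k x) \<in> L2"
    by (intro L2_add L2_mult continuous_on_const f g)
  ultimately show ?thesis
    unfolding floquet_graph_iff[OF c] using f g by (auto intro!: exI[of _ "\<lambda>x. a * f' x + b * g' x"] simp: algebra_simps)
qed

text \<open>The factor 2 replaces Minkowski's inequality: \<open>(x + y)\<^sup>2 \<le> 2 x\<^sup>2 + 2 y\<^sup>2\<close> holds pointwise.\<close>

lemma L2norm_linear_le: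
  assumes "h \<in> L2" "k \<in> L2"
  shows "L2norm (\<lambda>x. a * h x + b * k x) \<le> 2 * (norm a * L2norm h + norm b * L2norm k)"
proof -
  let ?N = "\<lambda>h. LBINT x:period. (norm (h x))\<^sup>2"
  have N0: "?N h \<ge> 0" for h
    unfolding set_lebesgue_integral_def by (intro Bochner_Integration.integral_nonneg) simp
  have ih: "set_integrable lborel period (\<lambda>x. (2 * (norm a)\<^sup>2) * (norm (h x))\<^sup>2)"
    and ik: "set_integrable lborel period (\<lambda>x. (2 * (norm b)\<^sup>2) * (norm (k x))\<^sup>2)"
    by (intro set_integrable_mult_right L2_square_integrable assms)+
  have "?N (\<lambda>x. a * h x + b * k x) \<le> (LBINT x:period. (2 * (norm a)\<^sup>2) * (norm (h x))\<^sup>2 + (2 * (norm b)\<^sup>2) * (norm (k x))\<^sup>2)"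
  proof (rule set_integral_mono)
    show "set_integrable lborel period (\<lambda>x. (norm (a * h x + b * k x))\<^sup>2)"
      by (intro L2_square_integrable L2_add L2_mult continuous_on_const assms)
    show "set_integrable lborel period (\<lambda>x. (2 * (norm a)\<^sup>2) * (norm (h x))\<^sup>2 + (2 * (norm b)\<^sup>2) * (norm (k x))\<^sup>2)"
      by (intro set_integral_add ih ik)
    fix x
    have "(norm (a * h x + b * k x))\<^sup>2 \<le> (norm a * norm (h x) + norm b * norm (k x))\<^sup>2"
      by (intro power_mono order_trans[OF norm_triangle_ineq]) (auto simp: norm_mult)
    also have "\<dots> \<le> (2 * (norm a)\<^sup>2) * (norm (h x))\<^sup>2 + (2 * (norm b)\<^sup>2) * (norm (k x))\<^sup>2"
      using zero_le_power2[of "norm a * norm (h x) - norm b * norm (k x)"] by (simp add: power2_eq_square algebra_simps)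
    finally show "(norm (a * h x + b * k x))\<^sup>2 \<le> (2 * (norm a)\<^sup>2) * (norm (h x))\<^sup>2 + (2 * (norm b)\<^sup>2) * (norm (k x))\<^sup>2" .
  qed
  also have "\<dots> = (2 * (norm a)\<^sup>2) * ?N h + (2 * (norm b)\<^sup>2) * ?N k"
    unfolding set_integral_add(2)[OF ih ik] set_integral_mult_right by simp
  also have "\<dots> = 2 * ((norm a * L2norm h)\<^sup>2 + (norm b * L2norm k)\<^sup>2)"
    by (simp add: L2norm_def power_mult_distrib N0)
  also have "\<dots> \<le> (2 * (norm a * L2norm h + norm b * L2norm k))\<^sup>2"
    using L2norm_nonneg[of h] L2norm_nonneg[of k] by (simp add: power2_eq_square algebra_simps)
  finally have "L2norm (\<lambda>x. a * h x + b * k x) \<le> sqrt ((2 * (norm a * L2norm h + norm b * L2norm k))\<^sup>2)"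
    unfolding L2norm_def by (rule real_sqrt_le_mono)
  then show ?thesis using L2norm_nonneg[of h] L2norm_nonneg[of k] by simp
qed

locale hill_family =
  fixes z \<mu> c0 :: complex
  assumes z: "z \<noteq> 0" and c0: "c0 \<notin> real_cut"
begin

abbreviation "T \<equiv> floquet_graph z \<mu>"
abbreviation "hill_chains m \<equiv> jordan_chains T c0 m"

text \<open>The Cauchy data at 0 of the \<open>j\<close>-th term of a chain.\<close>

definition initial :: "bool \<times> nat \<Rightarrow> (nat \<times> real \<Rightarrow> complex) \<Rightarrow> complex" where
  "initial = (\<lambda>(r, j) F. if r then F (j, 0) else vector_derivative (\<lambda>x. F (j, x)) (at 0 within period))"

text \<open>The entries of \<open>z - M(c)\<close>.\<close>

definition boundary_entry :: "bool \<Rightarrow> bool \<Rightarrow> complex \<Rightarrow> complex" where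
  "boundary_entry s r c =
    (if s then (if r then z - fst (endpoint (hill_coeff \<mu> c) 1 0) else - fst (endpoint (hill_coeff \<mu> c) 0 1))
     else (if r then - snd (endpoint (hill_coeff \<mu> c) 1 0) else z - snd (endpoint (hill_coeff \<mu> c) 0 1)))"

definition boundary_fps :: "bool \<Rightarrow> bool \<Rightarrow> complex fps" where
  "boundary_fps s r = fps_expansion (boundary_entry s r) c0"

lemma boundary_entry_holomorphic: "boundary_entry s r holomorphic_on - real_cut"
  unfolding boundary_entry_def by (cases s; cases r) (simp_all, (intro holomorphic_intros endpoint_holomorphic)+)

lemma boundary_fps: "(\<lambda>t. boundary_entry s r (c0 + t)) has_fps_expansion boundary_fps s r"
  unfolding boundary_fps_def
  using boundary_entry_holomorphic open_Compl_real_cut c0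
  by (intro analytic_at_imp_has_fps_expansion) (auto simp: analytic_at)

lemma boundary_entry_eq:
  assumes "c \<notin> real_cut"
  shows "z * v - fst (endpoint (hill_coeff \<mu> c) v v') = boundary_entry True True c * v + boundary_entry True False c * v'"
    and "z * v' - snd (endpoint (hill_coeff \<mu> c) v v') = boundary_entry False True c * v + boundary_entry False False c * v'"
  using endpoint_boundary[OF assms z] by (simp_all add: boundary_entry_def)

lemma eventually_good: "\<forall>\<^sub>F c in at c0. c \<notin> real_cut"
  using open_Compl_real_cut c0 by (auto intro!: eventually_at_in_open' elim!: eventually_mono simp: eventually_at_topological)

lemma chains_iff:
  "F \<in> hill_chains m \<longleftrightarrow> (\<forall>j\<ge>m. \<forall>x. F (j, x) = 0) \<and>
    (\<exists>h C. \<forall>\<^sub>F c in at c0. (\<lambda>x. \<Sum>j<m. (c - c0) ^ j * F (j, x), h c) \<in> T c \<and> L2norm (h c) \<le> C * norm (c - c0) ^ m)"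
proof -
  have "(\<lambda>c. L2norm (h c)) \<in> O[at c0](\<lambda>c. cmod (c - c0) ^ m) \<longleftrightarrow>
      (\<exists>C. \<forall>\<^sub>F c in at c0. L2norm (h c) \<le> C * norm (c - c0) ^ m)" for h
  proof
    assume "(\<lambda>c. L2norm (h c)) \<in> O[at c0](\<lambda>c. cmod (c - c0) ^ m)"
    then obtain C where "\<forall>\<^sub>F c in at c0. norm (L2norm (h c)) \<le> C * norm (cmod (c - c0) ^ m)" by (rule landau_o.bigE)
    then show "\<exists>C. \<forall>\<^sub>F c in at c0. L2norm (h c) \<le> C * norm (c - c0) ^ m"
      by (intro exI[of _ C]) (auto simp: L2norm_nonneg)
  next
    assume "\<exists>C. \<forall>\<^sub>F c in at c0. L2norm (h c) \<le> C * norm (c - c0) ^ m"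
    then obtain C where "\<forall>\<^sub>F c in at c0. L2norm (h c) \<le> C * norm (c - c0) ^ m" by blast
    then show "(\<lambda>c. L2norm (h c)) \<in> O[at c0](\<lambda>c. cmod (c - c0) ^ m)"
      by (intro bigoI[of _ C]) (auto simp: L2norm_nonneg)
  qed
  then show ?thesis unfolding jordan_chains_def by (auto simp: eventually_conj_iff)
qed

lemma chains_linear:
  assumes F: "F \<in> hill_chains m" and G: "G \<in> hill_chains m"
  shows "(\<lambda>y. a * F y + b * G y) \<in> hill_chains m"
proof -
  obtain h C where zF: "\<And>j x. j \<ge> m \<Longrightarrow> F (j, x) = 0"
    and h: "\<forall>\<^sub>F c in at c0. (\<lambda>x. \<Sum>j<m. (c - c0) ^ j * F (j, x), h c) \<in> T c \<and> L2norm (h c) \<le> C * norm (c - c0) ^ m"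
    using F unfolding chains_iff by auto
  obtain k D where zG: "\<And>j x. j \<ge> m \<Longrightarrow> G (j, x) = 0"
    and k: "\<forall>\<^sub>F c in at c0. (\<lambda>x. \<Sum>j<m. (c - c0) ^ j * G (j, x), k c) \<in> T c \<and> L2norm (k c) \<le> D * norm (c - c0) ^ m"
    using G unfolding chains_iff by auto
  have "\<forall>\<^sub>F c in at c0. (\<lambda>x. \<Sum>j<m. (c - c0) ^ j * (a * F (j, x) + b * G (j, x)), \<lambda>x. a * h c x + b * k c x) \<in> T c \<and>
      L2norm (\<lambda>x. a * h c x + b * k c x) \<le> (2 * (norm a * C + norm b * D)) * norm (c - c0) ^ m"
    using h k eventually_good
  proof eventually_elim
    case (elim c)
    have L2: "h c \<in> L2" "k c \<in> L2" using elim unfolding floquet_graph_iff[OF elim(3)] by auto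
    have "(\<lambda>x. a * (\<Sum>j<m. (c - c0) ^ j * F (j, x)) + b * (\<Sum>j<m. (c - c0) ^ j * G (j, x)), \<lambda>x. a * h c x + b * k c x) \<in> T c"
      by (rule floquet_graph_linear[OF elim(3)]) (use elim in auto)
    moreover have "a * (\<Sum>j<m. (c - c0) ^ j * F (j, x)) + b * (\<Sum>j<m. (c - c0) ^ j * G (j, x)) =
        (\<Sum>j<m. (c - c0) ^ j * (a * F (j, x) + b * G (j, x)))" for x
      by (simp add: sum_distrib_left sum.distrib algebra_simps)
    moreover have "L2norm (\<lambda>x. a * h c x + b * k c x) \<le> (2 * (norm a * C + norm b * D)) * norm (c - c0) ^ m"
    proof -
      have "L2norm (\<lambda>x. a * h c x + b * k c x) \<le> 2 * (norm a * L2norm (h c) + norm b * L2norm (k c))"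
        by (rule L2norm_linear_le[OF L2])
      also have "\<dots> \<le> 2 * (norm a * (C * norm (c - c0) ^ m) + norm b * (D * norm (c - c0) ^ m))"
        using elim by (intro mult_left_mono add_mono) auto
      finally show ?thesis by (simp add: algebra_simps)
    qed
    ultimately show ?case by simp
  qed
  then show ?thesis unfolding chains_iff using zF zG
    by (intro conjI exI[of _ "\<lambda>c x. a * h c x + b * k c x"] exI[of _ "2 * (norm a * C + norm b * D)"]) auto
qed

lemma zero_chain: "(\<lambda>_. 0) \<in> hill_chains m"
proof -
  have "((\<lambda>x. 0), (\<lambda>x. 0)) \<in> T c" if c: "c \<notin> real_cut" for c
  proof -
    have "solves (hill_coeff \<mu> c) (\<lambda>_. 0) (\<lambda>_. 0) (\<lambda>_. 0)"
      by (rule solvesI[OF continuous_on_hill_coeff[OF c]]) (auto intro!: derivative_eq_intros)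
    then show ?thesis unfolding floquet_graph_iff[OF c] by (auto intro!: L2_continuous)
  qed
  then have "\<forall>\<^sub>F c in at c0. (\<lambda>x. \<Sum>j<m. (c - c0) ^ j * 0, \<lambda>x. 0) \<in> T c \<and> L2norm (\<lambda>x. 0) \<le> 0 * norm (c - c0) ^ m"
    by (intro eventually_mono[OF eventually_good]) (simp add: L2norm_def set_lebesgue_integral_def)
  then show ?thesis unfolding chains_iff by (intro conjI exI[of _ "\<lambda>c x. 0"] exI[of _ 0]) auto
qed

lemma chains_sum:
  assumes "finite B" "B \<subseteq> hill_chains m"
  shows "(\<lambda>y. \<Sum>b\<in>B. u b * b y) \<in> hill_chains m"
  using assms
proof (induction B rule: finite_induct)
  case (insert b B)
  then show ?case using chains_linear[of b m "\<lambda>y. \<Sum>b\<in>B. u b * b y" "u b" 1] by simp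
qed (simp add: zero_chain)

text \<open>A chain is given by the values of its root function; the terms inherit the boundary conditions by
  \<open>polynomial_coefficients_in_subspace\<close>.\<close>

lemma chain_terms:
  assumes F: "F \<in> hill_chains m"
  shows "bc_space z (\<lambda>x. F (j, x))"
proof (cases "j < m")
  case True
  obtain h where h: "\<forall>\<^sub>F c in at c0. (\<lambda>x. \<Sum>j<m. (c - c0) ^ j * F (j, x), h c) \<in> T c"
    using F unfolding jordan_chains_def by auto
  have "\<forall>\<^sub>F c in at c0. bc_space z (\<lambda>x. \<Sum>j<m. (c - c0) ^ j * F (j, x))"
    using h eventually_good
  proof eventually_elim
    case (elim c)
    then obtain f' where "\<And>x. x \<notin> period \<Longrightarrow> (\<Sum>j<m. (c - c0) ^ j * F (j, x)) = 0"
      and s: "solves (hill_coeff \<mu> c) (h c) (\<lambda>x. \<Sum>j<m. (c - c0) ^ j * F (j, x)) f'"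
      and "(\<Sum>j<m. (c - c0) ^ j * F (j, 2*pi)) = z * (\<Sum>j<m. (c - c0) ^ j * F (j, 0))" "f' (2*pi) = z * f' 0"
      unfolding floquet_graph_iff[OF elim(2)] by blast
    then show ?case unfolding bc_space_def using solvesD(1)[OF s] by blast
  qed
  then obtain r where r: "r > 0" "\<And>c. c \<noteq> c0 \<Longrightarrow> dist c c0 < r \<Longrightarrow> bc_space z (\<lambda>x. \<Sum>j<m. (c - c0) ^ j * F (j, x))"
    unfolding eventually_at by auto
  show ?thesis
  proof (rule polynomial_coefficients_in_subspace[where P = "bc_space z" and F = "\<lambda>j x. F (j, x)", OF bc_space_linear r(1) _ True])
    fix t :: complex assume "t \<noteq> 0" "norm t < r"
    then show "bc_space z (\<lambda>x. \<Sum>j<m. t ^ j * F (j, x))" using r(2)[of "c0 + t"] by (simp add: dist_norm)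
  qed
next
  case False
  then have "F (j, x) = 0" for x using F unfolding jordan_chains_def by auto
  then show ?thesis unfolding bc_space_def by (auto intro!: exI[of _ "\<lambda>_. 0"] has_vector_derivative_const)
qed

lemma chain_derivative:
  assumes F: "F \<in> hill_chains m"
  obtains F' where "\<And>j x. x \<in> period \<Longrightarrow> ((\<lambda>x. F (j, x)) has_vector_derivative F' j x) (at x within period)"
    "\<And>j. F' j (2*pi) = z * F' j 0"
  using chain_terms[OF F] unfolding bc_space_def by metis

text \<open>The form in which a chain enters the estimates for solutions: the \<open>L\<^sup>2\<close> bound on the defect becomes
  an \<open>L\<^sup>1\<close> bound, and the coefficient of the equation is bounded uniformly near \<open>c0\<close>.\<close>

lemma chain_estimate:
  assumes F: "F \<in> hill_chains m"
    and F': "\<And>j x. x \<in> period \<Longrightarrow> ((\<lambda>x. F (j, x)) has_vector_derivative F' j x) (at x within period)"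
  obtains h C K where "\<forall>\<^sub>F c in at c0. c \<notin> real_cut \<and> h c \<in> L2 \<and>
      solves (hill_coeff \<mu> c) (h c) (\<lambda>x. \<Sum>j<m. (c - c0) ^ j * F (j, x)) (\<lambda>x. \<Sum>j<m. (c - c0) ^ j * F' j x) \<and>
      (\<forall>x. norm (hill_coeff \<mu> c x) \<le> K) \<and> (LBINT t:period. norm (h c t)) * exp (K * (2 * pi)) \<le> C * norm (c - c0) ^ m"
    "1 \<le> K"
proof -
  obtain h C where h: "\<forall>\<^sub>F c in at c0. (\<lambda>x. \<Sum>j<m. (c - c0) ^ j * F (j, x), h c) \<in> T c \<and> L2norm (h c) \<le> C * norm (c - c0) ^ m"
    using F unfolding chains_iff by auto
  obtain r where r: "r > 0" "ball c0 r \<subseteq> - real_cut" "\<And>c x. c \<in> ball c0 r \<Longrightarrow> norm (c + of_real (sin x)) \<ge> r"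
    using potential_denominator_bounded_below[OF c0] by blast
  define K where "K = norm \<mu> + 1 / r + 1"
  have evr: "\<forall>\<^sub>F c in at c0. c \<in> ball c0 r"
    unfolding eventually_at using r(1) by (intro exI[of _ r]) (auto simp: dist_commute)
  show ?thesis
  proof (rule that[of h K "sqrt (2 * pi) * C * exp (K * (2 * pi))"])
    show "1 \<le> K" using r(1) by (simp add: K_def)
    show "\<forall>\<^sub>F c in at c0. c \<notin> real_cut \<and> h c \<in> L2 \<and>
      solves (hill_coeff \<mu> c) (h c) (\<lambda>x. \<Sum>j<m. (c - c0) ^ j * F (j, x)) (\<lambda>x. \<Sum>j<m. (c - c0) ^ j * F' j x) \<and>
      (\<forall>x. norm (hill_coeff \<mu> c x) \<le> K) \<and>
      (LBINT t:period. norm (h c t)) * exp (K * (2 * pi)) \<le> (sqrt (2 * pi) * C * exp (K * (2 * pi))) * norm (c - c0) ^ m"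
      using h eventually_good evr
    proof eventually_elim
      case (elim c)
      obtain f' where L2: "h c \<in> L2" and s: "solves (hill_coeff \<mu> c) (h c) (\<lambda>x. \<Sum>j<m. (c - c0) ^ j * F (j, x)) f'"
        using elim(1) unfolding floquet_graph_iff[OF elim(2)] by blast
      have "f' x = (\<Sum>j<m. (c - c0) ^ j * F' j x)" if x: "x \<in> period" for x
      proof -
        have "((\<lambda>x. \<Sum>j<m. (c - c0) ^ j * F (j, x)) has_vector_derivative (\<Sum>j<m. (c - c0) ^ j * F' j x)) (at x within period)"
          by (intro has_vector_derivative_sum has_vector_derivative_mult_right F' x)
        from period_derivative[OF this x] period_derivative[OF solvesD(1)[OF s x] x] show ?thesis by simp
      qed
      then have "solves (hill_coeff \<mu> c) (h c) (\<lambda>x. \<Sum>j<m. (c - c0) ^ j * F (j, x)) (\<lambda>x. \<Sum>j<m. (c - c0) ^ j * F' j x)"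
        by (intro solves_cong[OF s]) auto
      moreover have "norm (hill_coeff \<mu> c x) \<le> K" for x
        unfolding K_def by (rule norm_hill_coeff_le[OF r(1) r(3)[OF elim(3)]])
      moreover have "(LBINT t:period. norm (h c t)) * exp (K * (2 * pi)) \<le> (sqrt (2 * pi) * C * exp (K * (2 * pi))) * norm (c - c0) ^ m"
      proof -
        have "(LBINT t:period. norm (h c t)) \<le> sqrt (2 * pi) * L2norm (h c)" by (rule L1_le_L2norm[OF L2])
        also have "\<dots> \<le> sqrt (2 * pi) * (C * norm (c - c0) ^ m)" using elim(1) by (intro mult_left_mono) auto
        finally have "(LBINT t:period. norm (h c t)) * exp (K * (2 * pi)) \<le> (sqrt (2 * pi) * (C * norm (c - c0) ^ m)) * exp (K * (2 * pi))"
          by (intro mult_right_mono) auto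
        then show ?thesis by (simp add: mult_ac)
      qed
      ultimately show ?case using elim(2) L2 by blast
    qed
  qed
qed

lemma vanishes_at_c0_iff:
  "vanishes_to_order m (\<lambda>t. f (c0 + t)) \<longleftrightarrow> (\<exists>C. \<forall>\<^sub>F c in at c0. norm (f c) \<le> C * norm (c - c0) ^ m)"
proof -
  have "(\<forall>\<^sub>F c in at c0. norm (f c) \<le> C * norm (c - c0) ^ m) \<longleftrightarrow> (\<forall>\<^sub>F t in at 0. norm (f (c0 + t)) \<le> C * norm t ^ m)" for C
    using at_to_0[of c0] by (simp add: eventually_filtermap add.commute)
  then show ?thesis unfolding vanishes_to_order_def by simp
qed

lemma boundary_row_expansion:
  assumes v: "\<And>r j. j \<ge> m \<Longrightarrow> v (r, j) = 0"
  shows "(\<lambda>t. boundary_entry s True (c0 + t) * (\<Sum>j<m. t ^ j * v (True, j)) + boundary_entry s False (c0 + t) * (\<Sum>j<m. t ^ j * v (False, j)))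
    has_fps_expansion (boundary_fps s True * vec_fps v True + boundary_fps s False * vec_fps v False)"
proof -
  have "vec_fps v r = Abs_fps (\<lambda>j. if j < m then v (r, j) else 0)" for r
    unfolding vec_fps_def using v by (intro fps_ext) auto
  then have "(\<lambda>t. \<Sum>j<m. t ^ j * v (r, j)) has_fps_expansion vec_fps v r" for r
    by (simp add: has_fps_expansion_polynomial)
  then show ?thesis by (intro has_fps_expansion_add has_fps_expansion_mult boundary_fps)
qed

lemma truncated_kernel_iff:
  "v \<in> truncated_kernel boundary_fps m \<longleftrightarrow> (\<forall>r. \<forall>j\<ge>m. v (r, j) = 0) \<and>
    (\<forall>s. vanishes_to_order m (\<lambda>t. boundary_entry s True (c0 + t) * (\<Sum>j<m. t ^ j * v (True, j)) +
        boundary_entry s False (c0 + t) * (\<Sum>j<m. t ^ j * v (False, j))))"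
proof (cases "\<forall>r. \<forall>j\<ge>m. v (r, j) = 0")
  case True
  then have "vanishes_to_order m (\<lambda>t. boundary_entry s True (c0 + t) * (\<Sum>j<m. t ^ j * v (True, j)) +
        boundary_entry s False (c0 + t) * (\<Sum>j<m. t ^ j * v (False, j))) \<longleftrightarrow>
      fps_X ^ m dvd boundary_fps s True * vec_fps v True + boundary_fps s False * vec_fps v False" for s
    by (intro vanishes_to_order_iff_dvd boundary_row_expansion) auto
  then show ?thesis using True unfolding truncated_kernel_def by simp
qed (auto simp: truncated_kernel_def)

text \<open>The root function satisfies the boundary conditions exactly and the equation up to
  \<open>O((c - c0)\<^sup>m)\<close>, so its initial data \<open>v(c)\<close> satisfy \<open>z v(c) = M(c) v(c) + O((c - c0)\<^sup>m)\<close>.\<close>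

lemma initial_in_kernel:
  assumes F: "F \<in> hill_chains m"
  shows "(\<lambda>(r, j). if j < m then initial (r, j) F else 0) \<in> truncated_kernel boundary_fps m"
proof -
  let ?v = "\<lambda>(r, j). if j < m then initial (r, j) F else 0"
  obtain F' where F': "\<And>j x. x \<in> period \<Longrightarrow> ((\<lambda>x. F (j, x)) has_vector_derivative F' j x) (at x within period)"
    "\<And>j. F' j (2*pi) = z * F' j 0" by (rule chain_derivative[OF F]) (rule that)
  have F2pi: "F (j, 2*pi) = z * F (j, 0)" for j using chain_terms[OF F] unfolding bc_space_def by blast
  have v: "?v (True, j) = F (j, 0)" "?v (False, j) = F' j 0" if "j < m" for j
    using that period_derivative[OF F'(1), of 0 j] by (simp_all add: initial_def)
  obtain h C K where ev: "\<forall>\<^sub>F c in at c0. c \<notin> real_cut \<and> h c \<in> L2 \<and>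
      solves (hill_coeff \<mu> c) (h c) (\<lambda>x. \<Sum>j<m. (c - c0) ^ j * F (j, x)) (\<lambda>x. \<Sum>j<m. (c - c0) ^ j * F' j x) \<and>
      (\<forall>x. norm (hill_coeff \<mu> c x) \<le> K) \<and> (LBINT t:period. norm (h c t)) * exp (K * (2 * pi)) \<le> C * norm (c - c0) ^ m"
    and K: "1 \<le> K" by (rule chain_estimate[OF F F'(1)])
  have rows: "\<forall>\<^sub>F c in at c0. norm (boundary_entry s True c * (\<Sum>j<m. (c - c0) ^ j * F (j, 0)) +
      boundary_entry s False c * (\<Sum>j<m. (c - c0) ^ j * F' j 0)) \<le> C * norm (c - c0) ^ m" for s
    using ev
  proof eventually_elim
    case (elim c)
    let ?f = "\<lambda>x. \<Sum>j<m. (c - c0) ^ j * F (j, x)" and ?f' = "\<lambda>x. \<Sum>j<m. (c - c0) ^ j * F' j x"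
    have cc: "c \<notin> real_cut" and hL: "h c \<in> L2" and s: "solves (hill_coeff \<mu> c) (h c) ?f ?f'"
      and Kb: "\<And>x. norm (hill_coeff \<mu> c x) \<le> K"
      and le: "(LBINT t:period. norm (h c t)) * exp (K * (2 * pi)) \<le> C * norm (c - c0) ^ m" using elim by auto
    have e1: "?f (2*pi) = z * ?f 0" unfolding sum_distrib_left by (intro sum.cong) (auto simp: F2pi)
    have e2: "?f' (2*pi) = z * ?f' 0" unfolding sum_distrib_left by (intro sum.cong) (auto simp: F'(2))
    have "norm (z * ?f 0 - fst (endpoint (hill_coeff \<mu> c) (?f 0) (?f' 0))) + norm (z * ?f' 0 - snd (endpoint (hill_coeff \<mu> c) (?f 0) (?f' 0)))
        \<le> C * norm (c - c0) ^ m"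
      using order_trans[OF endpoint_estimate[OF continuous_on_hill_coeff[OF cc] s L2_set_integrable[OF hL] Kb K] le]
      unfolding e1 e2 .
    then have "norm (boundary_entry True True c * ?f 0 + boundary_entry True False c * ?f' 0) +
        norm (boundary_entry False True c * ?f 0 + boundary_entry False False c * ?f' 0) \<le> C * norm (c - c0) ^ m"
      unfolding boundary_entry_eq[OF cc] .
    then show ?case by (cases s) (auto intro: order_trans[rotated])
  qed
  have sums: "(\<Sum>j<m. t ^ j * ?v (True, j)) = (\<Sum>j<m. t ^ j * F (j, 0))" "(\<Sum>j<m. t ^ j * ?v (False, j)) = (\<Sum>j<m. t ^ j * F' j 0)" for t
    by (intro sum.cong refl; simp only: v lessThan_iff)+
  have "vanishes_to_order m (\<lambda>t. boundary_entry s True (c0 + t) * (\<Sum>j<m. t ^ j * F (j, 0)) +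
        boundary_entry s False (c0 + t) * (\<Sum>j<m. t ^ j * F' j 0))" for s
    using rows[of s] vanishes_at_c0_iff[of m "\<lambda>c. boundary_entry s True c * (\<Sum>j<m. (c - c0) ^ j * F (j, 0)) +
      boundary_entry s False c * (\<Sum>j<m. (c - c0) ^ j * F' j 0)"] by auto
  then show ?thesis unfolding truncated_kernel_iff sums by simp
qed

text \<open>With zero initial data the root function is \<open>O((c - c0)\<^sup>m)\<close> at every point \<open>x\<close>, and it is a
  polynomial of degree below \<open>m\<close> in \<open>c - c0\<close>.\<close>

lemma chain_determined_by_initial:
  assumes F: "F \<in> hill_chains m" and 0: "\<And>r j. j < m \<Longrightarrow> initial (r, j) F = 0"
  shows "F = (\<lambda>_. 0)"
proof -
  obtain F' where F': "\<And>j x. x \<in> period \<Longrightarrow> ((\<lambda>x. F (j, x)) has_vector_derivative F' j x) (at x within period)"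
    by (rule chain_derivative[OF F]) (rule that)
  have init: "F (j, 0) = 0" "F' j 0 = 0" if "j < m" for j
    using 0[OF that, of True] 0[OF that, of False] period_derivative[OF F', of 0 j] by (simp_all add: initial_def)
  obtain h C K where ev: "\<forall>\<^sub>F c in at c0. c \<notin> real_cut \<and> h c \<in> L2 \<and>
      solves (hill_coeff \<mu> c) (h c) (\<lambda>x. \<Sum>j<m. (c - c0) ^ j * F (j, x)) (\<lambda>x. \<Sum>j<m. (c - c0) ^ j * F' j x) \<and>
      (\<forall>x. norm (hill_coeff \<mu> c x) \<le> K) \<and> (LBINT t:period. norm (h c t)) * exp (K * (2 * pi)) \<le> C * norm (c - c0) ^ m"
    and K: "1 \<le> K" by (rule chain_estimate[OF F F'])
  have inside: "F (j, x) = 0" if x: "x \<in> period" and j: "j < m" for j x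
  proof -
    have "\<forall>\<^sub>F c in at c0. norm (\<Sum>j<m. (c - c0) ^ j * F (j, x)) \<le> C * norm (c - c0) ^ m"
      using ev
    proof eventually_elim
      case (elim c)
      let ?f = "\<lambda>x. \<Sum>j<m. (c - c0) ^ j * F (j, x)" and ?f' = "\<lambda>x. \<Sum>j<m. (c - c0) ^ j * F' j x"
      have cc: "c \<notin> real_cut" and hL: "h c \<in> L2" and s: "solves (hill_coeff \<mu> c) (h c) ?f ?f'"
        and Kb: "\<And>x. norm (hill_coeff \<mu> c x) \<le> K"
        and le: "(LBINT t:period. norm (h c t)) * exp (K * (2 * pi)) \<le> C * norm (c - c0) ^ m" using elim by auto
      have z0: "?f 0 = 0" "?f' 0 = 0" by (intro sum.neutral ballI; simp add: init)+
      have "norm (?f x) + norm (?f' x) \<le> C * norm (c - c0) ^ m"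
        using order_trans[OF solves_estimate[OF continuous_on_hill_coeff[OF cc] s L2_set_integrable[OF hL] Kb K x]] le
        unfolding z0 by simp
      then show ?case using norm_ge_zero[of "?f' x"] by linarith
    qed
    then have "vanishes_to_order m (\<lambda>t. \<Sum>j<m. t ^ j * F (j, x))"
      using vanishes_at_c0_iff[of m "\<lambda>c. \<Sum>j<m. (c - c0) ^ j * F (j, x)"] by auto
    then show ?thesis using j by (rule polynomial_vanishing_coefficients)
  qed
  have "F (j, x) = 0" for j x
  proof (cases "j < m \<and> x \<in> period")
    case False
    then show ?thesis using F chain_terms[OF F, of j] unfolding jordan_chains_def bc_space_def by auto
  qed (use inside in auto)
  then show ?thesis by auto
qed

text \<open>The formal solution with initial data \<open>v\<close> satisfies the equation to order \<open>m\<close>. It also satisfies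
  the boundary conditions exactly: their defect is \<open>O((c - c0)\<^sup>m)\<close> since
  \<open>(z - M(c)) v(c)\<close> is, but it is a polynomial of degree below \<open>m\<close>.\<close>

lemma chain_with_initial_exists:
  assumes v: "v \<in> truncated_kernel boundary_fps m" and m: "m > 0"
  shows "\<exists>F\<in>hill_chains m. \<forall>r. \<forall>j<m. initial (r, j) F = v (r, j)"
proof -
  obtain F F' G :: "nat \<Rightarrow> real \<Rightarrow> complex" where init: "\<And>j. F j 0 = v (True, j)" "\<And>j. F' j 0 = v (False, j)"
    and G: "\<And>j. continuous_on period (G j)"
    and F: "\<And>j x. x \<in> period \<Longrightarrow> (F j has_vector_derivative F' j x) (at x within period)"
      "\<And>j x. x \<in> period \<Longrightarrow> (F' j has_vector_derivative \<mu> * F j x + G j x) (at x within period)"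
      "\<And>j x. x \<in> period \<Longrightarrow> (c0 + of_real (sin x)) * G j x + of_real (sin x) * F j x +
         (if j = 0 then 0 else G (j - 1) x) = 0"
    by (rule formal_solution_exists[OF c0, of "\<lambda>j. v (True, j)" "\<lambda>j. v (False, j)" \<mu>], rule that)
  obtain C r where r: "r > 0" "ball c0 r \<subseteq> - real_cut"
    and hC: "\<And>c x. c \<in> ball c0 r \<Longrightarrow> x \<in> period \<Longrightarrow>
      norm ((c - c0) ^ m * G (m - 1) x / (c + of_real (sin x))) \<le> C * norm (c - c0) ^ m"
    and est: "\<And>c. c \<in> ball c0 r \<Longrightarrow>
      norm ((\<Sum>j<m. (c - c0) ^ j * F j (2*pi)) -
        fst (endpoint (hill_coeff \<mu> c) (\<Sum>j<m. (c - c0) ^ j * F j 0) (\<Sum>j<m. (c - c0) ^ j * F' j 0))) +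
      norm ((\<Sum>j<m. (c - c0) ^ j * F' j (2*pi)) -
        snd (endpoint (hill_coeff \<mu> c) (\<Sum>j<m. (c - c0) ^ j * F j 0) (\<Sum>j<m. (c - c0) ^ j * F' j 0)))
      \<le> C * norm (c - c0) ^ m"
    using formal_solution_endpoint_estimate[OF c0 G F m] by blast
  have evr: "\<forall>\<^sub>F c in at c0. c \<in> ball c0 r"
    unfolding eventually_at using r(1) by (intro exI[of _ r]) (auto simp: dist_commute)
  have rows: "\<exists>D. \<forall>\<^sub>F c in at c0. norm (boundary_entry s True c * (\<Sum>j<m. (c - c0) ^ j * v (True, j)) +
      boundary_entry s False c * (\<Sum>j<m. (c - c0) ^ j * v (False, j))) \<le> D * norm (c - c0) ^ m" for s
    using v vanishes_at_c0_iff[of m "\<lambda>c. boundary_entry s True c * (\<Sum>j<m. (c - c0) ^ j * v (True, j)) +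
      boundary_entry s False c * (\<Sum>j<m. (c - c0) ^ j * v (False, j))"] unfolding truncated_kernel_iff by auto
  have bc: "z * v (True, j) = F j (2*pi)" "z * v (False, j) = F' j (2*pi)" if j: "j < m" for j
  proof -
    obtain D1 where D1: "\<forall>\<^sub>F c in at c0. norm (boundary_entry True True c * (\<Sum>j<m. (c - c0) ^ j * v (True, j)) +
      boundary_entry True False c * (\<Sum>j<m. (c - c0) ^ j * v (False, j))) \<le> D1 * norm (c - c0) ^ m" using rows[of True] by blast
    obtain D2 where D2: "\<forall>\<^sub>F c in at c0. norm (boundary_entry False True c * (\<Sum>j<m. (c - c0) ^ j * v (True, j)) +
      boundary_entry False False c * (\<Sum>j<m. (c - c0) ^ j * v (False, j))) \<le> D2 * norm (c - c0) ^ m" using rows[of False] by blast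
    have "\<forall>\<^sub>F c in at c0. norm (\<Sum>j<m. (c - c0) ^ j * (z * v (True, j) - F j (2*pi))) \<le> (D1 + C) * norm (c - c0) ^ m \<and>
        norm (\<Sum>j<m. (c - c0) ^ j * (z * v (False, j) - F' j (2*pi))) \<le> (D2 + C) * norm (c - c0) ^ m"
      using D1 D2 evr
    proof eventually_elim
      case (elim c)
      have cc: "c \<notin> real_cut" using elim(3) r(2) by auto
      let ?v = "\<Sum>j<m. (c - c0) ^ j * v (True, j)" and ?v' = "\<Sum>j<m. (c - c0) ^ j * v (False, j)"
      let ?M = "endpoint (hill_coeff \<mu> c) ?v ?v'"
      have 1: "norm (z * ?v - fst ?M) \<le> D1 * norm (c - c0) ^ m" "norm (z * ?v' - snd ?M) \<le> D2 * norm (c - c0) ^ m"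
        using elim(1,2) unfolding boundary_entry_eq[OF cc] by auto
      have 2: "norm ((\<Sum>j<m. (c - c0) ^ j * F j (2*pi)) - fst ?M) + norm ((\<Sum>j<m. (c - c0) ^ j * F' j (2*pi)) - snd ?M)
          \<le> C * norm (c - c0) ^ m"
        using est[OF elim(3)] unfolding init .
      have "(\<Sum>j<m. (c - c0) ^ j * (z * v (True, j) - F j (2*pi))) = (z * ?v - fst ?M) - ((\<Sum>j<m. (c - c0) ^ j * F j (2*pi)) - fst ?M)"
        "(\<Sum>j<m. (c - c0) ^ j * (z * v (False, j) - F' j (2*pi))) = (z * ?v' - snd ?M) - ((\<Sum>j<m. (c - c0) ^ j * F' j (2*pi)) - snd ?M)"
        by (simp_all add: sum_distrib_left sum_subtractf algebra_simps)
      then have "norm (\<Sum>j<m. (c - c0) ^ j * (z * v (True, j) - F j (2*pi))) \<le>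
          norm (z * ?v - fst ?M) + norm ((\<Sum>j<m. (c - c0) ^ j * F j (2*pi)) - fst ?M)"
        "norm (\<Sum>j<m. (c - c0) ^ j * (z * v (False, j) - F' j (2*pi))) \<le>
          norm (z * ?v' - snd ?M) + norm ((\<Sum>j<m. (c - c0) ^ j * F' j (2*pi)) - snd ?M)"
        by (simp_all only: norm_triangle_ineq4)
      then show ?case using 1 2 norm_ge_zero[of "(\<Sum>j<m. (c - c0) ^ j * F j (2*pi)) - fst ?M"]
          norm_ge_zero[of "(\<Sum>j<m. (c - c0) ^ j * F' j (2*pi)) - snd ?M"]
        unfolding distrib_right by linarith
    qed
    then have "\<exists>D. \<forall>\<^sub>F c in at c0. norm (\<Sum>j<m. (c - c0) ^ j * (z * v (True, j) - F j (2*pi))) \<le> D * norm (c - c0) ^ m"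
      "\<exists>D. \<forall>\<^sub>F c in at c0. norm (\<Sum>j<m. (c - c0) ^ j * (z * v (False, j) - F' j (2*pi))) \<le> D * norm (c - c0) ^ m"
      unfolding eventually_conj_iff by blast+
    then have "vanishes_to_order m (\<lambda>t. \<Sum>j<m. t ^ j * (z * v (True, j) - F j (2*pi)))"
      "vanishes_to_order m (\<lambda>t. \<Sum>j<m. t ^ j * (z * v (False, j) - F' j (2*pi)))"
      using vanishes_at_c0_iff[of m "\<lambda>c. \<Sum>j<m. (c - c0) ^ j * (z * v (True, j) - F j (2*pi))"]
        vanishes_at_c0_iff[of m "\<lambda>c. \<Sum>j<m. (c - c0) ^ j * (z * v (False, j) - F' j (2*pi))"] by auto
    from polynomial_vanishing_coefficients[OF this(1) j] polynomial_vanishing_coefficients[OF this(2) j]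
    show "z * v (True, j) = F j (2*pi)" "z * v (False, j) = F' j (2*pi)" by simp_all
  qed
  \<comment> \<open>elements of the operator domain vanish outside the period, and chains beyond their length\<close>
  define F1 where "F1 = (\<lambda>(j, x). if j < m \<and> x \<in> period then F j x else 0)"
  define h where "h = (\<lambda>c x. (c - c0) ^ m * G (m - 1) x / (c + of_real (sin x)))"
  have "\<forall>\<^sub>F c in at c0. (\<lambda>x. \<Sum>j<m. (c - c0) ^ j * F1 (j, x), h c) \<in> T c \<and>
      L2norm (h c) \<le> (sqrt (2 * pi) * C) * norm (c - c0) ^ m"
    using evr
  proof eventually_elim
    case (elim c)
    have cc: "c \<notin> real_cut" using elim r(2) by auto
    have hL2: "h c \<in> L2"
      unfolding h_def by (intro L2_continuous continuous_intros G) (auto simp: potential_denominator_nonzero cc)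
    have "solves (hill_coeff \<mu> c) (h c) (\<lambda>x. \<Sum>j<m. (c - c0) ^ j * F j x) (\<lambda>x. \<Sum>j<m. (c - c0) ^ j * F' j x)"
      unfolding h_def by (rule formal_solution_solves[OF cc G F m])
    then have "solves (hill_coeff \<mu> c) (h c) (\<lambda>x. \<Sum>j<m. (c - c0) ^ j * F1 (j, x)) (\<lambda>x. \<Sum>j<m. (c - c0) ^ j * F' j x)"
      by (rule solves_cong) (auto simp: F1_def)
    moreover have "(\<Sum>j<m. (c - c0) ^ j * F1 (j, 2*pi)) = z * (\<Sum>j<m. (c - c0) ^ j * F1 (j, 0))"
      unfolding sum_distrib_left by (intro sum.cong) (auto simp: F1_def bc[symmetric] init)
    moreover have "(\<Sum>j<m. (c - c0) ^ j * F' j (2*pi)) = z * (\<Sum>j<m. (c - c0) ^ j * F' j 0)"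
      unfolding sum_distrib_left by (intro sum.cong) (auto simp: bc[symmetric] init)
    moreover have "(\<Sum>j<m. (c - c0) ^ j * F1 (j, x)) = 0" if "x \<notin> period" for x
      using that by (auto simp: F1_def)
    ultimately have "(\<lambda>x. \<Sum>j<m. (c - c0) ^ j * F1 (j, x), h c) \<in> T c"
      unfolding floquet_graph_iff[OF cc] using hL2 by blast
    moreover have "L2norm (h c) \<le> sqrt (2 * pi) * (C * norm (c - c0) ^ m)"
      by (rule L2norm_le_sup[OF hL2]) (simp only: h_def hC[OF elim])
    ultimately show ?case by (simp add: mult_ac)
  qed
  then have "F1 \<in> hill_chains m"
    unfolding chains_iff by (intro conjI exI[of _ h] exI[of _ "sqrt (2 * pi) * C"]) (auto simp: F1_def)
  moreover have "initial (r, j) F1 = v (r, j)" if j: "j < m" for r j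
  proof (cases r)
    case False
    have "((\<lambda>x. F1 (j, x)) has_vector_derivative F' j 0) (at 0 within period)"
      using has_vector_derivative_transform[of 0 period "\<lambda>x. F1 (j, x)" "F j"] F(1)[of 0 j] j by (simp add: F1_def)
    from period_derivative[OF this] show ?thesis using False by (simp add: initial_def init)
  qed (use j in \<open>simp add: initial_def F1_def init\<close>)
  ultimately show ?thesis by blast
qed

lemma initial_sum:
  assumes B: "finite B" "B \<subseteq> hill_chains m"
  shows "initial k (\<lambda>y. \<Sum>b\<in>B. u b * b y) = (\<Sum>b\<in>B. u b * initial k b)"
proof (cases k)
  case (Pair r j)
  show ?thesis
  proof (cases r)
    case False
    have d: "((\<lambda>x. b (j, x)) has_vector_derivative initial k b) (at 0 within period)" if "b \<in> B" for b
    proof -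
      have "b \<in> hill_chains m" using that B by blast
      then obtain F' where F': "\<And>j x. x \<in> period \<Longrightarrow> ((\<lambda>x. b (j, x)) has_vector_derivative F' j x) (at x within period)"
        by (rule chain_derivative) (rule that)
      have "((\<lambda>x. b (j, x)) has_vector_derivative F' j 0) (at 0 within period)" by (rule F') simp
      moreover from period_derivative[OF this] have "initial k b = F' j 0" using Pair False by (simp add: initial_def)
      ultimately show ?thesis by simp
    qed
    have "((\<lambda>x. \<Sum>b\<in>B. u b * b (j, x)) has_vector_derivative (\<Sum>b\<in>B. u b * initial k b)) (at 0 within period)"
      by (intro has_vector_derivative_sum has_vector_derivative_mult_right d)
    from period_derivative[OF this] show ?thesis using Pair False by (simp add: initial_def)
  qed (use Pair in \<open>simp add: initial_def\<close>)
qed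

text \<open>Via the Cauchy data the chains are isomorphic to the truncated kernel, so its free positions give
  a dual basis for the chains.\<close>

lemma cdim_chains:
  assumes K: "K \<subseteq> UNIV \<times> {..<m}" "coordinates (truncated_kernel boundary_fps m) K"
  shows "cdim (hill_chains m) = enat (card K)"
proof (rule cdim_eq_card_dual_basis[where L = initial])
  show "finite K" using K(1) by (rule finite_subset) simp
  show "(\<lambda>x. \<Sum>b\<in>B. u b * b x) \<in> hill_chains m" if "finite B" "B \<subseteq> hill_chains m" for B u
    by (rule chains_sum[OF that])
  show "initial k (\<lambda>x. \<Sum>b\<in>B. u b * b x) = (\<Sum>b\<in>B. u b * initial k b)" if "finite B" "B \<subseteq> hill_chains m" for k B u
    by (rule initial_sum[OF that])
  show "F = (\<lambda>_. 0)" if F: "F \<in> hill_chains m" and 0: "\<And>k. k \<in> K \<Longrightarrow> initial k F = 0" for F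
  proof -
    let ?v = "\<lambda>(r, j). if j < m then initial (r, j) F else 0"
    have "\<forall>k\<in>K. ?v k = 0" using 0 by auto
    then have "?v = (\<lambda>_. 0)" using K(2) initial_in_kernel[OF F] unfolding coordinates_def by blast
    then have "?v (r, j) = 0" for r j by (rule fun_cong)
    then have "initial (r, j) F = 0" if "j < m" for r j using that by (metis (mono_tags, lifting) case_prod_conv)
    then show ?thesis by (rule chain_determined_by_initial[OF F])
  qed
  show "\<exists>F\<in>hill_chains m. \<forall>k'\<in>K. initial k' F = (if k' = k then 1 else 0)" if k: "k \<in> K" for k
  proof -
    obtain v where v: "v \<in> truncated_kernel boundary_fps m" "\<And>k'. k' \<in> K \<Longrightarrow> v k' = (if k' = k then 1 else 0)"
      using K(2) k unfolding coordinates_def by blast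
    have m: "m > 0" using k K(1) by auto
    obtain F where F: "F \<in> hill_chains m" "\<And>r j. j < m \<Longrightarrow> initial (r, j) F = v (r, j)"
      using chain_with_initial_exists[OF v(1) m] by blast
    show ?thesis
    proof (intro bexI[OF _ F(1)] ballI)
      fix k' assume k': "k' \<in> K"
      then obtain r j where "k' = (r, j)" "j < m" using K(1) by auto
      then show "initial k' F = (if k' = k then 1 else 0)" using F(2) v(2)[OF k'] by simp
    qed
  qed
qed

text \<open>\<open>\<Delta>\<close> is the Taylor series of \<open>det (z - M(c))\<close>, and from \<open>m = ord \<Delta>\<close> on the dimension of
  the space of chains is constant.\<close>

lemma family_alg_mult_eq_zorder:
  assumes nz: "\<exists>\<^sub>F c in at c0. z + 1 / z - monodromy_trace \<mu> c \<noteq> 0"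
  shows "family_alg_mult T c0 = enat (nat (zorder (\<lambda>c. z + 1 / z - monodromy_trace \<mu> c) c0))"
proof -
  let ?E = "\<lambda>c. z + 1 / z - monodromy_trace \<mu> c"
  let ?A = boundary_fps
  define \<Delta> where "\<Delta> = ?A True True * ?A False False - ?A True False * ?A False True"
  have exp_\<Delta>: "(\<lambda>t. boundary_entry True True (c0 + t) * boundary_entry False False (c0 + t) -
      boundary_entry True False (c0 + t) * boundary_entry False True (c0 + t)) has_fps_expansion \<Delta>"
    unfolding \<Delta>_def by (intro has_fps_expansion_diff has_fps_expansion_mult boundary_fps)
  have det: "boundary_entry True True c * boundary_entry False False c -
      boundary_entry True False c * boundary_entry False True c = z * ?E c" if "c \<notin> real_cut" for c
    using floquet_determinant[OF that z, of \<mu>] by (simp add: boundary_entry_def)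
  have ev: "\<forall>\<^sub>F t in nhds 0. c0 + t \<notin> real_cut"
  proof -
    have "\<forall>\<^sub>F c in nhds c0. c \<in> - real_cut" using open_Compl_real_cut c0 by (intro eventually_nhds_in_open) auto
    then show ?thesis using nhds_to_0[of c0] by (simp add: eventually_filtermap add.commute)
  qed
  have exp1: "(\<lambda>t. z * ?E (c0 + t)) has_fps_expansion \<Delta>"
  proof -
    have "\<forall>\<^sub>F t in nhds 0. boundary_entry True True (c0 + t) * boundary_entry False False (c0 + t) -
      boundary_entry True False (c0 + t) * boundary_entry False True (c0 + t) = z * ?E (c0 + t)"
      using ev by eventually_elim (rule det)
    from has_fps_expansion_cong[OF this refl, of \<Delta>] exp_\<Delta> show ?thesis by (simp only:)
  qed
  have "(\<lambda>t. (1 / z) * (z * ?E (c0 + t))) has_fps_expansion fps_const (1 / z) * \<Delta>"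
    by (rule has_fps_expansion_cmult_left[OF exp1])
  then have exp2: "(\<lambda>t. ?E (c0 + t)) has_fps_expansion fps_const (1 / z) * \<Delta>" using z by simp
  have \<Delta>0: "\<Delta> \<noteq> 0"
  proof
    assume "\<Delta> = 0"
    then have "(\<lambda>t. ?E (c0 + t)) has_fps_expansion 0" using exp2 by (simp only: mult_zero_right)
    then have "\<forall>\<^sub>F t in nhds 0. 0 = ?E (c0 + t)" by (simp only: has_fps_expansion_def eval_fps_0)
    then have "\<forall>\<^sub>F t in nhds 0. ?E (c0 + t) = 0" by eventually_elim (rule sym)
    then have "\<forall>\<^sub>F c in nhds c0. ?E c = 0" using nhds_to_0[of c0] by (simp add: eventually_filtermap add.commute)
    then have "\<forall>\<^sub>F c in at c0. \<not> ?E c \<noteq> 0" by (auto simp: eventually_at_filter elim: eventually_mono)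
    then show False using nz by (simp add: frequently_def)
  qed
  have sub: "subdegree (fps_const (1 / z) * \<Delta>) = subdegree \<Delta>" using z \<Delta>0 by simp
  have zord: "zorder ?E c0 = int (subdegree \<Delta>)"
    using has_fps_expansion_zorder[OF exp2] \<Delta>0 z sub by simp
  have le: "cdim (hill_chains m) \<le> enat (subdegree \<Delta>)" and eq: "subdegree \<Delta> \<le> m \<Longrightarrow> cdim (hill_chains m) = enat (subdegree \<Delta>)" for m
  proof -
    obtain K where K: "K \<subseteq> UNIV \<times> {..<m}" "coordinates (truncated_kernel ?A m) K" "card K \<le> subdegree \<Delta>"
      "subdegree \<Delta> \<le> m \<Longrightarrow> card K = subdegree \<Delta>"
      using truncated_kernel_coordinates[of ?A m] \<Delta>0 unfolding \<Delta>_def by blast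
    show "cdim (hill_chains m) \<le> enat (subdegree \<Delta>)" "subdegree \<Delta> \<le> m \<Longrightarrow> cdim (hill_chains m) = enat (subdegree \<Delta>)"
      using K cdim_chains[OF K(1,2)] by auto
  qed
  have "family_alg_mult T c0 = enat (subdegree \<Delta>)"
    unfolding family_alg_mult_def
  proof (rule antisym)
    show "(SUP m. cdim (hill_chains m)) \<le> enat (subdegree \<Delta>)" by (intro SUP_least le)
    show "enat (subdegree \<Delta>) \<le> (SUP m. cdim (hill_chains m))"
      using eq[of "subdegree \<Delta>"] SUP_upper[of "subdegree \<Delta>" UNIV "\<lambda>m. cdim (hill_chains m)"] by simp
  qed
  then show ?thesis using zord by simp
qed

end

section \<open>Conjugation by a unimodular factor\<close>

lemma integral_difference:
  fixes g :: "real \<Rightarrow> 'a::banach"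
  assumes "a \<le> s" "s \<le> t" "g integrable_on {a..t}"
  shows "integral {a..t} g - integral {a..s} g = integral {s..t} g"
  using Henstock_Kurzweil_Integration.integral_combine[OF assms] by (simp add: algebra_simps)

text \<open>The product rule when \<open>F\<close> is only an indefinite integral of an integrable function \<open>p\<close>. The
  difference \<open>\<Phi>\<close> of both sides satisfies \<open>|\<Phi>(t) - \<Phi>(s)| \<le> 2 L (t - s) (A(t) - A(s))\<close>, where
  \<open>L\<close> bounds \<open>|u'|\<close> and \<open>A\<close> is the indefinite integral of \<open>|p|\<close>. Since \<open>A\<close> is continuous,
  \<open>\<Phi>\<close> has derivative 0 at every point, although \<open>F\<close> need not be differentiable.\<close>

lemma integral_product_rule:
  fixes F p u u' :: "real \<Rightarrow> complex"
  assumes p: "set_integrable lborel period p"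
    and F: "\<And>x. x \<in> period \<Longrightarrow> F x = F 0 + (LBINT t:{0..x}. p t)"
    and u: "\<And>x. x \<in> period \<Longrightarrow> (u has_vector_derivative u' x) (at x within period)"
    and u': "continuous_on period u'"
    and x: "x \<in> period"
  shows "u x * F x = u 0 * F 0 + (LBINT t:{0..x}. u' t * F t + u t * p t)"
proof -
  have pi_HK: "p integrable_on period" by (rule set_borel_integral_eq_integral(1)[OF p])
  have pn: "set_integrable lborel period (\<lambda>t. norm (p t))" by (rule set_integrable_norm[OF p])
  have pn_HK: "(\<lambda>t. norm (p t)) integrable_on period" by (rule set_borel_integral_eq_integral(1)[OF pn])
  have F': "F x = F 0 + integral {0..x} p" if "x \<in> period" for x
    using F[OF that] set_borel_integral_eq_integral(2)[OF set_integrable_initial[OF p that]] by simp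
  have cF: "continuous_on period F"
  proof -
    have "continuous_on period (\<lambda>x. F 0 + integral {0..x} p)"
      by (intro continuous_intros indefinite_integral_continuous_1 pi_HK)
    then show ?thesis by (rule continuous_on_eq) (rule F'[symmetric])
  qed
  have cu: "continuous_on period u" by (rule continuous_on_vector_derivative[OF u])
  define q where "q = (\<lambda>t. u' t * F t + u t * p t)"
  have "bounded (u ` period)" by (intro compact_imp_bounded compact_continuous_image cu) simp
  then obtain K where K: "\<And>x. x \<in> period \<Longrightarrow> norm (u x) \<le> K" unfolding bounded_iff by blast
  have up: "set_integrable lborel period (\<lambda>t. u t * p t)"
    unfolding set_integrable_def
  proof (rule Bochner_Integration.integrable_bound)
    have "set_integrable lborel period (\<lambda>t. K * norm (p t))" by (rule set_integrable_mult_right) (rule pn)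
    then show "integrable lborel (\<lambda>t. indicator period t *\<^sub>R (K * norm (p t)))" by (simp add: set_integrable_def)
    show "AE t in lborel. norm (indicator period t *\<^sub>R (u t * p t)) \<le> norm (indicator period t *\<^sub>R (K * norm (p t)))"
    proof (intro AE_I2)
      fix t
      show "norm (indicator period t *\<^sub>R (u t * p t)) \<le> norm (indicator period t *\<^sub>R (K * norm (p t)))"
      proof (cases "t \<in> period")
        case True
        have "norm (u t) * norm (p t) \<le> K * norm (p t)" using K[OF True] by (intro mult_right_mono) auto
        then show ?thesis using True abs_ge_self[of "K * norm (p t)"] by (simp add: norm_mult)
      qed simp
    qed
    have "(\<lambda>t. indicator period t *\<^sub>R u t) \<in> borel_measurable borel"
      by (rule borel_measurable_continuous_on_indicator[OF _ cu]) simp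
    moreover have "(\<lambda>t. indicator period t *\<^sub>R p t) \<in> borel_measurable borel"
      using borel_measurable_integrable[OF p[unfolded set_integrable_def]] by simp
    moreover have "(\<lambda>t. indicator period t *\<^sub>R (u t * p t)) = (\<lambda>t. (indicator period t *\<^sub>R u t) * (indicator period t *\<^sub>R p t))"
      by (auto simp: fun_eq_iff split: split_indicator)
    ultimately show "(\<lambda>t. indicator period t *\<^sub>R (u t * p t)) \<in> borel_measurable lborel"
      by (simp only: borel_measurable_times measurable_lborel1 measurable_lborel2)
  qed
  have q: "set_integrable lborel period q"
    unfolding q_def by (intro set_integral_add(1)[OF _ up] set_integrable_continuous continuous_on_mult u' cF)
  have q_HK: "q integrable_on period" by (rule set_borel_integral_eq_integral(1)[OF q])
  have up_HK: "(\<lambda>t. u t * p t) integrable_on period" by (rule set_borel_integral_eq_integral(1)[OF up])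
  define A where "A = (\<lambda>x. integral {0..x} (\<lambda>t. norm (p t)))"
  have cA: "continuous_on period A" unfolding A_def by (rule indefinite_integral_continuous_1[OF pn_HK])
  have "bounded (u' ` period)" by (intro compact_imp_bounded compact_continuous_image u') simp
  then obtain L where L: "\<And>x. x \<in> period \<Longrightarrow> norm (u' x) \<le> L" unfolding bounded_iff by blast
  have L0: "L \<ge> 0" using order_trans[OF norm_ge_zero L[OF x]] .
  define \<Phi> where "\<Phi> = (\<lambda>x. u x * F x - integral {0..x} q)"
  have main: "norm (\<Phi> t - \<Phi> s) \<le> 2 * L * (t - s) * (A t - A s)" if st: "s \<in> period" "t \<in> period" "s \<le> t" for s t
  proof -
    have sub: "{s..t} \<subseteq> period" and sub0: "{0..t} \<subseteq> period" using st by auto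
    have st0: "0 \<le> s" using st by simp
    have diff_q: "integral {0..t} q - integral {0..s} q = integral {s..t} q"
      by (rule integral_difference[OF st0 st(3) integrable_on_subinterval[OF q_HK sub0]])
    have diff_A: "A t - A s = integral {s..t} (\<lambda>t. norm (p t))"
      unfolding A_def by (rule integral_difference[OF st0 st(3) integrable_on_subinterval[OF pn_HK sub0]])
    note int_pn = integrable_on_subinterval[OF pn_HK sub] and int_p = integrable_on_subinterval[OF pi_HK sub]
      and int_q = integrable_on_subinterval[OF q_HK sub]
    have AB: "norm (integral {s..r} p) \<le> A t - A s" if r: "r \<in> {s..t}" for r
    proof -
      have rs: "{s..r} \<subseteq> period" using r sub by auto
      have "norm (integral {s..r} p) \<le> integral {s..r} (\<lambda>t. norm (p t))"
        by (intro integral_norm_bound_integral integrable_on_subinterval[OF pi_HK rs] integrable_on_subinterval[OF pn_HK rs]) simp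
      also have "\<dots> \<le> integral {s..t} (\<lambda>t. norm (p t))"
        by (intro integral_subset_le integrable_on_subinterval[OF pn_HK rs] int_pn) (use r in auto)
      also have "\<dots> = A t - A s" by (rule diff_A[symmetric])
      finally show ?thesis .
    qed
    have Fd: "F r - F s = integral {s..r} p" if r: "r \<in> {s..t}" for r
    proof -
      have r': "r \<in> period" "{0..r} \<subseteq> period" using r sub st by auto
      have "F r - F s = integral {0..r} p - integral {0..s} p" using F'[OF r'(1)] F'[OF st(1)] by simp
      also have "\<dots> = integral {s..r} p"
        using r by (intro integral_difference st0 integrable_on_subinterval[OF pi_HK r'(2)]) auto
      finally show ?thesis .
    qed
    have ud: "(u' has_integral u t - u r) {r..t}" if r: "r \<in> {s..t}" for r
    proof (rule fundamental_theorem_of_calculus)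
      fix y assume "y \<in> {r..t}"
      then show "(u has_vector_derivative u' y) (at y within {r..t})"
        using r sub by (intro has_vector_derivative_within_subset[OF u]) auto
    qed (use r in auto)
    have ub: "norm (u t - u r) \<le> L * (t - s)" if r: "r \<in> {s..t}" for r
    proof -
      have "norm (u t - u r) \<le> integral {r..t} (\<lambda>_. L)"
        unfolding integral_unique[OF ud[OF r], symmetric]
        using ud[OF r] r sub L by (intro integral_norm_bound_integral) (auto simp: integrable_on_const)
      also have "\<dots> = L * (t - r)" using r by simp
      also have "\<dots> \<le> L * (t - s)" using L0 r by (intro mult_left_mono) auto
      finally show ?thesis .
    qed
    have s_in: "s \<in> {s..t}" and t_in: "t \<in> {s..t}" using st by auto
    have i1: "((\<lambda>r. u t * p r) has_integral u t * (F t - F s)) {s..t}"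
      unfolding Fd[OF t_in] by (intro has_integral_mult_right integrable_integral int_p)
    have i2: "((\<lambda>r. u' r * F s) has_integral (u t - u s) * F s) {s..t}"
      by (intro has_integral_mult_left ud s_in)
    have i3: "((\<lambda>r. u' r * F r + u r * p r) has_integral integral {0..t} q - integral {0..s} q) {s..t}"
      unfolding diff_q using int_q by (simp add: q_def integrable_integral)
    have i4: "((\<lambda>r. u t * p r + u' r * F s - (u' r * F r + u r * p r)) has_integral \<Phi> t - \<Phi> s) {s..t}"
    proof -
      have "u t * (F t - F s) + (u t - u s) * F s - (integral {0..t} q - integral {0..s} q) = \<Phi> t - \<Phi> s"
        by (simp add: \<Phi>_def algebra_simps)
      then show ?thesis using has_integral_diff[OF has_integral_add[OF i1 i2] i3] by (simp only:)
    qed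
    have "norm (\<Phi> t - \<Phi> s) \<le> integral {s..t} (\<lambda>r. L * (t - s) * norm (p r) + L * (A t - A s))"
      unfolding integral_unique[OF i4, symmetric]
    proof (rule integral_norm_bound_integral)
      show "(\<lambda>r. u t * p r + u' r * F s - (u' r * F r + u r * p r)) integrable_on {s..t}" using i4 by blast
      show "(\<lambda>r. L * (t - s) * norm (p r) + L * (A t - A s)) integrable_on {s..t}"
        by (intro integrable_add integrable_on_mult_right int_pn integrable_const_ivl)
      fix r assume r: "r \<in> {s..t}"
      have "u t * p r + u' r * F s - (u' r * F r + u r * p r) = (u t - u r) * p r - u' r * (F r - F s)"
        by (simp add: algebra_simps)
      also have "norm \<dots> \<le> norm ((u t - u r) * p r) + norm (u' r * (F r - F s))" by (rule norm_triangle_ineq4)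
      also have "\<dots> \<le> L * (t - s) * norm (p r) + L * (A t - A s)"
        unfolding norm_mult Fd[OF r] using r sub L0
        by (intro add_mono mult_mono ub AB L) auto
      finally show "norm (u t * p r + u' r * F s - (u' r * F r + u r * p r)) \<le> L * (t - s) * norm (p r) + L * (A t - A s)" .
    qed
    also have "\<dots> = L * (t - s) * (A t - A s) + (t - s) * (L * (A t - A s))"
    proof -
      have "integral {s..t} (\<lambda>r. L * (t - s) * norm (p r) + L * (A t - A s)) =
          integral {s..t} (\<lambda>r. L * (t - s) * norm (p r)) + integral {s..t} (\<lambda>r. L * (A t - A s))"
        by (intro integral_add integrable_on_mult_right int_pn integrable_const_ivl)
      moreover have "integral {s..t} (\<lambda>r. L * (t - s) * norm (p r)) = L * (t - s) * (A t - A s)"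
        unfolding diff_A by simp
      ultimately show ?thesis using st by simp
    qed
    finally show ?thesis by (simp add: algebra_simps)
  qed
  have main': "norm (\<Phi> t - \<Phi> s) \<le> 2 * L * \<bar>t - s\<bar> * \<bar>A t - A s\<bar>" if st: "s \<in> period" "t \<in> period" for s t
  proof -
    have *: "2 * L * (t - s) * (A t - A s) \<le> 2 * L * \<bar>t - s\<bar> * \<bar>A t - A s\<bar>" if "s \<le> t" for s t
    proof -
      have "2 * L * (t - s) * (A t - A s) \<le> 2 * L * (t - s) * \<bar>A t - A s\<bar>"
        using that L0 by (intro mult_left_mono) auto
      then show ?thesis using that by simp
    qed
    show ?thesis
    proof (cases "s \<le> t")
      case True
      then show ?thesis using main[OF st True] *[OF True] by linarith
    next
      case False
      then have "t \<le> s" by simp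
      then show ?thesis using main[OF st(2,1)] *[of t s] by (simp add: norm_minus_commute abs_minus_commute)
    qed
  qed
  have d\<Phi>: "(\<Phi> has_vector_derivative 0) (at y within period)" if y: "y \<in> period" for y
    unfolding has_vector_derivative_def has_derivative_within_alt
  proof (intro conjI allI impI)
    fix e :: real assume e: "e > 0"
    have "e / (2 * L + 1) > 0" using e L0 by simp
    then obtain d where d: "d > 0" "\<And>z. z \<in> period \<Longrightarrow> dist z y < d \<Longrightarrow> dist (A z) (A y) < e / (2 * L + 1)"
      using cA y unfolding continuous_on_iff by blast
    show "\<exists>d>0. \<forall>z\<in>period. norm (z - y) < d \<longrightarrow> norm (\<Phi> z - \<Phi> y - (z - y) *\<^sub>R 0) \<le> e * norm (z - y)"
    proof (intro exI[of _ d] conjI ballI impI d(1))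
      fix z assume z: "z \<in> period" "norm (z - y) < d"
      have "norm (\<Phi> z - \<Phi> y) \<le> 2 * L * \<bar>z - y\<bar> * \<bar>A z - A y\<bar>" by (rule main'[OF y z(1)])
      also have "\<dots> \<le> 2 * L * \<bar>z - y\<bar> * (e / (2 * L + 1))"
        using d(2)[OF z(1)] z(2) L0 by (intro mult_left_mono) (auto simp: dist_real_def)
      also have "\<dots> = (2 * L / (2 * L + 1)) * (e * \<bar>z - y\<bar>)" by simp
      also have "\<dots> \<le> 1 * (e * \<bar>z - y\<bar>)" using L0 e by (intro mult_right_mono) auto
      finally show "norm (\<Phi> z - \<Phi> y - (z - y) *\<^sub>R 0) \<le> e * norm (z - y)" by simp
    qed
  qed simp
  obtain k where k: "\<And>y. y \<in> period \<Longrightarrow> \<Phi> y = k"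
    by (rule has_vector_derivative_zero_constant[OF convex_real_interval(5) d\<Phi>], assumption, rule that)
  have "\<Phi> x = \<Phi> 0" using k[OF x] k[of 0] by simp
  then have "u x * F x = u 0 * F 0 + integral {0..x} q" by (simp add: \<Phi>_def algebra_simps)
  then show ?thesis
    using set_borel_integral_eq_integral(2)[OF set_integrable_initial[OF q x]] by (simp add: q_def)
qed

definition twist :: "real \<Rightarrow> real \<Rightarrow> complex" where
  "twist \<tau> x = exp (\<i> * of_real \<tau> * of_real x)"

lemma twist_inverse: "twist \<tau> x * twist (- \<tau>) x = 1" "twist (- \<tau>) x * twist \<tau> x = 1"
  by (simp_all add: twist_def exp_minus)

lemma norm_twist [simp]: "norm (twist \<tau> x) = 1"
  by (simp add: twist_def)

lemma twist_nonzero [simp]: "twist \<tau> x \<noteq> 0"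
  by (simp add: twist_def)

lemma twist_0 [simp]: "twist \<tau> 0 = 1"
  by (simp add: twist_def)

lemma twist_2pi: "twist \<tau> (2*pi) = exp (2 * of_real pi * \<i> * of_real \<tau>)"
  by (simp add: twist_def mult_ac)

lemma twist_has_vector_derivative:
  "(twist \<tau> has_vector_derivative \<i> * of_real \<tau> * twist \<tau> x) (at x within S)"
  unfolding twist_def by (rule has_vector_derivative_real_field) (auto intro!: derivative_eq_intros)

lemma continuous_on_twist: "continuous_on S (twist \<tau>)"
  unfolding twist_def by (intro continuous_intros)

text \<open>The Leibniz rule for \<open>exp (\<i> \<tau> x) f(x)\<close>; for the second derivative it is
  \<open>integral_product_rule\<close>, since \<open>f'\<close> is only absolutely continuous.\<close>

lemma second_order_op_twist:
  assumes "(f, h) \<in> second_order_op a V z"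
  shows "(\<lambda>x. twist \<tau> x * f x, \<lambda>x. twist \<tau> x * h x) \<in>
    second_order_op (a - 2 * \<i> * of_real \<tau>) (\<lambda>x. V x - (of_real \<tau>)\<^sup>2 - \<i> * of_real \<tau> * a) (z * twist \<tau> (2*pi))"
proof -
  let ?e = "twist \<tau>" and ?t = "\<i> * complex_of_real \<tau>"
  from assms obtain f' f'' where h: "h \<in> L2" and out: "\<And>x. x \<notin> period \<Longrightarrow> f x = 0" and H2: "H2_derivs f f' f''"
    and bc: "f (2*pi) = z * f 0" "f' (2*pi) = z * f' 0"
    and ae: "AE x in lborel. x \<in> period \<longrightarrow> h x = f'' x + a * f' x + V x * f x"
    by (rule second_order_opE) (rule that)
  have f'': "f'' \<in> L2" and f: "\<And>x. x \<in> period \<Longrightarrow> (f has_vector_derivative f' x) (at x within period)"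
    and f': "\<And>x. x \<in> period \<Longrightarrow> f' x = f' 0 + (LBINT t:{0..x}. f'' t)"
    using H2 unfolding H2_derivs_def by blast+
  have cf: "continuous_on period f" by (rule continuous_on_vector_derivative[OF f])
  have cf': "continuous_on period f'"
  proof -
    have "continuous_on period (\<lambda>x. f' 0 + integral {0..x} f'')"
      by (intro continuous_intros indefinite_integral_continuous_1 set_borel_integral_eq_integral(1) L2_set_integrable f'')
    then show ?thesis
    proof (rule continuous_on_eq)
      fix x assume x: "x \<in> period"
      show "f' 0 + integral {0..x} f'' = f' x"
        using f'[OF x] set_borel_integral_eq_integral(2)[OF set_integrable_initial[OF L2_set_integrable[OF f''] x]] by simp
    qed
  qed
  note ce = continuous_on_twist[of period \<tau>]
  let ?g' = "\<lambda>x. ?e x * (f' x + ?t * f x)"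
  let ?g'' = "\<lambda>x. ?t * ?e x * (f' x + ?t * f x) + ?e x * (f'' x + ?t * f' x)"
  have g'': "?g'' \<in> L2"
    by (intro L2_add L2_mult[OF ce] f'' L2_continuous continuous_intros ce cf cf')
  have H2g: "H2_derivs (\<lambda>x. ?e x * f x) ?g' ?g''"
    unfolding H2_derivs_def
  proof (intro conjI ballI g'')
    fix x assume x: "x \<in> period"
    have "((\<lambda>x. ?e x * f x) has_vector_derivative ?e x * f' x + ?t * ?e x * f x) (at x within period)"
      by (rule has_vector_derivative_mult[OF twist_has_vector_derivative f[OF x]])
    then show "((\<lambda>x. ?e x * f x) has_vector_derivative ?g' x) (at x within period)"
      by (simp add: algebra_simps)
    have p1: "set_integrable lborel period f''" by (rule L2_set_integrable[OF f''])
    have p2: "set_integrable lborel period (\<lambda>x. ?t * f' x)" by (intro set_integrable_continuous continuous_intros cf')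
    show "?g' x = ?g' 0 + (LBINT t:{0..x}. ?g'' t)"
    proof (rule integral_product_rule[OF set_integral_add(1)[OF p1 p2] _ twist_has_vector_derivative _ x])
      show "continuous_on period (\<lambda>x. ?t * ?e x)" by (intro continuous_intros ce)
      fix y assume y: "y \<in> period"
      have "(f' has_integral f y - f 0) {0..y}"
      proof (rule fundamental_theorem_of_calculus)
        fix s assume "s \<in> {0..y}"
        then show "(f has_vector_derivative f' s) (at s within {0..y})"
          using y by (intro has_vector_derivative_within_subset[OF f]) auto
      qed (use y in auto)
      then have "((\<lambda>s. ?t * f' s) has_integral ?t * (f y - f 0)) {0..y}" by (rule has_integral_mult_right)
      then have "(LBINT s:{0..y}. ?t * f' s) = ?t * (f y - f 0)"
        using set_borel_integral_eq_integral(2)[OF set_integrable_initial[OF p2 y]] by (simp only: integral_unique)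
      moreover have "(LBINT s:{0..y}. f'' s) = f' y - f' 0" using f'[OF y] by simp
      moreover have "(LBINT s:{0..y}. f'' s + ?t * f' s) = (LBINT s:{0..y}. f'' s) + (LBINT s:{0..y}. ?t * f' s)"
        by (rule set_integral_add(2)[OF set_integrable_initial[OF p1 y] set_integrable_initial[OF p2 y]])
      ultimately show "f' y + ?t * f y = f' 0 + ?t * f 0 + (LBINT s:{0..y}. f'' s + ?t * f' s)"
        by (simp add: algebra_simps)
    qed
  qed
  have "AE x in lborel. x \<in> period \<longrightarrow> ?e x * h x = ?g'' x + (a - 2 * \<i> * of_real \<tau>) * ?g' x +
      (V x - (of_real \<tau>)\<^sup>2 - \<i> * of_real \<tau> * a) * (?e x * f x)"
    using ae by eventually_elim (auto simp: power2_eq_square algebra_simps)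
  moreover have "?e (2*pi) * f (2*pi) = z * ?e (2*pi) * (?e 0 * f 0)" "?g' (2*pi) = z * ?e (2*pi) * ?g' 0"
    using bc by (simp_all add: algebra_simps)
  moreover have "(\<lambda>x. ?e x * h x) \<in> L2" by (rule L2_mult[OF ce h])
  moreover have "?e x * f x = 0" if "x \<notin> period" for x using out[OF that] by simp
  ultimately show ?thesis using H2g by (intro second_order_opI)
qed

definition twist_related :: "real \<Rightarrow> op_graph \<Rightarrow> op_graph \<Rightarrow> bool" where
  "twist_related \<tau> S T \<longleftrightarrow> (\<forall>f h. (f, h) \<in> S \<longleftrightarrow> (\<lambda>x. twist \<tau> x * f x, \<lambda>x. twist \<tau> x * h x) \<in> T)"

lemma twist_relatedI:
  assumes "\<And>f h. (f, h) \<in> S \<Longrightarrow> (\<lambda>x. twist \<tau> x * f x, \<lambda>x. twist \<tau> x * h x) \<in> T"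
    and "\<And>f h. (f, h) \<in> T \<Longrightarrow> (\<lambda>x. twist (- \<tau>) x * f x, \<lambda>x. twist (- \<tau>) x * h x) \<in> S"
  shows "twist_related \<tau> S T"
  unfolding twist_related_def
proof (intro allI iffI)
  fix f h assume "(\<lambda>x. twist \<tau> x * f x, \<lambda>x. twist \<tau> x * h x) \<in> T"
  from assms(2)[OF this] show "(f, h) \<in> S"
    by (simp add: mult.assoc[symmetric] twist_inverse)
qed (rule assms(1))

lemma twist_relatedD:
  "twist_related \<tau> S T \<Longrightarrow> (f, h) \<in> S \<Longrightarrow> (\<lambda>x. twist \<tau> x * f x, \<lambda>x. twist \<tau> x * h x) \<in> T"
  by (simp add: twist_related_def)

lemma twist_related_sym:
  assumes "twist_related \<tau> S T"
  shows "twist_related (- \<tau>) T S"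
  using assms unfolding twist_related_def by (simp add: mult.assoc[symmetric] twist_inverse)

lemma twist_related_op_minus:
  assumes "twist_related \<tau> S T"
  shows "twist_related \<tau> (op_minus S \<mu>) (op_minus T \<mu>)"
proof -
  have *: "(\<lambda>x. twist \<sigma> x * f x, \<lambda>x. twist \<sigma> x * h x) \<in> op_minus Y \<mu>"
    if r: "twist_related \<sigma> X Y" and fh: "(f, h) \<in> op_minus X \<mu>" for \<sigma> X Y f h
  proof -
    obtain k where k: "(f, k) \<in> X" "h = (\<lambda>x. k x - \<mu> * f x)" using fh by (rule op_minusE)
    have "(\<lambda>x. twist \<sigma> x * f x, \<lambda>x. twist \<sigma> x * k x) \<in> Y" by (rule twist_relatedD[OF r k(1)])
    then show ?thesis by (rule op_minusI) (simp add: k(2) algebra_simps)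
  qed
  show ?thesis
    by (rule twist_relatedI) (rule *[OF assms] *[OF twist_related_sym[OF assms]], assumption)+
qed

lemma op_minus_op_minus: "op_minus (op_minus T a) b = op_minus T (a + b)"
proof (rule equalityI; rule subsetI)
  fix p assume p: "p \<in> op_minus (op_minus T a) b"
  obtain f k where fk: "p = (f, k)" by (cases p)
  from p[unfolded fk] obtain h' where h': "(f, h') \<in> op_minus T a" "k = (\<lambda>x. h' x - b * f x)" by (rule op_minusE)
  from h'(1) obtain h where h: "(f, h) \<in> T" "h' = (\<lambda>x. h x - a * f x)" by (rule op_minusE)
  show "p \<in> op_minus T (a + b)" unfolding fk by (rule op_minusI[OF h(1)]) (simp add: h' h(2) algebra_simps)
next
  fix p assume p: "p \<in> op_minus T (a + b)"
  obtain f k where fk: "p = (f, k)" by (cases p)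
  from p[unfolded fk] obtain h where h: "(f, h) \<in> T" "k = (\<lambda>x. h x - (a + b) * f x)" by (rule op_minusE)
  show "p \<in> op_minus (op_minus T a) b" unfolding fk
    by (rule op_minusI[OF op_minusI[OF h(1) refl]]) (simp add: h(2) algebra_simps)
qed

lemma op_minus_0: "op_minus T 0 = T"
  unfolding op_minus_def by auto

lemma second_order_op_shift:
  "second_order_op a (\<lambda>x. V x - \<mu>) z = op_minus (second_order_op a V z) \<mu>"
proof -
  have *: "(f, \<lambda>x. h x - \<mu> * f x) \<in> second_order_op a (\<lambda>x. V x - \<mu>) z" if fh: "(f, h) \<in> second_order_op a V z" for f h V \<mu>
  proof -
    from fh obtain f' f'' where h: "h \<in> L2" and out: "\<And>x. x \<notin> period \<Longrightarrow> f x = 0" and H2: "H2_derivs f f' f''"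
      and bc: "f (2*pi) = z * f 0" "f' (2*pi) = z * f' 0"
      and ae: "AE x in lborel. x \<in> period \<longrightarrow> h x = f'' x + a * f' x + V x * f x"
      by (rule second_order_opE) (rule that)
    have "continuous_on period f"
    proof (rule continuous_on_vector_derivative)
      show "(f has_vector_derivative f' x) (at x within period)" if "x \<in> period" for x
        using H2 that unfolding H2_derivs_def by blast
    qed
    then have "(\<lambda>x. h x - \<mu> * f x) \<in> L2" by (intro L2_diff h L2_continuous continuous_intros)
    moreover have "AE x in lborel. x \<in> period \<longrightarrow> h x - \<mu> * f x = f'' x + a * f' x + (V x - \<mu>) * f x"
      using ae by eventually_elim (auto simp: algebra_simps)
    ultimately show ?thesis using H2 out bc by (intro second_order_opI)
  qed
  show ?thesis
  proof (rule equalityI; rule subsetI)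
    fix p assume p: "p \<in> second_order_op a (\<lambda>x. V x - \<mu>) z"
    obtain f h where fh: "p = (f, h)" by (cases p)
    have "(f, \<lambda>x. h x - (- \<mu>) * f x) \<in> second_order_op a (\<lambda>x. (V x - \<mu>) - (- \<mu>)) z"
      by (rule *) (use p fh in simp)
    then have "(f, \<lambda>x. h x + \<mu> * f x) \<in> second_order_op a V z" by simp
    then show "p \<in> op_minus (second_order_op a V z) \<mu>" unfolding fh by (rule op_minusI) simp
  next
    fix p assume "p \<in> op_minus (second_order_op a V z) \<mu>"
    then show "p \<in> second_order_op a (\<lambda>x. V x - \<mu>) z"
      by (cases p) (auto elim!: op_minusE intro: *)
  qed
qed

text \<open>The choice \<open>\<tau> = \<theta>\<close> is the one that removes the first-order term \<open>2 \<i> \<theta> f'\<close>.\<close>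

lemma second_order_op_twist_related:
  "twist_related \<theta> (second_order_op (2 * \<i> * of_real \<theta>) (\<lambda>x. V x - \<kappa>) 1)
    (op_minus (second_order_op 0 V (exp (2 * of_real pi * \<i> * of_real \<theta>))) (\<kappa> - (of_real \<theta>)\<^sup>2))"
  unfolding second_order_op_shift[symmetric]
proof (rule twist_relatedI)
  have V: "(\<lambda>x. V x - \<kappa> - (of_real \<theta>)\<^sup>2 - \<i> * of_real \<theta> * (2 * \<i> * of_real \<theta>)) = (\<lambda>x. V x - (\<kappa> - (of_real \<theta>)\<^sup>2))"
    by (auto simp: power2_eq_square algebra_simps)
  fix f h assume "(f, h) \<in> second_order_op (2 * \<i> * of_real \<theta>) (\<lambda>x. V x - \<kappa>) 1"
  from second_order_op_twist[OF this, of \<theta>]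
  show "(\<lambda>x. twist \<theta> x * f x, \<lambda>x. twist \<theta> x * h x) \<in>
      second_order_op 0 (\<lambda>x. V x - (\<kappa> - (of_real \<theta>)\<^sup>2)) (exp (2 * of_real pi * \<i> * of_real \<theta>))"
    by (simp add: V twist_2pi)
next
  fix f h assume "(f, h) \<in> second_order_op 0 (\<lambda>x. V x - (\<kappa> - (of_real \<theta>)\<^sup>2)) (exp (2 * of_real pi * \<i> * of_real \<theta>))"
  from second_order_op_twist[OF this, of "- \<theta>"]
  show "(\<lambda>x. twist (- \<theta>) x * f x, \<lambda>x. twist (- \<theta>) x * h x) \<in>
      second_order_op (2 * \<i> * of_real \<theta>) (\<lambda>x. V x - \<kappa>) 1"
    by (simp add: twist_2pi[symmetric] twist_inverse)
qed

lemma twist_related_regular: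
  assumes "twist_related \<tau> S T"
  shows "regular_graph S \<longleftrightarrow> regular_graph T"
proof -
  have *: "regular_graph X" if r: "twist_related \<sigma> X Y" and reg: "regular_graph Y" for \<sigma> X Y
    unfolding regular_graph_def
  proof (intro conjI ballI)
    fix h assume h: "h \<in> L2"
    have "(\<lambda>x. twist \<sigma> x * h x) \<in> L2" by (rule L2_mult[OF continuous_on_twist h])
    then obtain g where g: "(g, \<lambda>x. twist \<sigma> x * h x) \<in> Y" and uniq: "\<And>k. (k, \<lambda>x. twist \<sigma> x * h x) \<in> Y \<Longrightarrow> k = g"
      using reg unfolding regular_graph_def by blast
    have "(\<lambda>x. twist (- \<sigma>) x * g x, \<lambda>x. twist (- \<sigma>) x * (twist \<sigma> x * h x)) \<in> X"
      by (rule twist_relatedD[OF twist_related_sym[OF r] g])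
    then have "(\<lambda>x. twist (- \<sigma>) x * g x, h) \<in> X" by (simp add: mult.assoc[symmetric] twist_inverse)
    moreover have "f = (\<lambda>x. twist (- \<sigma>) x * g x)" if fX: "(f, h) \<in> X" for f
    proof -
      have "(\<lambda>x. twist \<sigma> x * f x, \<lambda>x. twist \<sigma> x * h x) \<in> Y" by (rule twist_relatedD[OF r fX])
      from uniq[OF this] show ?thesis by (auto simp: mult.assoc[symmetric] twist_inverse)
    qed
    ultimately show "\<exists>!f. (f, h) \<in> X" by blast
  next
    obtain C where C: "\<And>f h. (f, h) \<in> Y \<Longrightarrow> L2norm f \<le> C * L2norm h" using reg unfolding regular_graph_def by blast
    have "L2norm f \<le> C * L2norm h" if fX: "(f, h) \<in> X" for f h
    proof -
      have "(\<lambda>x. twist \<sigma> x * f x, \<lambda>x. twist \<sigma> x * h x) \<in> Y" by (rule twist_relatedD[OF r fX])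
      from C[OF this] show ?thesis
        by (simp add: L2norm_def norm_mult)
    qed
    then show "\<exists>C. \<forall>(f, h)\<in>X. L2norm f \<le> C * L2norm h" by blast
  qed
  show ?thesis using *[OF assms] *[OF twist_related_sym[OF assms]] by blast
qed

lemma twist_related_kernel:
  assumes "twist_related \<tau> S T"
  shows "(\<exists>f. f \<noteq> (\<lambda>x. 0) \<and> (f, \<lambda>x. 0) \<in> S) \<longleftrightarrow> (\<exists>f. f \<noteq> (\<lambda>x. 0) \<and> (f, \<lambda>x. 0) \<in> T)"
proof -
  have *: "\<exists>f. f \<noteq> (\<lambda>x. 0) \<and> (f, \<lambda>x. 0) \<in> Y" if r: "twist_related \<sigma> X Y" and f: "f \<noteq> (\<lambda>x. 0)" "(f, \<lambda>x. 0) \<in> X" for \<sigma> X Y f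
  proof (intro exI conjI)
    show "(\<lambda>x. twist \<sigma> x * f x) \<noteq> (\<lambda>x. 0)" using f(1) by (auto simp: fun_eq_iff)
    have "(\<lambda>x. twist \<sigma> x * f x, \<lambda>x. twist \<sigma> x * 0) \<in> Y" by (rule twist_relatedD[OF r f(2)])
    then show "(\<lambda>x. twist \<sigma> x * f x, \<lambda>x. 0) \<in> Y" by simp
  qed
  show ?thesis using *[OF assms] *[OF twist_related_sym[OF assms]] by blast
qed

text \<open>Multiplication by a function without zeros preserves linear independence.\<close>

lemma cdim_mult_le:
  fixes g :: "'x \<Rightarrow> complex"
  assumes g: "\<And>y. g y \<noteq> 0" and sub: "\<And>F. F \<in> V \<Longrightarrow> (\<lambda>y. g y * F y) \<in> W"
  shows "cdim V \<le> cdim W"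
  unfolding cdim_def
proof (rule SUP_mono)
  fix B assume "B \<in> {B. finite B \<and> B \<subseteq> V \<and> (\<forall>u. (\<forall>x. (\<Sum>b\<in>B. u b * b x) = 0) \<longrightarrow> (\<forall>b\<in>B. u b = 0))}"
  then have B: "finite B" "B \<subseteq> V" and ind: "\<And>u. (\<And>x. (\<Sum>b\<in>B. u b * b x) = 0) \<Longrightarrow> \<forall>b\<in>B. u b = 0" by auto
  let ?m = "\<lambda>F y. g y * F y"
  have inj: "inj_on ?m B" using g by (auto simp: inj_on_def fun_eq_iff)
  have "\<forall>b\<in>?m ` B. u b = 0" if 0: "\<And>x. (\<Sum>b\<in>?m ` B. u b * b x) = 0" for u
  proof -
    have "(\<Sum>b\<in>B. u (?m b) * b x) = 0" for x
    proof -
      have "g x * (\<Sum>b\<in>B. u (?m b) * b x) = (\<Sum>b\<in>?m ` B. u b * b x)"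
        unfolding sum.reindex[OF inj] o_def sum_distrib_left by (intro sum.cong refl) (simp only: mult_ac)
      then show ?thesis using 0[of x] g[of x] by simp
    qed
    from ind[of "\<lambda>b. u (?m b)", OF this] show ?thesis by blast
  qed
  then show "\<exists>B'\<in>{B. finite B \<and> B \<subseteq> W \<and> (\<forall>u. (\<forall>x. (\<Sum>b\<in>B. u b * b x) = 0) \<longrightarrow> (\<forall>b\<in>B. u b = 0))}. enat (card B) \<le> enat (card B')"
    using B sub by (intro bexI[of _ "?m ` B"]) (auto simp: card_image[OF inj])
qed

lemma jordan_chains_twist:
  assumes r: "\<forall>\<^sub>F c in at c0. twist_related \<tau> (S c) (T c)" and F: "F \<in> jordan_chains S c0 m"
  shows "(\<lambda>y. twist \<tau> (snd y) * F y) \<in> jordan_chains T c0 m"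
proof -
  obtain h where z: "\<And>j x. j \<ge> m \<Longrightarrow> F (j, x) = 0"
    and ev: "\<forall>\<^sub>F c in at c0. (\<lambda>x. \<Sum>j<m. (c - c0) ^ j * F (j, x), h c) \<in> S c"
    and O: "(\<lambda>c. L2norm (h c)) \<in> O[at c0](\<lambda>c. cmod (c - c0) ^ m)"
    using F unfolding jordan_chains_def by auto
  have "\<forall>\<^sub>F c in at c0. (\<lambda>x. \<Sum>j<m. (c - c0) ^ j * (twist \<tau> x * F (j, x)), \<lambda>x. twist \<tau> x * h c x) \<in> T c"
    using r ev
  proof eventually_elim
    case (elim c)
    then have "(\<lambda>x. twist \<tau> x * (\<Sum>j<m. (c - c0) ^ j * F (j, x)), \<lambda>x. twist \<tau> x * h c x) \<in> T c"
      by (intro twist_relatedD)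
    then show ?case by (simp add: sum_distrib_left mult_ac)
  qed
  moreover have "(\<lambda>c. L2norm (\<lambda>x. twist \<tau> x * h c x)) \<in> O[at c0](\<lambda>c. cmod (c - c0) ^ m)"
    using O by (simp add: L2norm_def norm_mult)
  ultimately show ?thesis
    unfolding jordan_chains_def using z by (auto intro!: exI[of _ "\<lambda>c x. twist \<tau> x * h c x"])
qed

lemma family_alg_mult_twist:
  assumes "\<forall>\<^sub>F c in at c0. twist_related \<tau> (S c) (T c)"
  shows "family_alg_mult S c0 = family_alg_mult T c0"
proof -
  have "\<forall>\<^sub>F c in at c0. twist_related (- \<tau>) (T c) (S c)"
    using assms by eventually_elim (rule twist_related_sym)
  then have "cdim (jordan_chains S c0 m) = cdim (jordan_chains T c0 m)" for m
    using jordan_chains_twist[OF assms] jordan_chains_twist[where \<tau> = "- \<tau>" and S = T and T = S]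
    by (intro antisym cdim_mult_le[of "\<lambda>y. twist \<tau> (snd y)"] cdim_mult_le[of "\<lambda>y. twist (- \<tau>) (snd y)"]) auto
  then show ?thesis unfolding family_alg_mult_def by simp
qed

lemma family_alg_mult_translate:
  "family_alg_mult (\<lambda>w. T (\<sigma> + w)) 0 = family_alg_mult T \<sigma>"
proof -
  have ev: "eventually P (at \<sigma>) \<longleftrightarrow> eventually (\<lambda>w. P (\<sigma> + w)) (at 0)" for P :: "complex \<Rightarrow> bool"
    using at_to_0[of \<sigma>] by (simp add: eventually_filtermap add.commute)
  have O: "f \<in> O[at \<sigma>](g) \<longleftrightarrow> (\<lambda>w. f (\<sigma> + w)) \<in> O[at 0](\<lambda>w. g (\<sigma> + w))" for f g :: "complex \<Rightarrow> real"
    unfolding bigo_def by (simp add: ev)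
  have "jordan_chains (\<lambda>w. T (\<sigma> + w)) 0 m = jordan_chains T \<sigma> m" for m
  proof (rule equalityI; rule subsetI)
    fix F assume "F \<in> jordan_chains (\<lambda>w. T (\<sigma> + w)) 0 m"
    then obtain h where "\<forall>j\<ge>m. \<forall>x. F (j, x) = 0"
      "\<forall>\<^sub>F w in at 0. (\<lambda>x. \<Sum>j<m. w ^ j * F (j, x), h w) \<in> T (\<sigma> + w)"
      "(\<lambda>w. L2norm (h w)) \<in> O[at 0](\<lambda>w. cmod w ^ m)"
      unfolding jordan_chains_def by auto
    then show "F \<in> jordan_chains T \<sigma> m"
      unfolding jordan_chains_def by (auto intro!: exI[of _ "\<lambda>c. h (c - \<sigma>)"] simp: ev O)
  next
    fix F assume "F \<in> jordan_chains T \<sigma> m"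
    then obtain h where "\<forall>j\<ge>m. \<forall>x. F (j, x) = 0"
      "\<forall>\<^sub>F c in at \<sigma>. (\<lambda>x. \<Sum>j<m. (c - \<sigma>) ^ j * F (j, x), h c) \<in> T c"
      "(\<lambda>c. L2norm (h c)) \<in> O[at \<sigma>](\<lambda>c. cmod (c - \<sigma>) ^ m)"
      unfolding jordan_chains_def by auto
    then show "F \<in> jordan_chains (\<lambda>w. T (\<sigma> + w)) 0 m"
      unfolding jordan_chains_def by (auto intro!: exI[of _ "\<lambda>w. h (\<sigma> + w)"] simp: ev O)
  qed
  then show ?thesis unfolding family_alg_mult_def by simp
qed

section \<open>Determinants over finite index sets\<close>

text \<open>The Leibniz formula over any finite index set. Truncations of a bi-infinite matrix can then be
  taken along all finite sets of integers and shifted without renumbering.\<close>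

definition leibniz_det :: "'a set \<Rightarrow> ('a \<Rightarrow> 'a \<Rightarrow> complex) \<Rightarrow> complex" where
  "leibniz_det S X = (\<Sum>p | p permutes S. of_int (sign p) * (\<Prod>i\<in>S. X i (p i)))"

lemma leibniz_det_cong:
  assumes "\<And>i j. i \<in> S \<Longrightarrow> j \<in> S \<Longrightarrow> X i j = Y i j"
  shows "leibniz_det S X = leibniz_det S Y"
  unfolding leibniz_det_def
  by (intro sum.cong refl arg_cong2[where f = "(*)"] prod.cong) (auto simp: assms permutes_in_image)

text \<open>Expanding the product of the row sums yields one term for each map of \<open>S\<close> into itself, in
  particular one for each permutation.\<close>

lemma norm_leibniz_det_le:
  assumes "finite S"
  shows "norm (leibniz_det S X) \<le> (\<Prod>i\<in>S. \<Sum>j\<in>S. norm (X i j))"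
proof -
  let ?P = "{p. p permutes S}"
  have inj: "inj_on (\<lambda>p. restrict p S) ?P"
  proof (rule inj_onI, rule ext)
    fix p q x
    assume "p \<in> ?P" "q \<in> ?P" and eq: "restrict p S = restrict q S"
    then have "p permutes S" "q permutes S" by auto
    then show "p x = q x"
      using fun_cong[OF eq, of x] by (cases "x \<in> S") (auto simp: permutes_not_in)
  qed
  have "norm (leibniz_det S X) \<le> (\<Sum>p\<in>?P. \<Prod>i\<in>S. norm (X i (p i)))"
    unfolding leibniz_det_def
    by (rule sum_norm_le) (auto simp: norm_mult prod_norm sign_def)
  also have "\<dots> = (\<Sum>f\<in>(\<lambda>p. restrict p S) ` ?P. \<Prod>i\<in>S. norm (X i (f i)))"
    by (subst sum.reindex[OF inj]) (auto intro!: sum.cong)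
  also have "\<dots> \<le> (\<Sum>f\<in>S \<rightarrow>\<^sub>E S. \<Prod>i\<in>S. norm (X i (f i)))"
    by (rule sum_mono2) (use assms in \<open>auto simp: finite_PiE prod_nonneg permutes_in_image\<close>)
  also have "\<dots> = (\<Prod>i\<in>S. \<Sum>j\<in>S. norm (X i j))"
    using assms by (simp add: prod_sum_PiE)
  finally show ?thesis .
qed

lemma leibniz_det_row:
  assumes "finite S" "k \<in> S"
  shows "leibniz_det S (X(k := u)) =
    (\<Sum>p | p permutes S. of_int (sign p) * (u (p k) * (\<Prod>i\<in>S - {k}. X i (p i))))"
  unfolding leibniz_det_def
  by (intro sum.cong refl arg_cong2[where f = "(*)"])
     (simp add: prod.remove[OF assms])

lemma leibniz_det_row_sum:
  assumes "finite S" "k \<in> S"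
  shows "leibniz_det S (X(k := (\<lambda>j. \<Sum>n\<in>I. c n * u n j))) = (\<Sum>n\<in>I. c n * leibniz_det S (X(k := u n)))"
  unfolding leibniz_det_row[OF assms]
  by (subst sum_distrib_left, subst sum.swap)
     (simp add: sum_distrib_left sum_distrib_right mult_ac)

lemma leibniz_det_row_diff:
  assumes "finite S" "k \<in> S"
  shows "leibniz_det S (X(k := (\<lambda>j. u j - v j))) = leibniz_det S (X(k := u)) - leibniz_det S (X(k := v))"
  unfolding leibniz_det_row[OF assms] by (simp add: algebra_simps flip: sum_subtractf)

lemma leibniz_det_scale_rows:
  shows "leibniz_det S (\<lambda>i j. r i * X i j) = (\<Prod>i\<in>S. r i) * leibniz_det S X"
  unfolding leibniz_det_def by (simp add: prod.distrib sum_distrib_left mult_ac)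

lemma leibniz_det_identical_rows:
  assumes "finite S" "k \<in> S" "l \<in> S" "k \<noteq> l" "X k = X l"
  shows "leibniz_det S X = 0"
proof -
  let ?\<tau> = "Transposition.transpose k l"
  have \<tau>: "?\<tau> permutes S" using assms by (simp add: permutes_swap_id)
  have "leibniz_det S X = (\<Sum>p | p permutes S. of_int (sign (p \<circ> ?\<tau>)) * (\<Prod>i\<in>S. X i ((p \<circ> ?\<tau>) i)))"
    unfolding leibniz_det_def by (rule sum_permutations_compose_right[OF \<tau>])
  also have "\<dots> = (\<Sum>p | p permutes S. - (of_int (sign p) * (\<Prod>i\<in>S. X i (p i))))"
  proof (rule sum.cong[OF refl])
    fix p assume "p \<in> {p. p permutes S}"
    then have p: "p permutes S" by simp
    have "permutation p" "permutation ?\<tau>"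
      using p \<tau> assms(1) permutation_permutes by blast+
    then have "sign (p \<circ> ?\<tau>) = - sign p"
      using assms(4) by (simp add: sign_compose sign_swap_id)
    moreover have "(\<Prod>i\<in>S. X i ((p \<circ> ?\<tau>) i)) = (\<Prod>i\<in>S. X (?\<tau> i) ((p \<circ> ?\<tau>) (?\<tau> i)))"
      using prod.permute[OF \<tau>, of "\<lambda>i. X i ((p \<circ> ?\<tau>) i)"] by (simp add: o_def)
    moreover have "X (?\<tau> i) = X i" for i
      using assms(5) by (simp add: Transposition.transpose_def)
    ultimately show "of_int (sign (p \<circ> ?\<tau>)) * (\<Prod>i\<in>S. X i ((p \<circ> ?\<tau>) i)) =
        - (of_int (sign p) * (\<Prod>i\<in>S. X i (p i)))"
      by simp
  qed
  also have "\<dots> = - leibniz_det S X"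
    unfolding leibniz_det_def by (simp add: sum_negf)
  finally show ?thesis by simp
qed

text \<open>By linearity in row \<open>k\<close>, where every row other than \<open>k\<close> contributes a determinant with two
  equal rows.\<close>

lemma leibniz_det_replace_row_combination:
  assumes "finite S" "k \<in> S"
  shows "leibniz_det S (X(k := (\<lambda>j. \<Sum>n\<in>S. x n * X n j))) = x k * leibniz_det S X"
proof -
  have "leibniz_det S (X(k := X n)) = (if n = k then leibniz_det S X else 0)" if "n \<in> S" for n
    using leibniz_det_identical_rows[OF assms(1,2) that, of "X(k := X n)"] by auto
  then show ?thesis
    using assms by (simp add: leibniz_det_row_sum if_distrib[of "(*) _"] sum.delta cong: if_cong)
qed

text \<open>A permutation that moves an index of \<open>T - S\<close> meets an off-diagonal zero there.\<close>

lemma leibniz_det_extend: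
  assumes "finite T" "S \<subseteq> T"
    and "\<And>i j. i \<in> T - S \<Longrightarrow> j \<in> T \<Longrightarrow> X i j = (if i = j then 1 else 0)"
  shows "leibniz_det T X = leibniz_det S X"
proof -
  have "(\<Prod>i\<in>T. X i (p i)) = 0" if p: "p permutes T" "\<not> p permutes S" for p
  proof -
    obtain i where "i \<in> T - S" "p i \<noteq> i"
      using permutes_superset[OF p(1), of S] p(2) by blast
    then have "X i (p i) = 0"
      using assms(3)[of i "p i"] p(1) by (auto simp: permutes_in_image)
    then show ?thesis
      using assms(1) \<open>i \<in> T - S\<close> by (intro prod_zero) auto
  qed
  then have "leibniz_det T X = (\<Sum>p | p permutes S. of_int (sign p) * (\<Prod>i\<in>T. X i (p i)))"
    unfolding leibniz_det_def
    by (intro sum.mono_neutral_right)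
       (use assms in \<open>auto simp: finite_permutations intro: permutes_subset\<close>)
  also have "\<dots> = leibniz_det S X"
    unfolding leibniz_det_def
  proof (intro sum.cong refl arg_cong2[where f = "(*)"] prod.mono_neutral_right)
    fix p assume "p \<in> {p. p permutes S}"
    then have "p i = i" if "i \<in> T - S" for i
      using that by (auto simp: permutes_not_in)
    then show "\<forall>i\<in>T - S. X i (p i) = 1"
      using assms(3) by auto
  qed (use assms in auto)
  finally show ?thesis .
qed

lemma leibniz_det_reindex:
  assumes "bij_betw f S T" "finite S"
  shows "leibniz_det T X = leibniz_det S (\<lambda>i j. X (f i) (f j))"
proof -
  let ?h = "\<lambda>\<pi> x. if x \<in> T then f (\<pi> (inv_into S f x)) else x"
  have fS: "f ` S = T" and inj: "inj_on f S"
    using assms(1) by (auto simp: bij_betw_def)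
  have h: "?h \<pi> = map_permutation S f \<pi>" for \<pi>
    by (auto simp: map_permutation_def restrict_id_def fS fun_eq_iff)
  have "leibniz_det T X = (\<Sum>\<pi> | \<pi> permutes S. of_int (sign (?h \<pi>)) * (\<Prod>i\<in>T. X i (?h \<pi> i)))"
    unfolding leibniz_det_def
    by (rule sum.reindex_bij_betw[OF bij_betw_permutations[OF assms(1)], symmetric])
  also have "\<dots> = leibniz_det S (\<lambda>i j. X (f i) (f j))"
    unfolding leibniz_det_def
  proof (rule sum.cong[OF refl])
    fix \<pi> assume "\<pi> \<in> {\<pi>. \<pi> permutes S}"
    then have \<pi>: "\<pi> permutes S" by simp
    have "sign (?h \<pi>) = sign \<pi>"
      unfolding h by (rule sign_map_permutation[OF inj \<pi> assms(2)])
    moreover have "(\<Prod>i\<in>T. X i (?h \<pi> i)) = (\<Prod>i\<in>S. X (f i) (?h \<pi> (f i)))"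
      by (rule prod.reindex_bij_betw[OF assms(1), symmetric])
    moreover have "?h \<pi> (f i) = f (\<pi> i)" if "i \<in> S" for i
      using that fS inj by (auto simp: inv_into_f_f)
    ultimately show "of_int (sign (?h \<pi>)) * (\<Prod>i\<in>T. X i (?h \<pi> i)) =
        of_int (sign \<pi>) * (\<Prod>i\<in>S. X (f i) (f (\<pi> i)))"
      by simp
  qed
  finally show ?thesis .
qed

text \<open>Exchanging one row at a time, each exchange costs the norm of the difference of the two rows times
  the bounds of the other rows.\<close>

lemma leibniz_det_diff_le:
  assumes S: "finite S" and b: "\<And>i. i \<in> S \<Longrightarrow> 1 \<le> b i"
    and X: "\<And>i. i \<in> S \<Longrightarrow> (\<Sum>j\<in>S. norm (X i j)) \<le> b i"
    and Y: "\<And>i. i \<in> S \<Longrightarrow> (\<Sum>j\<in>S. norm (Y i j)) \<le> b i"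
  shows "norm (leibniz_det S X - leibniz_det S Y) \<le>
    (\<Sum>i\<in>S. \<Sum>j\<in>S. norm (X i j - Y i j)) * (\<Prod>i\<in>S. b i)"
proof -
  define Z where "Z = (\<lambda>R i. if i \<in> R then X i else Y i)"
  have "norm (leibniz_det S (Z R) - leibniz_det S Y) \<le>
      (\<Sum>i\<in>R. \<Sum>j\<in>S. norm (X i j - Y i j)) * (\<Prod>i\<in>S. b i)" if "R \<subseteq> S" for R
    using finite_subset[OF that S] that
  proof (induction R rule: finite_induct)
    case empty
    then show ?case by (simp add: Z_def)
  next
    case (insert k R)
    have k: "k \<in> S" and kR: "k \<notin> R" using insert by auto
    have Z1: "Z (insert k R) = (Z R)(k := X k)" and Z2: "Z R = (Z R)(k := Y k)"
      using kR by (auto simp: Z_def fun_eq_iff)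
    have "leibniz_det S (Z (insert k R)) - leibniz_det S (Z R) =
        leibniz_det S ((Z R)(k := (\<lambda>j. X k j - Y k j)))"
      unfolding leibniz_det_row_diff[OF S k] by (simp only: Z1[symmetric] Z2[symmetric])
    also have "norm \<dots> \<le> (\<Prod>i\<in>S. \<Sum>j\<in>S. norm (((Z R)(k := (\<lambda>j. X k j - Y k j))) i j))"
      by (rule norm_leibniz_det_le[OF S])
    also have "\<dots> = (\<Sum>j\<in>S. norm (X k j - Y k j)) * (\<Prod>i\<in>S - {k}. \<Sum>j\<in>S. norm (Z R i j))"
      by (simp add: prod.remove[OF S k])
    also have "\<dots> \<le> (\<Sum>j\<in>S. norm (X k j - Y k j)) * (\<Prod>i\<in>S - {k}. b i)"
      by (intro mult_left_mono prod_mono conjI sum_nonneg) (auto simp: Z_def X Y)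
    also have "\<dots> \<le> (\<Sum>j\<in>S. norm (X k j - Y k j)) * (\<Prod>i\<in>S. b i)"
    proof (intro mult_left_mono sum_nonneg)
      have "1 * (\<Prod>i\<in>S - {k}. b i) \<le> b k * (\<Prod>i\<in>S - {k}. b i)"
        by (intro mult_right_mono prod_nonneg) (use b k in \<open>force+\<close>)
      then show "(\<Prod>i\<in>S - {k}. b i) \<le> (\<Prod>i\<in>S. b i)"
        by (simp add: prod.remove[OF S k])
    qed auto
    finally have *: "norm (leibniz_det S (Z (insert k R)) - leibniz_det S (Z R)) \<le>
      (\<Sum>j\<in>S. norm (X k j - Y k j)) * (\<Prod>i\<in>S. b i)" .
    have "norm (leibniz_det S (Z (insert k R)) - leibniz_det S Y) \<le>
       norm (leibniz_det S (Z (insert k R)) - leibniz_det S (Z R)) + norm (leibniz_det S (Z R) - leibniz_det S Y)"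
      using norm_triangle_ineq[of "leibniz_det S (Z (insert k R)) - leibniz_det S (Z R)"
          "leibniz_det S (Z R) - leibniz_det S Y"] by simp
    also have "\<dots> \<le> (\<Sum>j\<in>S. norm (X k j - Y k j)) * (\<Prod>i\<in>S. b i) +
        (\<Sum>i\<in>R. \<Sum>j\<in>S. norm (X i j - Y i j)) * (\<Prod>i\<in>S. b i)"
      using insert * by (intro add_mono) auto
    finally show ?case
      using insert by (simp add: algebra_simps)
  qed
  from this[of S] show ?thesis
    by (simp add: Z_def cong: leibniz_det_cong)
qed

section \<open>Infinite determinants\<close>

lemma summable_on_int_reflect:
  fixes \<gamma> :: "int \<Rightarrow> real"
  assumes "\<gamma> summable_on UNIV"
  shows "((\<lambda>m. \<gamma> (n - m)) has_sum infsum \<gamma> UNIV) UNIV"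
proof -
  have "(\<gamma> has_sum infsum \<gamma> UNIV) UNIV" using assms by simp
  moreover have "((\<lambda>m. \<gamma> (n - m)) has_sum infsum \<gamma> UNIV) UNIV \<longleftrightarrow> (\<gamma> has_sum infsum \<gamma> UNIV) UNIV"
    by (rule has_sum_reindex_bij_witness[where i = "\<lambda>m. n - m" and j = "\<lambda>m. n - m"]) auto
  ultimately show ?thesis by simp
qed

lemma summable_on_weighted_convolution:
  fixes w \<gamma> :: "int \<Rightarrow> real"
  assumes "w summable_on UNIV" "\<gamma> summable_on UNIV" "\<And>n. w n \<ge> 0" "\<And>n. \<gamma> n \<ge> 0"
  shows "(\<lambda>(n, m). w n * \<gamma> (n - m)) summable_on UNIV"
proof -
  have "(\<lambda>(n, m). w n * \<gamma> (n - m)) summable_on Sigma UNIV (\<lambda>_. UNIV)"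
    by (rule summable_on_SigmaI[where g = "\<lambda>n. w n * infsum \<gamma> UNIV"])
       (use assms in \<open>auto intro!: has_sum_cmult_right summable_on_int_reflect summable_on_cmult_left\<close>)
  then show ?thesis by simp
qed

lemma filterlim_symmetric_interval:
  "filterlim (\<lambda>N. {- int N..int N}) (finite_subsets_at_top UNIV) sequentially"
  unfolding filterlim_finite_subsets_at_top
proof (intro allI impI)
  fix X :: "int set" assume "finite X \<and> X \<subseteq> UNIV"
  then have "finite X" by simp
  define M where "M = Max (abs ` X)"
  have M: "\<bar>x\<bar> \<le> M" if "x \<in> X" for x
    unfolding M_def using \<open>finite X\<close> that by (intro Max_ge) auto
  then have "X \<subseteq> {- int N..int N}" if "N \<ge> nat \<bar>M\<bar>" for N
    using that by fastforce
  then show "\<forall>\<^sub>F N in sequentially. finite {- int N..int N} \<and> X \<subseteq> {- int N..int N} \<and> {- int N..int N} \<subseteq> UNIV"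
    unfolding eventually_sequentially by (intro exI[of _ "nat \<bar>M\<bar>"]) auto
qed

definition perturbed_id :: "('a \<Rightarrow> 'a \<Rightarrow> complex) \<Rightarrow> 'a \<Rightarrow> 'a \<Rightarrow> complex" where
  "perturbed_id A i j = (if i = j then 1 else 0) + A i j"

text \<open>Matrices in the spirit of von Koch: \<open>w\<close> makes the rows summable, and \<open>\<gamma>\<close> the entries along
  a row. For the Hill matrix \<open>\<gamma>\<close> comes from the Fourier coefficients and \<open>w n\<close> from the divisor
  of row \<open>n\<close>.\<close>

locale koch_matrix =
  fixes A :: "int \<Rightarrow> int \<Rightarrow> complex" and w \<gamma> :: "int \<Rightarrow> real"
  assumes w: "w summable_on UNIV" "\<And>n. w n \<ge> 0"
    and \<gamma>: "\<gamma> summable_on UNIV" "\<And>n. \<gamma> n \<ge> 0"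
    and A_le: "\<And>n m. norm (A n m) \<le> w n * \<gamma> (n - m)"
begin

definition total :: real where "total = infsum w UNIV * infsum \<gamma> UNIV"

lemma sum_row_le:
  assumes "finite S"
  shows "(\<Sum>j\<in>S. norm (A i j)) \<le> w i * infsum \<gamma> UNIV"
proof -
  have "(\<Sum>j\<in>S. norm (A i j)) \<le> (\<Sum>j\<in>S. w i * \<gamma> (i - j))"
    by (intro sum_mono A_le)
  also have "\<dots> = w i * (\<Sum>j\<in>S. \<gamma> (i - j))"
    by (simp add: sum_distrib_left)
  also have "(\<Sum>j\<in>S. \<gamma> (i - j)) \<le> infsum (\<lambda>j. \<gamma> (i - j)) UNIV"
    using summable_on_int_reflect[OF \<gamma>(1), of i] \<gamma>(2) assms
    by (intro finite_sum_le_infsum) (auto simp: has_sum_imp_summable)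
  also have "\<dots> = infsum \<gamma> UNIV"
    using summable_on_int_reflect[OF \<gamma>(1), of i] by (rule infsumI)
  finally show ?thesis using w by (simp add: mult_left_mono)
qed

lemma prod_rows_le:
  assumes "finite S"
  shows "(\<Prod>i\<in>S. 1 + w i * infsum \<gamma> UNIV) \<le> exp total"
proof -
  have \<Gamma>: "infsum \<gamma> UNIV \<ge> 0" by (intro infsum_nonneg) (auto simp: \<gamma>)
  have "(\<Prod>i\<in>S. 1 + w i * infsum \<gamma> UNIV) \<le> (\<Prod>i\<in>S. exp (w i * infsum \<gamma> UNIV))"
    by (intro prod_mono conjI exp_ge_add_one_self add_nonneg_nonneg mult_nonneg_nonneg w \<Gamma>) auto
  also have "\<dots> = exp ((\<Sum>i\<in>S. w i) * infsum \<gamma> UNIV)"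
    using assms by (simp add: exp_sum sum_distrib_right)
  also have "\<dots> \<le> exp total"
    unfolding total_def exp_le_cancel_iff using assms w
    by (intro mult_right_mono finite_sum_le_infsum \<Gamma>) auto
  finally show ?thesis .
qed

lemma sum_row_perturbed_le:
  assumes "finite S"
  shows "(\<Sum>j\<in>S. norm (perturbed_id A i j)) \<le> 1 + w i * infsum \<gamma> UNIV"
proof -
  have "(\<Sum>j\<in>S. norm (perturbed_id A i j)) \<le> (\<Sum>j\<in>S. (if i = j then 1 else 0) + norm (A i j))"
    unfolding perturbed_id_def by (intro sum_mono norm_triangle_le) auto
  also have "\<dots> \<le> 1 + (\<Sum>j\<in>S. norm (A i j))"
    using assms by (auto simp: sum.distrib)
  finally show ?thesis using sum_row_le[OF assms, of i] by simp
qed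

lemma prod_row_perturbed_le:
  assumes "finite S" "R \<subseteq> S"
  shows "(\<Prod>i\<in>R. \<Sum>j\<in>S. norm (perturbed_id A i j)) \<le> exp total"
proof -
  have "(\<Prod>i\<in>R. \<Sum>j\<in>S. norm (perturbed_id A i j)) \<le> (\<Prod>i\<in>R. 1 + w i * infsum \<gamma> UNIV)"
    by (intro prod_mono conjI sum_nonneg sum_row_perturbed_le assms) auto
  also have "\<dots> \<le> exp total"
    by (rule prod_rows_le) (use assms finite_subset in auto)
  finally show ?thesis .
qed

lemma norm_det_le: "finite S \<Longrightarrow> norm (leibniz_det S (perturbed_id A)) \<le> exp total"
  by (rule order_trans[OF norm_leibniz_det_le prod_row_perturbed_le]) auto

text \<open>The determinant over \<open>S\<close> equals the one over \<open>T\<close> of the matrix that is replaced by the identity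
  outside \<open>S \<times> S\<close>; the two matrices on \<open>T\<close> are then compared by \<open>leibniz_det_diff_le\<close>.\<close>

lemma norm_det_diff_le:
  assumes T: "finite T" "S \<subseteq> T"
  shows "norm (leibniz_det T (perturbed_id A) - leibniz_det S (perturbed_id A)) \<le>
    (\<Sum>(n, m)\<in>T \<times> T - S \<times> S. w n * \<gamma> (n - m)) * exp total"
proof -
  define Y where "Y = (\<lambda>i j. if i \<in> S \<and> j \<in> S then perturbed_id A i j else if i = j then 1 else 0)"
  let ?b = "\<lambda>i. 1 + w i * infsum \<gamma> UNIV"
  have \<Gamma>: "infsum \<gamma> UNIV \<ge> 0" by (intro infsum_nonneg) (auto simp: \<gamma>)
  have S: "finite S" using T finite_subset by blast
  have "leibniz_det T Y = leibniz_det S Y"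
    by (rule leibniz_det_extend[OF T]) (auto simp: Y_def)
  also have "\<dots> = leibniz_det S (perturbed_id A)"
    by (rule leibniz_det_cong) (auto simp: Y_def)
  finally have *: "leibniz_det S (perturbed_id A) = leibniz_det T Y" by simp
  have "norm (leibniz_det T (perturbed_id A) - leibniz_det T Y) \<le>
      (\<Sum>i\<in>T. \<Sum>j\<in>T. norm (perturbed_id A i j - Y i j)) * (\<Prod>i\<in>T. ?b i)"
  proof (rule leibniz_det_diff_le)
    fix i assume i: "i \<in> T"
    have "(\<Sum>j\<in>T. norm (Y i j)) = (\<Sum>j\<in>T. if i \<in> S \<and> j \<in> S then norm (perturbed_id A i j) else if i = j then 1 else 0)"
      by (intro sum.cong) (auto simp: Y_def)
    also have "\<dots> \<le> ?b i"
    proof (cases "i \<in> S")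
      case True
      then have "(\<Sum>j\<in>T. if i \<in> S \<and> j \<in> S then norm (perturbed_id A i j) else if i = j then 1 else 0) =
          (\<Sum>j\<in>S. norm (perturbed_id A i j))"
        using T by (intro sum.mono_neutral_cong_right) auto
      then show ?thesis using sum_row_perturbed_le[OF S] by simp
    next
      case False
      then show ?thesis using T i w(2)[of i] \<Gamma> by simp
    qed
    finally show "(\<Sum>j\<in>T. norm (Y i j)) \<le> ?b i" .
    show "(\<Sum>j\<in>T. norm (perturbed_id A i j)) \<le> ?b i" by (rule sum_row_perturbed_le[OF T(1)])
    show "1 \<le> ?b i" using w(2)[of i] \<Gamma> by simp
  qed (rule T)
  also have "(\<Sum>i\<in>T. \<Sum>j\<in>T. norm (perturbed_id A i j - Y i j)) =
      (\<Sum>(i, j)\<in>T \<times> T. norm (perturbed_id A i j - Y i j))"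
    by (simp add: sum.cartesian_product)
  also have "\<dots> = (\<Sum>(i, j)\<in>T \<times> T - S \<times> S. norm (A i j))"
    by (intro sum.mono_neutral_cong_right) (use T in \<open>auto simp: Y_def perturbed_id_def split: if_splits\<close>)
  also have "\<dots> \<le> (\<Sum>(n, m)\<in>T \<times> T - S \<times> S. w n * \<gamma> (n - m))"
    by (intro sum_mono) (auto simp: A_le)
  finally have "norm (leibniz_det T (perturbed_id A) - leibniz_det T Y) \<le>
      (\<Sum>(n, m)\<in>T \<times> T - S \<times> S. w n * \<gamma> (n - m)) * (\<Prod>i\<in>T. ?b i)"
    by (simp add: mult_right_mono prod_nonneg w \<Gamma> add_nonneg_nonneg)
  also have "\<dots> \<le> (\<Sum>(n, m)\<in>T \<times> T - S \<times> S. w n * \<gamma> (n - m)) * exp total"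
    by (intro mult_left_mono prod_rows_le T sum_nonneg) (auto simp: w \<gamma>)
  finally show ?thesis using * by simp
qed

lemma sum_entries_le:
  assumes "finite P"
  shows "(\<Sum>(n, m)\<in>P. w n * \<gamma> (n - m)) \<le> total"
proof -
  let ?f = "\<lambda>(n, m). w n * \<gamma> (n - m)"
  have s: "?f summable_on UNIV" by (rule summable_on_weighted_convolution) (auto simp: w \<gamma>)
  have "sum ?f P \<le> infsum ?f (UNIV \<times> UNIV)"
    unfolding UNIV_Times_UNIV by (rule finite_sum_le_infsum[OF s assms]) (auto simp: w \<gamma>)
  also have "infsum ?f (UNIV \<times> UNIV) = infsum (\<lambda>n. infsum (\<lambda>m. w n * \<gamma> (n - m)) UNIV) UNIV"
    using s by (subst infsum_Sigma'_banach[symmetric]) auto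
  also have "\<dots> = total"
    unfolding total_def
    by (simp add: infsum_cmult_right' infsum_cmult_left' infsumI[OF summable_on_int_reflect[OF \<gamma>(1)]])
  finally show ?thesis by simp
qed

lemma norm_det_minus_one_le:
  assumes "finite S"
  shows "norm (leibniz_det S (perturbed_id A) - 1) \<le> total * exp total"
proof -
  have "leibniz_det {} (perturbed_id A) = 1"
    unfolding leibniz_det_def by (simp add: permutes_empty)
  then have "norm (leibniz_det S (perturbed_id A) - 1) \<le> (\<Sum>(n, m)\<in>S \<times> S - {} \<times> {}. w n * \<gamma> (n - m)) * exp total"
    using norm_det_diff_le[OF assms, of "{}"] by simp
  also have "\<dots> \<le> total * exp total"
    by (intro mult_right_mono sum_entries_le) (use assms in auto)
  finally show ?thesis .
qed

text \<open>The entries of \<open>A\<close> are absolutely summable over all pairs of indices, so those outside a large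
  square contribute little.\<close>

lemma det_tail_le:
  assumes "e > 0"
  shows "\<exists>S. finite S \<and> (\<forall>T. finite T \<longrightarrow> S \<subseteq> T \<longrightarrow>
    norm (leibniz_det T (perturbed_id A) - leibniz_det S (perturbed_id A)) \<le> e)"
proof -
  let ?f = "\<lambda>(n, m). w n * \<gamma> (n - m)"
  have s: "?f summable_on UNIV" by (rule summable_on_weighted_convolution) (auto simp: w \<gamma>)
  have f0: "?f p \<ge> 0" for p by (auto simp: w \<gamma> split: prod.splits)
  define d where "d = e / exp total"
  have d: "d > 0" using assms by (simp add: d_def)
  have "(sum ?f \<longlongrightarrow> infsum ?f UNIV) (finite_subsets_at_top UNIV)"
    using s by (rule infsum_tendsto)
  then have "\<forall>\<^sub>F F in finite_subsets_at_top UNIV. dist (sum ?f F) (infsum ?f UNIV) < d"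
    using d by (rule tendstoD)
  then obtain F where F: "finite F" "dist (sum ?f F) (infsum ?f UNIV) < d"
    unfolding eventually_finite_subsets_at_top by auto
  define S where "S = fst ` F \<union> snd ` F"
  have FS: "F \<subseteq> S \<times> S" by (force simp: S_def)
  have finS: "finite S" using F by (simp add: S_def)
  have "norm (leibniz_det T (perturbed_id A) - leibniz_det S (perturbed_id A)) \<le> e"
    if T: "finite T" "S \<subseteq> T" for T
  proof -
    have "sum ?f (T \<times> T - S \<times> S) + sum ?f F = sum ?f ((T \<times> T - S \<times> S) \<union> F)"
      using T F FS by (intro sum.union_disjoint[symmetric]) auto
    also have "\<dots> \<le> infsum ?f UNIV"
      using T F f0 by (intro finite_sum_le_infsum[OF s]) auto
    finally have "sum ?f (T \<times> T - S \<times> S) \<le> d"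
      using F by (auto simp: dist_real_def)
    then have "sum ?f (T \<times> T - S \<times> S) * exp total \<le> d * exp total"
      by (intro mult_right_mono) auto
    then show ?thesis using norm_det_diff_le[OF T] by (simp add: d_def)
  qed
  then show ?thesis using finS by blast
qed

text \<open>The limit is taken along all finite sets of indices rather than along symmetric intervals, so that
  it is visibly invariant under translation of the indices.\<close>

definition inf_det :: complex where
  "inf_det = Lim (finite_subsets_at_top UNIV) (\<lambda>S. leibniz_det S (perturbed_id A))"

lemma det_tendsto:
  "((\<lambda>S. leibniz_det S (perturbed_id A)) \<longlongrightarrow> inf_det) (finite_subsets_at_top UNIV)"
proof -
  let ?D = "\<lambda>S. leibniz_det S (perturbed_id A)"
  let ?I = "\<lambda>N. {- int N..int N}"
  have ev: "\<forall>\<^sub>F N in sequentially. S \<subseteq> ?I N" if "finite S" for S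
    using filterlim_symmetric_interval that unfolding filterlim_finite_subsets_at_top by (force elim: eventually_mono)
  have "Cauchy (\<lambda>N. ?D (?I N))"
  proof (rule metric_CauchyI)
    fix e :: real assume "e > 0"
    then obtain S where S: "finite S" "\<And>T. finite T \<Longrightarrow> S \<subseteq> T \<Longrightarrow> norm (?D T - ?D S) \<le> e / 3"
      using det_tail_le[of "e / 3"] by auto
    obtain M where M: "\<And>N. N \<ge> M \<Longrightarrow> S \<subseteq> ?I N"
      using ev[OF S(1)] unfolding eventually_sequentially by auto
    have "dist (?D (?I m)) (?D (?I n)) < e" if "m \<ge> M" "n \<ge> M" for m n
      using S(2)[OF _ M[OF that(1)]] S(2)[OF _ M[OF that(2)]] \<open>e > 0\<close>
        dist_triangle2[of "?D (?I m)" "?D (?I n)" "?D S"]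
      by (simp add: dist_norm)
    then show "\<exists>M. \<forall>m\<ge>M. \<forall>n\<ge>M. dist (?D (?I m)) (?D (?I n)) < e" by blast
  qed
  then obtain L where L: "(\<lambda>N. ?D (?I N)) \<longlonglongrightarrow> L"
    using Cauchy_convergent convergent_def by blast
  have "(?D \<longlongrightarrow> L) (finite_subsets_at_top UNIV)"
  proof (rule tendstoI)
    fix e :: real assume "e > 0"
    then obtain S where S: "finite S" "\<And>T. finite T \<Longrightarrow> S \<subseteq> T \<Longrightarrow> norm (?D T - ?D S) \<le> e / 4"
      using det_tail_le[of "e / 4"] by auto
    have "norm (L - ?D S) \<le> e / 4"
    proof (rule tendsto_upperbound)
      show "((\<lambda>N. norm (?D (?I N) - ?D S)) \<longlongrightarrow> norm (L - ?D S)) sequentially"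
        by (intro tendsto_intros L)
      show "\<forall>\<^sub>F N in sequentially. norm (?D (?I N) - ?D S) \<le> e / 4"
        using ev[OF S(1)] by eventually_elim (use S in auto)
    qed auto
    then have "dist (?D T) L < e" if "finite T" "S \<subseteq> T" for T
      using S(2)[OF that] \<open>e > 0\<close> dist_triangle2[of "?D T" L "?D S"] by (simp add: dist_norm)
    then show "\<forall>\<^sub>F T in finite_subsets_at_top UNIV. dist (?D T) L < e"
      unfolding eventually_finite_subsets_at_top using S(1) by blast
  qed
  then show ?thesis unfolding inf_det_def by (metis tendsto_Lim finite_subsets_at_top_neq_bot)
qed

lemma det_tendsto_symmetric:
  "(\<lambda>N. leibniz_det {- int N..int N} (perturbed_id A)) \<longlonglongrightarrow> inf_det"
  using filterlim_compose[OF det_tendsto filterlim_symmetric_interval] .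

lemma norm_inf_det_minus_one_le: "norm (inf_det - 1) \<le> total * exp total"
proof (rule tendsto_upperbound)
  show "(\<lambda>N. norm (leibniz_det {- int N..int N} (perturbed_id A) - 1)) \<longlonglongrightarrow> norm (inf_det - 1)"
    by (intro tendsto_intros det_tendsto_symmetric)
qed (auto intro!: always_eventually norm_det_minus_one_le)

text \<open>\<open>x\<close> is a left null vector of \<open>I + A\<close>. Replacing row \<open>k\<close> of a truncation by the combination
  of the rows with coefficients \<open>x\<close> multiplies the determinant by \<open>x k\<close>. The new row is minus the
  combination of the rows outside the truncation, restricted to \<open>S\<close>; its norm tends to 0.\<close>

lemma inf_det_eq_0_of_left_null_vector:
  assumes null: "\<And>m. ((\<lambda>n. x n * A n m) has_sum - x m) UNIV"
    and bounded: "\<And>n. norm (x n) \<le> K" and nz: "x k \<noteq> 0"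
  shows "inf_det = 0"
proof -
  let ?D = "\<lambda>S. leibniz_det S (perturbed_id A)"
  let ?f = "\<lambda>(n, m). w n * \<gamma> (n - m)"
  define V where "V = infsum \<gamma> UNIV"
  have V: "V \<ge> 0" unfolding V_def by (intro infsum_nonneg) (auto simp: \<gamma>)
  have K: "K \<ge> 0" using bounded[of 0] norm_ge_zero order_trans by blast
  have bound: "norm (x k) * norm (?D S) \<le> (K * V * (infsum w UNIV - sum w S)) * exp total"
    if S: "finite S" "k \<in> S" for S
  proof -
    define e where "e = (\<lambda>j. \<Sum>n\<in>S. x n * perturbed_id A n j)"
    have "(\<Sum>m\<in>S. norm (e m - (x m + - x m))) \<le> K * V * (infsum w UNIV - sum w S)"
    proof (rule tendsto_upperbound)
      show "((\<lambda>T. \<Sum>m\<in>S. norm (e m - (x m + (\<Sum>n\<in>T. x n * A n m)))) \<longlongrightarrow>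
          (\<Sum>m\<in>S. norm (e m - (x m + - x m)))) (finite_subsets_at_top UNIV)"
        using null unfolding has_sum_def by (intro tendsto_intros) auto
      have "(\<Sum>m\<in>S. norm (e m - (x m + (\<Sum>n\<in>T. x n * A n m)))) \<le> K * V * (infsum w UNIV - sum w S)"
        if T: "finite T" "S \<subseteq> T" for T
      proof -
        have "e m - (x m + (\<Sum>n\<in>T. x n * A n m)) = - (\<Sum>n\<in>T - S. x n * A n m)" if "m \<in> S" for m
        proof -
          have "e m = (\<Sum>n\<in>S. (if n = m then x m else 0) + x n * A n m)"
            unfolding e_def perturbed_id_def by (intro sum.cong) (auto simp: algebra_simps)
          also have "\<dots> = x m + (\<Sum>n\<in>S. x n * A n m)"
            using that S by (simp add: sum.distrib)
          finally show ?thesis using sum.subset_diff[OF T(2,1), of "\<lambda>n. x n * A n m"] by simp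
        qed
        then have "(\<Sum>m\<in>S. norm (e m - (x m + (\<Sum>n\<in>T. x n * A n m)))) =
            (\<Sum>m\<in>S. norm (\<Sum>n\<in>T - S. x n * A n m))" by (intro sum.cong) auto
        also have "\<dots> \<le> (\<Sum>m\<in>S. \<Sum>n\<in>T - S. K * norm (A n m))"
          by (intro sum_mono order_trans[OF norm_sum]) (auto simp: norm_mult bounded mult_right_mono)
        also have "\<dots> = K * (\<Sum>n\<in>T - S. \<Sum>m\<in>S. norm (A n m))"
          by (subst sum.swap) (simp add: sum_distrib_left)
        also have "\<dots> \<le> K * (\<Sum>n\<in>T - S. w n * V)"
          unfolding V_def by (intro mult_left_mono sum_mono sum_row_le S K)
        also have "\<dots> = K * V * sum w (T - S)"
          by (simp add: sum_distrib_left sum_distrib_right mult_ac)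
        also have "\<dots> \<le> K * V * (infsum w UNIV - sum w S)"
        proof (intro mult_left_mono mult_nonneg_nonneg K V)
          have "sum w T \<le> infsum w UNIV"
            using w T by (intro finite_sum_le_infsum) auto
          then show "sum w (T - S) \<le> infsum w UNIV - sum w S"
            using sum.subset_diff[OF T(2,1), of w] by simp
        qed
        finally show ?thesis .
      qed
      then show "\<forall>\<^sub>F T in finite_subsets_at_top UNIV.
          (\<Sum>m\<in>S. norm (e m - (x m + (\<Sum>n\<in>T. x n * A n m)))) \<le> K * V * (infsum w UNIV - sum w S)"
        unfolding eventually_finite_subsets_at_top using S by blast
    qed auto
    then have "(\<Sum>m\<in>S. norm (e m)) \<le> K * V * (infsum w UNIV - sum w S)" by simp
    moreover have "norm (x k) * norm (?D S) \<le> (\<Sum>m\<in>S. norm (e m)) * exp total"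
    proof -
      have "norm (x k) * norm (?D S) = norm (leibniz_det S ((perturbed_id A)(k := e)))"
        unfolding e_def leibniz_det_replace_row_combination[OF S] by (simp add: norm_mult)
      also have "\<dots> \<le> (\<Prod>i\<in>S. \<Sum>j\<in>S. norm (((perturbed_id A)(k := e)) i j))"
        by (rule norm_leibniz_det_le) (rule S)
      also have "\<dots> = (\<Sum>j\<in>S. norm (e j)) * (\<Prod>i\<in>S - {k}. \<Sum>j\<in>S. norm (perturbed_id A i j))"
        by (simp add: prod.remove[OF S])
      also have "\<dots> \<le> (\<Sum>m\<in>S. norm (e m)) * exp total"
        by (intro mult_left_mono prod_row_perturbed_le S sum_nonneg) auto
      finally show ?thesis .
    qed
    ultimately show ?thesis
      by (meson exp_ge_zero mult_right_mono order_trans)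
  qed
  have "norm (x k) * norm inf_det \<le> (K * V * (infsum w UNIV - infsum w UNIV)) * exp total"
  proof (rule tendsto_le)
    show "((\<lambda>S. norm (x k) * norm (?D S)) \<longlongrightarrow> norm (x k) * norm inf_det) (finite_subsets_at_top UNIV)"
      by (intro tendsto_intros det_tendsto)
    show "((\<lambda>S. (K * V * (infsum w UNIV - sum w S)) * exp total) \<longlongrightarrow>
        (K * V * (infsum w UNIV - infsum w UNIV)) * exp total) (finite_subsets_at_top UNIV)"
      by (intro tendsto_intros infsum_tendsto w)
    show "\<forall>\<^sub>F S in finite_subsets_at_top UNIV. norm (x k) * norm (?D S) \<le> (K * V * (infsum w UNIV - sum w S)) * exp total"
      unfolding eventually_finite_subsets_at_top by (intro exI[of _ "{k}"]) (auto intro: bound)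
  qed auto
  then show ?thesis using nz by (simp add: mult_le_0_iff)
qed

end

section \<open>Uniqueness of Fourier coefficients\<close>

lemma continuous_on_real_polynomial_exp:
  assumes "real_polynomial_function p"
  shows "continuous_on S (\<lambda>\<eta>. p (exp (\<i> * of_real \<eta>)))"
proof (rule continuous_on_compose2[of UNIV p])
  show "continuous_on UNIV p"
    using assms by (intro continuous_on_polymonial_function) (simp add: real_polynomial_function_eq[symmetric])
qed (auto intro!: continuous_intros)

text \<open>On the unit circle a real linear form is a combination of \<open>exp (\<i> \<eta>)\<close> and \<open>exp (- \<i> \<eta>)\<close>;
  multiplication by it shifts Fourier coefficients by 1 and -1.\<close>

lemma Fourier_zero_times_polynomial:
  assumes "real_polynomial_function p"
    and "continuous_on {0..2*pi} w"
    and "\<And>n::int. integral {0..2*pi} (\<lambda>\<eta>. w \<eta> * exp (\<i> * of_int n * of_real \<eta>)) = 0"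
  shows "integral {0..2*pi} (\<lambda>\<eta>. w \<eta> * of_real (p (exp (\<i> * of_real \<eta>))) * exp (\<i> * of_int n * of_real \<eta>)) = 0"
  using assms
proof (induction p arbitrary: w n rule: real_polynomial_function.induct)
  case (linear f)
  have f: "of_real (f (exp (\<i> * of_real \<eta>))) =
      (of_real (f 1) - \<i> * of_real (f \<i>)) / 2 * exp (\<i> * of_int 1 * of_real \<eta>) +
      (of_real (f 1) + \<i> * of_real (f \<i>)) / 2 * exp (\<i> * of_int (-1) * of_real \<eta>)" for \<eta>
  proof -
    interpret bounded_linear f by fact
    have "exp (\<i> * of_real \<eta>) = cos \<eta> *\<^sub>R 1 + sin \<eta> *\<^sub>R \<i>"
      by (simp add: cis_conv_exp[symmetric] complex_eq_iff)
    then have "f (exp (\<i> * of_real \<eta>)) = f (cos \<eta> *\<^sub>R 1 + sin \<eta> *\<^sub>R \<i>)"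
      by simp
    also have "\<dots> = cos \<eta> * f 1 + sin \<eta> * f \<i>"
      by (simp add: add scaleR)
    finally have *: "f (exp (\<i> * of_real \<eta>)) = cos \<eta> * f 1 + sin \<eta> * f \<i>" .
    have e1: "exp (\<i> * of_int 1 * of_real \<eta>) = cis \<eta>"
      and e2: "exp (\<i> * of_int (- 1) * of_real \<eta>) = cis (- \<eta>)"
      by (simp_all add: cis_conv_exp)
    show ?thesis unfolding * e1 e2 by (simp add: complex_eq_iff field_simps)
  qed
  have exp_add_int: "exp (\<i> * of_int (n + k) * of_real \<eta>) = exp (\<i> * of_int k * of_real \<eta>) * exp (\<i> * of_int n * of_real \<eta>)"
    for \<eta> :: real and k :: int
    by (simp add: exp_add[symmetric] algebra_simps)
  have "integral {0..2*pi} (\<lambda>\<eta>. w \<eta> * of_real (f (exp (\<i> * of_real \<eta>))) * exp (\<i> * of_int n * of_real \<eta>)) =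
    integral {0..2*pi} (\<lambda>\<eta>. (of_real (f 1) - \<i> * of_real (f \<i>)) / 2 * (w \<eta> * exp (\<i> * of_int (n + 1) * of_real \<eta>)) +
      (of_real (f 1) + \<i> * of_real (f \<i>)) / 2 * (w \<eta> * exp (\<i> * of_int (n + -1) * of_real \<eta>)))"
    unfolding f exp_add_int by (intro integral_cong) (simp only: algebra_simps)
  also have "\<dots> = (of_real (f 1) - \<i> * of_real (f \<i>)) / 2 * 0 + (of_real (f 1) + \<i> * of_real (f \<i>)) / 2 * 0"
    by (subst integral_add)
       (intro integrable_continuous_real continuous_intros linear(2),
        intro integrable_continuous_real continuous_intros linear(2), simp only: integral_mult_right linear(3))
  finally show ?case by simp
next
  case (const c)
  have "integral {0..2*pi} (\<lambda>\<eta>. w \<eta> * of_real c * exp (\<i> * of_int n * of_real \<eta>)) =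
    integral {0..2*pi} (\<lambda>\<eta>. of_real c * (w \<eta> * exp (\<i> * of_int n * of_real \<eta>)))"
    by (intro integral_cong) simp
  then show ?case using const(2) by simp
next
  case (add p q)
  have c: "continuous_on {0..2*pi} (\<lambda>\<eta>. p (exp (\<i> * of_real \<eta>)))" "continuous_on {0..2*pi} (\<lambda>\<eta>. q (exp (\<i> * of_real \<eta>)))"
    by (intro continuous_on_real_polynomial_exp add.hyps)+
  have "integral {0..2*pi} (\<lambda>\<eta>. w \<eta> * of_real (p (exp (\<i> * of_real \<eta>)) + q (exp (\<i> * of_real \<eta>))) * exp (\<i> * of_int n * of_real \<eta>)) =
     integral {0..2*pi} (\<lambda>\<eta>. w \<eta> * of_real (p (exp (\<i> * of_real \<eta>))) * exp (\<i> * of_int n * of_real \<eta>) +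
       w \<eta> * of_real (q (exp (\<i> * of_real \<eta>))) * exp (\<i> * of_int n * of_real \<eta>))"
    by (intro integral_cong) (simp add: algebra_simps)
  also have "\<dots> = 0"
    by (subst integral_add) (auto intro!: integrable_continuous_real continuous_intros add.prems c simp: add.IH[OF add.prems])
  finally show ?case .
next
  case (mult p q)
  have c: "continuous_on {0..2*pi} (\<lambda>\<eta>. p (exp (\<i> * of_real \<eta>)))"
    by (intro continuous_on_real_polynomial_exp mult.hyps)
  have "integral {0..2*pi} (\<lambda>\<eta>. (w \<eta> * of_real (p (exp (\<i> * of_real \<eta>)))) * of_real (q (exp (\<i> * of_real \<eta>))) * exp (\<i> * of_int n * of_real \<eta>)) = 0"
    by (rule mult.IH(2)) (auto intro!: continuous_intros c mult.prems mult.IH(1))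
  then show ?case by (simp add: mult_ac)
qed

text \<open>\<open>w\<close> is orthogonal to all polynomials on the circle, which approximate \<open>cnj w\<close> uniformly by the
  theorem of Stone and Weierstrass; so \<open>\<integral> |w|\<^sup>2 = 0\<close>.\<close>

lemma Fourier_coefficients_zero_imp_zero:
  assumes w: "continuous_on {0..2*pi} w" and per: "w 0 = w (2*pi)"
    and zero: "\<And>n::int. integral {0..2*pi} (\<lambda>\<eta>. w \<eta> * exp (\<i> * of_int n * of_real \<eta>)) = 0"
    and x: "x \<in> {0..2*pi}"
  shows "w x = (0::complex)"
proof -
  let ?e = "\<lambda>\<eta>::real. exp (\<i> * of_real \<eta>)"
  define W where "W = (\<lambda>z. w (Arg2pi z))"
  have We: "W (?e \<eta>) = w \<eta>" if "\<eta> \<in> {0..2*pi}" for \<eta>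
  proof (cases "\<eta> = 2 * pi")
    case True
    then have "?e \<eta> = 1" by (simp add: exp_eq_1 mult_ac)
    moreover have "Arg2pi 1 = 0" by (simp add: Arg2pi_eq_0)
    ultimately show ?thesis using True per by (simp add: W_def)
  next
    case False
    then have "Arg2pi (?e \<eta>) = \<eta>"
      using that by (intro Arg2pi_unique[of 1]) auto
    then show ?thesis by (simp add: W_def)
  qed
  \<comment> \<open>\<open>Arg2pi\<close> jumps at 1; continuity holds because the circle is a quotient of the compact interval,
    so that preimages of closed sets are images of compact ones\<close>
  have contW: "continuous_on (sphere 0 1) W"
    unfolding continuous_closedin_preimage_eq
  proof (intro allI impI)
    fix T :: "complex set" assume T: "closed T"
    have img: "?e \<eta> \<in> sphere 0 1" for \<eta> by simp
    have "sphere 0 1 \<inter> W -` T = ?e ` ({0..2*pi} \<inter> w -` T)"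
    proof (intro equalityI subsetI)
      fix z assume z: "z \<in> sphere 0 1 \<inter> W -` T"
      then have "z = ?e (Arg2pi z)" using Arg2pi_eq[of z] by simp
      moreover have "Arg2pi z \<in> {0..2*pi}" using Arg2pi[of z] by auto
      moreover have "w (Arg2pi z) \<in> T" using z by (simp add: W_def)
      ultimately show "z \<in> ?e ` ({0..2*pi} \<inter> w -` T)" by blast
    next
      fix z assume "z \<in> ?e ` ({0..2*pi} \<inter> w -` T)"
      then show "z \<in> sphere 0 1 \<inter> W -` T" using We by auto
    qed
    moreover have "compact ({0..2*pi} \<inter> w -` T)"
      using compact_Int_closed[OF compact_Icc[of 0 "2*pi"] continuous_closed_preimage[OF w closed_atLeastAtMost T]]
      by (simp only: Int_assoc[symmetric] Int_absorb)
    then have "compact (?e ` ({0..2*pi} \<inter> w -` T))"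
      by (intro compact_continuous_image continuous_intros)
    ultimately show "closedin (top_of_set (sphere 0 1)) (sphere 0 1 \<inter> W -` T)"
      by (metis Int_lower1 closed_subset compact_imp_closed)
  qed
  have "compact (w ` {0..2*pi})" by (intro compact_continuous_image w) simp
  then obtain K where K: "\<And>\<eta>. \<eta> \<in> {0..2*pi} \<Longrightarrow> norm (w \<eta>) \<le> K"
    using compact_imp_bounded bounded_iff by (metis imageI)
  have K0: "K \<ge> 0" using K[OF x] norm_ge_zero order_trans by blast
  have cw: "continuous_on {0..2*pi} (\<lambda>\<eta>. (norm (w \<eta>))\<^sup>2)"
    by (intro continuous_intros w)
  have small: "integral {0..2*pi} (\<lambda>\<eta>. (norm (w \<eta>))\<^sup>2) \<le> K * \<epsilon> * (2 * pi)" if \<epsilon>: "\<epsilon> > 0" for \<epsilon>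
  proof -
    have "continuous_on (sphere 0 1) (\<lambda>z. cnj (W z))" by (intro continuous_intros contW)
    then obtain g where g: "polynomial_function g" "\<And>z. z \<in> sphere 0 1 \<Longrightarrow> norm (cnj (W z) - g z) < \<epsilon>"
      using Stone_Weierstrass_polynomial_function[of "sphere (0::complex) 1" "\<lambda>z. cnj (W z)" \<epsilon>] \<epsilon> by auto
    have re: "real_polynomial_function (\<lambda>z. Re (g z))" and im: "real_polynomial_function (\<lambda>z. Im (g z))"
      using g(1) bounded_linear_Re bounded_linear_Im unfolding polynomial_function_def o_def by blast+
    have cg: "continuous_on {0..2*pi} (\<lambda>\<eta>. g (?e \<eta>))"
      by (rule continuous_on_compose2[of UNIV g]) (auto intro!: continuous_on_polymonial_function[OF g(1)] continuous_intros)
    have "integral {0..2*pi} (\<lambda>\<eta>. w \<eta> * g (?e \<eta>)) =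
      integral {0..2*pi} (\<lambda>\<eta>. w \<eta> * of_real (Re (g (?e \<eta>))) * exp (\<i> * of_int 0 * of_real \<eta>) +
        \<i> * (w \<eta> * of_real (Im (g (?e \<eta>))) * exp (\<i> * of_int 0 * of_real \<eta>)))"
      by (intro integral_cong) (simp add: complex_eq_iff algebra_simps)
    also have "\<dots> = 0"
      using Fourier_zero_times_polynomial[OF re w zero, of 0] Fourier_zero_times_polynomial[OF im w zero, of 0]
      by (subst integral_add) (auto intro!: integrable_continuous_real continuous_intros w cg)
    finally have wg: "integral {0..2*pi} (\<lambda>\<eta>. w \<eta> * g (?e \<eta>)) = 0" .
    have "of_real (integral {0..2*pi} (\<lambda>\<eta>. (norm (w \<eta>))\<^sup>2)) = integral {0..2*pi} (\<lambda>\<eta>. w \<eta> * cnj (w \<eta>))"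
      by (subst integral_linear[OF _ bounded_linear_of_real, unfolded o_def, symmetric])
         (auto intro!: integrable_continuous_real cw integral_cong simp: complex_norm_square[symmetric])
    also have "\<dots> = integral {0..2*pi} (\<lambda>\<eta>. w \<eta> * (cnj (w \<eta>) - g (?e \<eta>)))"
      unfolding right_diff_distrib using wg
      by (subst integral_diff) (auto intro!: integrable_continuous_real continuous_intros w cg)
    finally have "norm (complex_of_real (integral {0..2*pi} (\<lambda>\<eta>. (norm (w \<eta>))\<^sup>2))) =
       norm (integral {0..2*pi} (\<lambda>\<eta>. w \<eta> * (cnj (w \<eta>) - g (?e \<eta>))))" by simp
    also have "\<dots> \<le> K * \<epsilon> * (2 * pi - 0)"
    proof (rule integral_bound)
      fix \<eta> assume \<eta>: "\<eta> \<in> {0..2*pi}"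
      then have "norm (cnj (w \<eta>) - g (?e \<eta>)) \<le> \<epsilon>"
        using g(2)[of "?e \<eta>"] We[OF \<eta>] by simp
      then show "norm (w \<eta> * (cnj (w \<eta>) - g (?e \<eta>))) \<le> K * \<epsilon>"
        unfolding norm_mult using K[OF \<eta>] K0 by (intro mult_mono) auto
    qed (auto intro!: continuous_intros w cg)
    finally show ?thesis by (simp add: abs_le_iff)
  qed
  have "integral {0..2*pi} (\<lambda>\<eta>. (norm (w \<eta>))\<^sup>2) \<le> 0"
  proof (rule field_le_epsilon)
    fix e :: real assume e: "e > 0"
    have "integral {0..2*pi} (\<lambda>\<eta>. (norm (w \<eta>))\<^sup>2) \<le> K * (e / (K + 1) / (2 * pi)) * (2 * pi)"
      using K0 e by (intro small) (auto intro!: divide_pos_pos mult_pos_pos)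
    also have "\<dots> = e * (K / (K + 1))" by simp
    also have "\<dots> \<le> e * 1" using K0 e by (intro mult_left_mono) auto
    finally show "integral {0..2*pi} (\<lambda>\<eta>. (norm (w \<eta>))\<^sup>2) \<le> 0 + e" by simp
  qed
  moreover have "integral {0..2*pi} (\<lambda>\<eta>. (norm (w \<eta>))\<^sup>2) \<ge> 0"
    by (intro integral_nonneg integrable_continuous_real cw) auto
  ultimately have "integral {0..2*pi} (\<lambda>\<eta>. (norm (w \<eta>))\<^sup>2) = 0" by simp
  then show ?thesis
    using integral_eq_0_iff[OF cw] x by simp
qed

section \<open>Entire periodic functions\<close>

text \<open>\<open>f(z) = G(exp (2 \<pi> \<i> z))\<close> with \<open>G\<close> holomorphic off 0. The growth condition says that
  \<open>G(\<zeta>)\<close> is \<open>o(|\<zeta>|)\<close> at infinity and \<open>o(1/|\<zeta>|)\<close> at 0. So \<open>\<zeta> G(\<zeta>)\<close> extends to an entire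
  function that vanishes at 0 and is \<open>o(|\<zeta>|\<^sup>2)\<close>, and by Liouville it is a multiple of \<open>\<zeta>\<close>.\<close>

lemma entire_periodic_bounded_growth_constant:
  assumes hol: "f holomorphic_on UNIV" and per: "\<And>z. f (z + 1) = f z"
    and growth: "\<And>\<epsilon>. \<epsilon> > 0 \<Longrightarrow> \<exists>Y. \<forall>z. \<bar>Re z\<bar> \<le> 1 \<longrightarrow> \<bar>Im z\<bar> \<ge> Y \<longrightarrow> norm (f z) \<le> \<epsilon> * exp (2 * pi * \<bar>Im z\<bar>)"
  shows "f z = f 0"
proof -
  have per_int: "f (z + of_int n) = f z" for z n
  proof (induction n rule: int_induct[where k = 0])
    case (step1 i)
    then show ?case using per[of "z + of_int i"] by (simp add: add_ac)
  next
    case (step2 i)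
    then show ?case using per[of "z + of_int (i - 1)"] by (simp add: algebra_simps)
  qed auto
  define G where "G = (\<lambda>z. f (Ln z / (2 * pi * \<i>)))"
  have G_exp: "G (exp (2 * pi * \<i> * z)) = f z" for z
  proof -
    have "exp (Ln (exp (2 * pi * \<i> * z))) = exp (2 * pi * \<i> * z)" by simp
    then obtain n :: int where "Ln (exp (2 * pi * \<i> * z)) = 2 * pi * \<i> * z + (of_int (2 * n) * pi) * \<i>"
      unfolding exp_eq by blast
    then have "Ln (exp (2 * pi * \<i> * z)) / (2 * pi * \<i>) = z + of_int n"
      by (simp add: field_simps)
    then show ?thesis unfolding G_def by (simp add: per_int)
  qed
  have hol_G: "G holomorphic_on - {0}"
  proof -
    have "G holomorphic_on - \<real>\<^sub>\<le>\<^sub>0"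
      unfolding G_def by (intro holomorphic_on_compose_gen[OF _ hol, unfolded o_def] holomorphic_intros) auto
    \<comment> \<open>a second branch of the logarithm covers the negative axis\<close>
    moreover have "(\<lambda>z. f (Ln (- z) / (2 * pi * \<i>) + 1/2)) holomorphic_on - \<real>\<^sub>\<ge>\<^sub>0"
      by (intro holomorphic_on_compose_gen[OF _ hol, unfolded o_def] holomorphic_intros)
         (auto simp: complex_nonpos_Reals_iff complex_nonneg_Reals_iff)
    moreover have "f (Ln (- z) / (2 * pi * \<i>) + 1/2) = G z" if "z \<in> - \<real>\<^sub>\<ge>\<^sub>0" for z
    proof -
      have z: "z \<noteq> 0" using that by auto
      have "2 * pi * \<i> * (Ln (- z) / (2 * pi * \<i>) + 1/2) = Ln (- z) + pi * \<i>"
        by (simp add: field_simps)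
      then have "exp (2 * pi * \<i> * (Ln (- z) / (2 * pi * \<i>) + 1/2)) = exp (Ln (- z)) * exp (pi * \<i>)"
        by (simp only: exp_add)
      also have "\<dots> = z" using z by (simp add: exp_Ln)
      finally show ?thesis using G_exp by metis
    qed
    ultimately have "G holomorphic_on - \<real>\<^sub>\<le>\<^sub>0" "G holomorphic_on - \<real>\<^sub>\<ge>\<^sub>0"
      using holomorphic_transform by blast+
    then have "G holomorphic_on (- \<real>\<^sub>\<le>\<^sub>0 \<union> - \<real>\<^sub>\<ge>\<^sub>0)"
      by (intro holomorphic_on_Un) (auto simp: open_Compl)
    moreover have "- \<real>\<^sub>\<le>\<^sub>0 \<union> - \<real>\<^sub>\<ge>\<^sub>0 = - {0::complex}"
      by (auto simp: complex_nonpos_Reals_iff complex_nonneg_Reals_iff complex_eq_iff)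
    ultimately show ?thesis by simp
  qed
  have bound: "\<exists>Y>0. \<forall>z. z \<noteq> 0 \<longrightarrow> \<bar>ln (norm z)\<bar> \<ge> Y \<longrightarrow> norm (G z) \<le> \<epsilon> * exp \<bar>ln (norm z)\<bar>" if \<epsilon>: "\<epsilon> > 0" for \<epsilon>
  proof -
    obtain Y where Y: "\<And>z. \<bar>Re z\<bar> \<le> 1 \<Longrightarrow> \<bar>Im z\<bar> \<ge> Y \<Longrightarrow> norm (f z) \<le> \<epsilon> * exp (2 * pi * \<bar>Im z\<bar>)"
      using growth[OF \<epsilon>] by blast
    have "norm (G z) \<le> \<epsilon> * exp \<bar>ln (norm z)\<bar>"
      if z: "z \<noteq> 0" "\<bar>ln (norm z)\<bar> \<ge> 2 * pi * \<bar>Y\<bar> + 1" for z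
    proof -
      let ?\<nu> = "Ln z / (2 * pi * \<i>)"
      have re: "Re ?\<nu> = Im (Ln z) / (2 * pi)"
        by (simp add: Re_divide power2_eq_square)
      have "Im ?\<nu> = - ln (norm z) / (2 * pi)"
        using z by (simp add: Im_divide power2_eq_square)
      then have im: "\<bar>Im ?\<nu>\<bar> = \<bar>ln (norm z)\<bar> / (2 * pi)"
        by (simp add: abs_divide)
      have "\<bar>Im (Ln z)\<bar> \<le> pi" using mpi_less_Im_Ln[OF z(1)] Im_Ln_le_pi[OF z(1)] by auto
      then have "\<bar>Re ?\<nu>\<bar> \<le> 1" unfolding re by (simp add: abs_divide)
      moreover have "2 * pi * Y \<le> \<bar>ln (norm z)\<bar>"
        using z(2) mult_left_mono[of Y "\<bar>Y\<bar>" "2 * pi", OF abs_ge_self] pi_gt_zero by linarith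
      then have "\<bar>Im ?\<nu>\<bar> \<ge> Y" unfolding im using z(2) by (simp add: field_simps)
      ultimately have "norm (f ?\<nu>) \<le> \<epsilon> * exp (2 * pi * \<bar>Im ?\<nu>\<bar>)" by (rule Y)
      then show ?thesis unfolding im by (simp add: G_def)
    qed
    then show ?thesis by (intro exI[of _ "2 * pi * \<bar>Y\<bar> + 1"]) (auto intro: add_nonneg_pos)
  qed
  define H where "H = (\<lambda>z. if z = 0 then 0 else z * G z)"
  have small: "\<exists>r>0. \<forall>z. z \<noteq> 0 \<longrightarrow> norm z < r \<longrightarrow> norm (z * G z) \<le> \<epsilon>" if \<epsilon>: "\<epsilon> > 0" for \<epsilon>
  proof -
    obtain Y where Y: "Y > 0" "\<And>z. z \<noteq> 0 \<Longrightarrow> \<bar>ln (norm z)\<bar> \<ge> Y \<Longrightarrow> norm (G z) \<le> \<epsilon> * exp \<bar>ln (norm z)\<bar>"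
      using bound[OF \<epsilon>] by blast
    have "norm (z * G z) \<le> \<epsilon>" if z: "z \<noteq> 0" "norm z < exp (- Y)" for z
    proof -
      have l: "ln (norm z) < - Y" using z by (metis ln_exp ln_less_cancel_iff exp_gt_zero zero_less_norm_iff)
      then have "norm (G z) \<le> \<epsilon> * exp (- ln (norm z))" using Y(1) Y(2)[OF z(1)] by simp
      also have "\<dots> = \<epsilon> / norm z" using z by (simp add: exp_minus field_simps)
      finally show ?thesis using z by (simp add: norm_mult field_simps)
    qed
    then show ?thesis by (intro exI[of _ "exp (- Y)"]) auto
  qed
  have large: "\<exists>r>0. \<forall>z. norm z \<ge> r \<longrightarrow> norm (H z) \<le> \<epsilon> * norm z ^ 2" if \<epsilon>: "\<epsilon> > 0" for \<epsilon>
  proof -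
    obtain Y where Y: "Y > 0" "\<And>z. z \<noteq> 0 \<Longrightarrow> \<bar>ln (norm z)\<bar> \<ge> Y \<Longrightarrow> norm (G z) \<le> \<epsilon> * exp \<bar>ln (norm z)\<bar>"
      using bound[OF \<epsilon>] by blast
    have "norm (H z) \<le> \<epsilon> * norm z ^ 2" if z: "norm z \<ge> exp Y" for z
    proof -
      have z0: "z \<noteq> 0" using z by (metis exp_gt_zero norm_zero not_le)
      have l: "ln (norm z) \<ge> Y" using z z0 by (metis ln_exp ln_le_cancel_iff exp_gt_zero zero_less_norm_iff)
      then have "\<bar>ln (norm z)\<bar> = ln (norm z)" using Y(1) by linarith
      then have "exp \<bar>ln (norm z)\<bar> = norm z" using z0 by (simp only: exp_ln zero_less_norm_iff simp_thms)
      then have "norm (G z) \<le> \<epsilon> * norm z" using Y(2)[OF z0] l by simp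
      then have "norm z * norm (G z) \<le> norm z * (\<epsilon> * norm z)" by (intro mult_left_mono) auto
      then show ?thesis using z0 by (simp add: H_def norm_mult power2_eq_square mult_ac)
    qed
    then show ?thesis by (intro exI[of _ "exp Y"]) auto
  qed
  have "((\<lambda>z. z * G z) \<longlongrightarrow> 0) (at 0)"
  proof (rule LIM_I)
    fix \<epsilon> :: real assume "\<epsilon> > 0"
    then obtain r where r: "r > 0" "\<And>z. z \<noteq> 0 \<Longrightarrow> norm z < r \<Longrightarrow> norm (z * G z) \<le> \<epsilon> / 2"
      using small[of "\<epsilon> / 2"] by auto
    have "norm (z * G z - 0) < \<epsilon>" if "z \<noteq> 0 \<and> norm (z - 0) < r" for z
      using r(2)[of z] that \<open>\<epsilon> > 0\<close> by simp
    then show "\<exists>s>0. \<forall>x. x \<noteq> 0 \<and> norm (x - 0) < s \<longrightarrow> norm (x * G x - 0) < \<epsilon>"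
      using r(1) by blast
  qed
  then have holH: "H holomorphic_on UNIV"
    unfolding H_def using hol_G
    by (intro removable_singularity) (auto intro!: holomorphic_intros simp: Compl_eq_Diff_UNIV)
  obtain r where r: "\<And>z. norm z \<ge> r \<Longrightarrow> norm (H z) \<le> 1 * norm z ^ 2" using large[of 1] by auto
  define a where "a = (\<lambda>k. (deriv ^^ k) H 0 / fact k)"
  have H_eq: "H z = a 1 * z + a 2 * z\<^sup>2" for z
  proof -
    have "H z = (\<Sum>k\<le>2. a k * z ^ k)"
      unfolding a_def by (rule Liouville_polynomial[OF holH r])
    then show ?thesis by (simp add: numeral_2_eq_2 a_def H_def)
  qed
  have "a 2 = 0"
  proof (rule ccontr)
    assume a2: "a 2 \<noteq> 0"
    define \<epsilon> where "\<epsilon> = norm (a 2) / 2"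
    have e: "\<epsilon> > 0" using a2 by (simp add: \<epsilon>_def)
    obtain r where r: "r > 0" "\<And>z. norm z \<ge> r \<Longrightarrow> norm (H z) \<le> \<epsilon> * norm z ^ 2" using large[OF e] by auto
    define R where "R = r + norm (a 1) / \<epsilon> + 1"
    have R: "R \<ge> r" "R > norm (a 1) / \<epsilon>" "R > 0" using r(1) e by (auto simp: R_def add_nonneg_pos add_pos_nonneg)
    have "norm (a 2) * R\<^sup>2 = norm (H (of_real R) - a 1 * of_real R)"
      by (simp add: H_eq norm_mult norm_power)
    also have "\<dots> \<le> norm (H (of_real R)) + norm (a 1) * R"
      using R(3) by (intro order_trans[OF norm_triangle_ineq4]) (simp add: norm_mult)
    also have "\<dots> \<le> \<epsilon> * R\<^sup>2 + norm (a 1) * R" using r(2)[of "of_real R"] R by simp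
    also have "norm (a 1) * R < \<epsilon> * R * R"
      using R e by (intro mult_strict_right_mono) (auto simp: field_simps)
    finally show False by (simp add: \<epsilon>_def power2_eq_square)
  qed
  then have "G z = a 1" if "z \<noteq> 0" for z using H_eq[of z] that by (simp add: H_def)
  then show ?thesis using G_exp[of z] G_exp[of 0] by simp
qed

section \<open>Hill determinants\<close>

text \<open>\<open>I\<close> plus this matrix is \<open>u (n - m) - (n + \<nu>)\<^sup>2 \<delta>\<^sub>n\<^sub>m\<close>, the matrix of \<open>g'' + U g = 0\<close> in
  Fourier space with Floquet exponent \<open>\<nu>\<close>, with row \<open>n\<close> divided by \<open>B - (n + \<nu>)\<^sup>2\<close>. The
  number \<open>B\<close> is free; different purposes ask for different values.\<close>

definition hill_perturbation :: "(int \<Rightarrow> complex) \<Rightarrow> complex \<Rightarrow> complex \<Rightarrow> int \<Rightarrow> int \<Rightarrow> complex" where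
  "hill_perturbation u B \<nu> n m = (u (n - m) - (if n = m then B else 0)) / (B - (of_int n + \<nu>)\<^sup>2)"

lemma summable_on_int_powr: "(\<lambda>n::int. (1 + \<bar>of_int n\<bar>) powr (-3/2) :: real) summable_on UNIV"
proof -
  let ?f = "\<lambda>n::int. (1 + \<bar>of_int n\<bar>) powr (-3/2) :: real"
  have s: "summable (\<lambda>n. of_nat n powr (-3/2) :: real)"
    by (simp add: summable_real_powr_iff)
  then have "summable (\<lambda>n. of_nat (Suc n) powr (-3/2) :: real)"
    by (subst summable_Suc_iff)
  then have *: "(\<lambda>n::nat. of_nat (Suc n) powr (-3/2) :: real) summable_on UNIV"
    by (rule summable_nonneg_imp_summable_on) auto
  have "?f summable_on range int"
    by (subst summable_on_reindex) (use * in \<open>auto simp: o_def add_ac\<close>)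
  moreover have "?f summable_on range (\<lambda>n. - int n)"
    by (subst summable_on_reindex) (use * in \<open>auto simp: o_def add_ac inj_on_def\<close>)
  ultimately have "?f summable_on range int \<union> range (\<lambda>n. - int n)"
    by (rule summable_on_union)
  also have "range int \<union> range (\<lambda>n. - int n) = UNIV"
    by (auto simp: image_iff) (metis int_cases2)
  finally show ?thesis .
qed

text \<open>Write \<open>q = q\<^sup>3\<^sup>/\<^sup>4 q\<^sup>1\<^sup>/\<^sup>4\<close>: the first factor gives a weight of exponent \<open>-3/2\<close>, still summable
  over the integers, and the second one leaves some decay in \<open>y\<close>, for which the distance of \<open>\<nu>\<close> from
  the real axis is taken below.\<close>

lemma powr_le_of_quadratic:
  fixes q a y :: real
  assumes "q \<ge> (1 + a)\<^sup>2 / 8" "q \<ge> y\<^sup>2" "y > 0" "a \<ge> 0"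
  shows "1 / q \<le> 8 * y powr (-1/2) * (1 + a) powr (-3/2)"
proof -
  have q: "q > 0" using assms by (metis zero_less_power order_less_le_trans)
  have "((1 + a)\<^sup>2 / 8) powr (3/4) * (y\<^sup>2) powr (1/4) \<le> q powr (3/4) * q powr (1/4)"
    using assms q by (intro mult_mono powr_mono2) auto
  also have "\<dots> = q" using q by (simp add: powr_add[symmetric])
  finally have "((1 + a)\<^sup>2 / 8) powr (3/4) * (y\<^sup>2) powr (1/4) \<le> q" .
  moreover have "((1 + a)\<^sup>2 / 8) powr (3/4) = (1 + a) powr (3/2) / 8 powr (3/4)"
    using assms by (simp add: powr_divide powr_powr flip: powr_numeral)
  moreover have "(y\<^sup>2) powr (1/4) = y powr (1/2)"
    using assms by (simp add: powr_powr flip: powr_numeral)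
  ultimately have le: "(1 + a) powr (3/2) * y powr (1/2) / 8 powr (3/4) \<le> q" by simp
  have pos: "(1 + a) powr (3/2) * y powr (1/2) / 8 powr (3/4) > 0" using assms by simp
  have "1 / q \<le> 1 / ((1 + a) powr (3/2) * y powr (1/2) / 8 powr (3/4))"
    by (intro frac_le le pos) auto
  also have "\<dots> = 8 powr (3/4) * (y powr (-1/2) * (1 + a) powr (-3/2))"
    by (simp add: powr_minus_divide)
  also have "\<dots> \<le> 8 powr 1 * (y powr (-1/2) * (1 + a) powr (-3/2))"
    by (intro mult_right_mono powr_mono) auto
  finally show ?thesis by simp
qed

lemma koch_hill_perturbation:
  assumes u: "(\<lambda>k. norm (u k)) summable_on UNIV"
    and w: "w summable_on UNIV" "\<And>n. norm (1 / (B - (of_int n + \<nu>)\<^sup>2)) \<le> w n"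
  shows "koch_matrix (hill_perturbation u B \<nu>) w (\<lambda>k. norm (u k) + (if k = 0 then norm B else 0))"
proof
  show "w n \<ge> 0" for n using w(2)[of n] norm_ge_zero order_trans by blast
  have "(\<lambda>k::int. if k = 0 then norm B else 0) summable_on UNIV"
    by (subst summable_on_cong_neutral[where T = "{0}" and g = "\<lambda>_. norm B"]) auto
  then show "(\<lambda>k. norm (u k) + (if k = 0 then norm B else 0)) summable_on UNIV"
    using u by (intro summable_on_add)
  show "norm (hill_perturbation u B \<nu> n m) \<le> w n * (norm (u (n - m)) + (if n - m = 0 then norm B else 0))" for n m
  proof -
    have "norm (hill_perturbation u B \<nu> n m) = norm (1 / (B - (of_int n + \<nu>)\<^sup>2)) * norm (u (n - m) - (if n = m then B else 0))"
      by (simp add: hill_perturbation_def norm_divide norm_mult)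
    also have "\<dots> \<le> w n * (norm (u (n - m)) + (if n - m = 0 then norm B else 0))"
      using norm_triangle_ineq4[of "u 0" B] by (intro mult_mono w) (auto intro: order_trans[OF norm_ge_zero w(2)])
    finally show ?thesis .
  qed
qed (auto simp: w)

lemma summable_on_inverse_quadratic:
  "(\<lambda>n::int. norm (1 / (B - (of_int n + \<nu>)\<^sup>2) :: complex)) summable_on UNIV"
proof -
  \<comment> \<open>for \<open>|n| \<ge> K\<close> the denominator is at least \<open>(1 + |n|)\<^sup>2 / 8\<close>\<close>
  define K where "K = 2 * norm \<nu> + 4 * norm B + 4"
  let ?f = "\<lambda>n::int. norm (1 / (B - (of_int n + \<nu>)\<^sup>2))"
  let ?S = "{- \<lceil>K\<rceil>..\<lceil>K\<rceil>}"
  have "?f summable_on - ?S"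
  proof (rule summable_on_comparison_test)
    show "(\<lambda>n::int. 8 * 1 powr (-1/2) * (1 + \<bar>of_int n\<bar>) powr (-3/2) :: real) summable_on - ?S"
      by (intro summable_on_cmult_right summable_on_subset[OF summable_on_int_powr]) auto
    fix n :: int assume "n \<in> - ?S"
    then have "\<bar>n\<bar> > \<lceil>K\<rceil>" by auto
    then have n: "\<bar>real_of_int n\<bar> \<ge> K" by linarith
    define t where "t = \<bar>real_of_int n\<bar>"
    have t: "t \<ge> 2 * norm \<nu> + 4 * norm B + 4" using n by (simp add: t_def K_def)
    have t4: "t \<ge> 4" and tB: "t \<ge> 4 * norm B + 4" using t norm_ge_zero[of B] norm_ge_zero[of \<nu>] by linarith+
    have "norm (of_int n + \<nu>) \<ge> t - norm \<nu>"
      using norm_diff_ineq[of "of_int n" \<nu>] by (simp add: t_def)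
    then have "norm (of_int n + \<nu>) \<ge> t / 2" using t norm_ge_zero[of B] by linarith
    then have "(t / 2)\<^sup>2 \<le> norm (of_int n + \<nu>) ^ 2" using t4 by (intro power_mono) auto
    then have "norm ((of_int n + \<nu>)\<^sup>2) \<ge> t\<^sup>2 / 4" by (simp add: norm_power power_divide)
    then have 1: "norm (B - (of_int n + \<nu>)\<^sup>2) \<ge> t\<^sup>2 / 4 - norm B"
      using norm_triangle_ineq2[of "(of_int n + \<nu>)\<^sup>2" B] by (simp add: norm_minus_commute)
    have "t * t \<ge> 4 * t" using t4 by (intro mult_right_mono) auto
    then have t2: "t\<^sup>2 \<ge> 4 * t" by (simp add: power2_eq_square)
    have "(1 + t)\<^sup>2 = 1 + 2 * t + t\<^sup>2" by (simp add: power2_eq_square algebra_simps)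
    then have 3: "(1 + t)\<^sup>2 \<ge> 25" using t2 t4 by linarith
    have 2: "norm (B - (of_int n + \<nu>)\<^sup>2) \<ge> (1 + t)\<^sup>2 / 8"
      using 1 tB t2 t4 \<open>(1 + t)\<^sup>2 = 1 + 2 * t + t\<^sup>2\<close> by linarith
    moreover have "(1 + t)\<^sup>2 / 8 \<ge> 1\<^sup>2" using 3 by simp
    ultimately have "1 / norm (B - (of_int n + \<nu>)\<^sup>2) \<le> 8 * 1 powr (-1/2) * (1 + t) powr (-3/2)"
      using t4 by (intro powr_le_of_quadratic) auto
    then show "norm (1 / (B - (of_int n + \<nu>)\<^sup>2)) \<le> 8 * 1 powr (-1/2) * (1 + \<bar>of_int n\<bar>) powr (-3/2)"
      by (simp add: t_def norm_divide)
  qed auto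
  moreover have "?f summable_on ?S" by (rule summable_on_finite) simp
  ultimately have "?f summable_on - ?S \<union> ?S" by (rule summable_on_union)
  then show ?thesis by (simp add: Compl_partition2)
qed

lemma prod_symmetric_interval:
  "(\<Prod>n\<in>{- int N..int N}. (z + of_int n) * (w - of_int n)) =
    z * w * (\<Prod>k = 1..N. (z\<^sup>2 - (of_nat k)\<^sup>2) * (w\<^sup>2 - (of_nat k)\<^sup>2) :: complex)"
proof (induction N)
  case (Suc N)
  have "{- int (Suc N)..int (Suc N)} = insert (int (Suc N)) (insert (- int (Suc N)) {- int N..int N})" by auto
  then show ?case using Suc
    by (simp add: power2_eq_square algebra_simps del: of_nat_Suc)
qed simp

text \<open>Factor \<open>B - (n + \<nu>)\<^sup>2 = (b + \<nu> + n) (b - \<nu> - n)\<close>, pair \<open>n\<close> with \<open>-n\<close>, and compare with Euler's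
  product for the sine at \<open>b + \<nu>\<close> and at \<open>b - \<nu>\<close>; the factors \<open>k\<^sup>2\<close> taken out make up \<open>N!\<^sup>4\<close>.\<close>

lemma sine_product_symmetric:
  assumes "b\<^sup>2 = (B::complex)"
  shows "(\<lambda>N. of_real pi ^ 2 / fact N ^ 4 * (\<Prod>n\<in>{- int N..int N}. B - (of_int n + \<nu>)\<^sup>2))
    \<longlonglongrightarrow> sin (of_real pi * (b + \<nu>)) * sin (of_real pi * (b - \<nu>))"
proof -
  let ?p = "\<lambda>z N. of_real pi * z * (\<Prod>k = 1..N. 1 - z\<^sup>2 / (of_nat k)\<^sup>2 :: complex)"
  have "of_real pi ^ 2 / fact N ^ 4 * (\<Prod>n\<in>{- int N..int N}. B - (of_int n + \<nu>)\<^sup>2) = ?p (b + \<nu>) N * ?p (b - \<nu>) N" for N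
  proof -
    let ?z = "b + \<nu>" and ?w = "b - \<nu>"
    have "B - (of_int n + \<nu>)\<^sup>2 = (?z + of_int n) * (?w - of_int n)" for n
      using assms by (auto simp: power2_eq_square algebra_simps)
    then have "(\<Prod>n\<in>{- int N..int N}. B - (of_int n + \<nu>)\<^sup>2) =
        ?z * ?w * (\<Prod>k = 1..N. (?z\<^sup>2 - (of_nat k)\<^sup>2) * (?w\<^sup>2 - (of_nat k)\<^sup>2))"
      by (simp add: prod_symmetric_interval)
    also have "(\<Prod>k = 1..N. (?z\<^sup>2 - (of_nat k)\<^sup>2) * (?w\<^sup>2 - (of_nat k)\<^sup>2)) =
        (\<Prod>k = 1..N. (of_nat k ^ 4) * ((1 - ?z\<^sup>2 / (of_nat k)\<^sup>2) * (1 - ?w\<^sup>2 / (of_nat k)\<^sup>2)))"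
      by (intro prod.cong refl) (simp add: field_simps power_numeral_reduce)
    also have "\<dots> = fact N ^ 4 * ((\<Prod>k = 1..N. 1 - ?z\<^sup>2 / (of_nat k)\<^sup>2) * (\<Prod>k = 1..N. 1 - ?w\<^sup>2 / (of_nat k)\<^sup>2))"
      by (simp add: prod.distrib fact_prod prod_power_distrib)
    finally show ?thesis by (simp add: power2_eq_square)
  qed
  then have "(\<lambda>N. of_real pi ^ 2 / fact N ^ 4 * (\<Prod>n\<in>{- int N..int N}. B - (of_int n + \<nu>)\<^sup>2)) =
      (\<lambda>N. ?p (b + \<nu>) N * ?p (b - \<nu>) N)" by (rule ext)
  then show ?thesis by (simp only:) (intro tendsto_mult sin_product_formula_complex)
qed

lemma sin_mult_sin_complex:
  "sin (p * (b + \<nu>)) * sin (p * (b - \<nu>)) = (sin (p * b))\<^sup>2 - (sin (p * \<nu>))\<^sup>2" for p b \<nu> :: complex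
proof -
  have "sin (p * (b + \<nu>)) * sin (p * (b - \<nu>)) =
      (sin (p * b) * cos (p * \<nu>))\<^sup>2 - (cos (p * b) * sin (p * \<nu>))\<^sup>2"
    by (simp add: distrib_left right_diff_distrib sin_add sin_diff power2_eq_square algebra_simps)
  also have "\<dots> = (sin (p * b))\<^sup>2 - (sin (p * \<nu>))\<^sup>2"
    by (simp add: power_mult_distrib cos_squared_eq algebra_simps)
  finally show ?thesis .
qed

locale summable_potential =
  fixes u :: "int \<Rightarrow> complex"
  assumes u: "(\<lambda>k. norm (u k)) summable_on UNIV"
begin

lemma koch: "koch_matrix (hill_perturbation u B \<nu>) (\<lambda>n. norm (1 / (B - (of_int n + \<nu>)\<^sup>2)))
    (\<lambda>k. norm (u k) + (if k = 0 then norm B else 0))"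
  by (rule koch_hill_perturbation[OF u]) (rule summable_on_inverse_quadratic, simp)

definition inf_hill :: "complex \<Rightarrow> complex \<Rightarrow> complex" where
  "inf_hill B \<nu> = koch_matrix.inf_det (hill_perturbation u B \<nu>)"

definition trunc_hill :: "complex \<Rightarrow> complex \<Rightarrow> nat \<Rightarrow> complex" where
  "trunc_hill B \<nu> N = leibniz_det {- int N..int N} (perturbed_id (hill_perturbation u B \<nu>))"

lemma trunc_hill_tendsto: "trunc_hill B \<nu> \<longlonglongrightarrow> inf_hill B \<nu>"
  unfolding trunc_hill_def inf_hill_def by (rule koch_matrix.det_tendsto_symmetric[OF koch])

text \<open>The determinant of the undivided matrix. The prefactor is the one that makes the products of the
  divisors \<open>B - (n + \<nu>)\<^sup>2\<close> converge, for every \<open>B\<close>.\<close>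

definition char_trunc :: "complex \<Rightarrow> nat \<Rightarrow> complex" where
  "char_trunc \<nu> N = of_real pi ^ 2 / fact N ^ 4 *
     leibniz_det {- int N..int N} (\<lambda>n m. u (n - m) - (if n = m then (of_int n + \<nu>)\<^sup>2 else 0))"

definition char_fun :: "complex \<Rightarrow> complex" where
  "char_fun \<nu> = lim (char_trunc \<nu>)"

definition nonresonant :: "complex \<Rightarrow> complex \<Rightarrow> bool" where
  "nonresonant B \<nu> \<longleftrightarrow> (\<forall>n::int. B \<noteq> (of_int n + \<nu>)\<^sup>2)"

lemma char_trunc_eq:
  assumes "nonresonant B \<nu>"
  shows "char_trunc \<nu> N = (of_real pi ^ 2 / fact N ^ 4 * (\<Prod>n\<in>{- int N..int N}. B - (of_int n + \<nu>)\<^sup>2)) * trunc_hill B \<nu> N"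
proof -
  have "(\<lambda>n m. u (n - m) - (if n = m then (of_int n + \<nu>)\<^sup>2 else 0)) =
      (\<lambda>n m. (B - (of_int n + \<nu>)\<^sup>2) * perturbed_id (hill_perturbation u B \<nu>) n m)"
    using assms by (auto simp: fun_eq_iff perturbed_id_def hill_perturbation_def nonresonant_def field_simps)
  then show ?thesis unfolding char_trunc_def trunc_hill_def by (simp add: leibniz_det_scale_rows)
qed

text \<open>The left-hand side does not involve \<open>B\<close>. This freedom is used below: \<open>B\<close> far to the left shows
  that \<open>char_fun\<close> is entire, \<open>B = 0\<close> gives its growth, and the \<open>B\<close> of the Hill determinant gives
  the final formula.\<close>

lemma char_fun_eq:
  assumes "nonresonant B \<nu>" "b\<^sup>2 = B"
  shows "char_fun \<nu> = ((sin (of_real pi * b))\<^sup>2 - (sin (of_real pi * \<nu>))\<^sup>2) * inf_hill B \<nu>"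
proof -
  have "char_trunc \<nu> \<longlonglongrightarrow> (sin (of_real pi * (b + \<nu>)) * sin (of_real pi * (b - \<nu>))) * inf_hill B \<nu>"
    unfolding char_trunc_eq[OF assms(1)] by (intro tendsto_mult sine_product_symmetric assms trunc_hill_tendsto)
  then show ?thesis unfolding char_fun_def sin_mult_sin_complex by (rule limI)
qed

text \<open>Increasing \<open>\<nu>\<close> by 1 renumbers the rows and columns.\<close>

lemma inf_hill_shift: "inf_hill B (\<nu> + 1) = inf_hill B \<nu>"
proof -
  let ?D = "\<lambda>\<nu> S. leibniz_det S (perturbed_id (hill_perturbation u B \<nu>))"
  have lim: "(?D (\<nu> + 1) \<longlongrightarrow> inf_hill B (\<nu> + 1)) (finite_subsets_at_top UNIV)"
    unfolding inf_hill_def by (rule koch_matrix.det_tendsto[OF koch])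
  have "(?D \<nu> \<longlongrightarrow> inf_hill B \<nu>) (finite_subsets_at_top UNIV)"
    unfolding inf_hill_def by (rule koch_matrix.det_tendsto[OF koch])
  then have "((\<lambda>S. ?D \<nu> ((\<lambda>n. n + 1) ` S)) \<longlongrightarrow> inf_hill B \<nu>) (finite_subsets_at_top UNIV)"
  proof (rule filterlim_compose)
    show "filterlim ((`) (\<lambda>n::int. n + 1)) (finite_subsets_at_top UNIV) (finite_subsets_at_top UNIV)"
      unfolding filterlim_finite_subsets_at_top eventually_finite_subsets_at_top
    proof (intro allI impI, elim conjE)
      fix X :: "int set" assume X: "finite X"
      show "\<exists>Y. finite Y \<and> Y \<subseteq> UNIV \<and> (\<forall>Z. finite Z \<and> Y \<subseteq> Z \<and> Z \<subseteq> UNIV \<longrightarrow>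
          finite ((\<lambda>n. n + 1) ` Z) \<and> X \<subseteq> (\<lambda>n. n + 1) ` Z \<and> (\<lambda>n. n + 1) ` Z \<subseteq> UNIV)"
        using X by (intro exI[of _ "(\<lambda>n. n - 1) ` X"]) (force simp: image_iff)
    qed
  qed
  moreover have "?D (\<nu> + 1) S = ?D \<nu> ((\<lambda>n. n + 1) ` S)" if "finite S" for S
  proof -
    have "?D \<nu> ((\<lambda>n. n + 1) ` S) =
        leibniz_det S (\<lambda>i j. perturbed_id (hill_perturbation u B \<nu>) (i + 1) (j + 1))"
      by (rule leibniz_det_reindex) (auto simp: bij_betw_def inj_on_def that)
    also have "\<dots> = ?D (\<nu> + 1) S"
      by (intro leibniz_det_cong) (simp add: perturbed_id_def hill_perturbation_def add_ac)
    finally show ?thesis by simp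
  qed
  then have "\<forall>\<^sub>F S in finite_subsets_at_top UNIV. ?D \<nu> ((\<lambda>n. n + 1) ` S) = ?D (\<nu> + 1) S"
    unfolding eventually_finite_subsets_at_top by (intro exI[of _ "{}"]) auto
  ultimately have "(?D (\<nu> + 1) \<longlongrightarrow> inf_hill B \<nu>) (finite_subsets_at_top UNIV)"
    by (rule Lim_transform_eventually)
  then show ?thesis using tendsto_unique[OF finite_subsets_at_top_neq_bot lim] by simp
qed

text \<open>With \<open>B = - (R + 1)\<^sup>2\<close> one has \<open>(n + \<nu>)\<^sup>2 - B = (n + \<nu> - \<i> (R + 1)) (n + \<nu> + \<i> (R + 1))\<close>, and
  for \<open>|\<nu>| \<le> R\<close> both factors have imaginary parts of modulus at least 1. So this \<open>B\<close> is nonresonant on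
  the whole disc.\<close>

lemma quadratic_lower_bound:
  fixes R :: real and \<nu> :: complex and n :: int
  assumes "norm \<nu> \<le> R"
  shows "norm (- of_real ((R + 1)\<^sup>2) - (of_int n + \<nu>)\<^sup>2) \<ge> (1 + (of_int n)\<^sup>2) / (2 * (1 + R\<^sup>2))"
proof -
  have R: "R \<ge> 0" using assms norm_ge_zero order_trans by blast
  define a where "a = real_of_int n + Re \<nu>"
  have im: "\<bar>Im \<nu>\<bar> \<le> R" and re: "\<bar>Re \<nu>\<bar> \<le> R" using assms abs_Im_le_cmod abs_Re_le_cmod order_trans by blast+
  have "(of_int n + \<nu> - \<i> * of_real (R + 1)) * (of_int n + \<nu> + \<i> * of_real (R + 1)) =
      - (- of_real ((R + 1)\<^sup>2) - (of_int n + \<nu>)\<^sup>2)"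
    by (simp add: power2_eq_square algebra_simps)
  then have eq: "norm (- of_real ((R + 1)\<^sup>2) - (of_int n + \<nu>)\<^sup>2) =
      norm (of_int n + \<nu> - \<i> * of_real (R + 1)) * norm (of_int n + \<nu> + \<i> * of_real (R + 1))"
    by (metis norm_minus_cancel norm_mult)
  have 1: "sqrt (1 + a\<^sup>2) \<le> norm (of_int n + \<nu> - \<i> * of_real (R + 1))"
    unfolding cmod_def a_def using im by (intro real_sqrt_le_mono) (auto simp: abs_square_le_1[symmetric] abs_le_square_iff intro!: power2_ge_1_iff[THEN iffD2])
  have 2: "sqrt (1 + a\<^sup>2) \<le> norm (of_int n + \<nu> + \<i> * of_real (R + 1))"
    unfolding cmod_def a_def using im by (intro real_sqrt_le_mono) (auto intro!: power2_ge_1_iff[THEN iffD2])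
  have "1 + a\<^sup>2 = sqrt (1 + a\<^sup>2) * sqrt (1 + a\<^sup>2)" by simp
  also have "\<dots> \<le> norm (- of_real ((R + 1)\<^sup>2) - (of_int n + \<nu>)\<^sup>2)"
    unfolding eq by (intro mult_mono 1 2) auto
  finally have *: "1 + a\<^sup>2 \<le> norm (- of_real ((R + 1)\<^sup>2) - (of_int n + \<nu>)\<^sup>2)" .
  have "(Re \<nu>)\<^sup>2 \<le> R\<^sup>2" using re by (simp add: abs_le_square_iff[symmetric])
  moreover have "(of_int n)\<^sup>2 \<le> 2 * a\<^sup>2 + 2 * (Re \<nu>)\<^sup>2"
    using zero_le_power2[of "real_of_int n + 2 * Re \<nu>"] unfolding a_def
    by (simp add: power2_eq_square algebra_simps)
  ultimately have "1 + (of_int n)\<^sup>2 \<le> 1 + 2 * a\<^sup>2 + 2 * R\<^sup>2" by simp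
  also have "\<dots> \<le> 2 * (1 + R\<^sup>2) * (1 + a\<^sup>2)" by (simp add: algebra_simps)
  finally have "(1 + (of_int n)\<^sup>2) / (2 * (1 + R\<^sup>2)) \<le> 1 + a\<^sup>2"
    by (simp add: pos_divide_le_eq add_pos_nonneg mult.commute)
  then show ?thesis using * by simp
qed

lemma nonresonant_large:
  assumes "norm \<nu> \<le> R"
  shows "nonresonant (- of_real ((R + 1)\<^sup>2)) \<nu>"
  unfolding nonresonant_def
proof (intro allI notI)
  fix n :: int assume eq: "- complex_of_real ((R + 1)\<^sup>2) = (of_int n + \<nu>)\<^sup>2"
  have "(1 + (of_int n)\<^sup>2) / (2 * (1 + R\<^sup>2)) > 0" by (auto intro!: divide_pos_pos add_pos_nonneg)
  then show False using quadratic_lower_bound[OF assms, of n] eq by simp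
qed

text \<open>A pointwise limit of holomorphic truncations that are uniformly bounded on the disc is holomorphic,
  by Montel's theorem.\<close>

lemma inf_hill_holomorphic: "inf_hill (- of_real ((R + 1)\<^sup>2)) holomorphic_on ball 0 R"
proof -
  let ?B = "- of_real ((R + 1)\<^sup>2) :: complex"
  define w where "w = (\<lambda>n::int. (2 * (1 + R\<^sup>2)) * (8 * 1 powr (-1/2) * (1 + \<bar>of_int n\<bar>) powr (-3/2)))"
  have w: "w summable_on UNIV"
    unfolding w_def by (intro summable_on_cmult_right summable_on_int_powr)
  have w_ge: "norm (1 / (?B - (of_int n + \<nu>)\<^sup>2)) \<le> w n" if "\<nu> \<in> ball 0 R" for \<nu> n
  proof -
    define t where "t = \<bar>real_of_int n\<bar>"
    have pos: "(1 + (of_int n)\<^sup>2) / (2 * (1 + R\<^sup>2)) > 0" by (auto intro!: divide_pos_pos add_pos_nonneg)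
    have nu: "norm \<nu> \<le> R" using that by simp
    have "norm (1 / (?B - (of_int n + \<nu>)\<^sup>2)) \<le> 1 / ((1 + (of_int n)\<^sup>2) / (2 * (1 + R\<^sup>2)))"
      unfolding norm_divide norm_one
      by (intro frac_le quadratic_lower_bound[OF nu] pos) auto
    also have "\<dots> = (2 * (1 + R\<^sup>2)) * (1 / (1 + t\<^sup>2))" by (simp add: t_def)
    also have "\<dots> \<le> w n" unfolding w_def t_def[symmetric]
    proof (intro mult_left_mono powr_le_of_quadratic)
      have "0 \<le> (1 - t)\<^sup>2" by simp
      then have "2 * t \<le> 1 + t\<^sup>2" by (simp add: power2_eq_square algebra_simps)
      moreover have "(1 + t)\<^sup>2 = 1 + 2 * t + t\<^sup>2" by (simp add: power2_eq_square algebra_simps)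
      ultimately show "(1 + t)\<^sup>2 / 8 \<le> 1 + t\<^sup>2" using zero_le_power2[of t] by linarith
    qed (auto simp: t_def)
    finally show ?thesis .
  qed
  let ?\<gamma> = "\<lambda>k. norm (u k) + (if k = 0 then norm ?B else 0)"
  have bound: "norm (trunc_hill ?B \<nu> N) \<le> exp (koch_matrix.total w ?\<gamma>)" if "\<nu> \<in> ball 0 R" for \<nu> N
  proof -
    interpret koch_matrix "hill_perturbation u ?B \<nu>" w ?\<gamma>
      by (rule koch_hill_perturbation[OF u w w_ge[OF that]])
    show ?thesis unfolding trunc_hill_def by (rule norm_det_le) simp
  qed
  have hol: "(\<lambda>\<nu>. trunc_hill ?B \<nu> N) holomorphic_on ball 0 R" for N
    unfolding trunc_hill_def leibniz_det_def perturbed_id_def hill_perturbation_def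
    using nonresonant_large by (intro holomorphic_intros) (auto simp: nonresonant_def)
  show ?thesis
  proof (rule Montel[where S = "ball 0 R" and \<H> = "range (\<lambda>N \<nu>. trunc_hill ?B \<nu> N)" and \<F> = "\<lambda>N \<nu>. trunc_hill ?B \<nu> N"])
    fix g r assume g: "g holomorphic_on ball 0 R" "strict_mono (r :: nat \<Rightarrow> nat)"
      and lim: "\<And>x. x \<in> ball 0 R \<Longrightarrow> (\<lambda>n. trunc_hill ?B x (r n)) \<longlonglongrightarrow> g x"
    have "g x = inf_hill ?B x" if "x \<in> ball 0 R" for x
      using LIMSEQ_unique[OF lim[OF that] LIMSEQ_subseq_LIMSEQ[OF trunc_hill_tendsto g(2), unfolded o_def]] .
    then show ?thesis using g(1) by (rule holomorphic_transform[rotated])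
  next
    fix K :: "complex set" assume "compact K" "K \<subseteq> ball 0 R"
    then show "\<exists>B. \<forall>h\<in>range (\<lambda>N \<nu>. trunc_hill ?B \<nu> N). \<forall>z\<in>K. norm (h z) \<le> B"
      using bound by (intro exI[of _ "exp (koch_matrix.total w ?\<gamma>)"]) auto
  qed (use hol in auto)
qed

lemma char_fun_holomorphic: "char_fun holomorphic_on UNIV"
proof -
  have "char_fun holomorphic_on ball 0 R" for R
  proof -
    have "char_fun \<nu> = ((sin (of_real pi * (\<i> * of_real (R + 1))))\<^sup>2 - (sin (of_real pi * \<nu>))\<^sup>2) *
        inf_hill (- of_real ((R + 1)\<^sup>2)) \<nu>" if "\<nu> \<in> ball 0 R" for \<nu>
      by (rule char_fun_eq[OF nonresonant_large]) (use that in \<open>auto simp: power_mult_distrib\<close>)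
    then have *: "char_fun holomorphic_on ball 0 R \<longleftrightarrow> (\<lambda>\<nu>. ((sin (of_real pi * (\<i> * of_real (R + 1))))\<^sup>2 - (sin (of_real pi * \<nu>))\<^sup>2) *
        inf_hill (- of_real ((R + 1)\<^sup>2)) \<nu>) holomorphic_on ball 0 R"
      by (intro holomorphic_cong) auto
    show ?thesis unfolding * by (intro holomorphic_intros inf_hill_holomorphic)
  qed
  then have "char_fun analytic_on {z}" for z
    unfolding analytic_at by (intro exI[of _ "ball 0 (norm z + 1)"]) auto
  then have "char_fun analytic_on UNIV" using analytic_on_analytic_at by blast
  then show ?thesis by (rule analytic_imp_holomorphic)
qed

lemma char_fun_shift: "char_fun (\<nu> + 1) = char_fun \<nu>"
proof -
  define R where "R = norm \<nu> + 1"
  have "norm \<nu> \<le> R" "norm (\<nu> + 1) \<le> R" using norm_triangle_ineq[of \<nu> 1] by (auto simp: R_def)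
  then have nr: "nonresonant (- of_real ((R + 1)\<^sup>2)) \<nu>" "nonresonant (- of_real ((R + 1)\<^sup>2)) (\<nu> + 1)"
    by (blast intro: nonresonant_large)+
  have b: "(\<i> * of_real (R + 1))\<^sup>2 = - complex_of_real ((R + 1)\<^sup>2)"
    by (simp add: power_mult_distrib)
  have "(sin (of_real pi * (\<nu> + 1)))\<^sup>2 = (sin (of_real pi * \<nu>))\<^sup>2"
    by (simp add: distrib_left sin_add)
  then show ?thesis
    unfolding char_fun_eq[OF nr(1) b] char_fun_eq[OF nr(2) b] inf_hill_shift by simp
qed

lemma norm_sin_squared_le: "norm ((sin (of_real pi * \<nu>))\<^sup>2) \<le> exp (2 * pi * \<bar>Im \<nu>\<bar>)" for \<nu> :: complex
proof -
  have "norm (sin (of_real pi * \<nu>)) \<le> (exp (pi * \<bar>Im \<nu>\<bar>) + exp (pi * \<bar>Im \<nu>\<bar>)) / 2"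
  proof -
    have "norm (exp (\<i> * (of_real pi * \<nu>)) - exp (- (\<i> * (of_real pi * \<nu>)))) \<le>
        norm (exp (\<i> * (of_real pi * \<nu>))) + norm (exp (- (\<i> * (of_real pi * \<nu>))))"
      by (rule norm_triangle_ineq4)
    also have "\<dots> = exp (- (pi * Im \<nu>)) + exp (pi * Im \<nu>)"
      by simp
    also have "\<dots> \<le> exp (pi * \<bar>Im \<nu>\<bar>) + exp (pi * \<bar>Im \<nu>\<bar>)"
      using mult_left_mono[of "- Im \<nu>" "\<bar>Im \<nu>\<bar>" pi] mult_left_mono[of "Im \<nu>" "\<bar>Im \<nu>\<bar>" pi]
      by (intro add_mono) auto
    finally show ?thesis by (simp add: sin_exp_eq norm_divide norm_mult)
  qed
  then have "(norm (sin (of_real pi * \<nu>)))\<^sup>2 \<le> (exp (pi * \<bar>Im \<nu>\<bar>))\<^sup>2"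
    by (intro power_mono) auto
  then show ?thesis by (simp add: norm_power exp_double[symmetric] mult_ac)
qed

text \<open>\<open>f = char_fun + sin\<^sup>2 (\<pi> \<nu>)\<close> is entire with period 1. For \<open>B = 0\<close>,
  \<open>f(\<nu>) = sin\<^sup>2 (\<pi> \<nu>) (1 - D(\<nu>))\<close>, where the infinite determinant \<open>D\<close> tends to 1 as \<open>|Im \<nu>|\<close>
  grows because the row weights decay like \<open>|Im \<nu>| powr (-1/2)\<close>. So \<open>f\<close> is
  \<open>o(exp (2 \<pi> |Im \<nu>|))\<close>, hence constant.\<close>

lemma char_fun_eq_const:
  "char_fun \<nu> = char_fun 0 - (sin (of_real pi * \<nu>))\<^sup>2"
proof -
  define S where "S = infsum (\<lambda>n::int. (1 + \<bar>of_int n\<bar>) powr (-3/2) :: real) UNIV"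
  define \<Gamma> where "\<Gamma> = infsum (\<lambda>k. norm (u k)) UNIV"
  define W where "W = (\<lambda>y. 8 * y powr (-1/2) * S * \<Gamma>)"
  have est: "norm (inf_hill 0 \<nu> - 1) \<le> W \<bar>Im \<nu>\<bar> * exp (W \<bar>Im \<nu>\<bar>)" and nonres: "nonresonant 0 \<nu>"
    if \<nu>: "\<bar>Re \<nu>\<bar> \<le> 1" "\<bar>Im \<nu>\<bar> \<ge> 1" for \<nu>
  proof -
    define y where "y = \<bar>Im \<nu>\<bar>"
    have y: "y \<ge> 1" using \<nu> by (simp add: y_def)
    let ?w = "\<lambda>n::int. 8 * y powr (-1/2) * (1 + \<bar>of_int n\<bar>) powr (-3/2)"
    have le: "norm (1 / (0 - (of_int n + \<nu>)\<^sup>2)) \<le> ?w n" for n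
    proof -
      define t where "t = \<bar>real_of_int n\<bar>"
      define q where "q = (real_of_int n + Re \<nu>)\<^sup>2 + y\<^sup>2"
      have q: "norm ((of_int n + \<nu>)\<^sup>2) = q"
        by (simp add: norm_power cmod_power2 q_def y_def)
      have y2: "y\<^sup>2 \<ge> 1" using y by simp
      define a where "a = \<bar>real_of_int n + Re \<nu>\<bar>"
      have "1 + t \<le> a + 2" using \<nu>(1) unfolding a_def t_def by linarith
      then have "(1 + t)\<^sup>2 \<le> (a + 2)\<^sup>2" by (intro power_mono) (auto simp: t_def)
      also have "\<dots> \<le> 2 * a\<^sup>2 + 8"
        using zero_le_power2[of "a - 2"] by (simp add: power2_eq_square algebra_simps)
      also have "\<dots> \<le> 8 * q" proof -
        have "q = a\<^sup>2 + y\<^sup>2" by (simp add: q_def a_def)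
        then show ?thesis using y2 zero_le_power2[of a] by linarith
      qed
      finally have "1 / q \<le> 8 * y powr (-1/2) * (1 + t) powr (-3/2)"
        using y by (intro powr_le_of_quadratic) (auto simp: q_def t_def)
      then show ?thesis by (simp add: norm_divide q t_def)
    qed
    show "nonresonant 0 \<nu>" unfolding nonresonant_def
    proof (intro allI notI)
      fix n :: int assume "0 = (of_int n + \<nu>)\<^sup>2"
      then have "Im (of_int n + \<nu>) = 0" by (metis zero_eq_power2 zero_complex.simps(2))
      then show False using \<nu>(2) by simp
    qed
    interpret koch_matrix "hill_perturbation u 0 \<nu>" ?w "\<lambda>k. norm (u k) + (if k = 0 then norm (0::complex) else 0)"
      by (rule koch_hill_perturbation[OF u _ le]) (intro summable_on_cmult_right summable_on_int_powr)
    have "(\<lambda>k. norm (u k) + (if k = 0 then norm (0::complex) else 0)) = (\<lambda>k. norm (u k))"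
      by auto
    then have "total = W y" unfolding total_def W_def S_def \<Gamma>_def
      by (simp add: infsum_cmult_right' mult_ac)
    then show "norm (inf_hill 0 \<nu> - 1) \<le> W \<bar>Im \<nu>\<bar> * exp (W \<bar>Im \<nu>\<bar>)"
      using norm_inf_det_minus_one_le by (simp add: inf_hill_def y_def)
  qed
  have lim: "((\<lambda>y. W y * exp (W y)) \<longlongrightarrow> 0) at_top"
  proof -
    have "(W \<longlongrightarrow> 8 * 0 * S * \<Gamma>) at_top"
      unfolding W_def by (intro tendsto_intros tendsto_neg_powr filterlim_ident) auto
    then have "(W \<longlongrightarrow> 0) at_top" by simp
    then have "((\<lambda>y. W y * exp (W y)) \<longlongrightarrow> 0 * exp 0) at_top" by (intro tendsto_intros)
    then show ?thesis by simp
  qed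
  define f where "f = (\<lambda>\<nu>. char_fun \<nu> + (sin (of_real pi * \<nu>))\<^sup>2)"
  have "f \<nu> = f 0"
  proof (rule entire_periodic_bounded_growth_constant)
    show "f holomorphic_on UNIV" unfolding f_def by (intro holomorphic_intros char_fun_holomorphic)
    show "f (z + 1) = f z" for z unfolding f_def by (simp add: char_fun_shift distrib_left sin_add)
    fix \<epsilon> :: real assume "\<epsilon> > 0"
    then have "\<forall>\<^sub>F y in at_top. norm (W y * exp (W y)) < \<epsilon>"
      using lim by (auto simp: tendsto_iff)
    then obtain Y where Y: "\<And>y. y \<ge> Y \<Longrightarrow> norm (W y * exp (W y)) < \<epsilon>"
      unfolding eventually_at_top_linorder by blast
    have "norm (f z) \<le> \<epsilon> * exp (2 * pi * \<bar>Im z\<bar>)" if z: "\<bar>Re z\<bar> \<le> 1" "\<bar>Im z\<bar> \<ge> max 1 Y" for z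
    proof -
      have "f z = (sin (of_real pi * z))\<^sup>2 * (1 - inf_hill 0 z)"
        unfolding f_def using char_fun_eq[OF nonres[of z], of 0] z by (simp add: algebra_simps)
      then have "norm (f z) = norm ((sin (of_real pi * z))\<^sup>2) * norm (inf_hill 0 z - 1)"
        by (simp add: norm_mult norm_minus_commute)
      also have "\<dots> \<le> exp (2 * pi * \<bar>Im z\<bar>) * \<epsilon>"
      proof (intro mult_mono norm_sin_squared_le)
        have "norm (inf_hill 0 z - 1) \<le> norm (W \<bar>Im z\<bar> * exp (W \<bar>Im z\<bar>))"
          using est[of z] z by simp
        then show "norm (inf_hill 0 z - 1) \<le> \<epsilon>" using Y[of "\<bar>Im z\<bar>"] z by simp
      qed auto
      finally show ?thesis by (simp add: mult.commute)
    qed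
    then show "\<exists>Y. \<forall>z. \<bar>Re z\<bar> \<le> 1 \<longrightarrow> \<bar>Im z\<bar> \<ge> Y \<longrightarrow> norm (f z) \<le> \<epsilon> * exp (2 * pi * \<bar>Im z\<bar>)" by blast
  qed
  then show ?thesis by (simp add: f_def algebra_simps)
qed

end

section \<open>Hill's formula\<close>

lemma has_vector_derivative_exp_frequency:
  "((\<lambda>\<eta>. exp (\<i> * \<kappa> * of_real \<eta>)) has_vector_derivative \<i> * \<kappa> * exp (\<i> * \<kappa> * of_real x)) (at x within S)"
  by (rule has_vector_derivative_real_field) (auto intro!: derivative_eq_intros)

context summable_potential begin

text \<open>By the boundary conditions \<open>h exp (\<i> \<nu> \<eta>)\<close> is periodic; let \<open>hat n\<close> be its Fourier coefficients.
  Two integrations by parts turn the equation into \<open>(n + \<nu>)\<^sup>2 hat n = \<Sum>\<^sub>m hat m u (m - n)\<close>, so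
  \<open>hat\<close> is a left null vector of the undivided matrix, and \<open>x n = (B - (n + \<nu>)\<^sup>2) hat n\<close> is one of
  the divided matrix. The equation also shows that \<open>x\<close> is bounded, although its definition
  contains a growing factor. It is nonzero since Fourier coefficients determine a function.\<close>

lemma char_fun_eq_0_at_Floquet_exponent:
  assumes U: "\<And>x. x \<in> {0..2*pi} \<Longrightarrow> ((\<lambda>k. u k * exp (\<i> * of_int k * of_real x)) has_sum U x) UNIV"
    and h: "\<And>x. x \<in> {0..2*pi} \<Longrightarrow> (h has_vector_derivative h' x) (at x within {0..2*pi})"
    and h': "\<And>x. x \<in> {0..2*pi} \<Longrightarrow> (h' has_vector_derivative - U x * h x) (at x within {0..2*pi})"
    and bc: "h (2*pi) * exp (2 * pi * \<i> * \<nu>) = h 0" "h' (2*pi) * exp (2 * pi * \<i> * \<nu>) = h' 0"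
    and nz: "x0 \<in> {0..2*pi}" "h x0 \<noteq> 0"
  shows "char_fun \<nu> = 0"
proof -
  let ?I = "{0..2*pi}"
  define R where "R = norm \<nu>"
  define B where "B = - complex_of_real ((R + 1)\<^sup>2)"
  have nr: "nonresonant B \<nu>" unfolding B_def by (rule nonresonant_large) (simp add: R_def)
  define E where "E = (\<lambda>n::int. \<lambda>\<eta>::real. exp (\<i> * (of_int n + \<nu>) * of_real \<eta>))"
  have E2pi: "E n (2*pi) = exp (2 * pi * \<i> * \<nu>)" for n
  proof -
    have "E n (2*pi) = exp (2 * pi * \<i> * \<nu>) * exp (2 * pi * of_int n * \<i>)"
      unfolding E_def by (simp add: exp_add[symmetric] algebra_simps)
    then show ?thesis by (simp add: mult_ac)
  qed
  have E0: "E n 0 = 1" for n by (simp add: E_def)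
  have cE: "continuous_on ?I (E n)" for n unfolding E_def by (intro continuous_intros)
  have ch: "continuous_on ?I h" using h by (rule continuous_on_vector_derivative)
  have unif: "uniform_limit ?I (\<lambda>S x. \<Sum>k\<in>S. u k * exp (\<i> * of_int k * of_real x)) U (finite_subsets_at_top UNIV)"
    by (rule Weierstrass_m_test_general'[OF _ U u]) (simp_all add: norm_mult)
  have cU: "continuous_on ?I U"
    by (rule uniform_limit_theorem[OF _ unif]) (auto intro!: always_eventually continuous_intros)
  define hat where "hat = (\<lambda>n. integral ?I (\<lambda>\<eta>. h \<eta> * E n \<eta>))"
  define Uhat where "Uhat = (\<lambda>n. integral ?I (\<lambda>\<eta>. U \<eta> * h \<eta> * E n \<eta>))"
  have parts: "(of_int n + \<nu>)\<^sup>2 * hat n = Uhat n" for n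
  proof -
    let ?\<kappa> = "of_int n + \<nu>"
    let ?\<Phi> = "\<lambda>\<eta>. h' \<eta> * E n \<eta> - \<i> * ?\<kappa> * (h \<eta> * E n \<eta>)"
    have "(?\<Phi> has_vector_derivative (?\<kappa>\<^sup>2 * (h x * E n x) - U x * h x * E n x)) (at x within ?I)" if x: "x \<in> ?I" for x
    proof -
      have dE: "(E n has_vector_derivative \<i> * ?\<kappa> * E n x) (at x within ?I)"
        unfolding E_def by (rule has_vector_derivative_exp_frequency)
      have "(?\<Phi> has_vector_derivative (h' x * (\<i> * ?\<kappa> * E n x) + - U x * h x * E n x) -
          \<i> * ?\<kappa> * (h x * (\<i> * ?\<kappa> * E n x) + h' x * E n x)) (at x within ?I)"
        by (intro has_vector_derivative_diff has_vector_derivative_mult_right has_vector_derivative_mult dE h h' x)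
      moreover have "(h' x * (\<i> * ?\<kappa> * E n x) + - U x * h x * E n x) -
          \<i> * ?\<kappa> * (h x * (\<i> * ?\<kappa> * E n x) + h' x * E n x) = ?\<kappa>\<^sup>2 * (h x * E n x) - U x * h x * E n x"
        by (simp add: power2_eq_square algebra_simps)
      ultimately show ?thesis by (simp only:)
    qed
    then have 1: "((\<lambda>x. ?\<kappa>\<^sup>2 * (h x * E n x) - U x * h x * E n x) has_integral ?\<Phi> (2*pi) - ?\<Phi> 0) ?I"
      by (intro fundamental_theorem_of_calculus) auto
    moreover have "?\<Phi> (2*pi) - ?\<Phi> 0 = 0" using bc by (simp add: E2pi E0)
    moreover have 2: "((\<lambda>x. ?\<kappa>\<^sup>2 * (h x * E n x) - U x * h x * E n x) has_integral ?\<kappa>\<^sup>2 * hat n - Uhat n) ?I"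
      unfolding hat_def Uhat_def
      by (intro has_integral_diff has_integral_mult_right integrable_integral integrable_continuous_real
          continuous_intros cE ch cU)
    ultimately show ?thesis using has_integral_unique[OF 2 1] by simp
  qed
  have bound: "\<exists>K. \<forall>n. norm (integral ?I (\<lambda>\<eta>. g \<eta> * E n \<eta>)) \<le> K" if g: "continuous_on ?I g" for g
  proof -
    have "bounded (g ` ?I)" by (intro compact_imp_bounded compact_continuous_image g) simp
    then obtain K where K: "\<And>\<eta>. \<eta> \<in> ?I \<Longrightarrow> norm (g \<eta>) \<le> K" unfolding bounded_iff by blast
    define L where "L = exp (\<bar>Im \<nu>\<bar> * (2 * pi))"
    have EL: "norm (E n \<eta>) \<le> L" if \<eta>: "\<eta> \<in> ?I" for n \<eta>
    proof -
      have "- (Im \<nu> * \<eta>) \<le> \<bar>Im \<nu>\<bar> * \<eta>" using mult_right_mono[of "- Im \<nu>" "\<bar>Im \<nu>\<bar>" \<eta>] \<eta> by auto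
      also have "\<dots> \<le> \<bar>Im \<nu>\<bar> * (2 * pi)" using \<eta> by (intro mult_left_mono) auto
      finally show ?thesis by (simp add: E_def L_def algebra_simps)
    qed
    have K0: "K \<ge> 0" using K[OF nz(1)] norm_ge_zero order_trans by blast
    have "norm (integral ?I (\<lambda>\<eta>. g \<eta> * E n \<eta>)) \<le> K * L * (2 * pi - 0)" for n
      by (rule integral_bound) (auto intro!: continuous_intros g cE mult_mono K EL K0 simp: norm_mult)
    then show ?thesis by blast
  qed
  define x where "x = (\<lambda>n. (B - (of_int n + \<nu>)\<^sup>2) * hat n)"
  have x_eq: "x n = B * hat n - Uhat n" for n by (simp add: x_def left_diff_distrib parts)
  obtain K1 where K1: "\<And>n. norm (hat n) \<le> K1" using bound[OF ch] unfolding hat_def by blast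
  obtain K2 where K2: "\<And>n. norm (Uhat n) \<le> K2"
    using bound[of "\<lambda>\<eta>. U \<eta> * h \<eta>"] cU ch unfolding Uhat_def by (auto intro: continuous_on_mult)
  have x_bound: "norm (x n) \<le> norm B * K1 + K2" for n
    unfolding x_eq using mult_left_mono[OF K1[of n] norm_ge_zero[of B]] K2[of n]
    by (intro order_trans[OF norm_triangle_ineq4]) (simp add: norm_mult)
  have null: "((\<lambda>n. x n * hill_perturbation u B \<nu> n m) has_sum - x m) UNIV" for m
  proof -
    have eq: "x n * hill_perturbation u B \<nu> n m = hat n * u (n - m) - (if n = m then B * hat m else 0)" for n
    proof -
      have "B - (of_int n + \<nu>)\<^sup>2 \<noteq> 0" using nr by (simp add: nonresonant_def)
      then have "x n * hill_perturbation u B \<nu> n m = hat n * (u (n - m) - (if n = m then B else 0))"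
        by (simp add: x_def hill_perturbation_def)
      then show ?thesis by (simp add: right_diff_distrib)
    qed
    have unif': "uniform_limit ?I (\<lambda>S \<eta>. (\<Sum>k\<in>S. u k * exp (\<i> * of_int k * of_real \<eta>)) * (h \<eta> * E m \<eta>))
        (\<lambda>\<eta>. U \<eta> * (h \<eta> * E m \<eta>)) (finite_subsets_at_top UNIV)"
    proof (rule uniform_lim_mult[OF unif uniform_limit_const])
      show "bounded (U ` ?I)" by (intro compact_imp_bounded compact_continuous_image cU) simp
      show "bounded ((\<lambda>\<eta>. h \<eta> * E m \<eta>) ` ?I)"
        by (intro compact_imp_bounded compact_continuous_image continuous_intros ch cE) simp
    qed
    have cont: "continuous_on ?I (\<lambda>\<eta>. (\<Sum>k\<in>S. u k * exp (\<i> * of_int k * of_real \<eta>)) * (h \<eta> * E m \<eta>))" for S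
      by (intro continuous_intros ch cE)
    obtain I J where I: "\<And>S. ((\<lambda>\<eta>. (\<Sum>k\<in>S. u k * exp (\<i> * of_int k * of_real \<eta>)) * (h \<eta> * E m \<eta>)) has_integral I S) ?I"
      and J: "((\<lambda>\<eta>. U \<eta> * (h \<eta> * E m \<eta>)) has_integral J) ?I" and IJ: "(I \<longlongrightarrow> J) (finite_subsets_at_top UNIV)"
      using uniform_limit_integral[OF unif' cont] by auto
    have "I S = (\<Sum>k\<in>S. u k * hat (m + k))" if "finite S" for S
    proof (rule has_integral_unique[OF I])
      have *: "(\<Sum>k\<in>S. u k * exp (\<i> * of_int k * of_real \<eta>)) * (h \<eta> * E m \<eta>) = (\<Sum>k\<in>S. u k * (h \<eta> * E (m + k) \<eta>))" for \<eta>
        unfolding sum_distrib_right E_def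
        by (intro sum.cong refl) (simp add: exp_add[symmetric] algebra_simps)
      show "((\<lambda>\<eta>. (\<Sum>k\<in>S. u k * exp (\<i> * of_int k * of_real \<eta>)) * (h \<eta> * E m \<eta>)) has_integral
          (\<Sum>k\<in>S. u k * hat (m + k))) ?I"
        unfolding * hat_def using that
        by (intro has_integral_sum has_integral_mult_right integrable_integral integrable_continuous_real
            continuous_intros ch cE) auto
    qed
    then have "\<forall>\<^sub>F S in finite_subsets_at_top UNIV. I S = (\<Sum>k\<in>S. u k * hat (m + k))"
      unfolding eventually_finite_subsets_at_top by blast
    then have "((\<lambda>k. u k * hat (m + k)) has_sum J) UNIV"
      unfolding has_sum_def using IJ Lim_transform_eventually by blast
    moreover have "J = Uhat m"
      unfolding Uhat_def using J by (simp add: integral_unique mult_ac)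
    moreover have "((\<lambda>n. hat n * u (n - m)) has_sum Uhat m) UNIV \<longleftrightarrow> ((\<lambda>k. u k * hat (m + k)) has_sum Uhat m) UNIV"
      by (rule has_sum_reindex_bij_witness[where i = "\<lambda>k. m + k" and j = "\<lambda>n. n - m"]) (auto simp: mult_ac)
    ultimately have 1: "((\<lambda>n. hat n * u (n - m)) has_sum Uhat m) UNIV" by simp
    have 2: "((\<lambda>n. if n = m then B * hat m else 0) has_sum B * hat m) UNIV"
      by (rule has_sum_finite_neutralI[where B = "{m}"]) auto
    have "((\<lambda>n. hat n * u (n - m) + - (if n = m then B * hat m else 0)) has_sum (Uhat m + - (B * hat m))) UNIV"
      using has_sum_add[OF 1 has_sum_uminusI[OF 2]] by simp
    then show ?thesis unfolding eq by (simp add: x_eq)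
  qed
  have "\<exists>k. x k \<noteq> 0"
  proof (rule ccontr)
    assume "\<nexists>k. x k \<noteq> 0"
    then have hat0: "hat n = 0" for n using nr unfolding x_def nonresonant_def by auto
    have "h x0 * E 0 x0 = 0"
    proof (rule Fourier_coefficients_zero_imp_zero)
      show "continuous_on ?I (\<lambda>\<eta>. h \<eta> * E 0 \<eta>)" by (intro continuous_intros ch cE)
      show "h 0 * E 0 0 = h (2*pi) * E 0 (2*pi)" using bc by (simp add: E2pi E0)
      show "integral ?I (\<lambda>\<eta>. h \<eta> * E 0 \<eta> * exp (\<i> * of_int n * of_real \<eta>)) = 0" for n
      proof -
        have "integral ?I (\<lambda>\<eta>. h \<eta> * E 0 \<eta> * exp (\<i> * of_int n * of_real \<eta>)) = hat n"
          unfolding hat_def E_def by (intro integral_cong) (simp add: exp_add[symmetric] algebra_simps)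
        then show ?thesis using hat0 by simp
      qed
    qed (rule nz(1))
    then show False using nz by (simp add: E_def)
  qed
  then obtain k where k: "x k \<noteq> 0" by blast
  have "inf_hill B \<nu> = 0"
    unfolding inf_hill_def by (rule koch_matrix.inf_det_eq_0_of_left_null_vector[OF koch null x_bound k])
  moreover have "(\<i> * of_real (R + 1))\<^sup>2 = B" by (simp add: B_def power_mult_distrib)
  ultimately show ?thesis using char_fun_eq[OF nr] by simp
qed

text \<open>The constant \<open>char_fun 0\<close> is found at the Floquet exponent \<open>\<nu> = - Ln \<rho> / (2 \<pi> \<i>)\<close>, and
  expressed by the Hill determinant at \<open>\<nu> = 0\<close>.\<close>

theorem Hill_formula:
  assumes U: "\<And>x. x \<in> {0..2*pi} \<Longrightarrow> ((\<lambda>k. u k * exp (\<i> * of_int k * of_real x)) has_sum U x) UNIV"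
    and h: "\<And>x. x \<in> {0..2*pi} \<Longrightarrow> (h has_vector_derivative h' x) (at x within {0..2*pi})"
    and h': "\<And>x. x \<in> {0..2*pi} \<Longrightarrow> (h' has_vector_derivative - U x * h x) (at x within {0..2*pi})"
    and bc: "h (2*pi) = \<rho> * h 0" "h' (2*pi) = \<rho> * h' 0" "\<rho> \<noteq> 0"
    and nz: "x0 \<in> {0..2*pi}" "h x0 \<noteq> 0"
    and nonsquare: "\<And>n::int. b\<^sup>2 \<noteq> (of_int n)\<^sup>2"
  shows "(sin (of_real pi * b))\<^sup>2 * inf_hill (b\<^sup>2) 0 = (2 - (\<rho> + 1 / \<rho>)) / 4"
proof -
  define \<nu> where "\<nu> = - Ln \<rho> / (2 * pi * \<i>)"
  have "exp (2 * pi * \<i> * \<nu>) = exp (- Ln \<rho>)" by (simp add: \<nu>_def)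
  then have e: "exp (2 * pi * \<i> * \<nu>) = 1 / \<rho>" using bc(3) by (simp add: exp_minus field_simps)
  have "char_fun \<nu> = 0"
    by (rule char_fun_eq_0_at_Floquet_exponent[OF U h h' _ _ nz]) (use bc e in auto)
  then have "char_fun 0 = (sin (of_real pi * \<nu>))\<^sup>2" using char_fun_eq_const[of \<nu>] by simp
  also have "\<dots> = (1 - cos (2 * (of_real pi * \<nu>))) / 2" by (simp add: cos_double_sin)
  also have "cos (2 * (of_real pi * \<nu>)) = (1 / \<rho> + \<rho>) / 2"
  proof -
    have "\<i> * (2 * (of_real pi * \<nu>)) = 2 * pi * \<i> * \<nu>" by simp
    then have "exp (\<i> * (2 * (of_real pi * \<nu>))) = 1 / \<rho>" using e by metis
    then show ?thesis unfolding cos_exp_eq exp_minus by simp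
  qed
  finally have "char_fun 0 = (2 - (\<rho> + 1 / \<rho>)) / 4" by (simp add: field_simps)
  moreover have "nonresonant (b\<^sup>2) 0" using nonsquare by (simp add: nonresonant_def)
  ultimately show ?thesis using char_fun_eq[of "b\<^sup>2" 0 b] by simp
qed

end

section \<open>Fourier coefficients of the potential\<close>

lemma Joukowski_injective:
  fixes s t :: complex
  assumes "s \<noteq> 0" "t \<noteq> 0" "(s + 1 / s) / 2 = (t + 1 / t) / 2" "norm s < 1" "norm t < 1"
  shows "s = t"
proof (rule ccontr)
  assume ne: "s \<noteq> t"
  have "(s - t) * (s * t - 1) = 0"
  proof -
    have "s + 1 / s = t + 1 / t" using assms(3) by (simp only: divide_cancel_right) simp
    then have "(s + 1 / s) * (s * t) = (t + 1 / t) * (s * t)" by simp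
    then show ?thesis using assms(1,2) by (simp add: algebra_simps)
  qed
  then have "s * t = 1" using ne by simp
  then have "norm s * norm t = 1" by (metis norm_mult norm_one)
  moreover have "norm s * norm t < 1 * 1" using assms by (intro mult_strict_mono) auto
  ultimately show False by simp
qed

text \<open>With \<open>w\<^sup>2 = c\<^sup>2 - 1\<close>, the two preimages \<open>c + w\<close> and \<open>c - w\<close> are reciprocal, so one of them lies in
  the disc unless both are unimodular. In that case they are conjugate, and \<open>c\<close> is their common real
  part.\<close>

lemma Joukowski_surjective:
  assumes "c \<notin> real_cut"
  shows "\<exists>s. s \<noteq> 0 \<and> c = (s + 1 / s) / 2 \<and> norm s < 1"
proof -
  define w where "w = csqrt (c\<^sup>2 - 1)"
  have w2: "w\<^sup>2 = c\<^sup>2 - 1" by (simp add: w_def)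
  have prod: "(c + w) * (c - w) = 1" using w2 by (simp add: algebra_simps power2_eq_square)
  then have nz: "c + w \<noteq> 0" "c - w \<noteq> 0" by auto
  have inv: "1 / (c + w) = c - w" "1 / (c - w) = c + w" using prod nz by (simp_all add: field_simps)
  have e: "c = ((c + w) + 1 / (c + w)) / 2" "c = ((c - w) + 1 / (c - w)) / 2" unfolding inv by simp_all
  have n: "norm (c + w) * norm (c - w) = 1" by (metis prod norm_mult norm_one)
  consider "norm (c + w) < 1" | "norm (c - w) < 1" | "norm (c + w) = 1"
  proof (atomize_elim, rule ccontr)
    assume "\<not> (norm (c + w) < 1 \<or> norm (c - w) < 1 \<or> norm (c + w) = 1)"
    then have "norm (c + w) > 1" "norm (c - w) \<ge> 1" by auto
    then have "1 * 1 < norm (c + w) * norm (c - w)" by (intro mult_less_le_imp_less) auto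
    then show False using n by simp
  qed
  then show ?thesis
  proof cases
    case 3
    then have "(c + w) * cnj (c + w) = 1" by (metis complex_norm_square of_real_1 power_one)
    then have "cnj (c + w) = c - w" using prod nz(1) by (metis mult_left_cancel)
    then have "c = of_real (Re (c + w))" by (simp add: complex_eq_iff)
    moreover have "\<bar>Re (c + w)\<bar> \<le> 1" using abs_Re_le_cmod[of "c + w"] 3 by simp
    ultimately have "c \<in> real_cut" by (metis (no_types, lifting) abs_le_iff atLeastAtMost_iff imageI minus_le_iff)
    then show ?thesis using assms by simp
  qed (use e nz in blast)+
qed

lemma sroot:
  assumes "c \<notin> real_cut"
  shows "sroot c \<noteq> 0" "c = (sroot c + 1 / sroot c) / 2" "norm (sroot c) < 1"
proof -
  have "\<exists>!s. s \<noteq> 0 \<and> c = (s + 1 / s) / 2 \<and> norm s < 1"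
    using Joukowski_surjective[OF assms] Joukowski_injective by metis
  from theI'[OF this] show "sroot c \<noteq> 0" "c = (sroot c + 1 / sroot c) / 2" "norm (sroot c) < 1"
    unfolding sroot_def by blast+
qed

lemma sroot_square_ne_1:
  assumes c: "c \<notin> real_cut"
  shows "1 - (sroot c)\<^sup>2 \<noteq> 0"
proof
  assume "1 - (sroot c)\<^sup>2 = 0"
  then have "(sroot c)\<^sup>2 = 1" by simp
  then have "norm (sroot c) ^ 2 = 1" by (metis norm_one norm_power)
  moreover have "norm (sroot c) ^ 2 < 1" using sroot(3)[OF c] by (simp add: power_less_one_iff)
  ultimately show False by simp
qed

text \<open>The inverse of an injective holomorphic function is holomorphic.\<close>

lemma sroot_holomorphic: "sroot holomorphic_on - real_cut"
proof -
  let ?J = "\<lambda>s::complex. (s + 1 / s) / 2" and ?S = "ball 0 1 - {0::complex}"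
  have "?J holomorphic_on ?S" by (intro holomorphic_intros) auto
  moreover have "open ?S" by auto
  moreover have "inj_on ?J ?S"
    by (rule inj_onI) (rule Joukowski_injective, auto)
  ultimately obtain g where g: "g holomorphic_on ?J ` ?S" "\<And>s. s \<in> ?S \<Longrightarrow> g (?J s) = s"
    by (rule holomorphic_has_inverse) (rule that)
  have *: "c \<in> ?J ` ?S \<and> g c = sroot c" if "c \<in> - real_cut" for c
  proof -
    have c: "c \<notin> real_cut" using that by simp
    have s: "sroot c \<in> ?S" using sroot[OF c] by simp
    have "?J (sroot c) = c" using sroot(2)[OF c] by simp
    then show ?thesis using g(2)[OF s] s by (metis (no_types, lifting) imageI)
  qed
  then have "g holomorphic_on - real_cut" using holomorphic_on_subset[OF g(1)] by blast
  then show ?thesis by (rule holomorphic_transform) (use * in blast)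
qed

lemma kap_holomorphic: "kap holomorphic_on - real_cut"
  unfolding kap_def by (intro holomorphic_intros sroot_holomorphic) (use sroot_square_ne_1 in \<open>simp_all only: Compl_iff not_False_eq_True\<close>)

lemma has_sum_geometric_complex:
  fixes w :: complex
  assumes "norm w < 1"
  shows "((\<lambda>n. w ^ n) has_sum 1 / (1 - w)) UNIV"
proof (rule norm_summable_imp_has_sum)
  show "summable (\<lambda>n. norm (w ^ n))" using assms by (simp add: norm_power summable_geometric)
  show "(\<lambda>n. w ^ n) sums (1 / (1 - w))" using assms by (rule geometric_sums)
qed

text \<open>With \<open>w = \<i> s exp (\<i> x)\<close> and \<open>v = - \<i> s exp (- \<i> x)\<close> the denominator factors,
  \<open>(1 - w) (1 - v) = 2 s (c + sin x)\<close>, and \<open>Q = 1 - c / (c + sin x)\<close> splits into geometric series in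
  \<open>w\<close> (nonnegative frequencies) and \<open>v\<close> (negative ones).\<close>

lemma potential_Fourier_series:
  assumes c: "c \<notin> real_cut"
  shows "((\<lambda>k. fcoeff c k * exp (\<i> * of_int k * of_real x)) has_sum potential c x) UNIV"
proof -
  let ?s = "sroot c" and ?f = "\<lambda>k. fcoeff c k * exp (\<i> * of_int k * of_real x)"
  define w where "w = \<i> * ?s * cis x"
  define v where "v = - \<i> * ?s * cis (- x)"
  note s = sroot[OF c]
  have w1: "norm w < 1" and v1: "norm v < 1" using s(3) by (simp_all add: w_def v_def norm_mult)
  have cis_pow: "exp (\<i> * of_int k * of_real x) = cis (of_int k * x)" for k
    by (simp add: cis_conv_exp mult_ac)
  have pos: "?f (int n) = (if n = 0 then 1 else 0) + kap c * w ^ n" for n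
  proof -
    have "cis x ^ n = cis (of_int (int n) * x)" by (simp only: Complex.DeMoivre of_int_of_nat_eq)
    then show ?thesis
      unfolding cis_pow fcoeff_def w_def \<open>cis x ^ n = _\<close>[symmetric] by (simp add: power_mult_distrib)
  qed
  have neg: "?f (- int (Suc n)) = kap c * v * v ^ n" for n
  proof -
    have "\<i> powi (- int (Suc n)) = (- \<i>) ^ Suc n"
      by (simp only: power_int_minus power_int_of_nat power_inverse[symmetric]) simp
    moreover have "cis (of_int (- int (Suc n)) * x) = cis (- x) ^ Suc n"
      by (simp only: Complex.DeMoivre) (simp add: algebra_simps)
    moreover have "nat \<bar>- int (Suc n)\<bar> = Suc n" "- int (Suc n) \<noteq> 0" by simp_all
    ultimately have "?f (- int (Suc n)) = kap c * (- \<i>) ^ Suc n * ?s ^ Suc n * cis (- x) ^ Suc n"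
      unfolding cis_pow fcoeff_def by (simp only: if_False)
    also have "\<dots> = kap c * v ^ Suc n" unfolding v_def by (simp only: power_mult_distrib mult.assoc)
    finally show ?thesis by (simp only: power_Suc mult.assoc)
  qed
  have "((\<lambda>n. (if n = 0 then 1 else 0) + kap c * w ^ n) has_sum (1 + kap c * (1 / (1 - w)))) (UNIV :: nat set)"
  proof (intro has_sum_add has_sum_cmult_right has_sum_geometric_complex w1)
    show "((\<lambda>n. if n = 0 then 1 else 0 :: complex) has_sum 1) (UNIV :: nat set)"
      by (rule has_sum_finite_neutralI[where B = "{0}"]) auto
  qed
  then have "((?f \<circ> int) has_sum (1 + kap c * (1 / (1 - w)))) UNIV" by (simp only: o_def pos)
  then have hs1: "(?f has_sum (1 + kap c * (1 / (1 - w)))) (range int)"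
    by (subst has_sum_reindex) (auto simp: inj_on_def)
  have "((\<lambda>n. kap c * v * v ^ n) has_sum (kap c * v * (1 / (1 - v)))) (UNIV :: nat set)"
    by (intro has_sum_cmult_right has_sum_geometric_complex v1)
  then have "((?f \<circ> (\<lambda>n. - int (Suc n))) has_sum (kap c * v * (1 / (1 - v)))) UNIV" by (simp only: o_def neg)
  then have hs2: "(?f has_sum (kap c * v * (1 / (1 - v)))) (range (\<lambda>n. - int (Suc n)))"
    by (subst has_sum_reindex) (auto simp: inj_on_def)
  have "(?f has_sum (1 + kap c * (1 / (1 - w)) + kap c * v * (1 / (1 - v)))) (range int \<union> range (\<lambda>n. - int (Suc n)))"
    by (rule has_sum_Un_disjoint[OF hs1 hs2]) auto
  moreover have "range int \<union> range (\<lambda>n. - int (Suc n)) = UNIV"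
  proof -
    have "k \<in> range int \<union> range (\<lambda>n. - int (Suc n))" for k by (cases k rule: int_cases) blast+
    then show ?thesis by blast
  qed
  moreover have "1 + kap c * (1 / (1 - w)) + kap c * v * (1 / (1 - v)) = potential c x"
  proof -
    have wne: "1 - w \<noteq> 0" "1 - v \<noteq> 0" using w1 v1 by auto
    have wv: "w * v = ?s\<^sup>2"
    proof -
      have "w * v = (\<i> * - \<i>) * (?s * ?s) * (cis x * cis (- x))"
        unfolding w_def v_def by (simp only: ac_simps)
      then show ?thesis by (simp add: cis_mult power2_eq_square)
    qed
    have "w + v = - 2 * ?s * of_real (sin x)"
      by (simp add: w_def v_def complex_eq_iff algebra_simps)
    have sc: "2 * ?s * c = 1 + ?s\<^sup>2"
    proof -
      have "2 * ?s * c = 2 * ?s * ((?s + 1 / ?s) / 2)" by (rule arg_cong[OF s(2)])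
      also have "\<dots> = 1 + ?s\<^sup>2" using s(1) by (simp add: field_simps power2_eq_square)
      finally show ?thesis .
    qed
    have den: "(1 - w) * (1 - v) = 2 * ?s * (c + of_real (sin x))"
    proof -
      have "(1 - w) * (1 - v) = 1 + w * v - (w + v)" by (simp add: algebra_simps)
      also have "\<dots> = 2 * ?s * (c + of_real (sin x))"
        unfolding wv \<open>w + v = _\<close> distrib_left sc by simp
      finally show ?thesis .
    qed
    have k: "kap c * (1 - ?s\<^sup>2) = - (2 * ?s * c)"
      unfolding kap_def sc using sroot_square_ne_1[OF c] by simp
    have "kap c * (1 / (1 - w)) + kap c * v * (1 / (1 - v)) = kap c * (1 - w * v) / ((1 - w) * (1 - v))"
      using wne by (simp add: field_simps)
    also have "\<dots> = - (2 * ?s * c) / (2 * ?s * (c + of_real (sin x)))" unfolding wv k den ..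
    also have "\<dots> = - c / (c + of_real (sin x))" using s(1) by simp
    finally have "1 + (kap c * (1 / (1 - w)) + kap c * v * (1 / (1 - v))) = 1 + - c / (c + of_real (sin x))" by simp
    also have "\<dots> = potential c x"
      using potential_denominator_nonzero[OF c, of x] by (simp add: potential_def field_simps)
    finally show ?thesis by (simp only: add.assoc)
  qed
  ultimately show ?thesis by simp
qed

text \<open>The Fourier coefficients of \<open>Q + \<Lambda> - g\<^sub>0\<close>. With \<open>B = \<Lambda>\<close> the diagonal of the divided matrix
  becomes 1, as in the definition of the truncated Hill determinants.\<close>

definition hill_Fourier :: "complex \<Rightarrow> complex \<Rightarrow> int \<Rightarrow> complex" where
  "hill_Fourier c \<Lambda> k = fcoeff_tilde c k + (if k = 0 then \<Lambda> else 0)"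

lemma hill_Fourier_series:
  assumes c: "c \<notin> real_cut"
  shows "((\<lambda>k. hill_Fourier c \<Lambda> k * exp (\<i> * of_int k * of_real x)) has_sum (potential c x + (\<Lambda> - fcoeff c 0))) UNIV"
proof -
  have "((\<lambda>k. if k = 0 then \<Lambda> - fcoeff c 0 else 0) has_sum (\<Lambda> - fcoeff c 0)) (UNIV :: int set)"
    by (rule has_sum_finite_neutralI[where B = "{0}"]) auto
  from has_sum_add[OF potential_Fourier_series[OF c, of x] this]
  have "((\<lambda>k. fcoeff c k * exp (\<i> * of_int k * of_real x) + (if k = 0 then \<Lambda> - fcoeff c 0 else 0)) has_sum (potential c x + (\<Lambda> - fcoeff c 0))) UNIV" .
  moreover have "(\<lambda>k. fcoeff c k * exp (\<i> * of_int k * of_real x) + (if k = 0 then \<Lambda> - fcoeff c 0 else 0)) =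
      (\<lambda>k. hill_Fourier c \<Lambda> k * exp (\<i> * of_int k * of_real x))"
    by (auto simp: hill_Fourier_def fcoeff_tilde_def fun_eq_iff)
  ultimately show ?thesis by simp
qed

lemma summable_hill_Fourier:
  assumes c: "c \<notin> real_cut"
  shows "summable_potential (hill_Fourier c \<Lambda>)"
proof
  have "(\<lambda>k. hill_Fourier c \<Lambda> k * exp (\<i> * of_int k * of_real 0)) summable_on UNIV"
    using hill_Fourier_series[OF c] by (rule has_sum_imp_summable)
  then show "(\<lambda>k. norm (hill_Fourier c \<Lambda> k)) summable_on UNIV"
    by (simp add: summable_on_iff_abs_summable_on_complex)
qed

section \<open>The Hill determinant and the trace of the monodromy\<close>

lemma hill_trunc_eq:
  assumes c: "c \<notin> real_cut"
  shows "hill_trunc c \<Lambda> N = summable_potential.trunc_hill (hill_Fourier c \<Lambda>) \<Lambda> 0 N"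
proof -
  interpret summable_potential "hill_Fourier c \<Lambda>" by (rule summable_hill_Fourier[OF c])
  let ?f = "\<lambda>i. int i - int N" and ?X = "perturbed_id (hill_perturbation (hill_Fourier c \<Lambda>) \<Lambda> 0)"
  have bij: "bij_betw ?f {0..<2 * N + 1} {- int N..int N}"
    by (rule bij_betw_byWitness[where f' = "\<lambda>k. nat (k + int N)"]) auto
  have "trunc_hill \<Lambda> 0 N = leibniz_det {0..<2 * N + 1} (\<lambda>i j. ?X (?f i) (?f j))"
    unfolding trunc_hill_def by (rule leibniz_det_reindex[OF bij]) simp
  also have "\<dots> = hill_trunc c \<Lambda> N"
    unfolding hill_trunc_def leibniz_det_def
    by (subst det_def'[OF mat_carrier])
       (auto intro!: sum.cong prod.cong simp: permutes_in_image perturbed_id_def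
         hill_perturbation_def hill_Fourier_def fcoeff_tilde_def Let_def)
  finally show ?thesis by simp
qed

lemma hill_trunc_tendsto:
  assumes c: "c \<notin> real_cut"
  shows "hill_trunc c \<Lambda> \<longlonglongrightarrow> summable_potential.inf_hill (hill_Fourier c \<Lambda>) \<Lambda> 0"
proof -
  interpret summable_potential "hill_Fourier c \<Lambda>" by (rule summable_hill_Fourier[OF c])
  have "hill_trunc c \<Lambda> = trunc_hill \<Lambda> 0" by (rule ext) (rule hill_trunc_eq[OF c])
  then show ?thesis using trunc_hill_tendsto by simp
qed

text \<open>Hill's formula for a Floquet solution whose multiplier \<open>\<rho>\<close> is an eigenvalue of the monodromy
  matrix, that is a root of \<open>\<rho> + 1/\<rho> = tr M\<close>.\<close>

lemma hill_det_eq_trace: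
  assumes c: "c \<notin> real_cut" and nonsquare: "\<not> int_square (fcoeff c 0 - \<mu>)"
  shows "hill_det c (fcoeff c 0 - \<mu>) * (sin (of_real pi * csqrt (fcoeff c 0 - \<mu>)))\<^sup>2 = (2 - monodromy_trace \<mu> c) / 4"
proof -
  let ?\<Lambda> = "fcoeff c 0 - \<mu>" and ?t = "monodromy_trace \<mu> c"
  interpret summable_potential "hill_Fourier c ?\<Lambda>" by (rule summable_hill_Fourier[OF c])
  define \<rho> where "\<rho> = (?t + csqrt (?t\<^sup>2 - 4)) / 2"
  define \<rho>' where "\<rho>' = (?t - csqrt (?t\<^sup>2 - 4)) / 2"
  have "\<rho> * \<rho>' = (?t\<^sup>2 - (csqrt (?t\<^sup>2 - 4))\<^sup>2) / 4"
    by (simp add: \<rho>_def \<rho>'_def power2_eq_square algebra_simps)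
  then have prod: "\<rho> * \<rho>' = 1" by simp
  then have \<rho>: "\<rho> \<noteq> 0" by auto
  have "1 / \<rho> = \<rho>'" using prod \<rho> by (simp add: field_simps)
  moreover have "\<rho> + \<rho>' = ?t" by (simp add: \<rho>_def \<rho>'_def field_simps)
  ultimately have sum: "\<rho> + 1 / \<rho> = ?t" by simp
  obtain f f' where s: "solves (hill_coeff \<mu> c) (\<lambda>_. 0) f f'" and bc: "f (2*pi) = \<rho> * f 0" "f' (2*pi) = \<rho> * f' 0"
    and nz: "(f 0, f' 0) \<noteq> (0, 0)"
    using floquet_eigenfunction_exists[OF c \<rho> sum] by blast
  have "\<exists>x\<in>period. f x \<noteq> 0"
  proof (rule ccontr)
    assume "\<not> (\<exists>x\<in>period. f x \<noteq> 0)"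
    then have f0: "f x = 0" if "x \<in> period" for x using that by blast
    have "(f has_vector_derivative f' 0) (at 0 within period)" using solvesD(1)[OF s, of 0] by simp
    moreover have "(f has_vector_derivative 0) (at 0 within period)"
      by (rule has_vector_derivative_transform[of 0 period f "\<lambda>_. 0"]) (auto simp: f0)
    ultimately have "f' 0 = 0" using period_derivative[of f _ 0] by (metis atLeastAtMost_iff order_refl pi_ge_zero zero_le_mult_iff zero_le_numeral)
    then show False using nz f0[of 0] by simp
  qed
  then obtain x0 where x0: "x0 \<in> period" "f x0 \<noteq> 0" by blast
  let ?U = "\<lambda>x. potential c x + (?\<Lambda> - fcoeff c 0)"
  have d: "(f' has_vector_derivative - ?U x * f x) (at x within period)" if "x \<in> period" for x
    using solves_has_vector_derivative[OF continuous_on_hill_coeff[OF c] s _ that] by (simp add: hill_coeff_def algebra_simps)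
  have "(sin (of_real pi * csqrt ?\<Lambda>))\<^sup>2 * inf_hill ((csqrt ?\<Lambda>)\<^sup>2) 0 = (2 - (\<rho> + 1 / \<rho>)) / 4"
  proof (rule Hill_formula[OF hill_Fourier_series[OF c] solvesD(1)[OF s] d bc \<rho> x0])
    show "(csqrt ?\<Lambda>)\<^sup>2 \<noteq> (of_int n)\<^sup>2" for n using nonsquare by (simp add: int_square_def)
  qed
  moreover have "hill_det c ?\<Lambda> = inf_hill ?\<Lambda> 0"
    unfolding hill_det_def by (rule limI[OF hill_trunc_tendsto[OF c]])
  ultimately show ?thesis unfolding sum by (simp add: mult.commute)
qed

text \<open>Integer squares have distance at least 1 from each other, so by continuity the only one that
  \<open>g\<^sub>0 - \<mu>\<close> could meet near \<open>c\<close> is its value at \<open>c\<close>. But \<open>\<kappa>\<close> determines \<open>s\<^sup>2\<close>, hence \<open>c\<close> up to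
  sign, and \<open>-c\<close> stays away from \<open>c\<close> as 0 lies on the cut.\<close>

lemma eventually_not_int_square:
  assumes c: "c \<notin> real_cut" and sq: "int_square (fcoeff c 0 - \<mu>)"
  shows "\<forall>\<^sub>F w in at c. \<not> int_square (fcoeff w 0 - \<mu>)"
proof -
  obtain n :: int where n: "fcoeff c 0 - \<mu> = (of_int n)\<^sup>2" using sq by (auto simp: int_square_def)
  have "isCont kap c"
    using holomorphic_on_imp_continuous_on[OF kap_holomorphic] open_Compl_real_cut c by (auto simp: continuous_on_eq_continuous_at)
  then have "(kap \<longlongrightarrow> kap c) (at c)" by (simp add: isCont_def)
  then have ev1: "\<forall>\<^sub>F w in at c. dist (kap w) (kap c) < 1" by (rule tendstoD) simp
  have ev2: "\<forall>\<^sub>F w in at c. w \<in> - real_cut" using open_Compl_real_cut c by (intro eventually_at_in_open') auto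
  have "c \<noteq> - c"
  proof
    assume "c = - c"
    then have "c = complex_of_real 0" by (simp add: complex_eq_iff)
    then have "c \<in> real_cut" by (rule image_eqI) simp
    then show False using c by simp
  qed
  then have ev3: "\<forall>\<^sub>F w in at c. w \<noteq> - c" by (rule tendsto_imp_eventually_ne[OF tendsto_ident_at])
  have ev4: "\<forall>\<^sub>F w in at c. w \<noteq> c" by (simp add: eventually_at_filter)
  show ?thesis
    using ev1 ev2 ev3 ev4
  proof eventually_elim
    case (elim w)
    have w: "w \<notin> real_cut" using elim(2) by simp
    show ?case
    proof
      assume "int_square (fcoeff w 0 - \<mu>)"
      then obtain k :: int where k: "fcoeff w 0 - \<mu> = (of_int k)\<^sup>2" by (auto simp: int_square_def)
      have "kap w - kap c = (fcoeff w 0 - \<mu>) - (fcoeff c 0 - \<mu>)" by (simp add: fcoeff_def)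
      then have diff: "kap w - kap c = of_int (k\<^sup>2 - n\<^sup>2)" unfolding k n by simp
      then have "norm (of_int (k\<^sup>2 - n\<^sup>2) :: complex) < 1" using elim(1) by (simp only: dist_norm diff)
      then have "k\<^sup>2 - n\<^sup>2 = 0" unfolding norm_of_int by linarith
      then have "kap w = kap c" using diff by simp
      then have "(1 + (sroot w)\<^sup>2) / (1 - (sroot w)\<^sup>2) = (1 + (sroot c)\<^sup>2) / (1 - (sroot c)\<^sup>2)"
        by (simp add: kap_def)
      then have "(sroot w)\<^sup>2 = (sroot c)\<^sup>2"
        using sroot_square_ne_1[OF w] sroot_square_ne_1[OF c] by (simp add: frac_eq_eq algebra_simps)
      then have "sroot w = sroot c \<or> sroot w = - sroot c" by (simp add: power2_eq_iff)
      then have "w = c \<or> w = - c"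
        using sroot(2)[OF w] sroot(2)[OF c] by (metis add_divide_distrib minus_add_distrib divide_minus_left divide_minus_right)
      then show False using elim(3,4) by simp
    qed
  qed
qed

text \<open>At the exceptional points both sides are limits of the same function, and the right-hand side is
  continuous.\<close>

lemma hill_product_eq_trace:
  assumes c: "c \<notin> real_cut"
  shows "hill_product d c = (2 - monodromy_trace (of_real (d\<^sup>2)) c) / 4"
proof -
  let ?\<mu> = "complex_of_real (d\<^sup>2)"
  let ?P = "\<lambda>w. hill_det w (fcoeff w 0 - (of_real d)\<^sup>2) * (sin (of_real pi * csqrt (fcoeff w 0 - (of_real d)\<^sup>2)))\<^sup>2"
  have P: "?P w = (2 - monodromy_trace ?\<mu> w) / 4" if "w \<notin> real_cut" "\<not> int_square (fcoeff w 0 - ?\<mu>)" for w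
    using hill_det_eq_trace[OF that] by simp
  show ?thesis
  proof (cases "int_square (fcoeff c 0 - ?\<mu>)")
    case False
    then show ?thesis using P[OF c False] by (simp add: hill_product_def)
  next
    case True
    have "\<forall>\<^sub>F w in at c. w \<in> - real_cut" using open_Compl_real_cut c by (intro eventually_at_in_open') auto
    with eventually_not_int_square[OF c True]
    have ev: "\<forall>\<^sub>F w in at c. (2 - monodromy_trace ?\<mu> w) / 4 = ?P w"
      by eventually_elim (rule P[symmetric], auto)
    have "isCont (monodromy_trace ?\<mu>) c"
      using holomorphic_on_imp_continuous_on[OF monodromy_trace_holomorphic] open_Compl_real_cut c
      by (auto simp: continuous_on_eq_continuous_at)
    then have "(monodromy_trace ?\<mu> \<longlongrightarrow> monodromy_trace ?\<mu> c) (at c)" by (simp add: isCont_def)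
    then have "((\<lambda>w. (2 - monodromy_trace ?\<mu> w) / 4) \<longlongrightarrow> (2 - monodromy_trace ?\<mu> c) / 4) (at c)"
      by (intro tendsto_intros) auto
    from Lim_transform_eventually[OF this ev]
    have "Lim (at c) ?P = (2 - monodromy_trace ?\<mu> c) / 4" by (intro tendsto_Lim) auto
    then show ?thesis using True by (simp add: hill_product_def)
  qed
qed

lemma evans_eq_trace:
  assumes c: "c \<notin> real_cut" and z: "z = exp (2 * of_real pi * \<i> * of_real \<theta>)"
  shows "evans \<theta> d c = z + 1 / z - monodromy_trace (of_real (d\<^sup>2)) c"
proof -
  have "z = cis (2 * pi * \<theta>)" unfolding z by (simp add: cis_conv_exp mult_ac)
  then have "z + 1 / z = 2 * of_real (cos (2 * pi * \<theta>))"
    by (simp add: complex_eq_iff cis_inverse[symmetric] inverse_eq_divide[symmetric] del: cis_inverse) 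
  then show ?thesis unfolding evans_def hill_product_eq_trace[OF c] by (simp add: field_simps)
qed

section \<open>The Evans function does not vanish identically\<close>

text \<open>Multiplying \<open>f'' = (d\<^sup>2 - Q) f\<close> by \<open>cnj f\<close> and integrating gives
  \<open>\<integral> (d\<^sup>2 - Q) |f|\<^sup>2 + |f'|\<^sup>2 = 0\<close>: the boundary terms cancel because the multiplier is unimodular.
  If \<open>|Q| \<le> d\<^sup>2 / 2\<close>, the real part of the integrand is positive definite.\<close>

lemma floquet_trace_ne_of_small_potential:
  assumes c: "c \<notin> real_cut" and z: "norm z = 1" and d: "d \<noteq> 0"
    and small: "\<And>x. norm (potential c x) \<le> d\<^sup>2 / 2"
  shows "z + 1 / z \<noteq> monodromy_trace (of_real (d\<^sup>2)) c"
proof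
  let ?\<mu> = "complex_of_real (d\<^sup>2)"
  assume "z + 1 / z = monodromy_trace ?\<mu> c"
  moreover have "z \<noteq> 0" using z by auto
  ultimately obtain f f' where s: "solves (hill_coeff ?\<mu> c) (\<lambda>_. 0) f f'" and bc: "f (2*pi) = z * f 0" "f' (2*pi) = z * f' 0"
    and nz: "(f 0, f' 0) \<noteq> (0, 0)"
    using floquet_eigenfunction_exists[OF c] by blast
  note R = continuous_on_hill_coeff[OF c, of period ?\<mu>]
  have cf: "continuous_on period f" by (rule solves_continuous[OF s])
  have cf': "continuous_on period f'" by (rule solves_continuous'[OF R s]) simp
  let ?g = "\<lambda>x. hill_coeff ?\<mu> c x * (f x * cnj (f x)) + f' x * cnj (f' x)"
  have "((\<lambda>x. f' x * cnj (f x)) has_vector_derivative ?g x) (at x within period)" if x: "x \<in> period" for x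
  proof -
    have df: "(f has_vector_derivative f' x) (at x within period)" by (rule solvesD(1)[OF s x])
    have df': "(f' has_vector_derivative hill_coeff ?\<mu> c x * f x) (at x within period)"
      using solves_has_vector_derivative[OF R s _ x] by simp
    have "((\<lambda>x. cnj (f x)) has_vector_derivative cnj (f' x)) (at x within period)"
      by (rule bounded_linear.has_vector_derivative[OF bounded_linear_cnj df])
    from has_vector_derivative_mult[OF df' this]
    show ?thesis by (simp add: algebra_simps)
  qed
  then have "(?g has_integral f' (2*pi) * cnj (f (2*pi)) - f' 0 * cnj (f 0)) period"
    by (intro fundamental_theorem_of_calculus) auto
  moreover have "f' (2*pi) * cnj (f (2*pi)) - f' 0 * cnj (f 0) = (z * cnj z - 1) * (f' 0 * cnj (f 0))"
    unfolding bc by (simp add: algebra_simps)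
  moreover have "z * cnj z = 1" using z by (metis complex_norm_square of_real_1 power_one)
  ultimately have "(?g has_integral 0) period" by simp
  then have int: "((\<lambda>x. Re (?g x)) has_integral 0) period"
    using has_integral_linear[OF _ bounded_linear_Re, of ?g 0 period] by (simp add: o_def)
  have lower: "Re (?g x) \<ge> d\<^sup>2 / 2 * (norm (f x))\<^sup>2 + (norm (f' x))\<^sup>2" for x
  proof -
    have "Re (?g x) = Re (hill_coeff ?\<mu> c x) * (norm (f x))\<^sup>2 + (norm (f' x))\<^sup>2"
      by (simp add: complex_norm_square[symmetric] flip: of_real_power)
    moreover have "Re (hill_coeff ?\<mu> c x) \<ge> d\<^sup>2 / 2"
      using small[of x] abs_Re_le_cmod[of "potential c x"] by (simp add: hill_coeff_def flip: of_real_power)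
    then have "d\<^sup>2 / 2 * (norm (f x))\<^sup>2 \<le> Re (hill_coeff ?\<mu> c x) * (norm (f x))\<^sup>2"
      by (rule mult_right_mono) simp
    ultimately show ?thesis by linarith
  qed
  have pos: "0 \<le> d\<^sup>2 / 2 * (norm (f x))\<^sup>2 + (norm (f' x))\<^sup>2" for x by simp
  have "continuous_on period (\<lambda>x. Re (?g x))" by (intro continuous_intros R cf cf')
  moreover have "integral period (\<lambda>x. Re (?g x)) = 0" using int by (simp add: integral_unique)
  ultimately have "\<forall>x\<in>period. Re (?g x) = 0"
    using integral_eq_0_iff[of 0 "2*pi" "\<lambda>x. Re (?g x)", OF _ _ order_trans[OF pos lower]] pi_gt_zero by (simp only: mult_pos_pos zero_less_numeral)
  moreover have "0 \<in> period" by simp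
  ultimately have "Re (?g 0) = 0" by (rule bspec)
  then have "d\<^sup>2 / 2 * (norm (f 0))\<^sup>2 + (norm (f' 0))\<^sup>2 \<le> 0" using lower[of 0] by (simp only:)
  then have "d\<^sup>2 / 2 * (norm (f 0))\<^sup>2 = 0" "(norm (f' 0))\<^sup>2 = 0"
    using zero_le_power2[of "norm (f' 0)"] mult_nonneg_nonneg[of "d\<^sup>2 / 2" "(norm (f 0))\<^sup>2"] by (simp_all only: zero_le_power2 divide_nonneg_pos zero_less_numeral; linarith)+
  then show False using nz d by simp
qed

text \<open>By the identity theorem on the connected complement of the cut, it suffices to find one point where
  the function is not zero.\<close>

lemma floquet_trace_not_identically:
  assumes c: "c \<notin> real_cut" and z: "norm z = 1" and d: "d \<noteq> 0"
  shows "\<exists>\<^sub>F w in at c. z + 1 / z - monodromy_trace (of_real (d\<^sup>2)) w \<noteq> 0"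
proof (rule ccontr)
  let ?E = "\<lambda>w. z + 1 / z - monodromy_trace (complex_of_real (d\<^sup>2)) w"
  assume "\<not> (\<exists>\<^sub>F w in at c. ?E w \<noteq> 0)"
  then have "\<forall>\<^sub>F w in at c. ?E w = 0" by (simp add: frequently_def)
  then obtain r where r: "r > 0" "\<And>w. w \<noteq> c \<Longrightarrow> dist w c < r \<Longrightarrow> ?E w = 0"
    unfolding eventually_at by auto
  have conn: "connected (- real_cut)"
  proof (rule connected_complement_bounded_convex)
    show "bounded real_cut" by (rule compact_imp_bounded[OF real_cut_compact])
    show "convex real_cut" by (intro convex_linear_image bounded_linear.linear bounded_linear_of_real) auto
  qed simp
  have hol: "?E holomorphic_on - real_cut" by (intro holomorphic_intros monodromy_trace_holomorphic)
  \<comment> \<open>chosen so that \<open>|w + sin x| \<ge> 2 / d\<^sup>2\<close>, which gives \<open>|Q| \<le> d\<^sup>2 / 2\<close>\<close>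
  define w where "w = complex_of_real (2 + 2 / d\<^sup>2)"
  have d2: "2 / d\<^sup>2 > 0" using d by simp
  have wcut: "w \<notin> real_cut"
  proof
    assume "w \<in> real_cut"
    then obtain r where "w = complex_of_real r" "r \<le> 1" by auto
    then have "2 + 2 / d\<^sup>2 = r" unfolding w_def by (simp only: of_real_eq_iff)
    then show False using d2 \<open>r \<le> 1\<close> by linarith
  qed
  have "?E w = 0"
  proof (rule analytic_continuation_open[where s = "- real_cut \<inter> ball c r - {c}" and s' = "- real_cut" and f = ?E and g = "\<lambda>_. 0"])
    show "open (- real_cut \<inter> ball c r - {c})" using open_Compl_real_cut by (intro open_delete open_Int) auto
    show "- real_cut \<inter> ball c r - {c} \<noteq> {}"
    proof -
      have "c islimpt (- real_cut \<inter> ball c r)"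
        using c r(1) open_Compl_real_cut by (intro interior_limit_point) (auto simp: interior_open open_Int)
      then show ?thesis unfolding islimpt_def by (metis (no_types, lifting) Diff_iff IntE UNIV_I empty_iff open_UNIV singletonD)
    qed
    show "?E v = 0" if "v \<in> - real_cut \<inter> ball c r - {c}" for v
      using that r(2)[of v] by (auto simp: dist_commute)
    show "w \<in> - real_cut" using wcut by simp
  qed (use open_Compl_real_cut conn hol in auto)
  moreover have "z + 1 / z \<noteq> monodromy_trace (of_real (d\<^sup>2)) w"
  proof (rule floquet_trace_ne_of_small_potential[OF wcut z d])
    fix x
    have "norm (w + of_real (sin x)) \<ge> norm w - norm (complex_of_real (sin x))"
      by (rule norm_diff_ineq)
    moreover have "norm w = 2 + 2 / d\<^sup>2" unfolding w_def norm_of_real using d2 by simp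
    ultimately have "norm (w + of_real (sin x)) \<ge> 2 / d\<^sup>2" using abs_sin_le_one[of x] unfolding norm_of_real by linarith
    then have "norm (potential w x) \<le> 1 / (2 / d\<^sup>2)"
      unfolding potential_def norm_divide using d2 by (intro frac_le) auto
    then show "norm (potential w x) \<le> d\<^sup>2 / 2" by simp
  qed
  ultimately show False by simp
qed

section \<open>The Evans function of the linearised Euler equations\<close>

theorem theorem5p1:
  fixes p\<^sub>1 p\<^sub>2 q\<^sub>1 q\<^sub>2 k :: int and d \<theta> :: real
  assumes "coprime p\<^sub>1 p\<^sub>2"
    and "p\<^sub>2 * q\<^sub>1 - p\<^sub>1 * q\<^sub>2 = 1"
    and "\<And>r\<^sub>1 r\<^sub>2 :: int. p\<^sub>2 * r\<^sub>1 - p\<^sub>1 * r\<^sub>2 = 1 \<Longrightarrow>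
           \<bar>p\<^sub>1 * q\<^sub>1 + p\<^sub>2 * q\<^sub>2\<bar> \<le> \<bar>p\<^sub>1 * r\<^sub>1 + p\<^sub>2 * r\<^sub>2\<bar>"
    and "k \<noteq> 0"
    and "d = real_of_int k / real_of_int (p\<^sub>1\<^sup>2 + p\<^sub>2\<^sup>2)"
    and "\<theta> = real_of_int (k * (p\<^sub>1 * q\<^sub>1 + p\<^sub>2 * q\<^sub>2)) / real_of_int (p\<^sub>1\<^sup>2 + p\<^sub>2\<^sup>2)"
  shows "(\<forall>c \<Lambda>. c \<notin> real_cut \<longrightarrow> \<not> int_square \<Lambda> \<longrightarrow> convergent (hill_trunc c \<Lambda>)) \<and>
    evans \<theta> d analytic_on (- real_cut) \<and>
    (\<forall>c. c \<notin> real_cut \<longrightarrow>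
      (evans \<theta> d c = 0 \<longleftrightarrow> 0 \<in> op_spectrum (ode_op p\<^sub>1 p\<^sub>2 q\<^sub>1 q\<^sub>2 k c)) \<and>
      (\<exists>\<^sub>F w in at c. evans \<theta> d w \<noteq> 0) \<and>
      enat (nat (zorder (evans \<theta> d) c)) = family_alg_mult (ode_op p\<^sub>1 p\<^sub>2 q\<^sub>1 q\<^sub>2 k) c \<and>
      enat (nat (zorder (evans \<theta> d) c)) = family_alg_mult (\<lambda>w. op_minus (hill_op \<theta> w) (of_real (d\<^sup>2))) c \<and>
      (op_eigenvalue (ode_op p\<^sub>1 p\<^sub>2 q\<^sub>1 q\<^sub>2 k c) 0 \<longleftrightarrow> op_eigenvalue (hill_op \<theta> c) (of_real (d\<^sup>2))) \<and>
      op_alg_mult (ode_op p\<^sub>1 p\<^sub>2 q\<^sub>1 q\<^sub>2 k c) 0 = op_alg_mult (hill_op \<theta> c) (of_real (d\<^sup>2)))"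
proof -
  define P where "P = real_of_int (p\<^sub>1\<^sup>2 + p\<^sub>2\<^sup>2)"
  have "p\<^sub>1 \<noteq> 0 \<or> p\<^sub>2 \<noteq> 0" using assms(2) by auto
  then have "p\<^sub>1\<^sup>2 + p\<^sub>2\<^sup>2 > 0" by (simp add: sum_power2_gt_zero_iff)
  then have P: "P > 0" unfolding P_def by (simp only: of_int_0_less_iff)
  have d: "d \<noteq> 0" using assms(4) P unfolding assms(5) P_def[symmetric] by simp
  define \<kappa> where "\<kappa> = real_of_int (k\<^sup>2 * (q\<^sub>1\<^sup>2 + q\<^sub>2\<^sup>2)) / P"
  have \<kappa>: "\<kappa> - \<theta>\<^sup>2 = d\<^sup>2"
  proof -
    \<comment> \<open>Lagrange's identity\<close>
    have "(p\<^sub>1\<^sup>2 + p\<^sub>2\<^sup>2) * (q\<^sub>1\<^sup>2 + q\<^sub>2\<^sup>2) - (p\<^sub>1 * q\<^sub>1 + p\<^sub>2 * q\<^sub>2)\<^sup>2 = (p\<^sub>2 * q\<^sub>1 - p\<^sub>1 * q\<^sub>2)\<^sup>2"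
      by (simp add: power2_eq_square algebra_simps)
    then have "k\<^sup>2 * ((p\<^sub>1\<^sup>2 + p\<^sub>2\<^sup>2) * (q\<^sub>1\<^sup>2 + q\<^sub>2\<^sup>2) - (p\<^sub>1 * q\<^sub>1 + p\<^sub>2 * q\<^sub>2)\<^sup>2) = k\<^sup>2"
      unfolding assms(2) by simp
    then have "k\<^sup>2 * (q\<^sub>1\<^sup>2 + q\<^sub>2\<^sup>2) * (p\<^sub>1\<^sup>2 + p\<^sub>2\<^sup>2) - (k * (p\<^sub>1 * q\<^sub>1 + p\<^sub>2 * q\<^sub>2))\<^sup>2 = k\<^sup>2"
      by (simp only: power_mult_distrib right_diff_distrib ac_simps)
    then have "real_of_int (k\<^sup>2 * (q\<^sub>1\<^sup>2 + q\<^sub>2\<^sup>2)) * P - (real_of_int (k * (p\<^sub>1 * q\<^sub>1 + p\<^sub>2 * q\<^sub>2)))\<^sup>2 = (real_of_int k)\<^sup>2"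
      unfolding P_def by (metis of_int_diff of_int_mult of_int_power)
    moreover have "\<kappa> - \<theta>\<^sup>2 = (real_of_int (k\<^sup>2 * (q\<^sub>1\<^sup>2 + q\<^sub>2\<^sup>2)) * P - (real_of_int (k * (p\<^sub>1 * q\<^sub>1 + p\<^sub>2 * q\<^sub>2)))\<^sup>2) / P\<^sup>2"
      using P unfolding \<kappa>_def assms(6) P_def[symmetric] by (simp add: power_divide diff_divide_distrib power2_eq_square)
    ultimately show ?thesis unfolding assms(5) P_def[symmetric] by (simp add: power_divide)
  qed
  define z where "z = exp (2 * of_real pi * \<i> * of_real \<theta> :: complex)"
  have z0: "z \<noteq> 0" and z1: "norm z = 1" by (simp_all add: z_def)
  let ?\<mu> = "complex_of_real (d\<^sup>2)"
  let ?A = "ode_op p\<^sub>1 p\<^sub>2 q\<^sub>1 q\<^sub>2 k"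
  have hill: "op_minus (hill_op \<theta> w) ?\<mu> = floquet_graph z ?\<mu> w" for w
    unfolding hill_op_def floquet_graph_def z_def ..
  have twist: "twist_related \<theta> (?A w) (floquet_graph z ?\<mu> w)" for w
  proof -
    have "?A w = second_order_op (2 * \<i> * of_real \<theta>) (\<lambda>x. potential w x - of_real \<kappa>) 1"
      unfolding ode_op_def \<kappa>_def assms(6) P_def by (simp add: mult.assoc)
    moreover have "complex_of_real \<kappa> - (of_real \<theta>)\<^sup>2 = ?\<mu>" using \<kappa> by (metis of_real_diff of_real_power)
    ultimately show ?thesis
      using second_order_op_twist_related[of \<theta> "potential w" "of_real \<kappa>"] by (simp add: floquet_graph_def z_def)
  qed
  let ?E = "\<lambda>w. z + 1 / z - monodromy_trace ?\<mu> w"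
  have evans: "evans \<theta> d w = ?E w" if "w \<notin> real_cut" for w
    by (rule evans_eq_trace[OF that z_def])
  have "?E holomorphic_on - real_cut" by (intro holomorphic_intros monodromy_trace_holomorphic)
  then have "evans \<theta> d holomorphic_on - real_cut"
    by (rule holomorphic_transform) (simp add: evans)
  then have analytic: "evans \<theta> d analytic_on - real_cut"
    using open_Compl_real_cut by (simp add: analytic_on_open)
  have conv: "convergent (hill_trunc c \<Lambda>)" if "c \<notin> real_cut" for c \<Lambda>
    using hill_trunc_tendsto[OF that] by (auto simp: convergent_def)
  have main: "(evans \<theta> d c = 0 \<longleftrightarrow> 0 \<in> op_spectrum (?A c)) \<and> (\<exists>\<^sub>F w in at c. evans \<theta> d w \<noteq> 0) \<and>
      enat (nat (zorder (evans \<theta> d) c)) = family_alg_mult ?A c \<and>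
      enat (nat (zorder (evans \<theta> d) c)) = family_alg_mult (\<lambda>w. op_minus (hill_op \<theta> w) ?\<mu>) c \<and>
      (op_eigenvalue (?A c) 0 \<longleftrightarrow> op_eigenvalue (hill_op \<theta> c) ?\<mu>) \<and>
      op_alg_mult (?A c) 0 = op_alg_mult (hill_op \<theta> c) ?\<mu>" if c: "c \<notin> real_cut" for c
  proof (intro conjI)
    interpret hill_family z ?\<mu> c by unfold_locales (rule z0 c)+
    have "0 \<in> op_spectrum (?A c) \<longleftrightarrow> \<not> regular_graph (floquet_graph z ?\<mu> c)"
      by (simp add: op_spectrum_iff op_minus_0 twist_related_regular[OF twist])
    also have "\<dots> \<longleftrightarrow> z + 1 / z = monodromy_trace ?\<mu> c"
      using floquet_graph_regular[OF c z0] floquet_graph_singular(1)[OF c z0] by blast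
    finally show "evans \<theta> d c = 0 \<longleftrightarrow> 0 \<in> op_spectrum (?A c)" by (simp add: evans[OF c])
    have ev: "\<forall>\<^sub>F w in at c. evans \<theta> d w = ?E w"
      using eventually_good by eventually_elim (rule evans)
    have freq: "\<exists>\<^sub>F w in at c. ?E w \<noteq> 0" by (rule floquet_trace_not_identically[OF c z1 d])
    show "\<exists>\<^sub>F w in at c. evans \<theta> d w \<noteq> 0"
      using frequently_eventually_frequently[OF freq ev] by (rule frequently_elim1) auto
    have "zorder (evans \<theta> d) c = zorder ?E c" by (rule zorder_cong[OF ev refl])
    then have zord: "enat (nat (zorder (evans \<theta> d) c)) = family_alg_mult (floquet_graph z ?\<mu>) c"
      using family_alg_mult_eq_zorder[OF freq] by simp
    show "enat (nat (zorder (evans \<theta> d) c)) = family_alg_mult (\<lambda>w. op_minus (hill_op \<theta> w) ?\<mu>) c"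
      unfolding hill using zord by simp
    show "enat (nat (zorder (evans \<theta> d) c)) = family_alg_mult ?A c"
      unfolding zord by (rule family_alg_mult_twist[symmetric]) (rule always_eventually, rule allI, rule twist)
    show "op_eigenvalue (?A c) 0 \<longleftrightarrow> op_eigenvalue (hill_op \<theta> c) ?\<mu>"
      unfolding op_eigenvalue_def op_minus_0 hill by (rule twist_related_kernel[OF twist])
    have "family_alg_mult (op_minus (?A c)) 0 = family_alg_mult (\<lambda>w. op_minus (hill_op \<theta> c) (?\<mu> + w)) 0"
    proof (rule family_alg_mult_twist, rule always_eventually, rule allI)
      fix w
      show "twist_related \<theta> (op_minus (?A c) w) (op_minus (hill_op \<theta> c) (?\<mu> + w))"
        using twist_related_op_minus[OF twist[of c], of w] by (simp only: hill[symmetric] op_minus_op_minus)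
    qed
    then show "op_alg_mult (?A c) 0 = op_alg_mult (hill_op \<theta> c) ?\<mu>"
      unfolding op_alg_mult_def family_alg_mult_translate .
  qed
  show ?thesis using conv analytic main by blast
qed

end
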